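(* Let $\mathcal V$ be an extensive, cartesian closed category with pullbacks, let $\mathcal G$ be a conservative family of objects in $\mathcal V$, and let $G\colon\mathcal I\to\mathcal C$ and $W\colon\mathcal I\to\mathcal V$ be $\mathcal V$-functors. Given a pair $(L,\lambda)$ of an object $L\in\mathcal C$ and a $\mathcal V$-natural transformation $\lambda\colon W\Rightarrow\mathcal C(L,G-)$ in $\mathcal V\text{-}\mathrm{Cat}(\mathcal I,\mathcal V)$, the following are equivalent: (i) the pair $(L,\lambda)$ is a $W$-weighted $\mathcal V$-limit of $G$; (ii) the pair $(L,\lambda)$ is an internal terminal object in the internal category $W\downarrow\mathrm{Int}\,\mathcal C(-,G)$; (iii) for every object $X\in\mathcal G$, the pair $(L,\lambda)$ is a $\mathcal V$-terminal object in the $\mathcal V$-category $\mathrm{Und}\llbracket\mathrm{cst}X,W\downarrow\mathrm{Int}\,\mathcal C(-,G)\rrbracket$.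
   Context: Extensive: $\mathcal V$ has all small coproducts and for every set $I$ and family $\{X_i\}_{i\in I}$ the functor $\bigsqcup_{i\in I}\colon\prod_{i\in I}\mathcal V_{/X_i}\to\mathcal V_{/\bigsqcup_i X_i}$ is an equivalence. $\ast$ is the terminal object, $\emptyset$ the initial object, $[X,Y]$ the internal hom of $\mathcal V$, $\iota$ denotes coproduct inclusions. A family $\mathcal G$ of objects is conservative if a map $f\colon Y\to Z$ in $\mathcal V$ is an isomorphism if and only if $f_*\colon\mathcal V(X,Y)\to\mathcal V(X,Z)$ is a bijection for every $X\in\mathcal G$. $\mathcal V$-categories are enriched over the cartesian structure and have a set of objects (except $\mathcal V$ and functor $\mathcal V$-categories into it). $\mathcal V^{\mathcal I}$ is the $\mathcal V$-category of $\mathcal V$-functors $\mathcal I\to\mathcal V$ with hom-objects the ends $\int_{i}[Fi,F'i]$; maps $\ast\to\mathcal V^{\mathcal I}(F,F')$ correspond to $\mathcal V$-natural transformations. An object $T$ of a $\mathcal V$-category $\mathcal D$ is $\mathcal V$-terminal if $\mathcal D(A,T)\to\ast$ is an isomorphism for all $A\in\mathcal D$. $\mathcal C(-,G)\colon\mathcal C^{\mathrm{op}}\to\mathcal V^{\mathcal I}$ is the $\mathcal V$-functor $A\mapsto\mathcal C(A,G-)$ acting on homs by composition in $\mathcal C$. $(L,\lambda)$ is a $W$-weighted $\mathcal V$-limit of $G$ if the induced $\mathcal V$-natural transformation $\lambda^*\colon\mathcal C(-,L)\Rightarrow\mathcal V^{\mathcal I}(W,\mathcal C(-,G))$ is an isomorphism.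 An internal category $\mathbb A$ to $\mathcal V$ consists of objects $\mathbb A_0,\mathbb A_1$ with maps $s,t,i,c$ satisfying the usual axioms; with internal functors these form $\mathrm{Cat}(\mathcal V)$, cartesian closed with internal hom $\llbracket-,-\rrbracket$. $\mathrm{cst}X$ is the internal category with $(\mathrm{cst}X)_0=(\mathrm{cst}X)_1=X$ and identity structure maps; $\ast=\mathrm{cst}\ast$ is terminal; an element of $\mathbb A$ is an internal functor $\ast\to\mathbb A$, i.e. a map $\ast\to\mathbb A_0$. $\mathrm{Int}\,\mathcal C$ has $(\mathrm{Int}\,\mathcal C)_0=\bigsqcup_{A}\ast$, $(\mathrm{Int}\,\mathcal C)_1=\bigsqcup_{A,B}\mathcal C(A,B)$ with the evident structure maps. $\mathrm{Und}\,\mathbb A$ is the $\mathcal V$-category with objects the maps $\ast\to\mathbb A_0$ and $\mathrm{Und}\,\mathbb A(A,B)$ the pullback of $(s,t)\colon\mathbb A_1\to\mathbb A_0\times\mathbb A_0$ along $(A,B)\colon\ast\to\mathbb A_0\times\mathbb A_0$. $\mathbb 2=\mathrm{Int}\,\mathbb 2$ for the $\mathcal V$-category with objects $0,1$, hom-objects $\mathbb 2(0,0)=\mathbb 2(0,1)=\mathbb 2(1,1)=\ast$, $\mathbb 2(1,0)=\emptyset$, with inclusion $\langle0,1\rangle\colon\ast\sqcup\ast\to\mathbb 2$. For $H\colon\mathbb A\to\mathbb B$ and an element $B$ of $\mathbb B$, the comma internal category $H\downarrow B$ is the pullback in $\mathrm{Cat}(\mathcal V)$ of $\langle0,1\rangle^*\colon\llbracket\mathbb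 2,\mathbb B\rrbracket\to\mathbb B\times\mathbb B$ along $H\times B\colon\mathbb A\to\mathbb B\times\mathbb B$. The slice is $\mathbb A_{/T}=\mathrm{id}_{\mathbb A}\downarrow T$; $T$ is an internal terminal object of $\mathbb A$ if the projection $\mathbb A_{/T}\to\mathbb A$ is an isomorphism. $W\downarrow\mathrm{Int}\,\mathcal C(-,G)$ is the comma internal category $H\downarrow B$ for $H=\mathrm{Int}(\mathcal C(-,G)^{\mathrm{op}})\colon\mathrm{Int}\,\mathcal C\to\mathrm{Int}((\mathcal V^{\mathcal I})^{\mathrm{op}})$ and $B=W$. (Size convention: $(\mathcal V^{\mathcal I})^{\mathrm{op}}$ may be replaced by any small full sub-$\mathcal V$-category containing $W$ and all $\mathcal C(A,G-)$; the result does not depend on the choice.) $(L,\lambda)$ is regarded as the element given by $\iota_L\colon\ast\to\mathrm{Int}\,\mathcal C$ and $\lambda\colon\ast\to\mathcal V^{\mathcal I}(W,\mathcal C(L,G-))=(\mathcal V^{\mathcal I})^{\mathrm{op}}(\mathcal C(L,G-),W)$; it is regarded as an object of $\mathrm{Und}\llbracket\mathrm{cst}X,\mathbb A\rrbracket$, where $\mathbb A=W\downarrow\mathrm{Int}\,\mathcal C(-,G)$, by post-composing with $!^*\colon\mathbb A\to\llbracket\mathrm{cst}X,\mathbb A\rrbracket$ induced by $\mathrm{cst}X\to\ast$. *)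

theory Defs
  imports "HOL-Library.FuncSet" "HOL-Library.Equipollence"
begin

section \<open>Categories, functors, equivalences\<close>

record ('o, 'm) category =
  Obj :: "'o set"
  Arr :: "'m set"
  Dom :: "'m \<Rightarrow> 'o"
  Cod :: "'m \<Rightarrow> 'o"
  Idn :: "'o \<Rightarrow> 'm"
  Cmp :: "'m \<Rightarrow> 'm \<Rightarrow> 'm"  (infixr "\<cdot>\<index>" 55)

definition hom :: "('o, 'm) category \<Rightarrow> 'o \<Rightarrow> 'o \<Rightarrow> 'm set" where
  "hom V A B = {f \<in> Arr V. Dom V f = A \<and> Cod V f = B}"

definition is_category :: "('o, 'm) category \<Rightarrow> bool" where
  "is_category V \<longleftrightarrow>
     (\<forall>f\<in>Arr V. Dom V f \<in> Obj V \<and> Cod V f \<in> Obj V) \<and>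
     (\<forall>A\<in>Obj V. Idn V A \<in> hom V A A) \<and>
     (\<forall>A B C f g. f \<in> hom V A B \<and> g \<in> hom V B C \<longrightarrow> g \<cdot>\<^bsub>V\<^esub> f \<in> hom V A C) \<and>
     (\<forall>A B f. f \<in> hom V A B \<longrightarrow> f \<cdot>\<^bsub>V\<^esub> Idn V A = f \<and> Idn V B \<cdot>\<^bsub>V\<^esub> f = f) \<and>
     (\<forall>A B C D f g h. f \<in> hom V A B \<and> g \<in> hom V B C \<and> h \<in> hom V C D \<longrightarrow>
        (h \<cdot>\<^bsub>V\<^esub> g) \<cdot>\<^bsub>V\<^esub> f = h \<cdot>\<^bsub>V\<^esub> (g \<cdot>\<^bsub>V\<^esub> f))"

definition is_iso :: "('o, 'm) category \<Rightarrow> 'm \<Rightarrow> bool" where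
  "is_iso V f \<longleftrightarrow> f \<in> Arr V \<and>
     (\<exists>g \<in> hom V (Cod V f) (Dom V f).
        g \<cdot>\<^bsub>V\<^esub> f = Idn V (Dom V f) \<and> f \<cdot>\<^bsub>V\<^esub> g = Idn V (Cod V f))"

record ('a, 'f, 'b, 'g) cat_functor =
  onObj :: "'a \<Rightarrow> 'b"
  onArr :: "'f \<Rightarrow> 'g"

definition is_functor ::
    "('a, 'f) category \<Rightarrow> ('b, 'g) category \<Rightarrow> ('a, 'f, 'b, 'g) cat_functor \<Rightarrow> bool" where
  "is_functor C D F \<longleftrightarrow>
     (\<forall>A\<in>Obj C. onObj F A \<in> Obj D) \<and>
     (\<forall>A B f. f \<in> hom C A B \<longrightarrow> onArr F f \<in> hom D (onObj F A) (onObj F B)) \<and>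
     (\<forall>A\<in>Obj C. onArr F (Idn C A) = Idn D (onObj F A)) \<and>
     (\<forall>A B E f g. f \<in> hom C A B \<and> g \<in> hom C B E \<longrightarrow>
        onArr F (g \<cdot>\<^bsub>C\<^esub> f) = onArr F g \<cdot>\<^bsub>D\<^esub> onArr F f)"

definition id_functor :: "('a, 'f, 'a, 'f) cat_functor" where
  "id_functor = \<lparr>onObj = (\<lambda>A. A), onArr = (\<lambda>f. f)\<rparr>"

definition comp_functor ::
    "('b, 'g, 'c, 'h) cat_functor \<Rightarrow> ('a, 'f, 'b, 'g) cat_functor \<Rightarrow> ('a, 'f, 'c, 'h) cat_functor" where
  "comp_functor G F = \<lparr>onObj = onObj G \<circ> onObj F, onArr = onArr G \<circ> onArr F\<rparr>"

definition naturally_isomorphic ::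
    "('a, 'f) category \<Rightarrow> ('b, 'g) category \<Rightarrow>
     ('a, 'f, 'b, 'g) cat_functor \<Rightarrow> ('a, 'f, 'b, 'g) cat_functor \<Rightarrow> bool" where
  "naturally_isomorphic C D F G \<longleftrightarrow>
     (\<exists>\<eta>. (\<forall>A\<in>Obj C. \<eta> A \<in> hom D (onObj F A) (onObj G A) \<and> is_iso D (\<eta> A)) \<and>
          (\<forall>A B f. f \<in> hom C A B \<longrightarrow> \<eta> B \<cdot>\<^bsub>D\<^esub> onArr F f = onArr G f \<cdot>\<^bsub>D\<^esub> \<eta> A))"

definition is_equivalence ::
    "('a, 'f) category \<Rightarrow> ('b, 'g) category \<Rightarrow> ('a, 'f, 'b, 'g) cat_functor \<Rightarrow> bool" where
  "is_equivalence C D F \<longleftrightarrow> is_functor C D F \<and>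
     (\<exists>G. is_functor D C G \<and>
          naturally_isomorphic C C (comp_functor G F) id_functor \<and>
          naturally_isomorphic D D (comp_functor F G) id_functor)"

text \<open>An arrow of the slice category from \<open>x\<close> to \<open>y\<close> is a triple \<open>(x, h, y)\<close> with \<open>y h = x\<close>.\<close>

definition slice_cat :: "('o, 'm) category \<Rightarrow> 'o \<Rightarrow> ('m, 'm \<times> 'm \<times> 'm) category" where
  "slice_cat V X =
     \<lparr>Obj = {x \<in> Arr V. Cod V x = X},
      Arr = {(x, h, y). x \<in> Arr V \<and> Cod V x = X \<and> y \<in> Arr V \<and> Cod V y = X \<and>
                        h \<in> hom V (Dom V x) (Dom V y) \<and> y \<cdot>\<^bsub>V\<^esub> h = x},
      Dom = (\<lambda>(x, h, y). x),
      Cod = (\<lambda>(x, h, y). y),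
      Idn = (\<lambda>x. (x, Idn V (Dom V x), x)),
      Cmp = (\<lambda>(y, k, z) (x, h, y'). (x, k \<cdot>\<^bsub>V\<^esub> h, z))\<rparr>"

definition prod_cat :: "'i set \<Rightarrow> ('i \<Rightarrow> ('o, 'm) category) \<Rightarrow> ('i \<Rightarrow> 'o, 'i \<Rightarrow> 'm) category" where
  "prod_cat K C =
     \<lparr>Obj = (\<Pi>\<^sub>E i\<in>K. Obj (C i)),
      Arr = (\<Pi>\<^sub>E i\<in>K. Arr (C i)),
      Dom = (\<lambda>f. \<lambda>i\<in>K. Dom (C i) (f i)),
      Cod = (\<lambda>f. \<lambda>i\<in>K. Cod (C i) (f i)),
      Idn = (\<lambda>A. \<lambda>i\<in>K. Idn (C i) (A i)),
      Cmp = (\<lambda>g f. \<lambda>i\<in>K. g i \<cdot>\<^bsub>C i\<^esub> f i)\<rparr>"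


section \<open>Limits, colimits and exponentials\<close>

text \<open>
  Each construction comes as a universal property together with a choice made by Hilbert's
  operator; the notation for the chosen structure is meaningful only where one exists.
\<close>

definition is_terminal :: "('o, 'm) category \<Rightarrow> 'o \<Rightarrow> bool" where
  "is_terminal V T \<longleftrightarrow> T \<in> Obj V \<and> (\<forall>A\<in>Obj V. \<exists>!f. f \<in> hom V A T)"

definition one_obj :: "('o, 'm) category \<Rightarrow> 'o"  ("\<one>\<index>") where
  "\<one>\<^bsub>V\<^esub> = (SOME T. is_terminal V T)"

definition bang :: "('o, 'm) category \<Rightarrow> 'o \<Rightarrow> 'm" where
  "bang V A = (THE f. f \<in> hom V A \<one>\<^bsub>V\<^esub>)"

definition is_initial :: "('o, 'm) category \<Rightarrow> 'o \<Rightarrow> bool" where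
  "is_initial V Z \<longleftrightarrow> Z \<in> Obj V \<and> (\<forall>A\<in>Obj V. \<exists>!f. f \<in> hom V Z A)"

definition zero_obj :: "('o, 'm) category \<Rightarrow> 'o"  ("\<zero>\<index>") where
  "\<zero>\<^bsub>V\<^esub> = (SOME Z. is_initial V Z)"

definition is_product ::
    "('o, 'm) category \<Rightarrow> 'o \<Rightarrow> 'o \<Rightarrow> 'o \<Rightarrow> 'm \<Rightarrow> 'm \<Rightarrow> bool" where
  "is_product V A B P p q \<longleftrightarrow> p \<in> hom V P A \<and> q \<in> hom V P B \<and>
     (\<forall>X f g. f \<in> hom V X A \<and> g \<in> hom V X B \<longrightarrow>
        (\<exists>!h. h \<in> hom V X P \<and> p \<cdot>\<^bsub>V\<^esub> h = f \<and> q \<cdot>\<^bsub>V\<^esub> h = g))"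

definition chosen_product :: "('o, 'm) category \<Rightarrow> 'o \<Rightarrow> 'o \<Rightarrow> 'o \<times> 'm \<times> 'm" where
  "chosen_product V A B = (SOME (P, p, q). is_product V A B P p q)"

definition prod_obj :: "('o, 'm) category \<Rightarrow> 'o \<Rightarrow> 'o \<Rightarrow> 'o"  (infixr "\<otimes>\<index>" 80) where
  "A \<otimes>\<^bsub>V\<^esub> B = fst (chosen_product V A B)"

definition pr1 :: "('o, 'm) category \<Rightarrow> 'o \<Rightarrow> 'o \<Rightarrow> 'm" where
  "pr1 V A B = fst (snd (chosen_product V A B))"

definition pr2 :: "('o, 'm) category \<Rightarrow> 'o \<Rightarrow> 'o \<Rightarrow> 'm" where
  "pr2 V A B = snd (snd (chosen_product V A B))"

definition pairing :: "('o, 'm) category \<Rightarrow> 'm \<Rightarrow> 'm \<Rightarrow> 'm"  ("\<langle>_,/ _\<rangle>\<index>") where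
  "\<langle>f, g\<rangle>\<^bsub>V\<^esub> = (THE h. h \<in> hom V (Dom V f) (Cod V f \<otimes>\<^bsub>V\<^esub> Cod V g) \<and>
                    pr1 V (Cod V f) (Cod V g) \<cdot>\<^bsub>V\<^esub> h = f \<and> pr2 V (Cod V f) (Cod V g) \<cdot>\<^bsub>V\<^esub> h = g)"

definition is_pullback ::
    "('o, 'm) category \<Rightarrow> 'm \<Rightarrow> 'm \<Rightarrow> 'o \<Rightarrow> 'm \<Rightarrow> 'm \<Rightarrow> bool" where
  "is_pullback V f g P p q \<longleftrightarrow> f \<in> Arr V \<and> g \<in> Arr V \<and> Cod V f = Cod V g \<and>
     p \<in> hom V P (Dom V f) \<and> q \<in> hom V P (Dom V g) \<and> f \<cdot>\<^bsub>V\<^esub> p = g \<cdot>\<^bsub>V\<^esub> q \<and>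
     (\<forall>X a b. a \<in> hom V X (Dom V f) \<and> b \<in> hom V X (Dom V g) \<and> f \<cdot>\<^bsub>V\<^esub> a = g \<cdot>\<^bsub>V\<^esub> b \<longrightarrow>
        (\<exists>!h. h \<in> hom V X P \<and> p \<cdot>\<^bsub>V\<^esub> h = a \<and> q \<cdot>\<^bsub>V\<^esub> h = b))"

definition chosen_pullback :: "('o, 'm) category \<Rightarrow> 'm \<Rightarrow> 'm \<Rightarrow> 'o \<times> 'm \<times> 'm" where
  "chosen_pullback V f g = (SOME (P, p, q). is_pullback V f g P p q)"

definition pb_obj :: "('o, 'm) category \<Rightarrow> 'm \<Rightarrow> 'm \<Rightarrow> 'o" where
  "pb_obj V f g = fst (chosen_pullback V f g)"

definition pb1 :: "('o, 'm) category \<Rightarrow> 'm \<Rightarrow> 'm \<Rightarrow> 'm" where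
  "pb1 V f g = fst (snd (chosen_pullback V f g))"

definition pb2 :: "('o, 'm) category \<Rightarrow> 'm \<Rightarrow> 'm \<Rightarrow> 'm" where
  "pb2 V f g = snd (snd (chosen_pullback V f g))"

definition pb_pair :: "('o, 'm) category \<Rightarrow> 'm \<Rightarrow> 'm \<Rightarrow> 'm \<Rightarrow> 'm \<Rightarrow> 'm" where
  "pb_pair V f g a b = (THE h. h \<in> hom V (Dom V a) (pb_obj V f g) \<and>
                          pb1 V f g \<cdot>\<^bsub>V\<^esub> h = a \<and> pb2 V f g \<cdot>\<^bsub>V\<^esub> h = b)"

definition is_coproduct ::
    "('o, 'm) category \<Rightarrow> 'k set \<Rightarrow> ('k \<Rightarrow> 'o) \<Rightarrow> 'o \<Rightarrow> ('k \<Rightarrow> 'm) \<Rightarrow> bool" where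
  "is_coproduct V K X S \<iota> \<longleftrightarrow> S \<in> Obj V \<and> (\<forall>k\<in>K. \<iota> k \<in> hom V (X k) S) \<and>
     (\<forall>Y\<in>Obj V. \<forall>f. (\<forall>k\<in>K. f k \<in> hom V (X k) Y) \<longrightarrow>
        (\<exists>!h. h \<in> hom V S Y \<and> (\<forall>k\<in>K. h \<cdot>\<^bsub>V\<^esub> \<iota> k = f k)))"

definition chosen_coproduct ::
    "('o, 'm) category \<Rightarrow> 'k set \<Rightarrow> ('k \<Rightarrow> 'o) \<Rightarrow> 'o \<times> ('k \<Rightarrow> 'm)" where
  "chosen_coproduct V K X = (SOME (S, \<iota>). is_coproduct V K X S \<iota>)"

definition coprod_obj :: "('o, 'm) category \<Rightarrow> 'k set \<Rightarrow> ('k \<Rightarrow> 'o) \<Rightarrow> 'o" where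
  "coprod_obj V K X = fst (chosen_coproduct V K X)"

definition incl :: "('o, 'm) category \<Rightarrow> 'k set \<Rightarrow> ('k \<Rightarrow> 'o) \<Rightarrow> 'k \<Rightarrow> 'm" where
  "incl V K X = snd (chosen_coproduct V K X)"

definition cotuple ::
    "('o, 'm) category \<Rightarrow> 'k set \<Rightarrow> ('k \<Rightarrow> 'o) \<Rightarrow> 'o \<Rightarrow> ('k \<Rightarrow> 'm) \<Rightarrow> 'm" where
  "cotuple V K X Y f = (THE h. h \<in> hom V (coprod_obj V K X) Y \<and>
                              (\<forall>k\<in>K. h \<cdot>\<^bsub>V\<^esub> incl V K X k = f k))"

definition is_exponential :: "('o, 'm) category \<Rightarrow> 'o \<Rightarrow> 'o \<Rightarrow> 'o \<Rightarrow> 'm \<Rightarrow> bool" where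
  "is_exponential V A B E e \<longleftrightarrow> E \<in> Obj V \<and> e \<in> hom V (E \<otimes>\<^bsub>V\<^esub> A) B \<and>
     (\<forall>X\<in>Obj V. \<forall>f \<in> hom V (X \<otimes>\<^bsub>V\<^esub> A) B.
        (\<exists>!h. h \<in> hom V X E \<and> e \<cdot>\<^bsub>V\<^esub> \<langle>h \<cdot>\<^bsub>V\<^esub> pr1 V X A, pr2 V X A\<rangle>\<^bsub>V\<^esub> = f))"

definition chosen_exponential :: "('o, 'm) category \<Rightarrow> 'o \<Rightarrow> 'o \<Rightarrow> 'o \<times> 'm" where
  "chosen_exponential V A B = (SOME (E, e). is_exponential V A B E e)"

definition exp_obj :: "('o, 'm) category \<Rightarrow> 'o \<Rightarrow> 'o \<Rightarrow> 'o"  ("\<lbrakk>_,/ _\<rbrakk>\<index>") where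
  "\<lbrakk>A, B\<rbrakk>\<^bsub>V\<^esub> = fst (chosen_exponential V A B)"

definition ev :: "('o, 'm) category \<Rightarrow> 'o \<Rightarrow> 'o \<Rightarrow> 'm" where
  "ev V A B = snd (chosen_exponential V A B)"

definition transpose :: "('o, 'm) category \<Rightarrow> 'o \<Rightarrow> 'o \<Rightarrow> 'o \<Rightarrow> 'm \<Rightarrow> 'm" where
  "transpose V X A B f = (THE h. h \<in> hom V X \<lbrakk>A, B\<rbrakk>\<^bsub>V\<^esub> \<and>
                             ev V A B \<cdot>\<^bsub>V\<^esub> \<langle>h \<cdot>\<^bsub>V\<^esub> pr1 V X A, pr2 V X A\<rangle>\<^bsub>V\<^esub> = f)"

definition has_pullbacks :: "('o, 'm) category \<Rightarrow> bool" where
  "has_pullbacks V \<longleftrightarrow>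
     (\<forall>f\<in>Arr V. \<forall>g\<in>Arr V. Cod V f = Cod V g \<longrightarrow> (\<exists>P p q. is_pullback V f g P p q))"

definition cartesian_closed :: "('o, 'm) category \<Rightarrow> bool" where
  "cartesian_closed V \<longleftrightarrow>
     (\<exists>T. is_terminal V T) \<and>
     (\<forall>A\<in>Obj V. \<forall>B\<in>Obj V. \<exists>P p q. is_product V A B P p q) \<and>
     (\<forall>A\<in>Obj V. \<forall>B\<in>Obj V. \<exists>E e. is_exponential V A B E e)"


section \<open>Smallness, extensivity, conservative families\<close>

text \<open>
  The type \<open>'u\<close> plays the role of the universe: a set, of any type, is small if it injects into
  \<open>'u\<close>, so up to bijection the small sets are the sets of elements of \<open>'u\<close>. For infinite \<open>'u\<close> they
  are closed under binary products and contain the finite sets.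
\<close>

definition small :: "'u itself \<Rightarrow> 'k set \<Rightarrow> bool" where
  "small U K \<longleftrightarrow> K \<lesssim> (UNIV :: 'u set)"

definition coprod_functor ::
    "('o, 'm) category \<Rightarrow> 'k set \<Rightarrow> ('k \<Rightarrow> 'o) \<Rightarrow>
     ('k \<Rightarrow> 'm, 'k \<Rightarrow> 'm \<times> 'm \<times> 'm, 'm, 'm \<times> 'm \<times> 'm) cat_functor" where
  "coprod_functor V K X =
     (let obj = (\<lambda>x. cotuple V K (\<lambda>k. Dom V (x k)) (coprod_obj V K X)
                       (\<lambda>k. incl V K X k \<cdot>\<^bsub>V\<^esub> x k))
      in \<lparr>onObj = obj,
          onArr = (\<lambda>f. let x = (\<lambda>k. fst (f k)); h = (\<lambda>k. fst (snd (f k))); y = (\<lambda>k. snd (snd (f k)))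
                       in (obj x,
                           cotuple V K (\<lambda>k. Dom V (x k)) (coprod_obj V K (\<lambda>k. Dom V (y k)))
                             (\<lambda>k. incl V K (\<lambda>k. Dom V (y k)) k \<cdot>\<^bsub>V\<^esub> h k),
                           obj y))\<rparr>)"

definition extensive :: "'u itself \<Rightarrow> ('o, 'm) category \<Rightarrow> bool" where
  "extensive U V \<longleftrightarrow>
     (\<forall>(K :: 'u set) X. (\<forall>k\<in>K. X k \<in> Obj V) \<longrightarrow>
        (\<exists>S \<iota>. is_coproduct V K X S \<iota>) \<and>
        is_equivalence (prod_cat K (\<lambda>k. slice_cat V (X k))) (slice_cat V (coprod_obj V K X))
          (coprod_functor V K X))"

definition conservative_family :: "('o, 'm) category \<Rightarrow> 'o set \<Rightarrow> bool" where
  "conservative_family V \<G> \<longleftrightarrow> \<G> \<subseteq> Obj V \<and>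
     (\<forall>Y Z f. f \<in> hom V Y Z \<longrightarrow>
        (is_iso V f \<longleftrightarrow> (\<forall>X\<in>\<G>. bij_betw (\<lambda>h. f \<cdot>\<^bsub>V\<^esub> h) (hom V X Y) (hom V X Z))))"


section \<open>Enriched categories\<close>

text \<open>\<open>VCmp C A B D\<close> is the composition map from \<open>C(B,D) \<times> C(A,B)\<close> to \<open>C(A,D)\<close>.\<close>

record ('o, 'm, 'c) vcat =
  VOb :: "'c set"
  VHom :: "'c \<Rightarrow> 'c \<Rightarrow> 'o"
  VCmp :: "'c \<Rightarrow> 'c \<Rightarrow> 'c \<Rightarrow> 'm"
  VId :: "'c \<Rightarrow> 'm"

definition is_vcat :: "('o, 'm) category \<Rightarrow> ('o, 'm, 'c) vcat \<Rightarrow> bool" where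
  "is_vcat V C \<longleftrightarrow>
     (\<forall>A\<in>VOb C. \<forall>B\<in>VOb C. VHom C A B \<in> Obj V) \<and>
     (\<forall>A\<in>VOb C. VId C A \<in> hom V \<one>\<^bsub>V\<^esub> (VHom C A A)) \<and>
     (\<forall>A\<in>VOb C. \<forall>B\<in>VOb C. \<forall>D\<in>VOb C.
        VCmp C A B D \<in> hom V (VHom C B D \<otimes>\<^bsub>V\<^esub> VHom C A B) (VHom C A D)) \<and>
     (\<forall>A\<in>VOb C. \<forall>B\<in>VOb C.
        VCmp C A A B \<cdot>\<^bsub>V\<^esub> \<langle>Idn V (VHom C A B), VId C A \<cdot>\<^bsub>V\<^esub> bang V (VHom C A B)\<rangle>\<^bsub>V\<^esub>
          = Idn V (VHom C A B) \<and>
        VCmp C A B B \<cdot>\<^bsub>V\<^esub> \<langle>VId C B \<cdot>\<^bsub>V\<^esub> bang V (VHom C A B), Idn V (VHom C A B)\<rangle>\<^bsub>V\<^esub>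
          = Idn V (VHom C A B)) \<and>
     (\<forall>A\<in>VOb C. \<forall>B\<in>VOb C. \<forall>D\<in>VOb C. \<forall>E\<in>VOb C.
        (let P = VHom C D E \<otimes>\<^bsub>V\<^esub> VHom C B D; Q = VHom C A B;
             f = pr2 V P Q;
             g = pr2 V (VHom C D E) (VHom C B D) \<cdot>\<^bsub>V\<^esub> pr1 V P Q;
             h = pr1 V (VHom C D E) (VHom C B D) \<cdot>\<^bsub>V\<^esub> pr1 V P Q
         in VCmp C A B E \<cdot>\<^bsub>V\<^esub> \<langle>VCmp C B D E \<cdot>\<^bsub>V\<^esub> \<langle>h, g\<rangle>\<^bsub>V\<^esub>, f\<rangle>\<^bsub>V\<^esub>
            = VCmp C A D E \<cdot>\<^bsub>V\<^esub> \<langle>h, VCmp C A B D \<cdot>\<^bsub>V\<^esub> \<langle>g, f\<rangle>\<^bsub>V\<^esub>\<rangle>\<^bsub>V\<^esub>))"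

definition vop :: "('o, 'm) category \<Rightarrow> ('o, 'm, 'c) vcat \<Rightarrow> ('o, 'm, 'c) vcat" where
  "vop V C =
     \<lparr>VOb = VOb C,
      VHom = (\<lambda>A B. VHom C B A),
      VCmp = (\<lambda>A B D. VCmp C D B A \<cdot>\<^bsub>V\<^esub>
                \<langle>pr2 V (VHom C D B) (VHom C B A), pr1 V (VHom C D B) (VHom C B A)\<rangle>\<^bsub>V\<^esub>),
      VId = VId C\<rparr>"

definition vfull :: "('o, 'm, 'c) vcat \<Rightarrow> 'c set \<Rightarrow> ('o, 'm, 'c) vcat" where
  "vfull C S = C\<lparr>VOb := S\<rparr>"

text \<open>\<open>V\<close> as a category enriched over itself.\<close>

definition vself :: "('o, 'm) category \<Rightarrow> ('o, 'm, 'o) vcat" where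
  "vself V =
     \<lparr>VOb = Obj V,
      VHom = (\<lambda>A B. \<lbrakk>A, B\<rbrakk>\<^bsub>V\<^esub>),
      VCmp = (\<lambda>A B D.
        let P = \<lbrakk>B, D\<rbrakk>\<^bsub>V\<^esub> \<otimes>\<^bsub>V\<^esub> \<lbrakk>A, B\<rbrakk>\<^bsub>V\<^esub>;
            g = pr1 V \<lbrakk>B, D\<rbrakk>\<^bsub>V\<^esub> \<lbrakk>A, B\<rbrakk>\<^bsub>V\<^esub> \<cdot>\<^bsub>V\<^esub> pr1 V P A;
            f = pr2 V \<lbrakk>B, D\<rbrakk>\<^bsub>V\<^esub> \<lbrakk>A, B\<rbrakk>\<^bsub>V\<^esub> \<cdot>\<^bsub>V\<^esub> pr1 V P A
        in transpose V P A D (ev V B D \<cdot>\<^bsub>V\<^esub> \<langle>g, ev V A B \<cdot>\<^bsub>V\<^esub> \<langle>f, pr2 V P A\<rangle>\<^bsub>V\<^esub>\<rangle>\<^bsub>V\<^esub>)),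
      VId = (\<lambda>A. transpose V \<one>\<^bsub>V\<^esub> A A (pr2 V \<one>\<^bsub>V\<^esub> A))\<rparr>"

definition name_of :: "('o, 'm) category \<Rightarrow> 'm \<Rightarrow> 'm" where
  "name_of V f = transpose V \<one>\<^bsub>V\<^esub> (Dom V f) (Cod V f) (f \<cdot>\<^bsub>V\<^esub> pr2 V \<one>\<^bsub>V\<^esub> (Dom V f))"

record ('c, 'd, 'm) vfun =
  FOb :: "'c \<Rightarrow> 'd"
  FHom :: "'c \<Rightarrow> 'c \<Rightarrow> 'm"

text \<open>
  Enriched functors are \<open>undefined\<close> off the objects of their domain, so that equality of functors
  is equality of records and the functors form the right set of objects.
\<close>

definition is_vfun ::
    "('o, 'm) category \<Rightarrow> ('o, 'm, 'c) vcat \<Rightarrow> ('o, 'm, 'd) vcat \<Rightarrow> ('c, 'd, 'm) vfun \<Rightarrow> bool" where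
  "is_vfun V C D F \<longleftrightarrow>
     FOb F \<in> VOb C \<rightarrow>\<^sub>E VOb D \<and>
     (\<forall>A\<in>VOb C. \<forall>B\<in>VOb C. FHom F A B \<in> hom V (VHom C A B) (VHom D (FOb F A) (FOb F B))) \<and>
     (\<forall>A B. \<not> (A \<in> VOb C \<and> B \<in> VOb C) \<longrightarrow> FHom F A B = undefined) \<and>
     (\<forall>A\<in>VOb C. FHom F A A \<cdot>\<^bsub>V\<^esub> VId C A = VId D (FOb F A)) \<and>
     (\<forall>A\<in>VOb C. \<forall>B\<in>VOb C. \<forall>E\<in>VOb C.
        FHom F A E \<cdot>\<^bsub>V\<^esub> VCmp C A B E
          = VCmp D (FOb F A) (FOb F B) (FOb F E) \<cdot>\<^bsub>V\<^esub>
              \<langle>FHom F B E \<cdot>\<^bsub>V\<^esub> pr1 V (VHom C B E) (VHom C A B),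
               FHom F A B \<cdot>\<^bsub>V\<^esub> pr2 V (VHom C B E) (VHom C A B)\<rangle>\<^bsub>V\<^esub>)"

definition mk_vfun :: "'c set \<Rightarrow> ('c \<Rightarrow> 'd) \<Rightarrow> ('c \<Rightarrow> 'c \<Rightarrow> 'm) \<Rightarrow> ('c, 'd, 'm) vfun" where
  "mk_vfun K F0 F1 =
     \<lparr>FOb = restrict F0 K, FHom = (\<lambda>A B. if A \<in> K \<and> B \<in> K then F1 A B else undefined)\<rparr>"

definition vfun_comp ::
    "('o, 'm) category \<Rightarrow> ('o, 'm, 'c) vcat \<Rightarrow> ('d, 'e, 'm) vfun \<Rightarrow> ('c, 'd, 'm) vfun \<Rightarrow>
     ('c, 'e, 'm) vfun" where
  "vfun_comp V C G F =
     mk_vfun (VOb C) (\<lambda>A. FOb G (FOb F A))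
       (\<lambda>A B. FHom G (FOb F A) (FOb F B) \<cdot>\<^bsub>V\<^esub> FHom F A B)"

definition vfun_op :: "('c, 'd, 'm) vfun \<Rightarrow> ('c, 'd, 'm) vfun" where
  "vfun_op F = \<lparr>FOb = FOb F, FHom = (\<lambda>A B. FHom F B A)\<rparr>"

definition vrep ::
    "('o, 'm) category \<Rightarrow> ('o, 'm, 'c) vcat \<Rightarrow> 'c \<Rightarrow> ('c, 'o, 'm) vfun" where
  "vrep V C A = mk_vfun (VOb C) (\<lambda>B. VHom C A B)
     (\<lambda>B B'. transpose V (VHom C B B') (VHom C A B) (VHom C A B') (VCmp C A B B'))"

definition is_vnat ::
    "('o, 'm) category \<Rightarrow> ('o, 'm, 'c) vcat \<Rightarrow> ('o, 'm, 'd) vcat \<Rightarrow>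
     ('c, 'd, 'm) vfun \<Rightarrow> ('c, 'd, 'm) vfun \<Rightarrow> ('c \<Rightarrow> 'm) \<Rightarrow> bool" where
  "is_vnat V C D F G \<alpha> \<longleftrightarrow>
     (\<forall>A\<in>VOb C. \<alpha> A \<in> hom V \<one>\<^bsub>V\<^esub> (VHom D (FOb F A) (FOb G A))) \<and>
     (\<forall>A\<in>VOb C. \<forall>B\<in>VOb C.
        VCmp D (FOb F A) (FOb F B) (FOb G B) \<cdot>\<^bsub>V\<^esub> \<langle>\<alpha> B \<cdot>\<^bsub>V\<^esub> bang V (VHom C A B), FHom F A B\<rangle>\<^bsub>V\<^esub>
          = VCmp D (FOb F A) (FOb G A) (FOb G B) \<cdot>\<^bsub>V\<^esub>
              \<langle>FHom G A B, \<alpha> A \<cdot>\<^bsub>V\<^esub> bang V (VHom C A B)\<rangle>\<^bsub>V\<^esub>)"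

definition is_viso ::
    "('o, 'm) category \<Rightarrow> ('o, 'm, 'd) vcat \<Rightarrow> 'd \<Rightarrow> 'd \<Rightarrow> 'm \<Rightarrow> bool" where
  "is_viso V D A B f \<longleftrightarrow> f \<in> hom V \<one>\<^bsub>V\<^esub> (VHom D A B) \<and>
     (\<exists>g \<in> hom V \<one>\<^bsub>V\<^esub> (VHom D B A).
        VCmp D A B A \<cdot>\<^bsub>V\<^esub> \<langle>g, f\<rangle>\<^bsub>V\<^esub> = VId D A \<and> VCmp D B A B \<cdot>\<^bsub>V\<^esub> \<langle>f, g\<rangle>\<^bsub>V\<^esub> = VId D B)"

definition is_vnat_iso ::
    "('o, 'm) category \<Rightarrow> ('o, 'm, 'c) vcat \<Rightarrow> ('o, 'm, 'd) vcat \<Rightarrow>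
     ('c, 'd, 'm) vfun \<Rightarrow> ('c, 'd, 'm) vfun \<Rightarrow> ('c \<Rightarrow> 'm) \<Rightarrow> bool" where
  "is_vnat_iso V C D F G \<alpha> \<longleftrightarrow> is_vnat V C D F G \<alpha> \<and>
     (\<forall>A\<in>VOb C. is_viso V D (FOb F A) (FOb G A) (\<alpha> A))"

definition is_vterminal ::
    "('o, 'm) category \<Rightarrow> ('o, 'm, 'd) vcat \<Rightarrow> 'd \<Rightarrow> bool" where
  "is_vterminal V D T \<longleftrightarrow> T \<in> VOb D \<and> (\<forall>A\<in>VOb D. is_iso V (bang V (VHom D A T)))"


section \<open>The enriched functor category\<close>

text \<open>
  The end of \<open>[F i, F' i]\<close> over \<open>i\<close>, for functors \<open>F\<close>, \<open>F'\<close> from \<open>J\<close> to \<open>V\<close>. The bifunctor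
  \<open>[F -, F' -]\<close> acts by composing with \<open>F\<close> and \<open>F'\<close>; the wedge condition for \<open>X\<close> equates two
  maps from \<open>X \<times> J(i,j)\<close> to \<open>[F i, F' j]\<close>.
\<close>

definition is_wedge ::
    "('o, 'm) category \<Rightarrow> ('o, 'm, 'i) vcat \<Rightarrow> ('i, 'o, 'm) vfun \<Rightarrow> ('i, 'o, 'm) vfun \<Rightarrow>
     'o \<Rightarrow> ('i \<Rightarrow> 'm) \<Rightarrow> bool" where
  "is_wedge V J F F' X \<omega> \<longleftrightarrow> X \<in> Obj V \<and>
     (\<forall>i\<in>VOb J. \<omega> i \<in> hom V X \<lbrakk>FOb F i, FOb F' i\<rbrakk>\<^bsub>V\<^esub>) \<and>
     (\<forall>i\<in>VOb J. \<forall>j\<in>VOb J.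
        VCmp (vself V) (FOb F i) (FOb F j) (FOb F' j) \<cdot>\<^bsub>V\<^esub>
          \<langle>\<omega> j \<cdot>\<^bsub>V\<^esub> pr1 V X (VHom J i j), FHom F i j \<cdot>\<^bsub>V\<^esub> pr2 V X (VHom J i j)\<rangle>\<^bsub>V\<^esub>
        = VCmp (vself V) (FOb F i) (FOb F' i) (FOb F' j) \<cdot>\<^bsub>V\<^esub>
          \<langle>FHom F' i j \<cdot>\<^bsub>V\<^esub> pr2 V X (VHom J i j), \<omega> i \<cdot>\<^bsub>V\<^esub> pr1 V X (VHom J i j)\<rangle>\<^bsub>V\<^esub>)"

definition is_end ::
    "('o, 'm) category \<Rightarrow> ('o, 'm, 'i) vcat \<Rightarrow> ('i, 'o, 'm) vfun \<Rightarrow> ('i, 'o, 'm) vfun \<Rightarrow>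
     'o \<Rightarrow> ('i \<Rightarrow> 'm) \<Rightarrow> bool" where
  "is_end V J F F' E \<pi> \<longleftrightarrow> is_wedge V J F F' E \<pi> \<and>
     (\<forall>X \<omega>. is_wedge V J F F' X \<omega> \<longrightarrow>
        (\<exists>!h. h \<in> hom V X E \<and> (\<forall>i\<in>VOb J. \<pi> i \<cdot>\<^bsub>V\<^esub> h = \<omega> i)))"

definition chosen_end ::
    "('o, 'm) category \<Rightarrow> ('o, 'm, 'i) vcat \<Rightarrow> ('i, 'o, 'm) vfun \<Rightarrow> ('i, 'o, 'm) vfun \<Rightarrow>
     'o \<times> ('i \<Rightarrow> 'm)" where
  "chosen_end V J F F' = (SOME (E, \<pi>). is_end V J F F' E \<pi>)"

definition end_obj ::
    "('o, 'm) category \<Rightarrow> ('o, 'm, 'i) vcat \<Rightarrow> ('i, 'o, 'm) vfun \<Rightarrow> ('i, 'o, 'm) vfun \<Rightarrow> 'o" where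
  "end_obj V J F F' = fst (chosen_end V J F F')"

definition end_pr ::
    "('o, 'm) category \<Rightarrow> ('o, 'm, 'i) vcat \<Rightarrow> ('i, 'o, 'm) vfun \<Rightarrow> ('i, 'o, 'm) vfun \<Rightarrow>
     'i \<Rightarrow> 'm" where
  "end_pr V J F F' = snd (chosen_end V J F F')"

definition end_lift ::
    "('o, 'm) category \<Rightarrow> ('o, 'm, 'i) vcat \<Rightarrow> ('i, 'o, 'm) vfun \<Rightarrow> ('i, 'o, 'm) vfun \<Rightarrow>
     'o \<Rightarrow> ('i \<Rightarrow> 'm) \<Rightarrow> 'm" where
  "end_lift V J F F' X \<omega> = (THE h. h \<in> hom V X (end_obj V J F F') \<and>
                               (\<forall>i\<in>VOb J. end_pr V J F F' i \<cdot>\<^bsub>V\<^esub> h = \<omega> i))"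

definition vfun_cat ::
    "('o, 'm) category \<Rightarrow> ('o, 'm, 'i) vcat \<Rightarrow> ('o, 'm, ('i, 'o, 'm) vfun) vcat" where
  "vfun_cat V J =
     \<lparr>VOb = {F. is_vfun V J (vself V) F},
      VHom = end_obj V J,
      VCmp = (\<lambda>F G H.
        let P = end_obj V J G H; Q = end_obj V J F G
        in end_lift V J F H (P \<otimes>\<^bsub>V\<^esub> Q)
             (\<lambda>i. VCmp (vself V) (FOb F i) (FOb G i) (FOb H i) \<cdot>\<^bsub>V\<^esub>
                    \<langle>end_pr V J G H i \<cdot>\<^bsub>V\<^esub> pr1 V P Q, end_pr V J F G i \<cdot>\<^bsub>V\<^esub> pr2 V P Q\<rangle>\<^bsub>V\<^esub>)),
      VId = (\<lambda>F. end_lift V J F F \<one>\<^bsub>V\<^esub> (\<lambda>i. VId (vself V) (FOb F i)))\<rparr>"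

text \<open>The map from the terminal object to \<open>V\<^sup>J(F,F')\<close> corresponding to a natural transformation.\<close>

definition vnat_elem ::
    "('o, 'm) category \<Rightarrow> ('o, 'm, 'i) vcat \<Rightarrow> ('i, 'o, 'm) vfun \<Rightarrow> ('i, 'o, 'm) vfun \<Rightarrow>
     ('i \<Rightarrow> 'm) \<Rightarrow> 'm" where
  "vnat_elem V J F F' \<alpha> = end_lift V J F F' \<one>\<^bsub>V\<^esub> \<alpha>"


section \<open>Weighted limits\<close>

text \<open>The functor \<open>C(A,G-)\<close> from \<open>J\<close> to \<open>V\<close>.\<close>

definition hom_along ::
    "('o, 'm) category \<Rightarrow> ('o, 'm, 'i) vcat \<Rightarrow> ('o, 'm, 'c) vcat \<Rightarrow> ('i, 'c, 'm) vfun \<Rightarrow>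
     'c \<Rightarrow> ('i, 'o, 'm) vfun" where
  "hom_along V J C G A = vfun_comp V J (vrep V C A) G"

text \<open>The functor \<open>C(-,G)\<close> from the opposite of \<open>C\<close> to \<open>V\<^sup>J\<close>.\<close>

definition yoneda_along ::
    "('o, 'm) category \<Rightarrow> ('o, 'm, 'i) vcat \<Rightarrow> ('o, 'm, 'c) vcat \<Rightarrow> ('i, 'c, 'm) vfun \<Rightarrow>
     ('c, ('i, 'o, 'm) vfun, 'm) vfun" where
  "yoneda_along V J C G =
     mk_vfun (VOb C) (hom_along V J C G)
       (\<lambda>A B. end_lift V J (hom_along V J C G A) (hom_along V J C G B) (VHom C B A)
          (\<lambda>i. let P = VHom C B A; Q = VHom C A (FOb G i)
               in transpose V P Q (VHom C B (FOb G i))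
                    (VCmp C B A (FOb G i) \<cdot>\<^bsub>V\<^esub> \<langle>pr2 V P Q, pr1 V P Q\<rangle>\<^bsub>V\<^esub>)))"

text \<open>
  The component at \<open>A\<close> of \<open>\<lambda>\<^sup>*\<close>, as a map from \<open>C(A,L)\<close> to \<open>V\<^sup>J(W,C(A,G-))\<close>: act by \<open>C(-,G)\<close>
  and precompose with \<open>\<lambda>\<close>.
\<close>

definition induced_map ::
    "('o, 'm) category \<Rightarrow> ('o, 'm, 'i) vcat \<Rightarrow> ('o, 'm, 'c) vcat \<Rightarrow> ('i, 'c, 'm) vfun \<Rightarrow>
     ('i, 'o, 'm) vfun \<Rightarrow> 'c \<Rightarrow> ('i \<Rightarrow> 'm) \<Rightarrow> 'c \<Rightarrow> 'm" where
  "induced_map V J C G W L l A =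
     VCmp (vfun_cat V J) W (hom_along V J C G L) (hom_along V J C G A) \<cdot>\<^bsub>V\<^esub>
       \<langle>FHom (yoneda_along V J C G) L A,
        vnat_elem V J W (hom_along V J C G L) l \<cdot>\<^bsub>V\<^esub> bang V (VHom C A L)\<rangle>\<^bsub>V\<^esub>"

text \<open>\<open>vrep V (vop V C) L\<close> is \<open>C(-,L)\<close>.\<close>

definition is_weighted_limit ::
    "('o, 'm) category \<Rightarrow> ('o, 'm, 'i) vcat \<Rightarrow> ('o, 'm, 'c) vcat \<Rightarrow> ('i, 'c, 'm) vfun \<Rightarrow>
     ('i, 'o, 'm) vfun \<Rightarrow> 'c \<Rightarrow> ('i \<Rightarrow> 'm) \<Rightarrow> bool" where
  "is_weighted_limit V J C G W L l \<longleftrightarrow>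
     is_vnat_iso V (vop V C) (vself V)
       (vrep V (vop V C) L)
       (vfun_comp V (vop V C) (vrep V (vfun_cat V J) W) (yoneda_along V J C G))
       (\<lambda>A. name_of V (induced_map V J C G W L l A))"


section \<open>Internal categories\<close>

text \<open>
  The composition \<open>icmp\<close> is defined on the pullback of the source along the target, whose
  generalized elements are the pairs \<open>(g, f)\<close> for which the source of \<open>g\<close> is the target of \<open>f\<close>.
\<close>

record ('o, 'm) icat =
  ic0 :: 'o
  ic1 :: 'o
  isrc :: 'm
  itgt :: 'm
  iidn :: 'm
  icmp :: 'm

definition is_icat :: "('o, 'm) category \<Rightarrow> ('o, 'm) icat \<Rightarrow> bool" where
  "is_icat V A \<longleftrightarrow>
     (let s = isrc A; t = itgt A; i = iidn A; c = icmp A;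
          p = pb1 V s t; q = pb2 V s t;
          comp = (\<lambda>g f. c \<cdot>\<^bsub>V\<^esub> pb_pair V s t g f)
      in ic0 A \<in> Obj V \<and> ic1 A \<in> Obj V \<and>
         s \<in> hom V (ic1 A) (ic0 A) \<and> t \<in> hom V (ic1 A) (ic0 A) \<and>
         i \<in> hom V (ic0 A) (ic1 A) \<and> c \<in> hom V (pb_obj V s t) (ic1 A) \<and>
         s \<cdot>\<^bsub>V\<^esub> i = Idn V (ic0 A) \<and> t \<cdot>\<^bsub>V\<^esub> i = Idn V (ic0 A) \<and>
         s \<cdot>\<^bsub>V\<^esub> c = s \<cdot>\<^bsub>V\<^esub> q \<and> t \<cdot>\<^bsub>V\<^esub> c = t \<cdot>\<^bsub>V\<^esub> p \<and>
         comp (Idn V (ic1 A)) (i \<cdot>\<^bsub>V\<^esub> s) = Idn V (ic1 A) \<and>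
         comp (i \<cdot>\<^bsub>V\<^esub> t) (Idn V (ic1 A)) = Idn V (ic1 A) \<and>
         (let f = pb2 V (s \<cdot>\<^bsub>V\<^esub> q) t;
              g = q \<cdot>\<^bsub>V\<^esub> pb1 V (s \<cdot>\<^bsub>V\<^esub> q) t;
              h = p \<cdot>\<^bsub>V\<^esub> pb1 V (s \<cdot>\<^bsub>V\<^esub> q) t
          in comp (comp h g) f = comp h (comp g f)))"

record ('o, 'm) ifun =
  idom :: "('o, 'm) icat"
  icod :: "('o, 'm) icat"
  if0 :: 'm
  if1 :: 'm

definition is_ifun :: "('o, 'm) category \<Rightarrow> ('o, 'm) ifun \<Rightarrow> bool" where
  "is_ifun V F \<longleftrightarrow>
     (let A = idom F; B = icod F
      in is_icat V A \<and> is_icat V B \<and>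
         if0 F \<in> hom V (ic0 A) (ic0 B) \<and> if1 F \<in> hom V (ic1 A) (ic1 B) \<and>
         isrc B \<cdot>\<^bsub>V\<^esub> if1 F = if0 F \<cdot>\<^bsub>V\<^esub> isrc A \<and>
         itgt B \<cdot>\<^bsub>V\<^esub> if1 F = if0 F \<cdot>\<^bsub>V\<^esub> itgt A \<and>
         iidn B \<cdot>\<^bsub>V\<^esub> if0 F = if1 F \<cdot>\<^bsub>V\<^esub> iidn A \<and>
         if1 F \<cdot>\<^bsub>V\<^esub> icmp A =
           icmp B \<cdot>\<^bsub>V\<^esub> pb_pair V (isrc B) (itgt B)
             (if1 F \<cdot>\<^bsub>V\<^esub> pb1 V (isrc A) (itgt A)) (if1 F \<cdot>\<^bsub>V\<^esub> pb2 V (isrc A) (itgt A)))"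

definition CatV :: "('o, 'm) category \<Rightarrow> (('o, 'm) icat, ('o, 'm) ifun) category" where
  "CatV V =
     \<lparr>Obj = {A. is_icat V A},
      Arr = {F. is_ifun V F},
      Dom = idom,
      Cod = icod,
      Idn = (\<lambda>A. \<lparr>idom = A, icod = A, if0 = Idn V (ic0 A), if1 = Idn V (ic1 A)\<rparr>),
      Cmp = (\<lambda>G F. \<lparr>idom = idom F, icod = icod G,
                    if0 = if0 G \<cdot>\<^bsub>V\<^esub> if0 F, if1 = if1 G \<cdot>\<^bsub>V\<^esub> if1 F\<rparr>)\<rparr>"

definition cst :: "('o, 'm) category \<Rightarrow> 'o \<Rightarrow> ('o, 'm) icat" where
  "cst V X = \<lparr>ic0 = X, ic1 = X, isrc = Idn V X, itgt = Idn V X, iidn = Idn V X,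
              icmp = pb1 V (Idn V X) (Idn V X)\<rparr>"

text \<open>The internal functor from \<open>cst \<one>\<close> named by a map \<open>a\<close> from \<open>\<one>\<close> to the object of objects.\<close>

definition elem_ifun :: "('o, 'm) category \<Rightarrow> ('o, 'm) icat \<Rightarrow> 'm \<Rightarrow> ('o, 'm) ifun" where
  "elem_ifun V A a = \<lparr>idom = cst V \<one>\<^bsub>V\<^esub>, icod = A, if0 = a, if1 = iidn A \<cdot>\<^bsub>V\<^esub> a\<rparr>"

definition ibang :: "('o, 'm) category \<Rightarrow> ('o, 'm) icat \<Rightarrow> ('o, 'm) ifun" where
  "ibang V A = \<lparr>idom = A, icod = cst V \<one>\<^bsub>V\<^esub>, if0 = bang V (ic0 A), if1 = bang V (ic1 A)\<rparr>"

definition Int_obj :: "('o, 'm) category \<Rightarrow> ('o, 'm, 'c) vcat \<Rightarrow> 'o" where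
  "Int_obj V C = coprod_obj V (VOb C) (\<lambda>A. \<one>\<^bsub>V\<^esub>)"

definition Int_obj_incl :: "('o, 'm) category \<Rightarrow> ('o, 'm, 'c) vcat \<Rightarrow> 'c \<Rightarrow> 'm" where
  "Int_obj_incl V C A = incl V (VOb C) (\<lambda>A. \<one>\<^bsub>V\<^esub>) A"

definition Int_arr :: "('o, 'm) category \<Rightarrow> ('o, 'm, 'c) vcat \<Rightarrow> 'o" where
  "Int_arr V C = coprod_obj V (VOb C \<times> VOb C) (\<lambda>(A, B). VHom C A B)"

definition Int_arr_incl :: "('o, 'm) category \<Rightarrow> ('o, 'm, 'c) vcat \<Rightarrow> 'c \<Rightarrow> 'c \<Rightarrow> 'm" where
  "Int_arr_incl V C A B = incl V (VOb C \<times> VOb C) (\<lambda>(A, B). VHom C A B) (A, B)"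

definition Int_src :: "('o, 'm) category \<Rightarrow> ('o, 'm, 'c) vcat \<Rightarrow> 'm" where
  "Int_src V C = cotuple V (VOb C \<times> VOb C) (\<lambda>(A, B). VHom C A B) (Int_obj V C)
     (\<lambda>(A, B). Int_obj_incl V C A \<cdot>\<^bsub>V\<^esub> bang V (VHom C A B))"

definition Int_tgt :: "('o, 'm) category \<Rightarrow> ('o, 'm, 'c) vcat \<Rightarrow> 'm" where
  "Int_tgt V C = cotuple V (VOb C \<times> VOb C) (\<lambda>(A, B). VHom C A B) (Int_obj V C)
     (\<lambda>(A, B). Int_obj_incl V C B \<cdot>\<^bsub>V\<^esub> bang V (VHom C A B))"

text \<open>
  By extensivity the composable pairs of \<open>Int C\<close> form the coproduct of the objects
  \<open>C(B,D) \<times> C(A,B)\<close>, so the composition is the only map that restricts on each of these to the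
  composition of \<open>C\<close>.
\<close>

definition Int_cat :: "('o, 'm) category \<Rightarrow> ('o, 'm, 'c) vcat \<Rightarrow> ('o, 'm) icat" where
  "Int_cat V C =
     \<lparr>ic0 = Int_obj V C,
      ic1 = Int_arr V C,
      isrc = Int_src V C,
      itgt = Int_tgt V C,
      iidn = cotuple V (VOb C) (\<lambda>A. \<one>\<^bsub>V\<^esub>) (Int_arr V C) (\<lambda>A. Int_arr_incl V C A A \<cdot>\<^bsub>V\<^esub> VId C A),
      icmp = (THE c. c \<in> hom V (pb_obj V (Int_src V C) (Int_tgt V C)) (Int_arr V C) \<and>
                (\<forall>A\<in>VOb C. \<forall>B\<in>VOb C. \<forall>D\<in>VOb C.
                   c \<cdot>\<^bsub>V\<^esub> pb_pair V (Int_src V C) (Int_tgt V C)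
                         (Int_arr_incl V C B D \<cdot>\<^bsub>V\<^esub> pr1 V (VHom C B D) (VHom C A B))
                         (Int_arr_incl V C A B \<cdot>\<^bsub>V\<^esub> pr2 V (VHom C B D) (VHom C A B))
                   = Int_arr_incl V C A D \<cdot>\<^bsub>V\<^esub> VCmp C A B D))\<rparr>"

definition Int_fun ::
    "('o, 'm) category \<Rightarrow> ('o, 'm, 'c) vcat \<Rightarrow> ('o, 'm, 'd) vcat \<Rightarrow> ('c, 'd, 'm) vfun \<Rightarrow>
     ('o, 'm) ifun" where
  "Int_fun V C D F =
     \<lparr>idom = Int_cat V C,
      icod = Int_cat V D,
      if0 = cotuple V (VOb C) (\<lambda>A. \<one>\<^bsub>V\<^esub>) (Int_obj V D) (\<lambda>A. Int_obj_incl V D (FOb F A)),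
      if1 = cotuple V (VOb C \<times> VOb C) (\<lambda>(A, B). VHom C A B) (Int_arr V D)
              (\<lambda>(A, B). Int_arr_incl V D (FOb F A) (FOb F B) \<cdot>\<^bsub>V\<^esub> FHom F A B)\<rparr>"

definition Und :: "('o, 'm) category \<Rightarrow> ('o, 'm) icat \<Rightarrow> ('o, 'm, 'm) vcat" where
  "Und V A =
     (let st = \<langle>isrc A, itgt A\<rangle>\<^bsub>V\<^esub>;
          H = (\<lambda>a b. pb_obj V st \<langle>a, b\<rangle>\<^bsub>V\<^esub>);
          \<kappa> = (\<lambda>a b. pb1 V st \<langle>a, b\<rangle>\<^bsub>V\<^esub>)
      in \<lparr>VOb = hom V \<one>\<^bsub>V\<^esub> (ic0 A),
          VHom = H,
          VCmp = (\<lambda>a b d. THE m. m \<in> hom V (H b d \<otimes>\<^bsub>V\<^esub> H a b) (H a d) \<and>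
                    \<kappa> a d \<cdot>\<^bsub>V\<^esub> m = icmp A \<cdot>\<^bsub>V\<^esub> pb_pair V (isrc A) (itgt A)
                      (\<kappa> b d \<cdot>\<^bsub>V\<^esub> pr1 V (H b d) (H a b)) (\<kappa> a b \<cdot>\<^bsub>V\<^esub> pr2 V (H b d) (H a b))),
          VId = (\<lambda>a. THE m. m \<in> hom V \<one>\<^bsub>V\<^esub> (H a a) \<and> \<kappa> a a \<cdot>\<^bsub>V\<^esub> m = iidn A \<cdot>\<^bsub>V\<^esub> a)\<rparr>)"


section \<open>Comma internal categories and internal terminal objects\<close>

text \<open>
  The object \<open>0\<close> is \<open>False\<close> and \<open>1\<close> is \<open>True\<close>. A product with an initial factor is initial in a
  cartesian closed category, so there is exactly one candidate for each composition map.
\<close>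

definition two :: "('o, 'm) category \<Rightarrow> ('o, 'm, bool) vcat" where
  "two V =
     (let H = (\<lambda>a b. if a \<le> b then \<one>\<^bsub>V\<^esub> else \<zero>\<^bsub>V\<^esub>)
      in \<lparr>VOb = {False, True},
          VHom = H,
          VCmp = (\<lambda>a b d. THE m. m \<in> hom V (H b d \<otimes>\<^bsub>V\<^esub> H a b) (H a d)),
          VId = (\<lambda>a. Idn V \<one>\<^bsub>V\<^esub>)\<rparr>)"

definition itwo :: "('o, 'm) category \<Rightarrow> ('o, 'm) icat" where
  "itwo V = Int_cat V (two V)"

text \<open>The functor from \<open>two V\<close> to \<open>D\<close> that picks out the map \<open>f\<close> from \<open>\<one>\<close> to \<open>D(A,B)\<close>.\<close>

definition arrow_vfun ::
    "('o, 'm) category \<Rightarrow> ('o, 'm, 'd) vcat \<Rightarrow> 'd \<Rightarrow> 'd \<Rightarrow> 'm \<Rightarrow> (bool, 'd, 'm) vfun" where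
  "arrow_vfun V D A B f =
     mk_vfun {False, True} (\<lambda>x. if x then B else A)
       (\<lambda>x y. if x = y then VId D (if x then B else A)
              else if y then f
              else (THE h. h \<in> hom V \<zero>\<^bsub>V\<^esub> (VHom D B A)))"

text \<open>
  The internal functor from \<open>\<lbrakk>\<two>, B\<rbrakk>\<close> to \<open>B\<close> given by precomposition with an object \<open>k\<close> of \<open>\<two>\<close>, that
  is, by evaluation at \<open>k\<close>. Under the identification of \<open>\<lbrakk>* \<squnion> *, B\<rbrakk>\<close> with \<open>B \<times> B\<close> the functor
  \<open>\<langle>0,1\<rangle>\<^sup>*\<close> has the evaluations at \<open>0\<close> and at \<open>1\<close> as its components.
\<close>

definition eval_at :: "('o, 'm) category \<Rightarrow> ('o, 'm) icat \<Rightarrow> bool \<Rightarrow> ('o, 'm) ifun" where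
  "eval_at V B k =
     (let E = \<lbrakk>itwo V, B\<rbrakk>\<^bsub>CatV V\<^esub>
      in ev (CatV V) (itwo V) B \<cdot>\<^bsub>CatV V\<^esub>
           \<langle>Idn (CatV V) E,
            elem_ifun V (itwo V) (Int_obj_incl V (two V) k) \<cdot>\<^bsub>CatV V\<^esub> ibang V E\<rangle>\<^bsub>CatV V\<^esub>)"

definition ends_ifun :: "('o, 'm) category \<Rightarrow> ('o, 'm) icat \<Rightarrow> ('o, 'm) ifun" where
  "ends_ifun V B = \<langle>eval_at V B False, eval_at V B True\<rangle>\<^bsub>CatV V\<^esub>"

definition comma_cospan ::
    "('o, 'm) category \<Rightarrow> ('o, 'm) ifun \<Rightarrow> 'm \<Rightarrow> ('o, 'm) ifun" where
  "comma_cospan V H b = \<langle>H, elem_ifun V (icod H) b \<cdot>\<^bsub>CatV V\<^esub> ibang V (idom H)\<rangle>\<^bsub>CatV V\<^esub>"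

definition comma :: "('o, 'm) category \<Rightarrow> ('o, 'm) ifun \<Rightarrow> 'm \<Rightarrow> ('o, 'm) icat" where
  "comma V H b = pb_obj (CatV V) (comma_cospan V H b) (ends_ifun V (icod H))"

definition comma_proj :: "('o, 'm) category \<Rightarrow> ('o, 'm) ifun \<Rightarrow> 'm \<Rightarrow> ('o, 'm) ifun" where
  "comma_proj V H b = pb1 (CatV V) (comma_cospan V H b) (ends_ifun V (icod H))"

definition is_internal_terminal ::
    "('o, 'm) category \<Rightarrow> ('o, 'm) icat \<Rightarrow> 'm \<Rightarrow> bool" where
  "is_internal_terminal V A T \<longleftrightarrow> T \<in> hom V \<one>\<^bsub>V\<^esub> (ic0 A) \<and>
     is_iso (CatV V) (comma_proj V (Idn (CatV V) A) T)"


section \<open>The internal category of cones\<close>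

text \<open>
  \<open>S\<close> is the set of objects of the small full subcategory of \<open>(V\<^sup>J)\<^sup>o\<^sup>p\<close> that replaces
  \<open>(V\<^sup>J)\<^sup>o\<^sup>p\<close> itself.
\<close>

definition fun_sub_op ::
    "('o, 'm) category \<Rightarrow> ('o, 'm, 'i) vcat \<Rightarrow> ('i, 'o, 'm) vfun set \<Rightarrow>
     ('o, 'm, ('i, 'o, 'm) vfun) vcat" where
  "fun_sub_op V J S = vfull (vop V (vfun_cat V J)) S"

definition cone_functor ::
    "('o, 'm) category \<Rightarrow> ('o, 'm, 'i) vcat \<Rightarrow> ('o, 'm, 'c) vcat \<Rightarrow> ('i, 'c, 'm) vfun \<Rightarrow>
     ('i, 'o, 'm) vfun set \<Rightarrow> ('o, 'm) ifun" where
  "cone_functor V J C G S = Int_fun V C (fun_sub_op V J S) (vfun_op (yoneda_along V J C G))"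

definition cone_icat ::
    "('o, 'm) category \<Rightarrow> ('o, 'm, 'i) vcat \<Rightarrow> ('o, 'm, 'c) vcat \<Rightarrow> ('i, 'c, 'm) vfun \<Rightarrow>
     ('i, 'o, 'm) vfun \<Rightarrow> ('i, 'o, 'm) vfun set \<Rightarrow> ('o, 'm) icat" where
  "cone_icat V J C G W S =
     comma V (cone_functor V J C G S) (Int_obj_incl V (fun_sub_op V J S) W)"

text \<open>
  The element \<open>(L, \<lambda>)\<close>: its component in \<open>\<lbrakk>\<two>, Int ((V\<^sup>J)\<^sup>o\<^sup>p)\<rbrakk>\<close> is the transpose of the internal
  functor out of \<open>\<two>\<close> that picks out \<open>\<lambda>\<close>, an arrow from \<open>C(L,G-)\<close> to \<open>W\<close> in \<open>(V\<^sup>J)\<^sup>o\<^sup>p\<close>.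
\<close>

definition cone_elem ::
    "('o, 'm) category \<Rightarrow> ('o, 'm, 'i) vcat \<Rightarrow> ('o, 'm, 'c) vcat \<Rightarrow> ('i, 'c, 'm) vfun \<Rightarrow>
     ('i, 'o, 'm) vfun \<Rightarrow> ('i, 'o, 'm) vfun set \<Rightarrow> 'c \<Rightarrow> ('i \<Rightarrow> 'm) \<Rightarrow> 'm" where
  "cone_elem V J C G W S L l =
     (let H = cone_functor V J C G S;
          D = fun_sub_op V J S;
          arrow = arrow_vfun V D (hom_along V J C G L) W (vnat_elem V J W (hom_along V J C G L) l)
      in if0 (pb_pair (CatV V)
           (comma_cospan V H (Int_obj_incl V D W)) (ends_ifun V (icod H))
           (elem_ifun V (Int_cat V C) (Int_obj_incl V C L))
           (transpose (CatV V) (cst V \<one>\<^bsub>V\<^esub>) (itwo V) (Int_cat V D)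
              (Int_fun V (two V) D arrow \<cdot>\<^bsub>CatV V\<^esub> pr2 (CatV V) (cst V \<one>\<^bsub>V\<^esub>) (itwo V)))))"

text \<open>
  The internal functor from \<open>A\<close> to \<open>\<lbrakk>cst X, A\<rbrakk>\<close> induced by the map from \<open>cst X\<close> to the terminal
  internal category, under the identification of \<open>\<lbrakk>*, A\<rbrakk>\<close> with \<open>A\<close>.
\<close>

definition const_ifun :: "('o, 'm) category \<Rightarrow> 'o \<Rightarrow> ('o, 'm) icat \<Rightarrow> ('o, 'm) ifun" where
  "const_ifun V X A = transpose (CatV V) A (cst V X) A (pr1 (CatV V) A (cst V X))"

end

theory Submission
 imports Defs
begin

text \<open>
 The three conditions are compared through generalized elements. An element of \<open>Y\<close> at stage \<open>X\<close> is
 a map from \<open>X\<close> to \<open>Y\<close>, and a map is invertible if and only if it is bijective on elements at all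
 stages (\<open>is_iso_iff_points\<close>).

 An element of the slice of an internal category over \<open>T\<close> is an arrow into \<open>T\<close>. So \<open>T\<close> is an
 internal terminal object if and only if at every stage each element of the object of objects has
 exactly one arrow to \<open>T\<close> (\<open>internal_terminal_iff\<close>). An arrow of a comma category is a commutative
 triangle. For \<open>T = (L, \<lambda>)\<close> in \<open>W \<down> Int C(-,G)\<close>, terminality therefore says: for all elements \<open>a\<close>
 of the object of objects of \<open>Int C\<close> and all arrows \<open>\<phi>\<close> from the value of \<open>C(-,G)\<close> at \<open>a\<close> to \<open>W\<close>
 in \<open>(V\<^sup>J)\<^sup>o\<^sup>p\<close> there is exactly one arrow \<open>u\<close> from \<open>a\<close> to \<open>L\<close> whose image followed by \<open>\<lambda>\<close> is \<open>\<phi>\<close>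
 (\<open>comma_terminal_iff\<close>). By extensivity the stage is a coproduct of parts on which \<open>a\<close> is constant
 with value an object \<open>A\<close> of \<open>C\<close>. On such a part \<open>\<phi>\<close> is an element of \<open>V\<^sup>J(W, C(A,G-))\<close>, \<open>u\<close> is an
 element of \<open>C(A, L)\<close>, and the condition on \<open>u\<close> is that \<open>\<lambda>\<^sup>*\<close> takes it to \<open>\<phi>\<close>. Since unique
 solutions on the parts can be glued, terminality says that every component of \<open>\<lambda>\<^sup>*\<close> is bijective
 on elements (\<open>unique_fillers_iff\<close>), which is the limit property, because \<open>\<lambda>\<^sup>*\<close> is natural anyway
 (\<open>is_weighted_limit_iff\<close>).

 An element of \<open>\<lbrakk>cst X, A\<rbrakk>\<close> at stage \<open>Z\<close> is an element of \<open>A\<close> at stage \<open>Z \<otimes> X\<close>. Terminality in the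
 underlying enriched category thus concerns the arrows of \<open>A\<close> at the stages \<open>Z \<otimes> X\<close> whose
 source is defined at stage \<open>X\<close> (\<open>vterminal_power_iff\<close>). It follows from internal terminality. For
 \<open>Z = \<one>\<close> it makes the projection from the object of arrows into \<open>T\<close> to the object of objects
 bijective on elements at stage \<open>X\<close>, and a conservative family detects from this that the
 projection is invertible (\<open>internal_terminal_iff_vterminal\<close>).

 All this rests on a description of the elements of \<open>\<lbrakk>\<two>, B\<rbrakk>\<close> and \<open>\<lbrakk>cst X, A\<rbrakk>\<close>. Both exponentials
 are constructed: the first as the category of arrows and commutative squares of \<open>B\<close>
 (\<open>arrow_category_is_exponential\<close>), where functors out of \<open>\<two>\<close> are defined by cases on its summands,
 and the second levelwise (\<open>power_is_exponential\<close>).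
\<close>

text \<open>Composition in a category takes over the symbol of composition of functions.\<close>

no_notation (ASCII) comp (infixl "o" 55)
notation Cmp ("(_ o\<index>/ _)" [56, 55] 55)

section \<open>Generalized elements in a category\<close>

lemma in_hom: "f : hom V A B \<longleftrightarrow> f : Arr V \<and> Dom V f = A \<and> Cod V f = B"
 by (simp add: hom_def)

lemma some_triple:
 assumes "\<exists>a b c. P a b c" and "t = (SOME (a, b, c). P a b c)"
 shows "P (fst t) (fst (snd t)) (snd (snd t))"
proof -
 have "\<exists>t. case t of (a, b, c) \<Rightarrow> P a b c" using assms(1) by auto
 from someI_ex[OF this] show ?thesis
  unfolding assms(2) by (cases "SOME (a, b, c). P a b c") simp
qed

lemma some_pair:
 assumes "\<exists>a b. P a b" and "t = (SOME (a, b). P a b)"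
 shows "P (fst t) (snd t)"
proof -
 have "\<exists>t. case t of (a, b) \<Rightarrow> P a b" using assms(1) by auto
 from someI_ex[OF this] show ?thesis
  unfolding assms(2) by (cases "SOME (a, b). P a b") simp
qed

locale cat =
 fixes V :: "('o, 'm) category" (structure)
 assumes is_category: "is_category V"
begin

lemmas category_laws = is_category[unfolded is_category_def]

lemma dom_in_Obj [simp]: "f : Arr V ==> Dom V f : Obj V"
 and cod_in_Obj [simp]: "f : Arr V ==> Cod V f : Obj V"
 using conjunct1[OF category_laws] by blast+

lemma homD:
 assumes "f : hom V A B"
 shows "f : Arr V" "Dom V f = A" "Cod V f = B" "A : Obj V" "B : Obj V"
 using assms by (auto simp: in_hom)

lemma id_in_hom: "A : Obj V ==> Idn V A : hom V A A"
 by (rule bspec[OF conjunct1[OF conjunct2[OF category_laws]]])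

lemma id_arr [simp]: "A : Obj V ==> Idn V A : Arr V"
 and id_dom [simp]: "A : Obj V ==> Dom V (Idn V A) = A"
 and id_cod [simp]: "A : Obj V ==> Cod V (Idn V A) = A"
 using id_in_hom[of A] by (auto simp only: in_hom)

lemma comp_in_hom: "f : hom V A B ==> g : hom V B C ==> g o f : hom V A C"
 by (rule conjunct1[OF conjunct2[OF conjunct2[OF category_laws]], rule_format, OF conjI])

lemma
 assumes "f : Arr V" "g : Arr V" "Dom V g = Cod V f"
 shows comp_arr [simp]: "g o f : Arr V"
  and comp_dom [simp]: "Dom V (g o f) = Dom V f"
  and comp_cod [simp]: "Cod V (g o f) = Cod V g"
 using comp_in_hom[of f "Dom V f" "Cod V f" g "Cod V g"] assms by (auto simp: in_hom)

lemma
 assumes "f : Arr V"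
 shows comp_id_right [simp]: "Dom V f = A ==> f o Idn V A = f"
  and comp_id_left [simp]: "Cod V f = B ==> Idn V B o f = f"
proof -
 have "f : hom V (Dom V f) (Cod V f)" using assms by (simp add: in_hom)
 then have "f o Idn V (Dom V f) = f \<and> Idn V (Cod V f) o f = f"
  by (rule conjunct1[OF conjunct2[OF conjunct2[OF conjunct2[OF category_laws]]], rule_format])
 then show "Dom V f = A ==> f o Idn V A = f" "Cod V f = B ==> Idn V B o f = f"
  by blast+
qed

lemma comp_assoc [simp]:
 assumes "f : Arr V" "g : Arr V" "h : Arr V" "Dom V g = Cod V f" "Dom V h = Cod V g"
 shows "(h o g) o f = h o (g o f)"
 by (rule conjunct2[OF conjunct2[OF conjunct2[OF conjunct2[OF category_laws]]], rule_format,
    of _ "Dom V f" "Dom V g" _ "Dom V h" _ "Cod V h"])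
  (use assms in \<open>auto simp: in_hom\<close>)

lemma isoE:
 assumes "is_iso V f" "f : hom V A B"
 obtains g where "g : hom V B A" "g o f = Idn V A" "f o g = Idn V B"
 using assms homD(2,3)[OF assms(2)] by (auto simp: is_iso_def)

lemma isoI:
 assumes "f : hom V A B" "g : hom V B A" "g o f = Idn V A" "f o g = Idn V B"
 shows "is_iso V f"
 using assms homD(1-3)[OF assms(1)] by (auto simp: is_iso_def)

text \<open>
 The Yoneda lemma in the form used throughout: a map is invertible as soon as it is bijective on
 generalized elements; the inverse is the element over the identity.
\<close>

lemma is_iso_iff_points:
 assumes f: "f : hom V A B"
 shows "is_iso V f \<longleftrightarrow> (\<forall>X\<in>Obj V. \<forall>b\<in>hom V X B. \<exists>!a. a : hom V X A \<and> f o a = b)"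
proof
 note [simp] = homD[OF f]
 assume "is_iso V f"
 then obtain g where g: "g : hom V B A" "g o f = Idn V A" "f o g = Idn V B"
  using f by (rule isoE)
 note [simp] = homD[OF g(1)]
 show "\<forall>X\<in>Obj V. \<forall>b\<in>hom V X B. \<exists>!a. a : hom V X A \<and> f o a = b"
 proof (intro ballI ex1I)
  fix X b assume b: "b : hom V X B"
  note [simp] = homD[OF b]
  have "f o (g o b) = (f o g) o b" by (subst comp_assoc) auto
  then show "g o b : hom V X A \<and> f o (g o b) = b"
   using g by (simp add: in_hom)
  fix a assume a: "a : hom V X A \<and> f o a = b"
  then have "g o b = (g o f) o a" using f by (subst comp_assoc) (auto simp: in_hom)
  then show "a = g o b" using a g by (simp add: in_hom)
 qed
next
 note [simp] = homD[OF f]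
 assume *: "\<forall>X\<in>Obj V. \<forall>b\<in>hom V X B. \<exists>!a. a : hom V X A \<and> f o a = b"
 have "Idn V B : hom V B B" by (simp add: in_hom)
 then obtain g where g: "g : hom V B A" "f o g = Idn V B"
  using * by (metis homD(5)[OF f])
 note [simp] = homD[OF g(1)]
 have "(f o g) o f = f" by (simp only: g) simp
 then have "f o (g o f) = f" by (subst (asm) comp_assoc) auto
 moreover have "g o f : hom V A A" "Idn V A : hom V A A" "f : hom V A B" "f o Idn V A = f"
  using f by (auto simp: in_hom)
 ultimately have "g o f = Idn V A"
  using * homD(4)[OF f] by metis
 then show "is_iso V f" using f g isoI by blast
qed

lemma square_point:
 assumes "f o a = g o b" "f : Arr V" "a : Arr V" "g : Arr V" "b : Arr V" "x : Arr V"
  "Dom V f = Cod V a" "Dom V g = Cod V b" "Dom V a = Cod V x" "Dom V b = Cod V x"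
 shows "f o (a o x) = g o (b o x)"
 using assms comp_assoc[of x a f] comp_assoc[of x b g] by metis

lemma comp_iso_cancel:
 assumes "g o f = Idn V A" "f : hom V A B" "g : hom V B A" "x : hom V X A"
 shows "g o (f o x) = x"
proof -
 have "g o (f o x) = (g o f) o x"
  using assms(2-) by (subst comp_assoc) (auto simp: in_hom)
 then show ?thesis using assms by (simp add: in_hom)
qed

text \<open>Chosen pullbacks are compared with constructed ones along this isomorphism.\<close>

lemma pullback_lift:
 assumes "is_pullback V f g P p q" "a : hom V X (Dom V f)" "b : hom V X (Dom V g)"
  "f o a = g o b"
 obtains h where "h : hom V X P" "p o h = a" "q o h = b"
 using assms unfolding is_pullback_def by blast

lemma pullback_ext:
 assumes "is_pullback V f g P p q" "h : hom V X P" "k : hom V X P"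
  "p o h = p o k" "q o h = q o k"
 shows "h = k"
proof -
 have P: "f : Arr V" "g : Arr V" "Cod V f = Cod V g"
   "p : hom V P (Dom V f)" "q : hom V P (Dom V g)" "f o p = g o q"
  using assms(1) unfolding is_pullback_def by auto
 have "f o p o h = (f o p) o h" "g o q o h = (g o q) o h"
  using P(1-5) assms(2) by (auto simp: in_hom)
 then have "f o (p o h) = g o (q o h)" by (simp only: P)
 moreover have "p o h : hom V X (Dom V f)" "q o h : hom V X (Dom V g)"
  using P(4,5) assms(2) by (auto simp: in_hom)
 ultimately have "\<exists>!z. z : hom V X P \<and> p o z = p o h \<and> q o z = q o h"
  using assms(1) unfolding is_pullback_def by blast
 then show ?thesis using assms by metis
qed

lemma pullback_cone_iso:
 assumes 1: "is_pullback V f g P p q" and 2: "is_pullback V f g P' p' q'"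
 obtains h k where "h : hom V P P'" "k : hom V P' P" "k o h = Idn V P" "h o k = Idn V P'"
  "p' o h = p" "q' o h = q" "p o k = p'" "q o k = q'"
proof -
 have p: "p : hom V P (Dom V f)" "q : hom V P (Dom V g)" "f o p = g o q"
  using 1 unfolding is_pullback_def by auto
 have p': "p' : hom V P' (Dom V f)" "q' : hom V P' (Dom V g)" "f o p' = g o q'"
  using 2 unfolding is_pullback_def by auto
 note [simp] = homD[OF p(1)] homD[OF p(2)] homD[OF p'(1)] homD[OF p'(2)]
 obtain h where h: "h : hom V P P'" "p' o h = p" "q' o h = q"
  using 2 p by (rule pullback_lift)
 obtain k where k: "k : hom V P' P" "p o k = p'" "q o k = q'"
  using 1 p' by (rule pullback_lift)
 note [simp] = homD[OF h(1)] homD[OF k(1)]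
 have "p o k o h = (p o k) o h" "q o k o h = (q o k) o h"
  "p' o h o k = (p' o h) o k" "q' o h o k = (q' o h) o k"
  by (subst comp_assoc; simp)+
 then have "p o k o h = p" "q o k o h = q" "p' o h o k = p'" "q' o h o k = q'"
  by (simp_all only: h k)
 then have "k o h = Idn V P" "h o k = Idn V P'"
  using pullback_ext[OF 1, of "k o h" P "Idn V P"] pullback_ext[OF 2, of "h o k" P' "Idn V P'"]
  by (auto simp: in_hom)
 then show thesis using that h k by blast
qed

lemma pullback_iso_invariant:
 assumes 1: "is_pullback V f g P p q" and h: "h : hom V P' P" "k : hom V P P'"
  "k o h = Idn V P'" "h o k = Idn V P"
 shows "is_pullback V f g P' (p o h) (q o h)"
proof -
 have P: "f : Arr V" "g : Arr V" "Cod V f = Cod V g"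
   "p : hom V P (Dom V f)" "q : hom V P (Dom V g)" "f o p = g o q"
  using 1 unfolding is_pullback_def by auto
 note [simp] = P(1-3) homD[OF P(4)] homD[OF P(5)] homD[OF h(1)] homD[OF h(2)]
 have "f o p o h = (f o p) o h" "g o q o h = (g o q) o h"
  by (subst comp_assoc; simp)+
 then have *: "f o (p o h) = g o (q o h)" by (simp only: P)
 have "\<exists>!z. z : hom V X P' \<and> (p o h) o z = a \<and> (q o h) o z = b"
  if ab: "a : hom V X (Dom V f)" "b : hom V X (Dom V g)" "f o a = g o b" for X a b
 proof -
  obtain z where z: "z : hom V X P" "p o z = a" "q o z = b"
   using 1 ab by (rule pullback_lift)
  note [simp] = homD[OF z(1)]
  have hk: "h o (k o z) = z" using comp_iso_cancel[OF h(4) h(2) h(1) z(1)] .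
  show ?thesis
  proof (intro ex1I[of _ "k o z"] conjI)
   show "k o z : hom V X P'" by (simp add: in_hom)
   show "(p o h) o k o z = a" "(q o h) o k o z = b" using z by (simp_all add: hk)
   fix w assume w: "w : hom V X P' \<and> (p o h) o w = a \<and> (q o h) o w = b"
   then have "w : hom V X P'" by blast
   note [simp] = homD[OF this]
   have "h o w = z"
    using w z pullback_ext[OF 1, of "h o w" X z] by (simp add: in_hom)
   then show "w = k o z"
    using comp_iso_cancel[OF h(3) h(1) h(2), of w X] w by simp
  qed
 qed
 then show ?thesis using * unfolding is_pullback_def by (auto simp: in_hom)
qed

end

subsection \<open>Products\<close>

locale cat_with_products = cat +
 assumes products: "\<forall>A\<in>Obj V. \<forall>B\<in>Obj V. \<exists>P p q. is_product V A B P p q"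
begin

lemma chosen_product:
 assumes "A : Obj V" "B : Obj V"
 shows "is_product V A B (A \<otimes> B) (pr1 V A B) (pr2 V A B)"
 unfolding prod_obj_def pr1_def pr2_def
 by (rule some_triple[OF _ chosen_product_def]) (use products assms in blast)

lemma
 assumes "A : Obj V" "B : Obj V"
 shows pr1_arr [simp]: "pr1 V A B : Arr V"
  and pr1_dom [simp]: "Dom V (pr1 V A B) = A \<otimes> B"
  and pr1_cod [simp]: "Cod V (pr1 V A B) = A"
  and pr2_arr [simp]: "pr2 V A B : Arr V"
  and pr2_dom [simp]: "Dom V (pr2 V A B) = A \<otimes> B"
  and pr2_cod [simp]: "Cod V (pr2 V A B) = B"
  and prod_in_Obj [simp]: "A \<otimes> B : Obj V"
 using chosen_product[OF assms] dom_in_Obj unfolding is_product_def in_hom by metis+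

lemma pairing_ex1:
 assumes "f : Arr V" "g : Arr V" "Dom V f = Dom V g"
 shows "\<exists>!h. h : hom V (Dom V f) (Cod V f \<otimes> Cod V g) \<and>
     pr1 V (Cod V f) (Cod V g) o h = f \<and> pr2 V (Cod V f) (Cod V g) o h = g"
proof -
 have "f : hom V (Dom V f) (Cod V f)" "g : hom V (Dom V f) (Cod V g)"
  using assms by (simp_all add: in_hom)
 then show ?thesis
  using chosen_product[of "Cod V f" "Cod V g"] assms(1,2) unfolding is_product_def by simp
qed

lemma pairing_unique:
 assumes "f : Arr V" "g : Arr V" "Dom V f = Dom V g"
  "h : hom V (Dom V f) (Cod V f \<otimes> Cod V g)"
  "pr1 V (Cod V f) (Cod V g) o h = f" "pr2 V (Cod V f) (Cod V g) o h = g"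
 shows "\<langle>f, g\<rangle> = h"
proof -
 show ?thesis unfolding pairing_def using assms by (intro the1_equality[OF pairing_ex1]) auto
qed

lemma pairing_props:
 assumes "f : Arr V" "g : Arr V" "Dom V f = Dom V g"
 shows "\<langle>f, g\<rangle> \<in> hom V (Dom V f) (Cod V f \<otimes> Cod V g) \<and>
     pr1 V (Cod V f) (Cod V g) o \<langle>f, g\<rangle> = f \<and> pr2 V (Cod V f) (Cod V g) o \<langle>f, g\<rangle> = g"
proof -
 from theI'[OF pairing_ex1[OF assms]] show ?thesis unfolding pairing_def .
qed

lemma
 assumes "f : Arr V" "g : Arr V" "Dom V f = Dom V g"
 shows pairing_arr [simp]: "\<langle>f, g\<rangle> \<in> Arr V"
  and pairing_dom [simp]: "Dom V \<langle>f, g\<rangle> = Dom V g"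
  and pairing_cod [simp]: "Cod V \<langle>f, g\<rangle> = Cod V f \<otimes> Cod V g"
 using pairing_props[OF assms] assms by (auto simp: in_hom)

lemma pr1_pairing [simp]:
 "f : Arr V ==> g : Arr V ==> Dom V f = Dom V g ==> Cod V f = A ==> Cod V g = B ==>
  pr1 V A B o \<langle>f, g\<rangle> = f"
 and pr2_pairing [simp]:
 "f : Arr V ==> g : Arr V ==> Dom V f = Dom V g ==> Cod V f = A ==> Cod V g = B ==>
  pr2 V A B o \<langle>f, g\<rangle> = g"
 using pairing_props by blast+

lemma prod_ext:
 assumes "h : Arr V" "k : Arr V" "Dom V h = Dom V k" "Cod V h = A \<otimes> B" "Cod V k = A \<otimes> B"
  "A : Obj V" "B : Obj V" "pr1 V A B o h = pr1 V A B o k" "pr2 V A B o h = pr2 V A B o k"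
 shows "h = k"
proof -
 have "\<langle>pr1 V A B o h, pr2 V A B o h\<rangle> = h"
  using assms by (intro pairing_unique) (auto simp: in_hom)
 moreover have "\<langle>pr1 V A B o h, pr2 V A B o h\<rangle> = k"
  using assms by (intro pairing_unique) (auto simp: in_hom)
 ultimately show ?thesis by simp
qed

lemma pairing_comp [simp]:
 assumes "f : Arr V" "g : Arr V" "Dom V f = Dom V g" "x : Arr V" "Cod V x = Dom V g"
 shows "\<langle>f, g\<rangle> o x = \<langle>f o x, g o x\<rangle>"
proof -
 have "pr1 V (Cod V f) (Cod V g) o \<langle>f, g\<rangle> o x = (pr1 V (Cod V f) (Cod V g) o \<langle>f, g\<rangle>) o x"
  "pr2 V (Cod V f) (Cod V g) o \<langle>f, g\<rangle> o x = (pr2 V (Cod V f) (Cod V g) o \<langle>f, g\<rangle>) o x"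
  using assms by (subst comp_assoc; simp)+
 then show ?thesis
  using assms by (intro pairing_unique[symmetric]) (auto simp: in_hom)
qed

lemma pairing_eta:
 assumes "h : Arr V" "Cod V h = A \<otimes> B" "A : Obj V" "B : Obj V"
 shows "\<langle>pr1 V A B o h, pr2 V A B o h\<rangle> = h"
 using assms by (intro pairing_unique) (auto simp: in_hom)

lemma pairing_pr [simp]:
 "A : Obj V ==> B : Obj V ==> \<langle>pr1 V A B, pr2 V A B\<rangle> = Idn V (A \<otimes> B)"
 by (intro pairing_unique) (auto simp: in_hom)

lemma pairing_eq_iff:
 assumes "f : Arr V" "g : Arr V" "Dom V f = Dom V g"
  "f' : Arr V" "g' : Arr V" "Dom V f' = Dom V g'"
  "Cod V f' = Cod V f" "Cod V g' = Cod V g"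
 shows "\<langle>f, g\<rangle> = \<langle>f', g'\<rangle> \<longleftrightarrow> f = f' \<and> g = g'"
 using assms pr1_pairing pr2_pairing by metis

end

subsection \<open>Pullbacks\<close>

locale cat_with_pullbacks = cat +
 assumes pullbacks: "has_pullbacks V"
begin

lemma chosen_pullback:
 assumes "f : Arr V" "g : Arr V" "Cod V f = Cod V g"
 shows "is_pullback V f g (pb_obj V f g) (pb1 V f g) (pb2 V f g)"
 unfolding pb_obj_def pb1_def pb2_def
 by (rule some_triple[OF _ chosen_pullback_def])
  (use pullbacks assms in \<open>unfold has_pullbacks_def, blast\<close>)

lemma
 assumes "f : Arr V" "g : Arr V" "Cod V f = Cod V g"
 shows pb1_arr [simp]: "pb1 V f g : Arr V"
  and pb1_dom [simp]: "Dom V (pb1 V f g) = pb_obj V f g"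
  and pb1_cod [simp]: "Cod V (pb1 V f g) = Dom V f"
  and pb2_arr [simp]: "pb2 V f g : Arr V"
  and pb2_dom [simp]: "Dom V (pb2 V f g) = pb_obj V f g"
  and pb2_cod [simp]: "Cod V (pb2 V f g) = Dom V g"
  and pb_in_Obj [simp]: "pb_obj V f g : Obj V"
  and pb_square: "f o pb1 V f g = g o pb2 V f g"
 using chosen_pullback[OF assms] dom_in_Obj unfolding is_pullback_def in_hom by metis+

lemma pb_square_point:
 assumes "f : Arr V" "g : Arr V" "Cod V f = Cod V g" "x : Arr V" "Cod V x = pb_obj V f g"
 shows "f o (pb1 V f g o x) = g o (pb2 V f g o x)"
proof -
 have "f o (pb1 V f g o x) = (f o pb1 V f g) o x"
  "g o (pb2 V f g o x) = (g o pb2 V f g) o x"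
  using assms by (subst comp_assoc; simp)+
 then show ?thesis using pb_square[OF assms(1-3)] by simp
qed

context
 fixes f g a b
 assumes *: "f : Arr V" "g : Arr V" "a : Arr V" "b : Arr V"
  "Cod V f = Cod V g" "Dom V f = Cod V a" "Dom V g = Cod V b" "Dom V a = Dom V b"
  "f o a = g o b"
begin

private lemma ex1:
 "\<exists>!h. h : hom V (Dom V a) (pb_obj V f g) \<and> pb1 V f g o h = a \<and> pb2 V f g o h = b"
proof -
 have "a : hom V (Dom V a) (Dom V f)" "b : hom V (Dom V a) (Dom V g)"
  using * by (simp_all add: in_hom)
 then show ?thesis
  using chosen_pullback[OF *(1,2,5)] *(9) unfolding is_pullback_def by blast
qed

private lemma pb_pair_props:
 "pb_pair V f g a b : hom V (Dom V a) (pb_obj V f g) \<and>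
  pb1 V f g o pb_pair V f g a b = a \<and> pb2 V f g o pb_pair V f g a b = b"
 using theI'[OF ex1] unfolding pb_pair_def .

lemma pb_pair_arr [simp]: "pb_pair V f g a b : Arr V"
 and pb_pair_dom [simp]: "Dom V (pb_pair V f g a b) = Dom V b"
 and pb_pair_cod [simp]: "Cod V (pb_pair V f g a b) = pb_obj V f g"
 and pb1_pb_pair [simp]: "pb1 V f g o pb_pair V f g a b = a"
 and pb2_pb_pair [simp]: "pb2 V f g o pb_pair V f g a b = b"
 using pb_pair_props * by (auto simp: in_hom)

end

lemma pb_ext:
 assumes "h : Arr V" "k : Arr V" "Dom V h = Dom V k" "Cod V h = pb_obj V f g" "Cod V k = pb_obj V f g"
  "f : Arr V" "g : Arr V" "Cod V f = Cod V g"
  "pb1 V f g o h = pb1 V f g o k" "pb2 V f g o h = pb2 V f g o k"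
 shows "h = k"
 using pullback_ext[OF chosen_pullback, of f g h "Dom V h" k] assms by (simp add: in_hom)

lemma pb_pair_comp [simp]:
 assumes "f : Arr V" "g : Arr V" "a : Arr V" "b : Arr V"
  "Cod V f = Cod V g" "Dom V f = Cod V a" "Dom V g = Cod V b" "Dom V a = Dom V b"
  "f o a = g o b" "x : Arr V" "Cod V x = Dom V b"
 shows "pb_pair V f g a b o x = pb_pair V f g (a o x) (b o x)"
proof -
 have eq: "f o a o x = g o b o x"
  by (rule square_point) (use assms in simp_all)
 have "pb1 V f g o pb_pair V f g a b o x = (pb1 V f g o pb_pair V f g a b) o x"
  "pb2 V f g o pb_pair V f g a b o x = (pb2 V f g o pb_pair V f g a b) o x"
  using assms by (subst comp_assoc; simp)+
 then show ?thesis
  by - (rule pb_ext[of _ _ f g]; use assms eq in simp)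
qed

lemma pb_pair_eta:
 assumes "f : Arr V" "g : Arr V" "Cod V f = Cod V g" "h : Arr V" "Cod V h = pb_obj V f g"
 shows "pb_pair V f g (pb1 V f g o h) (pb2 V f g o h) = h"
 by (rule pb_ext[of _ _ f g]) (use assms in \<open>simp_all add: pb_square_point\<close>)

lemma pb_pair_pb [simp]:
 "f : Arr V ==> g : Arr V ==> Cod V f = Cod V g ==>
  pb_pair V f g (pb1 V f g) (pb2 V f g) = Idn V (pb_obj V f g)"
 by (rule pb_ext[of _ _ f g]) (auto simp: pb_square)

end

subsection \<open>Exponentials\<close>

context cat_with_products
begin

text \<open>
 Exponentials are treated one at a time, since only some exponentials of internal categories will
 be needed.
\<close>

lemma chosen_exponential:
 assumes "is_exponential V A B E e"
 shows "is_exponential V A B \<lbrakk>A, B\<rbrakk> (ev V A B)"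
 unfolding exp_obj_def ev_def
 by (rule some_pair[OF _ chosen_exponential_def]) (use assms in blast)

lemma transpose_props:
 assumes "is_exponential V A B \<lbrakk>A, B\<rbrakk> (ev V A B)" "X : Obj V" "f : hom V (X \<otimes> A) B"
 shows "transpose V X A B f : hom V X \<lbrakk>A, B\<rbrakk> \<and>
  ev V A B o \<langle>transpose V X A B f o pr1 V X A, pr2 V X A\<rangle> = f"
proof -
 have "\<exists>!h. h : hom V X \<lbrakk>A, B\<rbrakk> \<and> ev V A B o \<langle>h o pr1 V X A, pr2 V X A\<rangle> = f"
  using assms unfolding is_exponential_def by blast
 from theI'[OF this] show ?thesis unfolding transpose_def .
qed

lemma exponential_iso:
 assumes 1: "is_exponential V A B E e" and 2: "is_exponential V A B E' e'" and A: "A : Obj V"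
 obtains h k where "h : hom V E E'" "k : hom V E' E" "k o h = Idn V E" "h o k = Idn V E'"
  "e' o \<langle>h o pr1 V E A, pr2 V E A\<rangle> = e" "e o \<langle>k o pr1 V E' A, pr2 V E' A\<rangle> = e'"
proof -
 have E: "E : Obj V" "E' : Obj V" "e : hom V (E \<otimes> A) B" "e' : hom V (E' \<otimes> A) B"
  using 1 2 unfolding is_exponential_def by auto
 obtain h where h: "h : hom V E E'" "e' o \<langle>h o pr1 V E A, pr2 V E A\<rangle> = e"
  using 2 E unfolding is_exponential_def by blast
 obtain k where k: "k : hom V E' E" "e o \<langle>k o pr1 V E' A, pr2 V E' A\<rangle> = e'"
  using 1 E unfolding is_exponential_def by blast
 note [simp] = A E(1,2) homD[OF h(1)] homD[OF k(1)] homD[OF E(3)] homD[OF E(4)]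
 have "e o \<langle>(k o h) o pr1 V E A, pr2 V E A\<rangle>
   = (e o \<langle>k o pr1 V E' A, pr2 V E' A\<rangle>) o \<langle>h o pr1 V E A, pr2 V E A\<rangle>"
  by simp
 then have 3: "e o \<langle>(k o h) o pr1 V E A, pr2 V E A\<rangle> = e"
  by (simp only: h k)
 have "e' o \<langle>(h o k) o pr1 V E' A, pr2 V E' A\<rangle>
   = (e' o \<langle>h o pr1 V E A, pr2 V E A\<rangle>) o \<langle>k o pr1 V E' A, pr2 V E' A\<rangle>"
  by simp
 then have 4: "e' o \<langle>(h o k) o pr1 V E' A, pr2 V E' A\<rangle> = e'"
  by (simp only: h k)
 have "\<exists>!u. u : hom V E E \<and> e o \<langle>u o pr1 V E A, pr2 V E A\<rangle> = e"
  using 1 E unfolding is_exponential_def by blast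
 moreover have "k o h : hom V E E" "Idn V E : hom V E E" by (auto simp: in_hom)
 moreover have "e o \<langle>Idn V E o pr1 V E A, pr2 V E A\<rangle> = e" by simp
 ultimately have kh: "k o h = Idn V E" using 3 by blast
 have "\<exists>!u. u : hom V E' E' \<and> e' o \<langle>u o pr1 V E' A, pr2 V E' A\<rangle> = e'"
  using 2 E unfolding is_exponential_def by blast
 moreover have "h o k : hom V E' E'" "Idn V E' : hom V E' E'" by (auto simp: in_hom)
 moreover have "e' o \<langle>Idn V E' o pr1 V E' A, pr2 V E' A\<rangle> = e'" by simp
 ultimately have hk: "h o k = Idn V E'" using 4 by blast
 show thesis using that h k kh hk by blast
qed

end

locale ccc = cat_with_products +
 assumes closed: "cartesian_closed V"
begin

lemma terminal_one: "is_terminal V \<one>"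
 using closed someI_ex[of "is_terminal V"] unfolding cartesian_closed_def one_obj_def by blast

lemma one_in_Obj [simp]: "\<one> \<in> Obj V"
 using terminal_one unfolding is_terminal_def by blast

lemma bang_in_hom: "A : Obj V ==> bang V A : hom V A \<one>"
 using terminal_one theI'[of "\<lambda>f. f : hom V A \<one>"] unfolding is_terminal_def bang_def by blast

lemma bang_arr [simp]: "A : Obj V ==> bang V A : Arr V"
 and bang_dom [simp]: "A : Obj V ==> Dom V (bang V A) = A"
 and bang_cod [simp]: "A : Obj V ==> Cod V (bang V A) = \<one>"
 using bang_in_hom by (auto simp: in_hom)

lemma bang_unique: "f : Arr V ==> Cod V f = \<one> ==> f = bang V (Dom V f)"
proof -
 assume f: "f : Arr V" "Cod V f = \<one>"
 have "\<exists>!h. h : hom V (Dom V f) \<one>" using terminal_one f unfolding is_terminal_def by simp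
 then show ?thesis using f bang_in_hom[of "Dom V f"] by (auto simp: in_hom)
qed

lemma to_one_eq: "f : Arr V ==> g : Arr V ==> Cod V f = \<one> ==> Cod V g = \<one> ==> Dom V f = Dom V g ==> f = g"
 using bang_unique by metis

lemma bang_comp [simp]: "x : Arr V ==> Cod V x = A ==> bang V A o x = bang V (Dom V x)"
 by (rule to_one_eq) auto

lemma bang_one [simp]: "bang V \<one> = Idn V \<one>"
 by (rule to_one_eq) auto

lemma exponential:
 assumes "A : Obj V" "B : Obj V"
 shows "is_exponential V A B \<lbrakk>A, B\<rbrakk> (ev V A B)"
 using assms closed chosen_exponential unfolding cartesian_closed_def by blast

lemma
 assumes "A : Obj V" "B : Obj V"
 shows exp_in_Obj [simp]: "\<lbrakk>A, B\<rbrakk> \<in> Obj V"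
  and ev_arr [simp]: "ev V A B : Arr V"
  and ev_dom [simp]: "Dom V (ev V A B) = \<lbrakk>A, B\<rbrakk> \<otimes> A"
  and ev_cod [simp]: "Cod V (ev V A B) = B"
 using exponential[OF assms] unfolding is_exponential_def by (auto simp: in_hom)

lemma
 assumes "f : Arr V" "X : Obj V" "A : Obj V" "Dom V f = X \<otimes> A" "Cod V f = B"
 shows transpose_arr [simp]: "transpose V X A B f : Arr V"
  and transpose_dom [simp]: "Dom V (transpose V X A B f) = X"
  and transpose_cod [simp]: "Cod V (transpose V X A B f) = \<lbrakk>A, B\<rbrakk>"
  and ev_transpose: "ev V A B o \<langle>transpose V X A B f o pr1 V X A, pr2 V X A\<rangle> = f"
 using transpose_props[OF exponential, of A B X f] assms by (auto simp: in_hom)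

lemma beta [simp]:
 assumes "f : Arr V" "X : Obj V" "A : Obj V" "Dom V f = X \<otimes> A" "Cod V f = B"
  "x : Arr V" "a : Arr V" "Dom V x = Dom V a" "Cod V x = X" "Cod V a = A"
 shows "ev V A B o \<langle>transpose V X A B f o x, a\<rangle> = f o \<langle>x, a\<rangle>"
proof -
 have B: "B : Obj V" using assms(1,5) by auto
 have "(ev V A B o \<langle>transpose V X A B f o pr1 V X A, pr2 V X A\<rangle>) o \<langle>x, a\<rangle>
   = ev V A B o \<langle>transpose V X A B f o x, a\<rangle>"
  using assms(1-4,6-) B assms(5) by simp
 then show ?thesis using assms by (simp add: ev_transpose)
qed

lemma beta_id [simp]:
 assumes "f : Arr V" "X : Obj V" "A : Obj V" "Dom V f = X \<otimes> A" "Cod V f = B"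
  "a : Arr V" "Dom V a = X" "Cod V a = A"
 shows "ev V A B o \<langle>transpose V X A B f, a\<rangle> = f o \<langle>Idn V X, a\<rangle>"
 using beta[of f X A B "Idn V X" a] assms by simp

lemma transpose_unique:
 assumes "h : hom V X \<lbrakk>A, B\<rbrakk>" "A : Obj V" "B : Obj V"
  "ev V A B o \<langle>h o pr1 V X A, pr2 V X A\<rangle> = ev V A B o \<langle>k o pr1 V X A, pr2 V X A\<rangle>"
  "k : hom V X \<lbrakk>A, B\<rbrakk>"
 shows "h = k"
proof -
 note [simp] = homD[OF assms(1)] homD[OF assms(5)] assms(2,3)
 have "ev V A B o \<langle>k o pr1 V X A, pr2 V X A\<rangle> \<in> hom V (X \<otimes> A) B"
  by (simp add: in_hom)
 then have "\<exists>!h. h : hom V X \<lbrakk>A, B\<rbrakk> \<and> ev V A B o \<langle>h o pr1 V X A, pr2 V X A\<rangle> =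
   ev V A B o \<langle>k o pr1 V X A, pr2 V X A\<rangle>"
  using exponential[OF assms(2,3)] homD(4)[OF assms(1)] unfolding is_exponential_def by blast
 then show ?thesis using assms by metis
qed

text \<open>Function extensionality for maps into an exponential, tested at all later stages.\<close>

lemma exp_ext:
 assumes "h : hom V X \<lbrakk>A, B\<rbrakk>" "k : hom V X \<lbrakk>A, B\<rbrakk>" "A : Obj V" "B : Obj V"
  "\<And>Y y a. y : hom V Y X ==> a : hom V Y A ==>
    ev V A B o \<langle>h o y, a\<rangle> = ev V A B o \<langle>k o y, a\<rangle>"
 shows "h = k"
proof -
 note [simp] = assms(3,4) homD(4)[OF assms(1)]
 have "ev V A B o \<langle>h o pr1 V X A, pr2 V X A\<rangle> = ev V A B o \<langle>k o pr1 V X A, pr2 V X A\<rangle>"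
  by (rule assms(5)[of _ "X \<otimes> A"]) (simp_all add: in_hom)
 then show ?thesis
  by (rule transpose_unique[OF assms(1,3,4) _ assms(2)])
qed

end

locale pullback_ccc = ccc V + cat_with_pullbacks V for V (structure)

section \<open>Coproducts in an extensive category\<close>

subsection \<open>Equivalences are fully faithful and essentially surjective\<close>

text \<open>
 Extensivity provides an equivalence with some quasi-inverse. It enters only through the three
 properties below: the coproduct functor is faithful, full and essentially surjective.
\<close>

lemma nat_iso_id_faithful:
 assumes "is_category C" "naturally_isomorphic C C H id_functor"
  and f: "f : hom C A B" "f' : hom C A B" "onArr H f = onArr H f'"
 shows "f = f'"
proof -
 interpret cat C by (rule cat.intro) fact
 obtain \<eta> where \<eta>: "\<And>A. A : Obj C ==> \<eta> A : hom C (onObj H A) A \<and> is_iso C (\<eta> A)"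
  "\<And>A B f. f : hom C A B ==> Cmp C (\<eta> B) (onArr H f) = Cmp C f (\<eta> A)"
  using assms(2) unfolding naturally_isomorphic_def id_functor_def by auto
 have A: "A : Obj C" using homD[OF f(1)] by simp
 obtain k where k: "k : hom C A (onObj H A)" "Cmp C (\<eta> A) k = Idn C A"
  using isoE \<eta>(1)[OF A] by metis
 have 1: "\<eta> A : hom C (onObj H A) A" using \<eta>(1) A by blast
 have 2: "Cmp C f (\<eta> A) = Cmp C f' (\<eta> A)"
  using \<eta>(2)[OF f(1)] \<eta>(2)[OF f(2)] f(3) by simp
 note [simp] = homD[OF f(1)] homD[OF f(2)] homD[OF 1] homD[OF k(1)]
 have "Cmp C (Cmp C f (\<eta> A)) k = f" "Cmp C (Cmp C f' (\<eta> A)) k = f'"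
  by (simp_all add: k(2))
 with 2 show ?thesis by metis
qed

lemma equivalence_faithful:
 assumes C: "is_category C" and F: "is_equivalence C D F"
  and f: "f : hom C A B" "f' : hom C A B" "onArr F f = onArr F f'"
 shows "f = f'"
proof -
 obtain G where "naturally_isomorphic C C (comp_functor G F) id_functor"
  using F unfolding is_equivalence_def by blast
 from nat_iso_id_faithful[OF C this f(1,2)] show ?thesis
  using f(3) by (simp add: comp_functor_def)
qed

lemma equivalence_full:
 assumes C: "is_category C" and D: "is_category D" and F: "is_equivalence C D F"
  and A: "A : Obj C" and B: "B : Obj C" and g: "g : hom D (onObj F A) (onObj F B)"
 obtains f where "f : hom C A B" "onArr F f = g"
proof -
 interpret cat C by (rule cat.intro) fact
 obtain G where G: "is_functor D C G" "naturally_isomorphic C C (comp_functor G F) id_functor"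
  "naturally_isomorphic D D (comp_functor F G) id_functor"
  using F unfolding is_equivalence_def by blast
 have F': "is_functor C D F" using F unfolding is_equivalence_def by blast
 obtain \<eta> where \<eta>: "\<And>A. A : Obj C ==> \<eta> A : hom C (onObj G (onObj F A)) A \<and> is_iso C (\<eta> A)"
  "\<And>A B f. f : hom C A B ==> Cmp C (\<eta> B) (onArr G (onArr F f)) = Cmp C f (\<eta> A)"
  using G(2) unfolding naturally_isomorphic_def id_functor_def comp_functor_def by auto
 have \<eta>A: "\<eta> A : hom C (onObj G (onObj F A)) A" and \<eta>B: "\<eta> B : hom C (onObj G (onObj F B)) B"
  using \<eta>(1) A B by blast+
 obtain a where a: "a : hom C A (onObj G (onObj F A))" "Cmp C a (\<eta> A) = Idn C (onObj G (onObj F A))"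
  using isoE \<eta>(1)[OF A] by metis
 obtain b where b: "b : hom C B (onObj G (onObj F B))" "Cmp C b (\<eta> B) = Idn C (onObj G (onObj F B))"
  using isoE \<eta>(1)[OF B] by metis
 have Gg: "onArr G g : hom C (onObj G (onObj F A)) (onObj G (onObj F B))"
  using G(1) g unfolding is_functor_def by blast
 define f where "f = Cmp C (\<eta> B) (Cmp C (onArr G g) a)"
 note [simp] = homD[OF \<eta>A] homD[OF \<eta>B] homD[OF a(1)] homD[OF b(1)] homD[OF Gg]
 have f: "f : hom C A B" unfolding f_def by (simp add: in_hom)
 have Ff: "onArr F f : hom D (onObj F A) (onObj F B)"
  using F' f unfolding is_functor_def by blast
 then have GFf: "onArr G (onArr F f) \<in> hom C (onObj G (onObj F A)) (onObj G (onObj F B))"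
  using G(1) unfolding is_functor_def by blast
 have "Cmp C (\<eta> B) (onArr G (onArr F f)) = Cmp C f (\<eta> A)" by (rule \<eta>(2)[OF f])
 also have "\<dots> = Cmp C (\<eta> B) (onArr G g)"
  unfolding f_def by (simp add: a(2))
 finally have "Cmp C b (Cmp C (\<eta> B) (onArr G (onArr F f))) = Cmp C b (Cmp C (\<eta> B) (onArr G g))"
  by simp
 then have "onArr G (onArr F f) = onArr G g"
  using comp_iso_cancel[OF b(2) \<eta>B b(1) GFf] comp_iso_cancel[OF b(2) \<eta>B b(1) Gg] by simp
 then have "onArr F f = g"
  using nat_iso_id_faithful[OF D G(3) Ff g] by (simp add: comp_functor_def)
 then show thesis using that f by blast
qed

lemma equivalence_surj:
 assumes F: "is_equivalence C D F" and Y: "Y : Obj D"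
 obtains A u where "A : Obj C" "u : hom D (onObj F A) Y" "is_iso D u"
proof -
 obtain G where G: "is_functor D C G" "naturally_isomorphic D D (comp_functor F G) id_functor"
  using F unfolding is_equivalence_def by blast
 obtain \<eta> where \<eta>: "\<And>A. A : Obj D ==> \<eta> A : hom D (onObj F (onObj G A)) A \<and> is_iso D (\<eta> A)"
  using G(2) unfolding naturally_isomorphic_def id_functor_def comp_functor_def by auto
 have "onObj G Y : Obj C" using G(1) Y unfolding is_functor_def by blast
 then show thesis using that \<eta>[OF Y] by blast
qed

lemma (in cat) slice_hom:
 "u : hom (slice_cat V X) x y \<longleftrightarrow>
  (\<exists>h. u = (x, h, y) \<and> x : Arr V \<and> Cod V x = X \<and> y : Arr V \<and> Cod V y = X \<and>
   h : hom V (Dom V x) (Dom V y) \<and> y o h = x)"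
 by (auto simp: slice_cat_def hom_def)

lemma (in cat) slice_category: "is_category (slice_cat V X)"
 unfolding is_category_def
proof (intro conjI allI ballI impI; (elim conjE)?)
 fix f assume "f : Arr (slice_cat V X)"
 then show "Dom (slice_cat V X) f : Obj (slice_cat V X)" "Cod (slice_cat V X) f : Obj (slice_cat V X)"
  by (auto simp: slice_cat_def)
next
 fix x assume "x : Obj (slice_cat V X)"
 then show "Idn (slice_cat V X) x : hom (slice_cat V X) x x"
  by (simp add: slice_hom) (simp add: slice_cat_def in_hom)
next
 fix x y z f g assume f: "f : hom (slice_cat V X) x y" and g: "g : hom (slice_cat V X) y z"
 obtain h where h: "f = (x, h, y)" "x : Arr V" "Cod V x = X" "y : Arr V" "Cod V y = X"
   "h : hom V (Dom V x) (Dom V y)" "y o h = x" using f unfolding slice_hom by blast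
 obtain k where k: "g = (y, k, z)" "z : Arr V" "Cod V z = X"
   "k : hom V (Dom V y) (Dom V z)" "z o k = y" using g unfolding slice_hom by blast
 note [simp] = homD[OF h(6)] homD[OF k(4)] h(2-5) k(2,3)
 have "z o (k o h) = (z o k) o h" by simp
 then have "z o (k o h) = x" by (simp only: k(5) h(7))
 then show "Cmp (slice_cat V X) g f : hom (slice_cat V X) x z"
  unfolding slice_hom by (simp add: slice_cat_def h(1) k(1) in_hom)
next
 fix x y f assume f: "f : hom (slice_cat V X) x y"
 obtain h where h: "f = (x, h, y)" "x : Arr V" "Cod V x = X" "y : Arr V" "Cod V y = X"
   "h : hom V (Dom V x) (Dom V y)" "y o h = x" using f unfolding slice_hom by blast
 note [simp] = homD[OF h(6)] h(2-5)
 show "Cmp (slice_cat V X) f (Idn (slice_cat V X) x) = f" "Cmp (slice_cat V X) (Idn (slice_cat V X) y) f = f"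
  by (simp_all add: slice_cat_def h(1))
next
 fix x y z w f g h
 assume f: "f : hom (slice_cat V X) x y" and g: "g : hom (slice_cat V X) y z"
  and h: "h : hom (slice_cat V X) z w"
 obtain f' where f': "f = (x, f', y)" "f' : hom V (Dom V x) (Dom V y)"
  using f unfolding slice_hom by blast
 obtain g' where g': "g = (y, g', z)" "g' : hom V (Dom V y) (Dom V z)"
  using g unfolding slice_hom by blast
 obtain h' where h': "h = (z, h', w)" "h' : hom V (Dom V z) (Dom V w)"
  using h unfolding slice_hom by blast
 show "Cmp (slice_cat V X) (Cmp (slice_cat V X) h g) f = Cmp (slice_cat V X) h (Cmp (slice_cat V X) g f)"
  by (simp add: slice_cat_def f'(1) g'(1) h'(1) homD[OF f'(2)] homD[OF g'(2)] homD[OF h'(2)])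
qed

lemma prod_hom:
 "u : hom (prod_cat K C) x y \<longleftrightarrow>
  u : (\<Pi>\<^sub>E i\<in>K. Arr (C i)) \<and> (\<lambda>i\<in>K. Dom (C i) (u i)) = x \<and> (\<lambda>i\<in>K. Cod (C i) (u i)) = y"
 by (auto simp: prod_cat_def hom_def)

lemma prod_category:
 assumes "\<And>i. i : K ==> is_category (C i)"
 shows "is_category (prod_cat K C)"
proof -
 have c: "cat (C i)" if "i : K" for i using assms[OF that] by (rule cat.intro)
 note [simp] = cat.dom_in_Obj[OF c] cat.cod_in_Obj[OF c] cat.id_arr[OF c] cat.id_dom[OF c]
  cat.id_cod[OF c] cat.comp_arr[OF c] cat.comp_dom[OF c] cat.comp_cod[OF c]
  cat.comp_id_left[OF c] cat.comp_id_right[OF c] cat.comp_assoc[OF c]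
 have restr: "f i = g i" if "restrict f K = restrict g K" "i : K" for f g :: "_ \<Rightarrow> 'd" and i
  using that by (metis restrict_apply')
 show ?thesis
  unfolding is_category_def prod_hom
 proof (intro conjI allI ballI impI; (elim conjE)?)
  fix f assume "f : Arr (prod_cat K C)"
  then show "Dom (prod_cat K C) f : Obj (prod_cat K C)"
   "Cod (prod_cat K C) f : Obj (prod_cat K C)"
   by (auto simp: prod_cat_def PiE_iff)
 next
  fix A assume "A : Obj (prod_cat K C)"
  then show "Idn (prod_cat K C) A : (\<Pi>\<^sub>E i\<in>K. Arr (C i))"
   "(\<lambda>i\<in>K. Dom (C i) (Idn (prod_cat K C) A i)) = A"
   "(\<lambda>i\<in>K. Cod (C i) (Idn (prod_cat K C) A i)) = A"
   by (auto simp: prod_cat_def PiE_iff extensional_def fun_eq_iff)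
 next
  fix A B E f g
  assume f: "f : (\<Pi>\<^sub>E i\<in>K. Arr (C i))" "(\<lambda>i\<in>K. Dom (C i) (f i)) = A" "(\<lambda>i\<in>K. Cod (C i) (f i)) = B"
   and g: "g : (\<Pi>\<^sub>E i\<in>K. Arr (C i))" "(\<lambda>i\<in>K. Dom (C i) (g i)) = B" "(\<lambda>i\<in>K. Cod (C i) (g i)) = E"
  have "Dom (C i) (g i) = Cod (C i) (f i)" if "i : K" for i
   using restr[OF trans[OF g(2) f(3)[symmetric]] that] by simp
  then show "Cmp (prod_cat K C) g f : (\<Pi>\<^sub>E i\<in>K. Arr (C i))"
   "(\<lambda>i\<in>K. Dom (C i) (Cmp (prod_cat K C) g f i)) = A"
   "(\<lambda>i\<in>K. Cod (C i) (Cmp (prod_cat K C) g f i)) = E"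
   using f(1) g(1) unfolding f(2)[symmetric] g(3)[symmetric]
   by (auto simp: prod_cat_def PiE_iff intro!: restrict_ext)
 next
  fix A B f
  assume f: "f : (\<Pi>\<^sub>E i\<in>K. Arr (C i))" "(\<lambda>i\<in>K. Dom (C i) (f i)) = A" "(\<lambda>i\<in>K. Cod (C i) (f i)) = B"
  show "Cmp (prod_cat K C) f (Idn (prod_cat K C) A) = f"
   "Cmp (prod_cat K C) (Idn (prod_cat K C) B) f = f"
   using f(1) unfolding f(2,3)[symmetric]
   by (auto simp: prod_cat_def PiE_iff extensional_def fun_eq_iff)
 next
  fix A B D E f g h
  assume f: "f : (\<Pi>\<^sub>E i\<in>K. Arr (C i))" "(\<lambda>i\<in>K. Dom (C i) (f i)) = A" "(\<lambda>i\<in>K. Cod (C i) (f i)) = B"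
   and g: "g : (\<Pi>\<^sub>E i\<in>K. Arr (C i))" "(\<lambda>i\<in>K. Dom (C i) (g i)) = B" "(\<lambda>i\<in>K. Cod (C i) (g i)) = D"
   and h: "h : (\<Pi>\<^sub>E i\<in>K. Arr (C i))" "(\<lambda>i\<in>K. Dom (C i) (h i)) = D" "(\<lambda>i\<in>K. Cod (C i) (h i)) = E"
  have "Dom (C i) (g i) = Cod (C i) (f i)" "Dom (C i) (h i) = Cod (C i) (g i)" if "i : K" for i
   using restr[OF trans[OF g(2) f(3)[symmetric]] that]
    restr[OF trans[OF h(2) g(3)[symmetric]] that] by simp_all
  then show "Cmp (prod_cat K C) (Cmp (prod_cat K C) h g) f
   = Cmp (prod_cat K C) h (Cmp (prod_cat K C) g f)"
   using f(1) g(1) h(1)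
   by (auto simp: prod_cat_def PiE_iff intro!: restrict_ext)
 qed
qed

subsection \<open>Coproduct cocones\<close>

context cat
begin

lemma coproductD:
 assumes "is_coproduct V K X S \<iota>"
 shows "S : Obj V" "k : K ==> \<iota> k : hom V (X k) S"
 using assms unfolding is_coproduct_def by blast+

lemma coproduct_ex1:
 assumes "is_coproduct V K X S \<iota>" "Y : Obj V" "\<And>k. k : K ==> f k : hom V (X k) Y"
 shows "\<exists>!h. h : hom V S Y \<and> (\<forall>k\<in>K. h o \<iota> k = f k)"
 using conjunct2[OF conjunct2[OF assms(1)[unfolded is_coproduct_def]], THEN bspec, OF assms(2),
   THEN spec, of f] assms(3) by blast

lemma coproduct_desc:
 assumes "is_coproduct V K X S \<iota>" "Y : Obj V" "\<And>k. k : K ==> f k : hom V (X k) Y"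
 obtains h where "h : hom V S Y" "\<And>k. k : K ==> h o \<iota> k = f k"
 using coproduct_ex1[of K X S \<iota> Y f] assms by blast

lemma coproduct_ext:
 assumes "is_coproduct V K X S \<iota>" "h : hom V S Y" "h' : hom V S Y"
  "\<And>k. k : K ==> h o \<iota> k = h' o \<iota> k"
 shows "h = h'"
proof -
 have Y: "Y : Obj V" using homD[OF assms(2)] by simp
 have "\<exists>!z. z : hom V S Y \<and> (\<forall>k\<in>K. z o \<iota> k = h o \<iota> k)"
  by (rule coproduct_ex1[OF assms(1) Y]) (rule comp_in_hom[OF coproductD(2)[OF assms(1)] assms(2)])
 moreover have "\<forall>k\<in>K. h' o \<iota> k = h o \<iota> k" using assms(4) by simp
 ultimately show ?thesis using assms(2,3) by blast
qed

lemma coproduct_cocone_iso: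
 assumes 1: "is_coproduct V K X S \<iota>" and 2: "is_coproduct V K X S' \<iota>'"
 obtains h k where "h : hom V S S'" "k : hom V S' S" "k o h = Idn V S" "h o k = Idn V S'"
  "\<And>j. j : K ==> h o \<iota> j = \<iota>' j" "\<And>j. j : K ==> k o \<iota>' j = \<iota> j"
proof -
 obtain h where h: "h : hom V S S'" "\<And>j. j : K ==> h o \<iota> j = \<iota>' j"
  using coproduct_desc[OF 1 coproductD(1)[OF 2] coproductD(2)[OF 2]] by blast
 obtain k where k: "k : hom V S' S" "\<And>j. j : K ==> k o \<iota>' j = \<iota> j"
  using coproduct_desc[OF 2 coproductD(1)[OF 1] coproductD(2)[OF 1]] by blast
 note [simp] = homD[OF h(1)] homD[OF k(1)] homD[OF coproductD(2)[OF 1]] homD[OF coproductD(2)[OF 2]]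
 have "k o h = Idn V S"
  by (rule coproduct_ext[OF 1, of _ S]) (use h k in \<open>simp_all add: in_hom\<close>)
 moreover have "h o k = Idn V S'"
  by (rule coproduct_ext[OF 2, of _ S']) (use h k in \<open>simp_all add: in_hom\<close>)
 ultimately show thesis using that h k by blast
qed

lemma coproduct_along_iso:
 assumes 1: "is_coproduct V K X S \<iota>"
  and h: "h : hom V S S'" "k : hom V S' S" "k o h = Idn V S" "h o k = Idn V S'"
 shows "is_coproduct V K X S' (\<lambda>j. h o \<iota> j)"
 unfolding is_coproduct_def
proof (intro conjI ballI allI impI)
 note [simp] = homD[OF h(1)] homD[OF h(2)] homD[OF coproductD(2)[OF 1]]
 show "S' : Obj V" by simp
 show "h o \<iota> j : hom V (X j) S'" if "j : K" for j using that by (simp add: in_hom)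
 fix Y f assume Y: "Y : Obj V" and f: "\<forall>j\<in>K. f j : hom V (X j) Y"
 then obtain g where g: "g : hom V S Y" "\<And>j. j : K ==> g o \<iota> j = f j"
  using coproduct_desc[OF 1] by metis
 note [simp] = homD[OF g(1)]
 show "\<exists>!z. z : hom V S' Y \<and> (\<forall>j\<in>K. z o h o \<iota> j = f j)"
 proof (intro ex1I[of _ "g o k"] conjI ballI)
  show "g o k : hom V S' Y" by (simp add: in_hom)
  show "(g o k) o h o \<iota> j = f j" if "j : K" for j
   using that comp_iso_cancel[OF h(3,1,2) coproductD(2)[OF 1 that]] g(2)[OF that] by simp
  fix z assume z: "z : hom V S' Y \<and> (\<forall>j\<in>K. z o h o \<iota> j = f j)"
  then have z': "z : hom V S' Y" by blast
  note [simp] = homD[OF z']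
  have "z o h = g"
   by (rule coproduct_ext[OF 1, of _ Y]) (use z g in \<open>simp_all add: in_hom\<close>)
  then have "(z o h) o k = g o k" by simp
  then show "z = g o k" by (simp add: h)
 qed
qed

text \<open>
 A small set injects into the universe, so coproducts over small sets of any type reduce to
 coproducts over sets of elements of the universe, to which extensivity applies.
\<close>

lemma coproduct_reindex:
 assumes "bij_betw b K K'" "is_coproduct V K' X S \<iota>"
 shows "is_coproduct V K (X \<circ> b) S (\<iota> \<circ> b)"
 unfolding is_coproduct_def
proof (intro conjI ballI allI impI)
 let ?i = "inv_into K b"
 have bi: "?i k' : K" "b (?i k') = k'" if "k' : K'" for k'
  using assms(1) that by (auto simp: bij_betw_def inv_into_into f_inv_into_f)
 have ib: "b k : K'" "?i (b k) = k" if "k : K" for k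
  using assms(1) that by (auto simp: bij_betw_def)
 show "S : Obj V" using coproductD[OF assms(2)] by simp
 show "(\<iota> \<circ> b) k : hom V ((X \<circ> b) k) S" if "k : K" for k
  using coproductD(2)[OF assms(2) ib(1)[OF that]] by simp
 fix Y f assume Y: "Y : Obj V" and f: "\<forall>k\<in>K. f k : hom V ((X \<circ> b) k) Y"
 have "f (?i k') \<in> hom V (X k') Y" if "k' : K'" for k'
  using bspec[OF f bi(1)[OF that]] bi(2)[OF that] by simp
 then have "\<exists>!h. h : hom V S Y \<and> (\<forall>k'\<in>K'. h o \<iota> k' = f (?i k'))"
  by (rule coproduct_ex1[OF assms(2) Y])
 moreover have "(\<forall>k'\<in>K'. h o \<iota> k' = f (?i k')) \<longleftrightarrow> (\<forall>k\<in>K. h o (\<iota> \<circ> b) k = f k)" for h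
 proof (intro iffI ballI)
  fix k assume A: "\<forall>k'\<in>K'. h o \<iota> k' = f (?i k')" and "k : K"
  then show "h o (\<iota> \<circ> b) k = f k" using bspec[OF A ib(1)] ib(2) by simp
 next
  fix k' assume A: "\<forall>k\<in>K. h o (\<iota> \<circ> b) k = f k" and "k' : K'"
  then show "h o \<iota> k' = f (?i k')" using bspec[OF A bi(1)] bi(2) by simp
 qed
 ultimately show "\<exists>!h. h : hom V S Y \<and> (\<forall>k\<in>K. h o (\<iota> \<circ> b) k = f k)"
  by simp
qed

lemma chosen_coproduct:
 assumes "is_coproduct V K X S \<iota>"
 shows "is_coproduct V K X (coprod_obj V K X) (incl V K X)"
 unfolding coprod_obj_def incl_def
 by (rule some_pair[OF _ chosen_coproduct_def]) (use assms in blast)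

lemma cotuple_props:
 assumes "is_coproduct V K X (coprod_obj V K X) (incl V K X)"
  "Y : Obj V" "\<And>k. k : K ==> f k : hom V (X k) Y"
 shows "cotuple V K X Y f : hom V (coprod_obj V K X) Y"
  "k : K ==> cotuple V K X Y f o incl V K X k = f k"
proof -
 have *: "cotuple V K X Y f : hom V (coprod_obj V K X) Y \<and>
   (\<forall>k\<in>K. cotuple V K X Y f o incl V K X k = f k)"
  unfolding cotuple_def by (rule theI'[OF coproduct_ex1[OF assms]])
 from * show "cotuple V K X Y f : hom V (coprod_obj V K X) Y" by (rule conjunct1)
 from * show "cotuple V K X Y f o incl V K X k = f k" if "k : K" using that by simp
qed

end

subsection \<open>Small sets\<close>

lemma small_Times:
 assumes inf: "infinite (UNIV :: 'u set)" and "small (U :: 'u itself) K" "small U K'"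
 shows "small U (K \<times> K')"
proof -
 obtain p where "bij_betw p (UNIV \<times> UNIV :: ('u \<times> 'u) set) (UNIV :: 'u set)"
  using card_of_Times_same_infinite[OF inf] card_of_ordIso by blast
 then have p: "inj p" by (simp add: bij_betw_def)
 obtain f g where f: "inj_on (f :: _ \<Rightarrow> 'u) K" and g: "inj_on (g :: _ \<Rightarrow> 'u) K'"
  using assms(2,3) unfolding small_def lepoll_def by blast
 have "inj_on (\<lambda>(x, y). p (f x, g y)) (K \<times> K')"
 proof (rule inj_onI, clarify)
  fix x y x' y' assume xy: "x : K" "y : K'" "x' : K" "y' : K'"
   and "p (f x, g y) = p (f x', g y')"
  then have "(f x, g y) = (f x', g y')" using injD[OF p] by blast
  then show "x = x' \<and> y = y'" using xy inj_onD[OF f] inj_onD[OF g] by simp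
 qed
 then show ?thesis unfolding small_def lepoll_def by blast
qed

lemma small_finite:
 assumes inf: "infinite (UNIV :: 'u set)" and "finite K"
 shows "small (U :: 'u itself) K"
 unfolding small_def using assms finite_lepoll_infinite by blast

subsection \<open>Coproduct inclusions: pullback squares, disjointness, stability\<close>

text \<open>
 The chosen coproduct of a family depends only on the values at the indices, since this holds for
 the property by which it is chosen. Objects of the product category agree only there.
\<close>

lemma chosen_coproduct_cong:
 assumes "\<And>k. k : K ==> X k = X' k"
 shows "chosen_coproduct V K X = chosen_coproduct V K X'"
proof -
 have "is_coproduct V K X = is_coproduct V K X'"
  using assms unfolding is_coproduct_def by (auto simp: fun_eq_iff)
 then show ?thesis unfolding chosen_coproduct_def by simp
qed

lemma coprod_obj_cong: "(\<And>k. k : K ==> X k = X' k) ==> coprod_obj V K X = coprod_obj V K X'"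
 and incl_cong: "(\<And>k. k : K ==> X k = X' k) ==> incl V K X = incl V K X'"
 unfolding coprod_obj_def incl_def using chosen_coproduct_cong[of K X X'] by metis+

lemma cotuple_cong:
 assumes "\<And>k. k : K ==> X k = X' k" "\<And>k. k : K ==> f k = f' k"
 shows "cotuple V K X Y f = cotuple V K X' Y f'"
proof -
 have "(\<forall>k\<in>K. h o\<^bsub>V\<^esub> incl V K X k = f k) \<longleftrightarrow> (\<forall>k\<in>K. h o\<^bsub>V\<^esub> incl V K X' k = f' k)" for h
  using assms incl_cong[of K X X' V] by (metis (no_types, lifting))
 then show ?thesis unfolding cotuple_def using coprod_obj_cong[of K X X' V] assms(1) by simp
qed

lemma onObj_coprod_functor:
 assumes "\<And>k. k : K ==> Dom V (x k) = Y k" "\<And>k. k : K ==> incl V K X k o\<^bsub>V\<^esub> x k = f k"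
 shows "onObj (coprod_functor V K X) x = cotuple V K Y (coprod_obj V K X) f"
 unfolding coprod_functor_def Let_def cat_functor.simps by (rule cotuple_cong) (use assms in auto)

lemma onArr_coprod_functor:
 assumes "\<And>k. k : K ==> Dom V (fst (u k)) = W k" "\<And>k. k : K ==> Dom V (snd (snd (u k))) = Y k"
  "\<And>k. k : K ==> incl V K Y k o\<^bsub>V\<^esub> fst (snd (u k)) = f k"
 shows "onArr (coprod_functor V K X) u =
  (onObj (coprod_functor V K X) (\<lambda>k. fst (u k)), cotuple V K W (coprod_obj V K Y) f,
   onObj (coprod_functor V K X) (\<lambda>k. snd (snd (u k))))"
proof -
 have "coprod_obj V K (\<lambda>k. Dom V (snd (snd (u k)))) = coprod_obj V K Y"
  "incl V K (\<lambda>k. Dom V (snd (snd (u k)))) = incl V K Y"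
  using assms(2) by (auto intro!: coprod_obj_cong incl_cong)
 moreover have "cotuple V K (\<lambda>k. Dom V (fst (u k))) (coprod_obj V K Y)
   (\<lambda>k. incl V K Y k o\<^bsub>V\<^esub> fst (snd (u k))) = cotuple V K W (coprod_obj V K Y) f"
  by (rule cotuple_cong) (use assms in auto)
 ultimately show ?thesis unfolding coprod_functor_def Let_def by simp
qed

locale extensive_cat = pullback_ccc V for V (structure) +
 fixes U :: "'u itself"
 assumes infinite_universe: "infinite (UNIV :: 'u set)"
  and extensive: "extensive U V"
begin

lemma coproduct:
 assumes "small U K" "\<And>k. k : K ==> X k : Obj V"
 shows "is_coproduct V K X (coprod_obj V K X) (incl V K X)"
proof -
 obtain b where b: "inj_on (b :: _ \<Rightarrow> 'u) K"
  using assms(1) unfolding small_def lepoll_def by blast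
 let ?X = "X \<circ> inv_into K b"
 have "\<forall>k\<in>b ` K. ?X k : Obj V"
  using assms(2) b by auto
 then obtain S \<iota> where "is_coproduct V (b ` K) ?X S \<iota>"
  using extensive unfolding extensive_def by blast
 then have "is_coproduct V K (?X \<circ> b) S (\<iota> \<circ> b)"
  using b by (intro coproduct_reindex) (auto simp: bij_betw_def)
 moreover have "is_coproduct V K (?X \<circ> b) S (\<iota> \<circ> b) = is_coproduct V K X S (\<iota> \<circ> b)"
  using b unfolding is_coproduct_def by (simp add: inv_into_f_f)
 ultimately show ?thesis using chosen_coproduct by blast
qed

lemma initial_zero: "is_initial V \<zero>"
proof -
 let ?X = "\<lambda>_ :: 'u. \<one>"
 have "is_coproduct V {} ?X (coprod_obj V {} ?X) (incl V {} ?X)"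
  by (rule coproduct) (simp_all add: small_finite[OF infinite_universe])
 then have "is_initial V (coprod_obj V {} ?X)"
  unfolding is_coproduct_def is_initial_def by simp
 then show ?thesis unfolding zero_obj_def by (rule someI)
qed

lemma zero_in_Obj [simp]: "\<zero> \<in> Obj V"
 using initial_zero unfolding is_initial_def by blast

lemma from_zero: "A : Obj V ==> \<exists>f. f : hom V \<zero> A"
 using initial_zero unfolding is_initial_def by blast

lemma from_zero_eq: "f : hom V \<zero> A ==> g : hom V \<zero> A ==> f = g"
 using initial_zero homD(5)[of f \<zero> A] unfolding is_initial_def by blast

text \<open>
 The initial object is strict, because \<open>\<zero> \<otimes> Z\<close> is initial for every \<open>Z\<close>: its maps to \<open>Y\<close> are
 the maps from \<open>\<zero>\<close> to \<open>\<lbrakk>Z, Y\<rbrakk>\<close>.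
\<close>

lemma strict_initial:
 assumes u: "u : hom V Z \<zero>" and f: "f : hom V Z Y" and g: "g : hom V Z Y"
 shows "f = g"
proof -
 note [simp] = homD[OF u] homD[OF f] homD[OF g]
 have "transpose V \<zero> Z Y (f o pr2 V \<zero> Z) = transpose V \<zero> Z Y (g o pr2 V \<zero> Z)"
  by (rule from_zero_eq[of _ "\<lbrakk>Z, Y\<rbrakk>"]) (simp_all add: in_hom)
 then have "ev V Z Y o \<langle>transpose V \<zero> Z Y (f o pr2 V \<zero> Z) o u, Idn V Z\<rangle>
   = ev V Z Y o \<langle>transpose V \<zero> Z Y (g o pr2 V \<zero> Z) o u, Idn V Z\<rangle>" by simp
 then show ?thesis by simp
qed

lemma chosen_equivalence:
 fixes K :: "'u set"
 assumes "\<And>k. k : K ==> X k : Obj V"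
 shows "is_equivalence (prod_cat K (\<lambda>k. slice_cat V (X k))) (slice_cat V (coprod_obj V K X))
     (coprod_functor V K X)"
 using assms extensive unfolding extensive_def by blast

lemma coproduct_u:
 fixes K :: "'u set"
 assumes "\<And>k. k : K ==> X k : Obj V"
 shows "is_coproduct V K X (coprod_obj V K X) (incl V K X)"
 using assms extensive chosen_coproduct unfolding extensive_def by blast

text \<open>
 Essential surjectivity of the coproduct functor: a map into a coproduct is, up to an isomorphism,
 a coproduct of maps into the summands, so its source splits into the parts over the summands.
\<close>

lemma coproduct_decompose_chosen:
 fixes K :: "'u set"
 assumes X: "\<And>k. k : K ==> X k : Obj V" and f: "f : hom V Z (coprod_obj V K X)"
 obtains Y x \<kappa> where "is_coproduct V K Y Z \<kappa>" "\<And>k. k : K ==> x k : hom V (Y k) (X k)"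
  "\<And>k. k : K ==> f o \<kappa> k = incl V K X k o x k"
proof -
 let ?S = "coprod_obj V K X" and ?\<iota> = "incl V K X"
 let ?F = "coprod_functor V K X"
 note [simp] = homD[OF f]
 have "f : Obj (slice_cat V ?S)" by (simp add: slice_cat_def)
 then obtain x u where x: "x : Obj (prod_cat K (\<lambda>k. slice_cat V (X k)))"
  and u: "u : hom (slice_cat V ?S) (onObj ?F x) f" "is_iso (slice_cat V ?S) u"
  using equivalence_surj[OF chosen_equivalence[of K X]] X by metis
 have x': "x k : Arr V" "Cod V (x k) = X k" if "k : K" for k
  using x that by (auto simp: prod_cat_def slice_cat_def)
 let ?Y = "\<lambda>k. Dom V (x k)"
 let ?T = "coprod_obj V K ?Y" and ?\<tau> = "incl V K ?Y"
 have copY: "is_coproduct V K ?Y ?T ?\<tau>"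
  by (rule coproduct_u) (use x' in simp)
 note \<iota>[simp] = homD[OF coproductD(2)[OF coproduct_u[of K X, OF X]]]
 note \<tau>[simp] = homD[OF coproductD(2)[OF copY]]
 define Fx where "Fx = onObj ?F x"
 have Fx': "Fx = cotuple V K ?Y ?S (\<lambda>k. ?\<iota> k o x k)"
  unfolding Fx_def coprod_functor_def by simp
 have Fx: "Fx : hom V ?T ?S" "\<And>k. k : K ==> Fx o ?\<tau> k = ?\<iota> k o x k"
  unfolding Fx' by (rule cotuple_props[OF copY]; use x' X in \<open>simp add: in_hom\<close>)+
 obtain h where h: "u = (Fx, h, f)" "h : hom V ?T Z" "f o h = Fx"
  using u(1) homD(2)[OF Fx(1)] unfolding slice_hom Fx_def[symmetric] by auto
 obtain v where v: "v : hom (slice_cat V ?S) f Fx"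
  "Cmp (slice_cat V ?S) v u = Idn (slice_cat V ?S) Fx"
  "Cmp (slice_cat V ?S) u v = Idn (slice_cat V ?S) f"
  by (rule cat.isoE[OF cat.intro[OF slice_category] u(2)]) (use u(1) Fx_def in auto)
 obtain k where k: "v = (f, k, Fx)" "k : hom V Z ?T"
  using v(1) homD(2)[OF Fx(1)] unfolding slice_hom by auto
 have kh: "k o h = Idn V ?T" "h o k = Idn V Z"
  using v(2,3) homD(2)[OF Fx(1)] unfolding h(1) k(1) by (simp_all add: slice_cat_def)
 have "is_coproduct V K ?Y Z (\<lambda>j. h o ?\<tau> j)"
  by (rule coproduct_along_iso[OF copY h(2) k(2) kh])
 moreover have "f o h o ?\<tau> j = ?\<iota> j o x j" if "j : K" for j
 proof -
  have "f o h o ?\<tau> j = (f o h) o ?\<tau> j"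
   using that homD[OF h(2)] by simp
  then show ?thesis using h(3) Fx(2) that by simp
 qed
 moreover have "x j : hom V (?Y j) (X j)" if "j : K" for j using x' that by (simp add: in_hom)
 ultimately show thesis using that by blast
qed

text \<open>
 An element \<open>f\<close> of \<open>\<Squnion>\<^sub>k Y k\<close> whose image in \<open>\<Squnion>\<^sub>k X k\<close> lies in the summand \<open>X k\<close> comes from \<open>Y k\<close>.
 The element is regarded as a map over \<open>\<Squnion>\<^sub>k X k\<close> from the coproduct of the family that is \<open>Z\<close> at \<open>k\<close>
 and initial elsewhere, and such maps are families of maps over the \<open>X k\<close>.
\<close>

lemma coproduct_square_chosen:
 fixes K :: "'u set"
 assumes x: "\<And>k. k : K ==> x k : hom V (Y k) (X k)"
  and p: "p : hom V (coprod_obj V K Y) (coprod_obj V K X)"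
   "\<And>k. k : K ==> p o incl V K Y k = incl V K X k o x k"
  and f: "f : hom V Z (coprod_obj V K Y)"
  and k: "k : K" and z: "z : hom V Z (X k)" "p o f = incl V K X k o z"
 shows "\<exists>!h. h : hom V Z (Y k) \<and> x k o h = z \<and> incl V K Y k o h = f"
proof -
 let ?S = "coprod_obj V K X" and ?\<iota> = "incl V K X"
 let ?T = "coprod_obj V K Y" and ?\<tau> = "incl V K Y"
 let ?F = "coprod_functor V K X" and ?P = "prod_cat K (\<lambda>k. slice_cat V (X k))"
 have X: "X j : Obj V" and Y: "Y j : Obj V" if "j : K" for j
  using homD[OF x[OF that]] by blast+
 obtain e where e: "\<And>A. A : Obj V ==> e A : hom V \<zero> A" using from_zero by metis
 define W where "W j = (if j = k then Z else \<zero>)" for j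
 define w where "w j = (if j = k then z else e (X j))" for j
 have w: "w j : hom V (W j) (X j)" if "j : K" for j
  using z(1) e[OF X[OF that]] by (simp add: w_def W_def)
 let ?R = "coprod_obj V K W" and ?\<rho> = "incl V K W"
 note Z = homD(4)[OF f]
 have copX: "is_coproduct V K X ?S ?\<iota>" by (rule coproduct_u) (rule X)
 have copY: "is_coproduct V K Y ?T ?\<tau>" by (rule coproduct_u) (rule Y)
 have copW: "is_coproduct V K W ?R ?\<rho>" by (rule coproduct_u) (use w homD in blast)
 note [simp] = homD[OF coproductD(2)[OF copX]] homD[OF coproductD(2)[OF copY]]
  homD[OF coproductD(2)[OF copW]] homD[OF x] homD[OF w] homD[OF f] homD[OF p(1)] homD[OF z(1)] k
 have oX: "restrict x K : Obj ?P" and oW: "restrict w K : Obj ?P"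
  using x w by (auto simp: prod_cat_def slice_cat_def in_hom)
 have "onObj ?F y = p" if "\<And>j. j : K ==> y j = x j" for y
 proof -
  have 0: "onObj ?F y = cotuple V K Y ?S (\<lambda>j. ?\<iota> j o x j)"
   by (rule onObj_coprod_functor) (use that in simp_all)
  have 1: "onObj ?F y : hom V ?T ?S" "\<And>j. j : K ==> onObj ?F y o ?\<tau> j = ?\<iota> j o x j"
   unfolding 0 by (rule cotuple_props[OF copY]; simp add: in_hom)+
  show ?thesis by (rule coproduct_ext[OF copY 1(1) p(1)]) (use 1 p in simp)
 qed
 note Fx = this
 define q where "q = cotuple V K W ?S (\<lambda>j. ?\<iota> j o w j)"
 have q: "q : hom V ?R ?S" "\<And>j. j : K ==> q o ?\<rho> j = ?\<iota> j o w j"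
  unfolding q_def by (rule cotuple_props[OF copW]; simp add: in_hom)+
 have Fw: "onObj ?F y = q" if "\<And>j. j : K ==> y j = w j" for y
  unfolding q_def by (rule onObj_coprod_functor) (use that in simp_all)
 note [simp] = homD[OF q(1)]
 obtain r where r: "r : hom V ?R Z" "r o ?\<rho> k = Idn V Z"
 proof -
  have "(if j = k then Idn V Z else e Z) \<in> hom V (W j) Z" if "j : K" for j
   using e[OF Z] by (simp add: W_def in_hom)
  from coproduct_desc[OF copW Z this, simplified] k that show thesis by metis
 qed
 note [simp] = homD[OF r(1)]
 have W0: "W j = \<zero>" if "j \<noteq> k" for j using that by (simp add: W_def)
 have Wk [simp]: "W k = Z" and wk [simp]: "w k = z" by (simp_all add: W_def w_def)
 have pfr: "p o (f o r) = q"
 proof (rule coproduct_ext[OF copW, of _ ?S])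
  fix j assume j: "j : K"
  show "(p o f o r) o ?\<rho> j = q o ?\<rho> j"
  proof (cases "j = k")
   case True
   have "(p o f o r) o ?\<rho> k = p o f o (r o ?\<rho> k)" by simp
   also have "\<dots> = ?\<iota> k o z" using z(2) r(2) by simp
   finally show ?thesis using q(2)[OF k] True by simp
  next
   case False
   show ?thesis
    by (rule from_zero_eq[of _ ?S]) (use j W0[OF False] in \<open>simp_all add: in_hom\<close>)
  qed
 qed (simp_all add: in_hom)
 have m_iff: "u : hom ?P (restrict w K) (restrict x K) \<longleftrightarrow>
   (\<exists>h. u = (\<lambda>j\<in>K. (w j, h j, x j)) \<and> (\<forall>j\<in>K. h j : hom V (W j) (Y j) \<and> x j o h j = w j))" for u
 proof
  assume u: "u : hom ?P (restrict w K) (restrict x K)"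
  then have u1: "u : (\<Pi>\<^sub>E j\<in>K. Arr (slice_cat V (X j)))"
   and ud: "(\<lambda>j\<in>K. Dom (slice_cat V (X j)) (u j)) = restrict w K"
   and uc: "(\<lambda>j\<in>K. Cod (slice_cat V (X j)) (u j)) = restrict x K"
   unfolding prod_hom by blast+
  have u2: "u j : hom (slice_cat V (X j)) (w j) (x j)" if "j : K" for j
   using fun_cong[OF ud, of j] fun_cong[OF uc, of j] u1 that by (simp add: in_hom PiE_iff)
  have "u j = (w j, fst (snd (u j)), x j) \<and> fst (snd (u j)) \<in> hom V (W j) (Y j) \<and>
    x j o fst (snd (u j)) = w j" if "j : K" for j
   using u2[OF that] that unfolding slice_hom by auto
  moreover from this u1 have "u = (\<lambda>j\<in>K. (w j, fst (snd (u j)), x j))"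
   by (intro extensionalityI[of _ K]) (simp_all add: PiE_iff)
  ultimately show "\<exists>h. u = (\<lambda>j\<in>K. (w j, h j, x j)) \<and> (\<forall>j\<in>K. h j : hom V (W j) (Y j) \<and> x j o h j = w j)"
   by (intro exI[of _ "\<lambda>j. fst (snd (u j))"]) blast
 next
  assume "\<exists>h. u = (\<lambda>j\<in>K. (w j, h j, x j)) \<and> (\<forall>j\<in>K. h j : hom V (W j) (Y j) \<and> x j o h j = w j)"
  then show "u : hom ?P (restrict w K) (restrict x K)"
   unfolding prod_hom by (auto simp: slice_cat_def in_hom)
 qed
 have onA: "\<exists>m. onArr ?F (\<lambda>j\<in>K. (w j, h j, x j)) = (q, m, p) \<and> m : hom V ?R ?T \<and>
   (\<forall>j\<in>K. m o ?\<rho> j = ?\<tau> j o h j)"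
  if h: "\<And>j. j : K ==> h j : hom V (W j) (Y j)" for h
 proof -
  let ?u = "\<lambda>j\<in>K. (w j, h j, x j)"
  define m where "m = cotuple V K W ?T (\<lambda>j. ?\<tau> j o h j)"
  have m: "m : hom V ?R ?T" "\<And>j. j : K ==> m o ?\<rho> j = ?\<tau> j o h j"
   unfolding m_def by (rule cotuple_props[OF copW]; use homD[OF h] in \<open>simp add: in_hom\<close>)+
  have "onArr ?F ?u = (onObj ?F (\<lambda>j. fst (?u j)), m, onObj ?F (\<lambda>j. snd (snd (?u j))))"
   unfolding m_def by (rule onArr_coprod_functor) simp_all
  moreover have "onObj ?F (\<lambda>j. fst (?u j)) = q" "onObj ?F (\<lambda>j. snd (snd (?u j))) = p"
   by (rule Fw Fx; simp)+
  ultimately show ?thesis using m by simp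
 qed
 have cP: "is_category ?P" by (rule prod_category) (rule slice_category)
 show ?thesis
 proof (rule ex_ex1I)
  have "(q, f o r, p) \<in> hom (slice_cat V ?S) (onObj ?F (restrict w K)) (onObj ?F (restrict x K))"
   unfolding slice_hom using pfr Fx[of "restrict x K"] Fw[of "restrict w K"] by (simp add: in_hom)
  from equivalence_full[OF cP slice_category chosen_equivalence oW oX this] X
  obtain u where u: "u : hom ?P (restrict w K) (restrict x K)" "onArr ?F u = (q, f o r, p)"
   by blast
  obtain h where h: "u = (\<lambda>j\<in>K. (w j, h j, x j))" "\<And>j. j : K ==> h j : hom V (W j) (Y j)"
   "\<And>j. j : K ==> x j o h j = w j"
   using u(1) unfolding m_iff by blast
  have "(f o r) o ?\<rho> k = ?\<tau> k o h k" using onA[OF h(2)] u(2) h(1) k by auto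
  moreover have "(f o r) o ?\<rho> k = f" using r(2) by simp
  ultimately have "?\<tau> k o h k = f" by simp
  then show "\<exists>h. h : hom V Z (Y k) \<and> x k o h = z \<and> ?\<tau> k o h = f"
   using h(2,3)[OF k] by auto
 next
  fix a b assume a: "a : hom V Z (Y k) \<and> x k o a = z \<and> ?\<tau> k o a = f"
   and b: "b : hom V Z (Y k) \<and> x k o b = z \<and> ?\<tau> k o b = f"
  define ext where "ext a j = (if j = k then a else e (Y j))" for a j
  have ext1: "ext a j : hom V (W j) (Y j)" if "j : K" "a : hom V Z (Y k)" for a j
   using that e[OF Y[OF that(1)]] by (simp add: ext_def W_def)
  have ext2: "x j o ext a j = w j" if "j : K" "a : hom V Z (Y k)" "x k o a = z" for a j
  proof (cases "j = k")
   case True then show ?thesis using that by (simp add: ext_def)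
  next
   case False
   show ?thesis
    by (rule from_zero_eq[of _ "X j"])
     (use that False homD[OF ext1[OF that(1,2)]] W0[OF False] in \<open>simp_all add: in_hom\<close>)
  qed
  let ?u = "\<lambda>a. \<lambda>j\<in>K. (w j, ext a j, x j)"
  have uh: "?u a : hom ?P (restrict w K) (restrict x K)" if "a : hom V Z (Y k)" "x k o a = z" for a
   unfolding m_iff by (rule exI[of _ "ext a"]) (use that ext1 ext2 in blast)
  obtain m where m: "onArr ?F (?u a) = (q, m, p)" "m : hom V ?R ?T" "\<And>j. j : K ==> m o ?\<rho> j = ?\<tau> j o ext a j"
   using onA[of "ext a"] ext1 a by blast
  obtain n where n: "onArr ?F (?u b) = (q, n, p)" "n : hom V ?R ?T" "\<And>j. j : K ==> n o ?\<rho> j = ?\<tau> j o ext b j"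
   using onA[of "ext b"] ext1 b by blast
  have "m = n"
  proof (rule coproduct_ext[OF copW m(2) n(2)])
   fix j assume j: "j : K"
   have "?\<tau> j o ext a j = ?\<tau> j o ext b j"
    using a b by (cases "j = k") (simp_all add: ext_def)
   then show "m o ?\<rho> j = n o ?\<rho> j" using m(3)[OF j] n(3)[OF j] by simp
  qed
  then have "onArr ?F (?u a) = onArr ?F (?u b)" using m n by simp
  moreover have "is_equivalence ?P (slice_cat V ?S) ?F" by (rule chosen_equivalence) (rule X)
  ultimately have "?u a = ?u b"
   using equivalence_faithful[OF cP _ uh uh] a b by blast
  then have "?u a k = ?u b k" by (rule fun_cong)
  then show "a = b" by (simp add: ext_def)
 qed
qed

end

lemma (in cat) is_coproduct_cong:
 assumes "\<And>k. k : K ==> X k = X' k" "\<And>k. k : K ==> \<iota> k = \<iota>' k" "is_coproduct V K X S \<iota>"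
 shows "is_coproduct V K X' S \<iota>'"
 using assms unfolding is_coproduct_def by simp

context extensive_cat
begin

lemma chosen_along_injection:
 assumes b: "inj_on (b :: _ \<Rightarrow> 'u) K" and X: "is_coproduct V K X S \<iota>"
 defines "X' \<equiv> X \<circ> inv_into K b"
 obtains h k where "h : hom V S (coprod_obj V (b ` K) X')" "k : hom V (coprod_obj V (b ` K) X') S"
  "k o h = Idn V S" "h o k = Idn V (coprod_obj V (b ` K) X')"
  "\<And>j. j : K ==> h o \<iota> j = incl V (b ` K) X' (b j)"
  "\<And>j. j : K ==> k o incl V (b ` K) X' (b j) = \<iota> j"
proof -
 have "is_coproduct V (b ` K) X' (coprod_obj V (b ` K) X') (incl V (b ` K) X')"
  by (rule coproduct_u) (use homD(4)[OF coproductD(2)[OF X]] b in \<open>auto simp: X'_def\<close>)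
 then have "is_coproduct V K (X' \<circ> b) (coprod_obj V (b ` K) X') (incl V (b ` K) X' \<circ> b)"
  using b by (intro coproduct_reindex) (auto simp: bij_betw_def)
 then have "is_coproduct V K X (coprod_obj V (b ` K) X') (incl V (b ` K) X' \<circ> b)"
  by (rule is_coproduct_cong[rotated 2]) (use b in \<open>simp_all add: X'_def\<close>)
 from coproduct_cocone_iso[OF X this] that show thesis by auto
qed

lemma coproduct_decompose:
 assumes K: "small U K" and X: "is_coproduct V K X S \<iota>" and f: "f : hom V Z S"
 obtains Y x \<kappa> where "is_coproduct V K Y Z \<kappa>" "\<And>k. k : K ==> x k : hom V (Y k) (X k)"
  "\<And>k. k : K ==> f o \<kappa> k = \<iota> k o x k"
proof -
 obtain b where b: "inj_on (b :: _ \<Rightarrow> 'u) K"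
  using K unfolding small_def lepoll_def by blast
 define X' where "X' = X \<circ> inv_into K b"
 let ?S = "coprod_obj V (b ` K) X'" and ?\<iota> = "incl V (b ` K) X'"
 obtain h k where hk: "h : hom V S ?S" "k : hom V ?S S"
  "k o h = Idn V S" "h o k = Idn V ?S" "\<And>j. j : K ==> h o \<iota> j = ?\<iota> (b j)"
  "\<And>j. j : K ==> k o ?\<iota> (b j) = \<iota> j"
  using chosen_along_injection[OF b X] unfolding X'_def by blast
 have X': "X' (b j) = X j" if "j : K" for j using that b by (simp add: X'_def)
 have XO: "X' j : Obj V" if "j : b ` K" for j
  using that X' homD(4)[OF coproductD(2)[OF X]] by auto
 have hf: "h o f : hom V Z ?S" using f hk(1) by (rule comp_in_hom)
 obtain Y x \<kappa> where *: "is_coproduct V (b ` K) Y Z \<kappa>"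
  "\<And>j. j : b ` K ==> x j : hom V (Y j) (X' j)"
  "\<And>j. j : b ` K ==> (h o f) o \<kappa> j = ?\<iota> j o x j"
  by (rule coproduct_decompose_chosen[OF XO hf], assumption, rule that) auto
 have 1: "is_coproduct V K (Y \<circ> b) Z (\<kappa> \<circ> b)"
  using b * by (intro coproduct_reindex) (auto simp: bij_betw_def)
 have 2: "(x \<circ> b) j : hom V ((Y \<circ> b) j) (X j)" if "j : K" for j
  using *(2)[of "b j"] X'[OF that] that by simp
 have 3: "f o (\<kappa> \<circ> b) j = \<iota> j o (x \<circ> b) j" if j: "j : K" for j
 proof -
  have bj: "b j : b ` K" using j by blast
  note [simp] = homD[OF f] homD[OF hk(1)] homD[OF hk(2)] homD[OF coproductD(2)[OF *(1) bj]]
   homD[OF *(2)[OF bj]] homD[OF coproductD(2)[OF X j]] X'[OF j]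
   homD[OF coproductD(2)[OF coproduct_u[OF XO] bj]]
  have "k o h o (f o \<kappa> (b j)) = f o \<kappa> (b j)"
   by (rule comp_iso_cancel[OF hk(3,1,2)]) (simp add: in_hom)
  moreover have "h o (f o \<kappa> (b j)) = (h o f) o \<kappa> (b j)" by simp
  moreover have "k o ?\<iota> (b j) o x (b j) = (k o ?\<iota> (b j)) o x (b j)" by simp
  ultimately show ?thesis using *(3)[OF bj] hk(6)[OF j] by simp
 qed
 show thesis by (rule that[OF 1 2 3])
qed

lemma coproduct_square:
 assumes K: "small U K" and X: "is_coproduct V K X S \<iota>" and Y: "is_coproduct V K Y T \<kappa>"
  and x: "\<And>k. k : K ==> x k : hom V (Y k) (X k)"
  and p: "p : hom V T S" "\<And>k. k : K ==> p o \<kappa> k = \<iota> k o x k"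
  and f: "f : hom V Z T" and j: "j : K" and z: "z : hom V Z (X j)" "p o f = \<iota> j o z"
 shows "\<exists>!h. h : hom V Z (Y j) \<and> x j o h = z \<and> \<kappa> j o h = f"
proof -
 obtain b where b: "inj_on (b :: _ \<Rightarrow> 'u) K"
  using K unfolding small_def lepoll_def by blast
 define X' where "X' = X \<circ> inv_into K b"
 define Y' where "Y' = Y \<circ> inv_into K b"
 define x' where "x' = x \<circ> inv_into K b"
 let ?S = "coprod_obj V (b ` K) X'" and ?\<iota> = "incl V (b ` K) X'"
 let ?T = "coprod_obj V (b ` K) Y'" and ?\<kappa> = "incl V (b ` K) Y'"
 obtain h k where hk: "h : hom V S ?S" "k : hom V ?S S"
  "k o h = Idn V S" "h o k = Idn V ?S" "\<And>j. j : K ==> h o \<iota> j = ?\<iota> (b j)"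
  "\<And>j. j : K ==> k o ?\<iota> (b j) = \<iota> j"
  using chosen_along_injection[OF b X] unfolding X'_def by blast
 note h = hk(1,5)
 obtain m n where m: "m : hom V T ?T" "n : hom V ?T T"
  "n o m = Idn V T" "m o n = Idn V ?T" "\<And>j. j : K ==> m o \<kappa> j = ?\<kappa> (b j)"
  "\<And>j. j : K ==> n o ?\<kappa> (b j) = \<kappa> j"
  using chosen_along_injection[OF b Y] unfolding Y'_def by blast
 have s: "X' (b j) = X j" "Y' (b j) = Y j" "x' (b j) = x j" if "j : K" for j
  using that b by (simp_all add: X'_def Y'_def x'_def)
 note [simp] = homD[OF h(1)] homD[OF m(1)] homD[OF m(2)] homD[OF coproductD(2)[OF X]]
  homD[OF coproductD(2)[OF Y]] homD[OF x] homD[OF p(1)] homD[OF f] homD[OF z(1)]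
 have XO: "X' i : Obj V" and YO: "Y' i : Obj V" if "i : b ` K" for i
  using that homD(4,5)[OF x] s by auto
 note [simp] = homD[OF coproductD(2)[OF coproduct_u[OF XO]]] homD[OF coproductD(2)[OF coproduct_u[OF YO]]]
 have m\<kappa>: "m o \<kappa> j o a = ?\<kappa> (b j) o a" if "j : K" "a : hom V A (Y j)" for a A j
 proof -
  have "m o \<kappa> j o a = (m o \<kappa> j) o a" using that by (simp add: homD[OF that(2)])
  then show ?thesis using m(5)[OF that(1)] by simp
 qed
 have *: "\<exists>!c. c : hom V Z (Y' (b j)) \<and> x' (b j) o c = z \<and> ?\<kappa> (b j) o c = m o f"
 proof (rule coproduct_square_chosen[where p = "h o p o n" and X = X'])
  show "x' i : hom V (Y' i) (X' i)" if i: "i : b ` K" for i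
  proof -
   obtain l where "i = b l" "l : K" using i by blast
   then show ?thesis using x[of l] by (simp only: s)
  qed
  show "h o p o n : hom V ?T ?S" by (simp add: in_hom)
  show "(h o p o n) o ?\<kappa> i = ?\<iota> i o x' i" if i: "i : b ` K" for i
  proof -
   obtain l where l: "i = b l" "l : K" using i by blast
   have "(h o p o n) o ?\<kappa> i = h o (p o (n o ?\<kappa> (b l)))" using l by (simp add: s)
   also have "\<dots> = h o (\<iota> l o x l)" using m(6)[OF l(2)] p(2)[OF l(2)] by simp
   also have "\<dots> = (h o \<iota> l) o x l" using l(2) by simp
   finally show ?thesis using h(2)[OF l(2)] l s by simp
  qed
  show "m o f : hom V Z ?T" "b j : b ` K" "z : hom V Z (X' (b j))"
   using j z(1) s by (simp_all add: in_hom)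
  have "n o (m o f) = f" by (rule comp_iso_cancel[OF m(3,1,2) f])
  then have "(h o p o n) o m o f = h o (p o f)" by simp
  also have "\<dots> = (h o \<iota> j) o z" using j z(2) by simp
  finally show "(h o p o n) o m o f = ?\<iota> (b j) o z" using h(2)[OF j] by simp
 qed
 have "?\<kappa> (b j) o c = m o f \<longleftrightarrow> \<kappa> j o c = f" if c: "c : hom V Z (Y j)" for c
 proof
  assume "?\<kappa> (b j) o c = m o f"
  then have "n o (m o (\<kappa> j o c)) = n o (m o f)" using m\<kappa>[OF j c] by simp
  moreover have "\<kappa> j o c : hom V Z T" by (rule comp_in_hom[OF c coproductD(2)[OF Y j]])
  ultimately show "\<kappa> j o c = f"
   using comp_iso_cancel[OF m(3,1,2)] f by simp
 next
  assume "\<kappa> j o c = f" then show "?\<kappa> (b j) o c = m o f" using m\<kappa>[OF j c] by simp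
 qed
 then show ?thesis using * unfolding s[OF j] by blast
qed

subsection \<open>Reasoning locally over a coproduct\<close>

text \<open>
 Given a map \<open>f\<close> from \<open>Z\<close> to a coproduct, call an element \<open>w\<close> of \<open>Z\<close> local if \<open>f o w\<close> factors
 through a summand. Since coproducts are stable under pullback, maps out of \<open>Z\<close> are determined by
 their values at local elements, and compatible values at the local elements can be glued.
\<close>

lemma local_ext:
 assumes K: "small U K" and X: "is_coproduct V K X S \<iota>" and f: "f : hom V Z S"
  and a: "a : hom V Z A" "b : hom V Z A"
  and eq: "\<And>W w j x. w : hom V W Z ==> j : K ==> x : hom V W (X j) ==> f o w = \<iota> j o x ==> a o w = b o w"
 shows "a = b"
proof -
 obtain Y x \<kappa> where *: "is_coproduct V K Y Z \<kappa>" "\<And>k. k : K ==> x k : hom V (Y k) (X k)"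
  "\<And>k. k : K ==> f o \<kappa> k = \<iota> k o x k"
  by (rule coproduct_decompose[OF K X f], rule that) auto
 show ?thesis
  by (rule coproduct_ext[OF *(1) a]) (rule eq[OF coproductD(2)[OF *(1)] _ *(2,3)])
qed

lemma local_glue:
 assumes K: "small U K" and X: "is_coproduct V K X S \<iota>" and f: "f : hom V Z S" and A: "A : Obj V"
  and stable: "\<And>W w a W' v. w : hom V W Z ==> a : hom V W A ==> v : hom V W' W ==> R w a ==>
    R (w o v) (a o v)"
  and ex1: "\<And>W w j x. w : hom V W Z ==> j : K ==> x : hom V W (X j) ==> f o w = \<iota> j o x ==>
    \<exists>a. a : hom V W A \<and> R w a"
 obtains g where "g : hom V Z A"
  "\<And>W w j x. w : hom V W Z ==> j : K ==> x : hom V W (X j) ==> f o w = \<iota> j o x ==> R w (g o w)"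
proof -
 obtain Y x \<kappa> where *: "is_coproduct V K Y Z \<kappa>" "\<And>k. k : K ==> x k : hom V (Y k) (X k)"
  "\<And>k. k : K ==> f o \<kappa> k = \<iota> k o x k"
  by (rule coproduct_decompose[OF K X f], rule that) auto
 have "\<forall>k\<in>K. \<exists>a. a : hom V (Y k) A \<and> R (\<kappa> k) a"
  using ex1[OF coproductD(2)[OF *(1)] _ *(2,3)] by blast
 then obtain a where a: "\<And>k. k : K ==> a k : hom V (Y k) A" "\<And>k. k : K ==> R (\<kappa> k) (a k)"
  by metis
 obtain g where g: "g : hom V Z A" "\<And>k. k : K ==> g o \<kappa> k = a k"
  using coproduct_desc[OF *(1) A a(1)] by blast
 have "R w (g o w)" if w: "w : hom V W Z" and j: "j : K" and z: "z : hom V W (X j)" "f o w = \<iota> j o z"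
  for W w j z
 proof -
  obtain h where h: "h : hom V W (Y j)" "\<kappa> j o h = w"
   using coproduct_square[OF K X *(1,2) f *(3) w j z] by blast
  have k: "\<kappa> j : hom V (Y j) Z" by (rule coproductD(2)[OF *(1) j])
  have "R (\<kappa> j o h) (a j o h)" by (rule stable[OF k a(1)[OF j] h(1) a(2)[OF j]])
  moreover have "a j o h = g o w"
   unfolding h(2)[symmetric] g(2)[OF j, symmetric]
   using homD[OF k] homD[OF h(1)] homD[OF g(1)] by simp
  ultimately show ?thesis using h(2) by simp
 qed
 then show thesis using that g(1) by blast
qed

lemma incl_mono:
 assumes K: "small U K" and X: "is_coproduct V K X S \<iota>" and j: "j : K"
  and a: "a : hom V Z (X j)" "b : hom V Z (X j)" "\<iota> j o a = \<iota> j o b"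
 shows "a = b"
proof -
 have X': "X k : Obj V" if "k : K" for k using homD[OF coproductD(2)[OF X that]] by simp
 have T: "is_coproduct V K (\<lambda>_. \<one>) (coprod_obj V K (\<lambda>_. \<one>)) (incl V K (\<lambda>_. \<one>))"
  by (rule coproduct[OF K]) simp
 note [simp] = homD[OF coproductD(2)[OF X]] homD[OF coproductD(2)[OF T]] homD[OF a(1)] homD[OF a(2)]
 have "incl V K (\<lambda>_. \<one>) k o bang V (X k) \<in> hom V (X k) (coprod_obj V K (\<lambda>_. \<one>))"
  if "k : K" for k using X' that by (simp add: in_hom)
 then obtain p where p: "p : hom V S (coprod_obj V K (\<lambda>_. \<one>))"
  "\<And>k. k : K ==> p o \<iota> k = incl V K (\<lambda>_. \<one>) k o bang V (X k)"
  using coproduct_desc[OF X coproductD(1)[OF T], of "\<lambda>k. incl V K (\<lambda>_. \<one>) k o bang V (X k)"] by blast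
 note [simp] = homD[OF p(1)]
 have "p o \<iota> j o a = (p o \<iota> j) o a" using j by simp
 also have "\<dots> = incl V K (\<lambda>_. \<one>) j o bang V Z" using p(2) j by simp
 finally have *: "p o \<iota> j o a = incl V K (\<lambda>_. \<one>) j o bang V Z" .
 have "\<exists>!h. h : hom V Z (X j) \<and> bang V (X j) o h = bang V Z \<and> \<iota> j o h = \<iota> j o a"
  by (rule coproduct_square[OF K T X _ p, of "\<iota> j o a" Z j "bang V Z"])
   (use X' j * in \<open>simp_all add: in_hom\<close>)
 moreover have "bang V (X j) o a = bang V Z" "bang V (X j) o b = bang V Z" by simp_all
 ultimately show ?thesis using a by metis
qed

text \<open>
 A stage at which an element lies in two different summands maps to the initial object; as that is
 strict, all maps out of such a stage are equal.
\<close>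

lemma incl_disjoint:
 assumes K: "small U K" and X: "is_coproduct V K X S \<iota>" and ij: "i : K" "j : K" "i \<noteq> j"
  and a: "a : hom V Z (X i)" "b : hom V Z (X j)" "\<iota> i o a = \<iota> j o b"
 obtains u where "u : hom V Z \<zero>"
proof -
 have X': "X k : Obj V" if "k : K" for k using homD[OF coproductD(2)[OF X that]] by simp
 define Y where "Y k = (if k = j then X j else \<zero>)" for k
 obtain e where e: "\<And>A. A : Obj V ==> e A : hom V \<zero> A" using from_zero by metis
 define x where "x k = (if k = j then Idn V (X j) else e (X k))" for k
 have x: "x k : hom V (Y k) (X k)" if "k : K" for k
  using e[OF X'[OF that]] X' that ij by (auto simp: x_def Y_def in_hom)
 have T: "is_coproduct V K Y (coprod_obj V K Y) (incl V K Y)"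
  by (rule coproduct[OF K]) (use homD[OF x] in blast)
 note [simp] = homD[OF coproductD(2)[OF X]] homD[OF coproductD(2)[OF T]] homD[OF a(1)] homD[OF a(2)]
  homD[OF x] ij(1,2)
 have "\<iota> k o x k : hom V (Y k) S" if "k : K" for k using that by (simp add: in_hom)
 then obtain p where p: "p : hom V (coprod_obj V K Y) S" "\<And>k. k : K ==> p o incl V K Y k = \<iota> k o x k"
  using coproduct_desc[OF T coproductD(1)[OF X], of "\<lambda>k. \<iota> k o x k"] by blast
 note [simp] = homD[OF p(1)]
 have [simp]: "Y j = X j" by (simp add: Y_def)
 have "p o incl V K Y j o b = (p o incl V K Y j) o b" by simp
 also have "\<dots> = (\<iota> j o x j) o b" using p(2) by simp
 also have "\<dots> = \<iota> j o b" using X' by (simp add: x_def)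
 finally have *: "p o incl V K Y j o b = \<iota> i o a" using a(3) by simp
 have "\<exists>!h. h : hom V Z (Y i) \<and> x i o h = a \<and> incl V K Y i o h = incl V K Y j o b"
  by (rule coproduct_square[OF K X T x p, of "incl V K Y j o b" Z i a])
   (use a * in \<open>simp_all add: in_hom\<close>)
 then show thesis using that ij(3) unfolding Y_def by auto
qed

subsection \<open>Small products\<close>

text \<open>
 A family of maps \<open>Z \<rightarrow> X k\<close> is the same as a map \<open>Z \<otimes> S \<rightarrow> T\<close> over \<open>S\<close>, where \<open>S\<close> is the
 coproduct of copies of \<open>\<one>\<close> and \<open>T\<close> that of the \<open>X k\<close>. So the product of the \<open>X k\<close> is the object of
 sections of \<open>T \<rightarrow> S\<close>, a pullback of exponentials.
\<close>

lemma small_product: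
 assumes K: "small U K" and X: "\<And>k. k : K ==> X k : Obj V"
 obtains P \<pi> where "P : Obj V" "\<And>k. k : K ==> \<pi> k : hom V P (X k)"
  "\<And>Z f. Z : Obj V ==> (\<And>k. k : K ==> f k : hom V Z (X k)) ==>
    \<exists>h. h : hom V Z P \<and> (\<forall>k\<in>K. \<pi> k o h = f k)"
  "\<And>Z h h'. h : hom V Z P ==> h' : hom V Z P ==> (\<And>k. k : K ==> \<pi> k o h = \<pi> k o h') ==> h = h'"
proof -
 define S where "S = coprod_obj V K (\<lambda>_. \<one>)"
 define \<iota> where "\<iota> = incl V K (\<lambda>_. \<one>)"
 define T where "T = coprod_obj V K X"
 define \<kappa> where "\<kappa> = incl V K X"
 have copS: "is_coproduct V K (\<lambda>_. \<one>) S \<iota>" unfolding S_def \<iota>_def by (rule coproduct[OF K]) simp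
 have copT: "is_coproduct V K X T \<kappa>" unfolding T_def \<kappa>_def by (rule coproduct[OF K X])
 note [simp] = homD[OF coproductD(2)[OF copS]] homD[OF coproductD(2)[OF copT]] X
  coproductD(1)[OF copS] coproductD(1)[OF copT]
 have "\<iota> k o bang V (X k) \<in> hom V (X k) S" if "k : K" for k
  using that by (simp add: in_hom)
 then obtain p where p: "p : hom V T S" "\<And>k. k : K ==> p o \<kappa> k = \<iota> k o bang V (X k)"
  using coproduct_desc[OF copT coproductD(1)[OF copS], of "\<lambda>k. \<iota> k o bang V (X k)"] by blast
 note [simp] = homD[OF p(1)]
 have p\<kappa>: "p o \<kappa> k o a = \<iota> k o bang V Z" if "k : K" "a : hom V Z (X k)" for k a Z
 proof -
  have "p o \<kappa> k o a = (p o \<kappa> k) o a" using that(1) homD[OF that(2)] by simp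
  then show ?thesis using p(2)[OF that(1)] that(1) homD[OF that(2)] by simp
 qed
 have lift: "\<exists>!h. h : hom V Z (X k) \<and> \<kappa> k o h = f"
  if "k : K" "f : hom V Z T" "p o f = \<iota> k o bang V Z" for k f Z
 proof -
  note [simp] = homD[OF that(2)]
  have "\<exists>!h. h : hom V Z (X k) \<and> bang V (X k) o h = bang V Z \<and> \<kappa> k o h = f"
   by (rule coproduct_square[OF K copS copT _ p that(2,1) _ that(3)])
    (use that(1) in \<open>simp_all add: in_hom\<close>)
  moreover have "bang V (X k) o h = bang V Z" if "h : hom V Z (X k)" for h
   using homD[OF that] by simp
  ultimately show ?thesis by blast
 qed
 define c where "c = transpose V \<lbrakk>S, T\<rbrakk> S S (p o ev V S T)"
 define n where "n = transpose V \<one> S S (pr2 V \<one> S)"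
 define P where "P = pb_obj V c n"
 have c [simp]: "c : Arr V" "Dom V c = \<lbrakk>S, T\<rbrakk>" "Cod V c = \<lbrakk>S, S\<rbrakk>" by (simp_all add: c_def)
 have n [simp]: "n : Arr V" "Dom V n = \<one>" "Cod V n = \<lbrakk>S, S\<rbrakk>" by (simp_all add: n_def)
 have c\<beta>: "ev V S S o \<langle>c o x, s\<rangle> = p o ev V S T o \<langle>x, s\<rangle>"
  if "x : Arr V" "s : Arr V" "Dom V x = Dom V s" "Cod V x = \<lbrakk>S, T\<rbrakk>" "Cod V s = S" for x s
  using that by (simp add: c_def)
 have n\<beta>: "ev V S S o \<langle>n o bang V Z, s\<rangle> = s"
  if "s : Arr V" "Cod V s = S" "Dom V s = Z" for s Z
  using that dom_in_Obj[OF that(1)] by (simp add: n_def)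
 have P [simp]: "P : Obj V" by (simp add: P_def)
 have sec: "p o ev V S T o \<langle>pb1 V c n o h, s\<rangle> = s" if h: "h : hom V Z P" and s: "s : hom V Z S" for h s Z
 proof -
  note [simp] = homD[OF h] homD[OF s]
  have "pb2 V c n o h = bang V Z"
   using bang_unique[of "pb2 V c n o h"] by (simp add: P_def[symmetric])
  then have "ev V S S o \<langle>c o (pb1 V c n o h), s\<rangle> = ev V S S o \<langle>n o bang V Z, s\<rangle>"
   using pb_square_point[of c n h] by (simp add: P_def[symmetric])
  then show ?thesis by (simp add: c\<beta> n\<beta> P_def[symmetric])
 qed
 define q where "q k = ev V S T o \<langle>pb1 V c n, \<iota> k o bang V P\<rangle>" for k
 have q: "q k : hom V P T" "p o q k = \<iota> k o bang V P" if "k : K" for k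
  using that sec[of "Idn V P" P "\<iota> k o bang V P"] by (simp_all add: q_def in_hom P_def[symmetric])
 define \<pi> where "\<pi> k = (THE h. h : hom V P (X k) \<and> \<kappa> k o h = q k)" for k
 have \<pi>: "\<pi> k : hom V P (X k)" "\<kappa> k o \<pi> k = q k" if "k : K" for k
  using theI'[OF lift[OF that q(1)[OF that] q(2)[OF that]]] unfolding \<pi>_def by blast+
 note [simp] = homD[OF \<pi>(1)]
 have \<kappa>\<pi>: "\<kappa> k o \<pi> k o h = ev V S T o \<langle>pb1 V c n o h, \<iota> k o bang V Z\<rangle>"
  if k: "k : K" and h: "h : hom V Z P" for k h Z
 proof -
  note [simp] = homD[OF h] k
  have "\<kappa> k o \<pi> k o h = (\<kappa> k o \<pi> k) o h" by simp
  also have "\<dots> = q k o h" using \<pi>(2)[OF k] by simp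
  finally show ?thesis by (simp add: q_def flip: P_def)
 qed
 show thesis
 proof (rule that[OF P \<pi>(1)])
  fix Z f assume Z: "Z : Obj V" and f: "\<And>k. k : K ==> f k : hom V Z (X k)"
  note [simp] = Z homD[OF f]
  have "transpose V \<one> Z T (\<kappa> k o f k o pr2 V \<one> Z) \<in> hom V \<one> \<lbrakk>Z, T\<rbrakk>" if "k : K" for k
   using that by (simp add: in_hom)
  then obtain g where g: "g : hom V S \<lbrakk>Z, T\<rbrakk>"
   "\<And>k. k : K ==> g o \<iota> k = transpose V \<one> Z T (\<kappa> k o f k o pr2 V \<one> Z)"
   using coproduct_desc[OF copS, of "\<lbrakk>Z, T\<rbrakk>" "\<lambda>k. transpose V \<one> Z T (\<kappa> k o f k o pr2 V \<one> Z)"]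
    exp_in_Obj[of Z T] Z coproductD(1)[OF copT] by blast
  note [simp] = homD[OF g(1)]
  have g\<iota>: "ev V Z T o \<langle>g o \<iota> k o t, z\<rangle> = \<kappa> k o f k o z"
   if k: "k : K" and t: "t : hom V W \<one>" and z: "z : hom V W Z" for k t z W
  proof -
   note [simp] = homD[OF t] homD[OF z] k
   have "g o \<iota> k o t = (g o \<iota> k) o t" by simp
   then show ?thesis using g(2)[OF k] by simp
  qed
  define a where "a = transpose V Z S T (ev V Z T o \<langle>g o pr2 V Z S, pr1 V Z S\<rangle>)"
  have a [simp]: "a : Arr V" "Dom V a = Z" "Cod V a = \<lbrakk>S, T\<rbrakk>" by (simp_all add: a_def)
  have "c o a = n o bang V Z"
  proof (rule exp_ext[of _ Z S S])
   fix W y s assume y: "y : hom V W Z" and s: "s : hom V W S"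
   note [simp] = homD[OF y] homD[OF s]
   have "p o ev V Z T o \<langle>g o s, y\<rangle> = s"
   proof (rule local_ext[OF K copS s, of _ S])
    fix W' w j x assume w: "w : hom V W' W" and j: "j : K" and x: "x : hom V W' \<one>"
     and sw: "s o w = \<iota> j o x"
    note [simp] = homD[OF w] homD[OF x] j
    have "(p o ev V Z T o \<langle>g o s, y\<rangle>) o w = p o ev V Z T o \<langle>g o \<iota> j o x, y o w\<rangle>"
     by (simp add: sw)
    also have "\<dots> = p o \<kappa> j o f j o y o w"
     using g\<iota>[OF j x, of "y o w"] by (simp add: in_hom)
    also have "\<dots> = \<iota> j o bang V W'"
     by (rule p\<kappa>) (simp_all add: in_hom)
    finally show "(p o ev V Z T o \<langle>g o s, y\<rangle>) o w = s o w"
     using sw bang_unique[of x] by simp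
   qed (simp_all add: in_hom)
   then show "ev V S S o \<langle>(c o a) o y, s\<rangle> = ev V S S o \<langle>(n o bang V Z) o y, s\<rangle>"
    by (simp add: c\<beta> n\<beta>) (simp add: a_def)
  qed (simp_all add: in_hom)
  note can = this
  define h where "h = pb_pair V c n a (bang V Z)"
  have h: "h : hom V Z P" "pb1 V c n o h = a" using can by (simp_all add: h_def P_def in_hom)
  have "\<pi> k o h = f k" if k: "k : K" for k
  proof (rule incl_mono[OF K copT k])
   have "\<kappa> k o \<pi> k o h = ev V S T o \<langle>a, \<iota> k o bang V Z\<rangle>" using \<kappa>\<pi>[OF k h(1)] h(2) by simp
   also have "\<dots> = ev V Z T o \<langle>g o \<iota> k o bang V Z, Idn V Z\<rangle>" using k by (simp add: a_def)
   also have "\<dots> = \<kappa> k o f k"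
    using g\<iota>[OF k bang_in_hom[OF Z], of "Idn V Z"] k by (simp add: in_hom)
   finally show "\<kappa> k o \<pi> k o h = \<kappa> k o f k" .
  qed (use k h in \<open>simp_all add: in_hom\<close>)
  then show "\<exists>h. h : hom V Z P \<and> (\<forall>k\<in>K. \<pi> k o h = f k)" using h(1) by blast
 next
  fix Z h h' assume h: "h : hom V Z P" and h': "h' : hom V Z P"
   and eq: "\<And>k. k : K ==> \<pi> k o h = \<pi> k o h'"
  note [simp] = homD[OF h] homD[OF h']
  have "pb1 V c n o h = pb1 V c n o h'"
  proof (rule exp_ext[of _ Z S T])
   fix W y s assume y: "y : hom V W Z" and s: "s : hom V W S"
   note [simp] = homD[OF y] homD[OF s]
   show "ev V S T o \<langle>(pb1 V c n o h) o y, s\<rangle> = ev V S T o \<langle>(pb1 V c n o h') o y, s\<rangle>"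
   proof (rule local_ext[OF K copS s, of _ T])
    fix W' w j x assume w: "w : hom V W' W" and j: "j : K" and x: "x : hom V W' \<one>"
     and sw: "s o w = \<iota> j o x"
    note [simp] = homD[OF w] homD[OF x] j
    have xb: "x = bang V W'" using bang_unique[of x] by simp
    have "\<pi> j o (h o y o w) = \<pi> j o (h' o y o w)"
     by (rule square_point[OF eq[OF j]]) simp_all
    then have "\<kappa> j o \<pi> j o (h o y o w) = \<kappa> j o \<pi> j o (h' o y o w)" by simp
    then show "(ev V S T o \<langle>(pb1 V c n o h) o y, s\<rangle>) o w = (ev V S T o \<langle>(pb1 V c n o h') o y, s\<rangle>) o w"
     using \<kappa>\<pi>[OF j, of "h o y o w" W'] \<kappa>\<pi>[OF j, of "h' o y o w" W']
     by (simp add: sw xb in_hom P_def[symmetric])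
   qed (simp_all add: in_hom P_def[symmetric])
  qed (simp_all add: in_hom P_def[symmetric])
  moreover have "pb2 V c n o h = pb2 V c n o h'"
   by (rule to_one_eq) (simp_all add: P_def[symmetric])
  ultimately show "h = h'"
   by - (rule pb_ext[of _ _ c n], simp_all add: P_def[symmetric])
 qed
qed

end

section \<open>Enriched categories through generalized elements\<close>

context ccc
begin

lemma vcat_laws:
 assumes C: "is_vcat V C"
 shows vhom_in_Obj [simp]: "A : VOb C ==> B : VOb C ==> VHom C A B : Obj V"
  and vid_arr [simp]: "A : VOb C ==> VId C A : Arr V"
  and vid_dom [simp]: "A : VOb C ==> Dom V (VId C A) = \<one>"
  and vid_cod [simp]: "A : VOb C ==> Cod V (VId C A) = VHom C A A"
  and vcmp_arr [simp]: "A : VOb C ==> B : VOb C ==> D : VOb C ==> VCmp C A B D : Arr V"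
  and vcmp_dom [simp]: "A : VOb C ==> B : VOb C ==> D : VOb C ==>
   Dom V (VCmp C A B D) = VHom C B D \<otimes> VHom C A B"
  and vcmp_cod [simp]: "A : VOb C ==> B : VOb C ==> D : VOb C ==> Cod V (VCmp C A B D) = VHom C A D"
proof -
 note C' = C[unfolded is_vcat_def]
 show "A : VOb C ==> B : VOb C ==> VHom C A B : Obj V"
  using conjunct1[OF C'] by blast
 show "A : VOb C ==> VId C A : Arr V" "A : VOb C ==> Dom V (VId C A) = \<one>"
  "A : VOb C ==> Cod V (VId C A) = VHom C A A"
  using conjunct1[OF conjunct2[OF C']] by (simp_all add: in_hom)
 show "A : VOb C ==> B : VOb C ==> D : VOb C ==> VCmp C A B D : Arr V"
  "A : VOb C ==> B : VOb C ==> D : VOb C ==> Dom V (VCmp C A B D) = VHom C B D \<otimes> VHom C A B"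
  "A : VOb C ==> B : VOb C ==> D : VOb C ==> Cod V (VCmp C A B D) = VHom C A D"
  using conjunct1[OF conjunct2[OF conjunct2[OF C']]] by (simp_all add: in_hom)
qed

text \<open>
 The laws of an enriched category equate maps out of products of hom-objects. Applied to elements
 they become the familiar unit and associativity laws, which are used for rewriting.
\<close>

lemma vunit_right [simp]:
 assumes C: "is_vcat V C" and "A : VOb C" "B : VOb C" "f : Arr V" "Cod V f = VHom C A B"
  "x : Arr V" "Cod V x = \<one>" "Dom V f = Dom V x"
 shows "VCmp C A A B o \<langle>f, VId C A o x\<rangle> = f"
proof -
 note C' = C[unfolded is_vcat_def]
 have "VCmp C A A B o \<langle>Idn V (VHom C A B), VId C A o bang V (VHom C A B)\<rangle> = Idn V (VHom C A B)"
  using conjunct1[OF conjunct2[OF conjunct2[OF conjunct2[OF C']]]] assms(2,3) by blast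
 then have "(VCmp C A A B o \<langle>Idn V (VHom C A B), VId C A o bang V (VHom C A B)\<rangle>) o f = f"
  using assms by (metis comp_id_left)
 moreover have "bang V (Dom V x) = x" using bang_unique assms by metis
 ultimately show ?thesis using assms by simp
qed

lemma vunit_left [simp]:
 assumes C: "is_vcat V C" and "A : VOb C" "B : VOb C" "f : Arr V" "Cod V f = VHom C A B"
  "x : Arr V" "Cod V x = \<one>" "Dom V x = Dom V f"
 shows "VCmp C A B B o \<langle>VId C B o x, f\<rangle> = f"
proof -
 note C' = C[unfolded is_vcat_def]
 have "VCmp C A B B o \<langle>VId C B o bang V (VHom C A B), Idn V (VHom C A B)\<rangle> = Idn V (VHom C A B)"
  using conjunct1[OF conjunct2[OF conjunct2[OF conjunct2[OF C']]]] assms(2,3) by blast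
 then have "(VCmp C A B B o \<langle>VId C B o bang V (VHom C A B), Idn V (VHom C A B)\<rangle>) o f = f"
  using assms by (metis comp_id_left)
 moreover have "bang V (Dom V x) = x" using bang_unique assms by metis
 ultimately show ?thesis using assms by simp
qed

lemma vassoc:
 assumes C: "is_vcat V C" and "A : VOb C" "B : VOb C" "D : VOb C" "E : VOb C"
  "h : Arr V" "g : Arr V" "f : Arr V" "Dom V h = Dom V f" "Dom V g = Dom V f"
  "Cod V h = VHom C D E" "Cod V g = VHom C B D" "Cod V f = VHom C A B"
 shows "VCmp C A B E o \<langle>VCmp C B D E o \<langle>h, g\<rangle>, f\<rangle> = VCmp C A D E o \<langle>h, VCmp C A B D o \<langle>g, f\<rangle>\<rangle>"
proof -
 note C' = C[unfolded is_vcat_def]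
 define P Q where "P = VHom C D E \<otimes> VHom C B D" and "Q = VHom C A B"
 define f' g' h' where "f' = pr2 V P Q" and "g' = pr2 V (VHom C D E) (VHom C B D) o pr1 V P Q"
  and "h' = pr1 V (VHom C D E) (VHom C B D) o pr1 V P Q"
 have "VCmp C A B E o \<langle>VCmp C B D E o \<langle>h', g'\<rangle>, f'\<rangle> = VCmp C A D E o \<langle>h', VCmp C A B D o \<langle>g', f'\<rangle>\<rangle>"
  using conjunct2[OF conjunct2[OF conjunct2[OF conjunct2[OF C']]]] assms(2-5)
  unfolding Let_def P_def Q_def f'_def g'_def h'_def by blast
 then have "(VCmp C A B E o \<langle>VCmp C B D E o \<langle>h', g'\<rangle>, f'\<rangle>) o \<langle>\<langle>h, g\<rangle>, f\<rangle>
  = (VCmp C A D E o \<langle>h', VCmp C A B D o \<langle>g', f'\<rangle>\<rangle>) o \<langle>\<langle>h, g\<rangle>, f\<rangle>" by simp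
 then show ?thesis using assms by (simp add: f'_def g'_def h'_def P_def Q_def)
qed

lemma is_vcatI:
 assumes hom: "\<And>A B. A : VOb C ==> B : VOb C ==> VHom C A B : Obj V"
  and id: "\<And>A. A : VOb C ==> VId C A : hom V \<one> (VHom C A A)"
  and cmp: "\<And>A B D. A : VOb C ==> B : VOb C ==> D : VOb C ==>
   VCmp C A B D : hom V (VHom C B D \<otimes> VHom C A B) (VHom C A D)"
  and unit: "\<And>A B X f. A : VOb C ==> B : VOb C ==> f : hom V X (VHom C A B) ==>
   VCmp C A A B o \<langle>f, VId C A o bang V X\<rangle> = f"
   "\<And>A B X f. A : VOb C ==> B : VOb C ==> f : hom V X (VHom C A B) ==>
   VCmp C A B B o \<langle>VId C B o bang V X, f\<rangle> = f"
  and assoc: "\<And>A B D E X f g h. A : VOb C ==> B : VOb C ==> D : VOb C ==> E : VOb C ==>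
   f : hom V X (VHom C A B) ==> g : hom V X (VHom C B D) ==> h : hom V X (VHom C D E) ==>
   VCmp C A B E o \<langle>VCmp C B D E o \<langle>h, g\<rangle>, f\<rangle> = VCmp C A D E o \<langle>h, VCmp C A B D o \<langle>g, f\<rangle>\<rangle>"
 shows "is_vcat V C"
 unfolding is_vcat_def Let_def
proof (intro conjI ballI)
 fix A B assume AB: "A : VOb C" "B : VOb C"
 show "VHom C A B : Obj V" by (rule hom[OF AB])
 show "VCmp C A A B o \<langle>Idn V (VHom C A B), VId C A o bang V (VHom C A B)\<rangle> = Idn V (VHom C A B)"
  by (rule unit[OF AB]) (simp add: in_hom hom AB)
 show "VCmp C A B B o \<langle>VId C B o bang V (VHom C A B), Idn V (VHom C A B)\<rangle> = Idn V (VHom C A B)"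
  by (rule unit[OF AB]) (simp add: in_hom hom AB)
 fix D assume D: "D : VOb C"
 show "VCmp C A B D : hom V (VHom C B D \<otimes> VHom C A B) (VHom C A D)" by (rule cmp[OF AB D])
 fix E assume E: "E : VOb C"
 let ?P = "VHom C D E \<otimes> VHom C B D" let ?Q = "VHom C A B"
 note [simp] = hom AB D E
 show "VCmp C A B E o \<langle>VCmp C B D E o \<langle>pr1 V (VHom C D E) (VHom C B D) o pr1 V ?P ?Q,
     pr2 V (VHom C D E) (VHom C B D) o pr1 V ?P ?Q\<rangle>, pr2 V ?P ?Q\<rangle>
  = VCmp C A D E o \<langle>pr1 V (VHom C D E) (VHom C B D) o pr1 V ?P ?Q,
    VCmp C A B D o \<langle>pr2 V (VHom C D E) (VHom C B D) o pr1 V ?P ?Q, pr2 V ?P ?Q\<rangle>\<rangle>"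
  by (rule assoc[where X = "?P \<otimes> ?Q"]) (simp_all add: in_hom)
qed (rule id)

lemma vop_simps [simp]: "VOb (vop V C) = VOb C" "VHom (vop V C) A B = VHom C B A" "VId (vop V C) = VId C"
 by (simp_all add: vop_def)

lemma vop_cmp [simp]:
 assumes "is_vcat V C" "A : VOb C" "B : VOb C" "D : VOb C" "g : Arr V" "f : Arr V"
  "Dom V g = Dom V f" "Cod V g = VHom C D B" "Cod V f = VHom C B A"
 shows "VCmp (vop V C) A B D o \<langle>g, f\<rangle> = VCmp C D B A o \<langle>f, g\<rangle>"
 using assms by (simp add: vop_def)

lemma vop_vcat:
 assumes C: "is_vcat V C"
 shows "is_vcat V (vop V C)"
proof (rule is_vcatI)
 note [simp] = C
 show "VCmp (vop V C) A B D : hom V (VHom (vop V C) B D \<otimes> VHom (vop V C) A B) (VHom (vop V C) A D)"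
  if "A : VOb (vop V C)" "B : VOb (vop V C)" "D : VOb (vop V C)" for A B D
  using that by (simp add: vop_def in_hom)
 fix A B X f assume A: "A : VOb (vop V C)" "B : VOb (vop V C)" and f: "f : hom V X (VHom (vop V C) A B)"
 note [simp] = homD[OF f]
 show "VCmp (vop V C) A A B o \<langle>f, VId (vop V C) A o bang V X\<rangle> = f"
  "VCmp (vop V C) A B B o \<langle>VId (vop V C) B o bang V X, f\<rangle> = f"
  using A by simp_all
 fix D E g h assume D: "D : VOb (vop V C)" "E : VOb (vop V C)"
  and g: "g : hom V X (VHom (vop V C) B D)" and h: "h : hom V X (VHom (vop V C) D E)"
 note [simp] = homD[OF g] homD[OF h]
 show "VCmp (vop V C) A B E o \<langle>VCmp (vop V C) B D E o \<langle>h, g\<rangle>, f\<rangle> =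
   VCmp (vop V C) A D E o \<langle>h, VCmp (vop V C) A B D o \<langle>g, f\<rangle>\<rangle>"
  using A D by (simp add: vassoc)
qed (use C in \<open>simp_all add: in_hom\<close>)

lemma vfull_simps [simp]: "VOb (vfull C S) = S" "VHom (vfull C S) = VHom C" "VId (vfull C S) = VId C"
 "VCmp (vfull C S) = VCmp C"
 by (simp_all add: vfull_def)

lemma vfull_vcat: "is_vcat V C ==> S \<subseteq> VOb C ==> is_vcat V (vfull C S)"
 by (rule is_vcatI) (auto simp: in_hom vassoc subset_iff)

subsection \<open>Enriched functors\<close>

lemma vfunD:
 assumes F: "is_vfun V C D F" and C: "is_vcat V C" and D: "is_vcat V D"
 shows "A : VOb C ==> FOb F A : VOb D"
  and "A : VOb C ==> B : VOb C ==> FHom F A B : Arr V"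
  and "A : VOb C ==> B : VOb C ==> Dom V (FHom F A B) = VHom C A B"
  and "A : VOb C ==> B : VOb C ==> Cod V (FHom F A B) = VHom D (FOb F A) (FOb F B)"
proof -
 note F' = F[unfolded is_vfun_def]
 show "A : VOb C ==> FOb F A : VOb D" using conjunct1[OF F'] by blast
 show "A : VOb C ==> B : VOb C ==> FHom F A B : Arr V"
  "A : VOb C ==> B : VOb C ==> Dom V (FHom F A B) = VHom C A B"
  "A : VOb C ==> B : VOb C ==> Cod V (FHom F A B) = VHom D (FOb F A) (FOb F B)"
  using conjunct1[OF conjunct2[OF F']] by (simp_all add: in_hom)
qed

lemma vfun_id:
 assumes F: "is_vfun V C D F" and C: "is_vcat V C" and D: "is_vcat V D"
  and "A : VOb C" "x : Arr V" "Cod V x = \<one>"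
 shows "FHom F A A o VId C A o x = VId D (FOb F A) o x"
proof -
 note [simp] = vfunD[OF F C D] assms(2-)
 have "FHom F A A o VId C A = VId D (FOb F A)"
  using conjunct1[OF conjunct2[OF conjunct2[OF conjunct2[OF F[unfolded is_vfun_def]]]]] assms(4) by blast
 then have "(FHom F A A o VId C A) o x = VId D (FOb F A) o x" by simp
 then show ?thesis by (subst (asm) comp_assoc) simp_all
qed

lemma vfun_cmp:
 assumes F: "is_vfun V C D F" and C: "is_vcat V C" and D: "is_vcat V D"
  and "A : VOb C" "B : VOb C" "E : VOb C" "g : Arr V" "f : Arr V" "Dom V g = Dom V f"
  "Cod V g = VHom C B E" "Cod V f = VHom C A B"
 shows "FHom F A E o VCmp C A B E o \<langle>g, f\<rangle>
  = VCmp D (FOb F A) (FOb F B) (FOb F E) o \<langle>FHom F B E o g, FHom F A B o f\<rangle>"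
proof -
 note [simp] = vfunD[OF F C D] assms(2-)
 have "FHom F A E o VCmp C A B E = VCmp D (FOb F A) (FOb F B) (FOb F E) o
   \<langle>FHom F B E o pr1 V (VHom C B E) (VHom C A B), FHom F A B o pr2 V (VHom C B E) (VHom C A B)\<rangle>"
  using conjunct2[OF conjunct2[OF conjunct2[OF conjunct2[OF F[unfolded is_vfun_def]]]]] assms(4-6) by blast
 then have "(FHom F A E o VCmp C A B E) o \<langle>g, f\<rangle> = (VCmp D (FOb F A) (FOb F B) (FOb F E) o
   \<langle>FHom F B E o pr1 V (VHom C B E) (VHom C A B), FHom F A B o pr2 V (VHom C B E) (VHom C A B)\<rangle>) o \<langle>g, f\<rangle>"
  by simp
 then show ?thesis by (subst (asm) comp_assoc) simp_all
qed

lemma is_vfunI: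
 assumes C: "is_vcat V C" and D: "is_vcat V D"
  and "FOb F : VOb C \<rightarrow>\<^sub>E VOb D" "\<And>A B. \<not> (A : VOb C \<and> B : VOb C) ==> FHom F A B = undefined"
  and F: "\<And>A B. A : VOb C ==> B : VOb C ==> FHom F A B : hom V (VHom C A B) (VHom D (FOb F A) (FOb F B))"
  and id: "\<And>A. A : VOb C ==> FHom F A A o VId C A = VId D (FOb F A)"
  and cmp: "\<And>A B E X g f. A : VOb C ==> B : VOb C ==> E : VOb C ==>
   g : hom V X (VHom C B E) ==> f : hom V X (VHom C A B) ==>
   FHom F A E o VCmp C A B E o \<langle>g, f\<rangle>
   = VCmp D (FOb F A) (FOb F B) (FOb F E) o \<langle>FHom F B E o g, FHom F A B o f\<rangle>"
 shows "is_vfun V C D F"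
 unfolding is_vfun_def
proof (intro conjI ballI allI impI)
 fix A B E assume ABE: "A : VOb C" "B : VOb C" "E : VOb C"
 note [simp] = ABE C
 have [simp]: "FOb F A : VOb D" "FOb F B : VOb D" using assms(3) by auto
 have "FHom F A E o VCmp C A B E o \<langle>pr1 V (VHom C B E) (VHom C A B), pr2 V (VHom C B E) (VHom C A B)\<rangle>
   = VCmp D (FOb F A) (FOb F B) (FOb F E) o
   \<langle>FHom F B E o pr1 V (VHom C B E) (VHom C A B), FHom F A B o pr2 V (VHom C B E) (VHom C A B)\<rangle>"
  by (rule cmp[where X = "VHom C B E \<otimes> VHom C A B"]) (simp_all add: in_hom)
 then show "FHom F A E o VCmp C A B E = VCmp D (FOb F A) (FOb F B) (FOb F E) o
   \<langle>FHom F B E o pr1 V (VHom C B E) (VHom C A B), FHom F A B o pr2 V (VHom C B E) (VHom C A B)\<rangle>"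
  by simp
qed (use assms in blast)+

lemma mk_vfun_simps [simp]: "A : K ==> FOb (mk_vfun K F0 F1) A = F0 A"
 "A : K ==> B : K ==> FHom (mk_vfun K F0 F1) A B = F1 A B"
 by (simp_all add: mk_vfun_def)

lemma mk_vfun_is_vfun:
 assumes C: "is_vcat V C" and D: "is_vcat V D"
  and F0: "\<And>A. A : VOb C ==> F0 A : VOb D"
  and F1: "\<And>A B. A : VOb C ==> B : VOb C ==> F1 A B : hom V (VHom C A B) (VHom D (F0 A) (F0 B))"
  and id: "\<And>A. A : VOb C ==> F1 A A o VId C A = VId D (F0 A)"
  and cmp: "\<And>A B E X g f. A : VOb C ==> B : VOb C ==> E : VOb C ==>
   g : hom V X (VHom C B E) ==> f : hom V X (VHom C A B) ==>
   F1 A E o VCmp C A B E o \<langle>g, f\<rangle> = VCmp D (F0 A) (F0 B) (F0 E) o \<langle>F1 B E o g, F1 A B o f\<rangle>"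
 shows "is_vfun V C D (mk_vfun (VOb C) F0 F1)"
 by (rule is_vfunI[OF C D]) (use F0 F1 id cmp in \<open>auto simp: mk_vfun_def\<close>)

subsection \<open>The enrichment of the base category over itself\<close>

lemma vself_simps [simp]: "VOb (vself V) = Obj V" "VHom (vself V) A B = \<lbrakk>A, B\<rbrakk>"
 by (simp_all add: vself_def)

lemma vself_cmp_in_hom:
 assumes "A : Obj V" "B : Obj V" "D : Obj V"
 shows "VCmp (vself V) A B D : hom V (\<lbrakk>B, D\<rbrakk> \<otimes> \<lbrakk>A, B\<rbrakk>) \<lbrakk>A, D\<rbrakk>"
 using assms by (simp add: vself_def Let_def in_hom)

lemma vself_id_in_hom: "A : Obj V ==> VId (vself V) A : hom V \<one> \<lbrakk>A, A\<rbrakk>"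
 by (simp add: vself_def in_hom)

lemma vself_cmp_apply [simp]:
 assumes "A : Obj V" "B : Obj V" "D : Obj V" "g : Arr V" "f : Arr V" "a : Arr V"
  "Dom V g = Dom V a" "Dom V f = Dom V a" "Cod V g = \<lbrakk>B, D\<rbrakk>" "Cod V f = \<lbrakk>A, B\<rbrakk>" "Cod V a = A"
 shows "ev V A D o \<langle>VCmp (vself V) A B D o \<langle>g, f\<rangle>, a\<rangle> = ev V B D o \<langle>g, ev V A B o \<langle>f, a\<rangle>\<rangle>"
 using assms by (simp add: vself_def Let_def)

lemma vself_id_apply [simp]:
 assumes "A : Obj V" "x : Arr V" "a : Arr V" "Dom V x = Dom V a" "Cod V x = \<one>" "Cod V a = A"
 shows "ev V A A o \<langle>VId (vself V) A o x, a\<rangle> = a"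
 using assms by (simp add: vself_def)

lemma vself_vcat [simp]: "is_vcat V (vself V)"
proof (rule is_vcatI)
 note [simp] = homD[OF vself_cmp_in_hom] homD[OF vself_id_in_hom]
 fix A B X f assume A: "A : VOb (vself V)" "B : VOb (vself V)" and f: "f : hom V X (VHom (vself V) A B)"
 have [simp]: "A : Obj V" "B : Obj V" using A by simp_all
 note [simp] = homD[OF f[unfolded vself_simps]]
 show "VCmp (vself V) A A B o \<langle>f, VId (vself V) A o bang V X\<rangle> = f"
 proof (rule exp_ext[of _ X A B])
  fix Y y a assume y: "y : hom V Y X" and a: "a : hom V Y A"
  show "ev V A B o \<langle>(VCmp (vself V) A A B o \<langle>f, VId (vself V) A o bang V X\<rangle>) o y, a\<rangle> = ev V A B o \<langle>f o y, a\<rangle>"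
   by (simp add: homD[OF y] homD[OF a])
 qed (simp_all add: in_hom)
 show "VCmp (vself V) A B B o \<langle>VId (vself V) B o bang V X, f\<rangle> = f"
 proof (rule exp_ext[of _ X A B])
  fix Y y a assume y: "y : hom V Y X" and a: "a : hom V Y A"
  show "ev V A B o \<langle>(VCmp (vself V) A B B o \<langle>VId (vself V) B o bang V X, f\<rangle>) o y, a\<rangle> = ev V A B o \<langle>f o y, a\<rangle>"
   by (simp add: homD[OF y] homD[OF a])
 qed (simp_all add: in_hom)
 fix D E g h assume D: "D : VOb (vself V)" "E : VOb (vself V)"
  and g: "g : hom V X (VHom (vself V) B D)" and h: "h : hom V X (VHom (vself V) D E)"
 have [simp]: "D : Obj V" "E : Obj V" using D by simp_all
 note [simp] = homD[OF g[unfolded vself_simps]] homD[OF h[unfolded vself_simps]]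
 show "VCmp (vself V) A B E o \<langle>VCmp (vself V) B D E o \<langle>h, g\<rangle>, f\<rangle> =
   VCmp (vself V) A D E o \<langle>h, VCmp (vself V) A B D o \<langle>g, f\<rangle>\<rangle>"
 proof (rule exp_ext[of _ X A E])
  fix Y y a assume y: "y : hom V Y X" and a: "a : hom V Y A"
  show "ev V A E o \<langle>(VCmp (vself V) A B E o \<langle>VCmp (vself V) B D E o \<langle>h, g\<rangle>, f\<rangle>) o y, a\<rangle>
   = ev V A E o \<langle>(VCmp (vself V) A D E o \<langle>h, VCmp (vself V) A B D o \<langle>g, f\<rangle>\<rangle>) o y, a\<rangle>"
   by (simp add: homD[OF y] homD[OF a])
 qed (simp_all add: in_hom)
qed (use homD[OF vself_cmp_in_hom] homD[OF vself_id_in_hom] in \<open>simp_all add: in_hom\<close>)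

subsection \<open>Representable functors\<close>

lemma vrep_apply [simp]:
 assumes "is_vcat V C" "A : VOb C" "B : VOb C" "B' : VOb C" "u : Arr V" "f : Arr V"
  "Dom V u = Dom V f" "Cod V u = VHom C B B'" "Cod V f = VHom C A B"
 shows "ev V (VHom C A B) (VHom C A B') o \<langle>FHom (vrep V C A) B B' o u, f\<rangle> = VCmp C A B B' o \<langle>u, f\<rangle>"
 using assms by (simp add: vrep_def)

lemma vrep_FOb [simp]: "B : VOb C ==> FOb (vrep V C A) B = VHom C A B"
 by (simp add: vrep_def)

lemma vrep_vfun:
 assumes C: "is_vcat V C" and A: "A : VOb C"
 shows "is_vfun V C (vself V) (vrep V C A)"
 unfolding vrep_def
proof (rule mk_vfun_is_vfun[OF C vself_vcat])
 note [simp] = C A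
 fix B assume [simp]: "B : VOb C"
 show "transpose V (VHom C B B) (VHom C A B) (VHom C A B) (VCmp C A B B) o VId C B = VId (vself V) (VHom C A B)"
 proof (rule exp_ext[of _ \<one> "VHom C A B" "VHom C A B"])
  fix Y y a assume y: "y : hom V Y \<one>" and a: "a : hom V Y (VHom C A B)"
  show "ev V (VHom C A B) (VHom C A B) o \<langle>(transpose V (VHom C B B) (VHom C A B) (VHom C A B) (VCmp C A B B) o VId C B) o y, a\<rangle>
   = ev V (VHom C A B) (VHom C A B) o \<langle>VId (vself V) (VHom C A B) o y, a\<rangle>"
   by (simp add: homD[OF y] homD[OF a])
 qed (simp_all add: in_hom)
 fix D E X g f
 assume [simp]: "D : VOb C" "E : VOb C" and g: "g : hom V X (VHom C D E)" and f: "f : hom V X (VHom C B D)"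
 note [simp] = homD[OF g] homD[OF f]
 show "transpose V (VHom C B E) (VHom C A B) (VHom C A E) (VCmp C A B E) o VCmp C B D E o \<langle>g, f\<rangle> =
    VCmp (vself V) (VHom C A B) (VHom C A D) (VHom C A E) o
    \<langle>transpose V (VHom C D E) (VHom C A D) (VHom C A E) (VCmp C A D E) o g,
    transpose V (VHom C B D) (VHom C A B) (VHom C A D) (VCmp C A B D) o f\<rangle>" (is "?l = ?r")
 proof (rule exp_ext[of _ X "VHom C A B" "VHom C A E"])
  fix Y y a assume y: "y : hom V Y X" and a: "a : hom V Y (VHom C A B)"
  show "ev V (VHom C A B) (VHom C A E) o \<langle>?l o y, a\<rangle> = ev V (VHom C A B) (VHom C A E) o \<langle>?r o y, a\<rangle>"
   by (simp add: homD[OF y] homD[OF a] vassoc)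
 qed (simp_all add: in_hom)
qed (use C A in \<open>simp_all add: in_hom\<close>)

lemma vfun_comp_vfun:
 assumes C: "is_vcat V C" and D: "is_vcat V D" and E: "is_vcat V E"
  and F: "is_vfun V C D F" and G: "is_vfun V D E G"
 shows "is_vfun V C E (vfun_comp V C G F)"
 unfolding vfun_comp_def
proof (rule mk_vfun_is_vfun[OF C E])
 note [simp] = vfunD[OF F C D] vfunD[OF G D E] C D E vfun_cmp[OF F C D] vfun_cmp[OF G D E]
 fix A assume [simp]: "A : VOb C"
 show "(FHom G (FOb F A) (FOb F A) o FHom F A A) o VId C A = VId E (FOb G (FOb F A))"
  using vfun_id[OF F C D, of A "Idn V \<one>"] vfun_id[OF G D E, of "FOb F A" "Idn V \<one>"] by simp
 fix B H X g f
 assume [simp]: "B : VOb C" "H : VOb C" and g: "g : hom V X (VHom C B H)" and f: "f : hom V X (VHom C A B)"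
 note [simp] = homD[OF g] homD[OF f]
 show "(FHom G (FOb F A) (FOb F H) o FHom F A H) o VCmp C A B H o \<langle>g, f\<rangle> =
    VCmp E (FOb G (FOb F A)) (FOb G (FOb F B)) (FOb G (FOb F H)) o
    \<langle>(FHom G (FOb F B) (FOb F H) o FHom F B H) o g, (FHom G (FOb F A) (FOb F B) o FHom F A B) o f\<rangle>"
  by simp
qed (simp_all add: vfunD[OF F C D] vfunD[OF G D E] in_hom)

lemma vfun_comp_simps [simp]:
 "A : VOb C ==> FOb (vfun_comp V C G F) A = FOb G (FOb F A)"
 "A : VOb C ==> B : VOb C ==> FHom (vfun_comp V C G F) A B = FHom G (FOb F A) (FOb F B) o FHom F A B"
 by (simp_all add: vfun_comp_def)

lemma vfun_op_vfun:
 assumes C: "is_vcat V C" and D: "is_vcat V D" and F: "is_vfun V (vop V C) D F"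
  and S: "\<And>A. A : VOb C ==> FOb F A : S" "S \<subseteq> VOb D"
 shows "is_vfun V C (vfull (vop V D) S) (vfun_op F)"
proof (rule is_vfunI[OF C vfull_vcat[OF vop_vcat[OF D]]])
 note F' = F[unfolded is_vfun_def]
 note [simp] = vfunD[OF F vop_vcat[OF C] D, simplified] C D
 show "S \<subseteq> VOb (vop V D)" using S by simp
 have "FOb F : extensional (VOb C)" using conjunct1[OF F'] by (simp add: PiE_def)
 then show "FOb (vfun_op F) \<in> VOb C \<rightarrow>\<^sub>E VOb (vfull (vop V D) S)"
  using S by (auto simp: vfun_op_def PiE_def)
 show "FHom (vfun_op F) A B = undefined" if "\<not> (A : VOb C \<and> B : VOb C)" for A B
  using that conjunct1[OF conjunct2[OF conjunct2[OF F']]] by (auto simp: vfun_op_def)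
 fix A assume [simp]: "A : VOb C"
 show "FHom (vfun_op F) A A o VId C A = VId (vfull (vop V D) S) (FOb (vfun_op F) A)"
  using vfun_id[OF F vop_vcat[OF C] D, of A "Idn V \<one>"] by (simp add: vfun_op_def)
 fix B assume [simp]: "B : VOb C"
 show "FHom (vfun_op F) A B : hom V (VHom C A B) (VHom (vfull (vop V D) S) (FOb (vfun_op F) A) (FOb (vfun_op F) B))"
  by (simp add: vfun_op_def in_hom)
 fix E X g f
 assume [simp]: "E : VOb C" and g: "g : hom V X (VHom C B E)" and f: "f : hom V X (VHom C A B)"
 note [simp] = homD[OF g] homD[OF f]
 show "FHom (vfun_op F) A E o VCmp C A B E o \<langle>g, f\<rangle> =
    VCmp (vfull (vop V D) S) (FOb (vfun_op F) A) (FOb (vfun_op F) B) (FOb (vfun_op F) E) o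
    \<langle>FHom (vfun_op F) B E o g, FHom (vfun_op F) A B o f\<rangle>"
  using vfun_cmp[OF F vop_vcat[OF C] D, of E B A f g] by (simp add: vfun_op_def)
qed

end

section \<open>Enriched functor categories\<close>

context ccc
begin

lemma wedge_point:
 assumes \<omega>: "is_wedge V J F F' X \<omega>" and J: "is_vcat V J"
  and F: "is_vfun V J (vself V) F" and F': "is_vfun V J (vself V) F'"
  and ij: "i : VOb J" "j : VOb J" and x: "x : Arr V" "u : Arr V" "Dom V x = Dom V u" "Cod V x = X"
   "Cod V u = VHom J i j"
 shows "VCmp (vself V) (FOb F i) (FOb F j) (FOb F' j) o \<langle>\<omega> j o x, FHom F i j o u\<rangle>
  = VCmp (vself V) (FOb F i) (FOb F' i) (FOb F' j) o \<langle>FHom F' i j o u, \<omega> i o x\<rangle>"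
proof -
 note FF = vfunD[OF F J vself_vcat, simplified] vfunD[OF F' J vself_vcat, simplified]
 have X: "X : Obj V" using x by auto
 have \<omega>': "\<omega> i : hom V X \<lbrakk>FOb F i, FOb F' i\<rbrakk>" if "i : VOb J" for i
  using \<omega> that unfolding is_wedge_def by blast
 note [simp] = FF J X homD[OF \<omega>'] ij homD[OF vself_cmp_in_hom] x
 have "VCmp (vself V) (FOb F i) (FOb F j) (FOb F' j) o
     \<langle>\<omega> j o pr1 V X (VHom J i j), FHom F i j o pr2 V X (VHom J i j)\<rangle>
    = VCmp (vself V) (FOb F i) (FOb F' i) (FOb F' j) o
     \<langle>FHom F' i j o pr2 V X (VHom J i j), \<omega> i o pr1 V X (VHom J i j)\<rangle>"
  using \<omega> ij unfolding is_wedge_def by blast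
 then have "(VCmp (vself V) (FOb F i) (FOb F j) (FOb F' j) o
     \<langle>\<omega> j o pr1 V X (VHom J i j), FHom F i j o pr2 V X (VHom J i j)\<rangle>) o \<langle>x, u\<rangle>
    = (VCmp (vself V) (FOb F i) (FOb F' i) (FOb F' j) o
     \<langle>FHom F' i j o pr2 V X (VHom J i j), \<omega> i o pr1 V X (VHom J i j)\<rangle>) o \<langle>x, u\<rangle>" by simp
 then show ?thesis by (subst (asm) (1 2) comp_assoc) simp_all
qed

lemma is_wedgeI:
 assumes J: "is_vcat V J" and X: "X : Obj V" and \<omega>: "\<And>i. i : VOb J ==> \<omega> i : hom V X \<lbrakk>FOb F i, FOb F' i\<rbrakk>"
  and eq: "\<And>i j Y x u. i : VOb J ==> j : VOb J ==> x : hom V Y X ==> u : hom V Y (VHom J i j) ==>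
   VCmp (vself V) (FOb F i) (FOb F j) (FOb F' j) o \<langle>\<omega> j o x, FHom F i j o u\<rangle>
  = VCmp (vself V) (FOb F i) (FOb F' i) (FOb F' j) o \<langle>FHom F' i j o u, \<omega> i o x\<rangle>"
 shows "is_wedge V J F F' X \<omega>"
 unfolding is_wedge_def
 using X \<omega> J by (auto intro!: eq[where Y = "X \<otimes> VHom J _ _"] simp: in_hom)

end

context extensive_cat
begin

text \<open>
 The end is the equalizer of two maps between small products, cut out of the product of the
 \<open>\<lbrakk>F i, F' i\<rbrakk>\<close> by transposing the wedge conditions.
\<close>

lemma end_exists:
 assumes J: "is_vcat V J" "small U (VOb J)"
  and F: "is_vfun V J (vself V) F" and F': "is_vfun V J (vself V) F'"
 shows "\<exists>E \<pi>. is_end V J F F' E \<pi>"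
proof -
 note [simp] = vfunD[OF F J(1) vself_vcat, simplified] vfunD[OF F' J(1) vself_vcat, simplified]
  J(1) homD[OF vself_cmp_in_hom]
 define H where "H i = \<lbrakk>FOb F i, FOb F' i\<rbrakk>" for i
 define K where "K = (\<lambda>(i, j). \<lbrakk>VHom J i j, \<lbrakk>FOb F i, FOb F' j\<rbrakk>\<rbrakk>)"
 obtain Q \<pi> where Q: "Q : Obj V" "\<And>k. k : VOb J ==> \<pi> k : hom V Q (H k)"
  "\<And>Z f. Z : Obj V ==> (\<And>k. k : VOb J ==> f k : hom V Z (H k)) ==>
    \<exists>h. h : hom V Z Q \<and> (\<forall>k\<in>VOb J. \<pi> k o h = f k)"
  "\<And>Z h h'. h : hom V Z Q ==> h' : hom V Z Q ==> (\<And>k. k : VOb J ==> \<pi> k o h = \<pi> k o h') ==> h = h'"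
  by (rule small_product[OF J(2), of H]) (simp add: H_def, blast)
 obtain R \<rho> where R: "R : Obj V" "\<And>k. k : VOb J \<times> VOb J ==> \<rho> k : hom V R (K k)"
  "\<And>Z f. Z : Obj V ==> (\<And>k. k : VOb J \<times> VOb J ==> f k : hom V Z (K k)) ==>
    \<exists>h. h : hom V Z R \<and> (\<forall>k\<in>VOb J \<times> VOb J. \<rho> k o h = f k)"
  "\<And>Z h h'. h : hom V Z R ==> h' : hom V Z R ==> (\<And>k. k : VOb J \<times> VOb J ==> \<rho> k o h = \<rho> k o h') ==> h = h'"
  by (rule small_product[OF small_Times[OF infinite_universe J(2) J(2)], of K]) (auto simp: K_def)
 note [simp] = Q(1) R(1) homD[OF Q(2)[unfolded H_def]]
 have \<rho>: "\<rho> (i, j) \<in> hom V R \<lbrakk>VHom J i j, \<lbrakk>FOb F i, FOb F' j\<rbrakk>\<rbrakk>" if "i : VOb J" "j : VOb J" for i j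
  using R(2)[of "(i, j)"] that by (simp add: K_def)
 note [simp] = homD[OF \<rho>]
 let ?u = "\<lambda>i j. transpose V Q (VHom J i j) \<lbrakk>FOb F i, FOb F' j\<rbrakk>
  (VCmp (vself V) (FOb F i) (FOb F j) (FOb F' j) o \<langle>\<pi> j o pr1 V Q (VHom J i j), FHom F i j o pr2 V Q (VHom J i j)\<rangle>)"
 let ?v = "\<lambda>i j. transpose V Q (VHom J i j) \<lbrakk>FOb F i, FOb F' j\<rbrakk>
  (VCmp (vself V) (FOb F i) (FOb F' i) (FOb F' j) o \<langle>FHom F' i j o pr2 V Q (VHom J i j), \<pi> i o pr1 V Q (VHom J i j)\<rangle>)"
 have "\<exists>u. u : hom V Q R \<and> (\<forall>k\<in>VOb J \<times> VOb J. \<rho> k o u = (case k of (i, j) \<Rightarrow> ?u i j))"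
  by (rule R(3)) (auto simp: K_def in_hom)
 then obtain u where u: "u : hom V Q R" "\<And>i j. i : VOb J ==> j : VOb J ==> \<rho> (i, j) o u = ?u i j" by auto
 have "\<exists>v. v : hom V Q R \<and> (\<forall>k\<in>VOb J \<times> VOb J. \<rho> k o v = (case k of (i, j) \<Rightarrow> ?v i j))"
  by (rule R(3)) (auto simp: K_def in_hom)
 then obtain v where v: "v : hom V Q R" "\<And>i j. i : VOb J ==> j : VOb J ==> \<rho> (i, j) o v = ?v i j" by auto
 note [simp] = homD[OF u(1)] homD[OF v(1)]
 have eq_iff: "u o h = v o h \<longleftrightarrow> is_wedge V J F F' X (\<lambda>i. \<pi> i o h)" if h: "h : hom V X Q" for h X
 proof -
  note [simp] = homD[OF h]
  have 1: "\<rho> (i, j) o u o h = ?u i j o h" "\<rho> (i, j) o v o h = ?v i j o h"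
   if "i : VOb J" "j : VOb J" for i j
   using that u(2)[OF that] v(2)[OF that] comp_assoc[of h u "\<rho> (i, j)"] comp_assoc[of h v "\<rho> (i, j)"] by simp_all
  have "?u i j o h = ?v i j o h \<longleftrightarrow>
    VCmp (vself V) (FOb F i) (FOb F j) (FOb F' j) o
     \<langle>(\<pi> j o h) o pr1 V X (VHom J i j), FHom F i j o pr2 V X (VHom J i j)\<rangle>
    = VCmp (vself V) (FOb F i) (FOb F' i) (FOb F' j) o
     \<langle>FHom F' i j o pr2 V X (VHom J i j), (\<pi> i o h) o pr1 V X (VHom J i j)\<rangle>" (is "?l = ?r \<longleftrightarrow> ?a = ?b")
   if [simp]: "i : VOb J" "j : VOb J" for i j
  proof -
   let ?E = "ev V (VHom J i j) \<lbrakk>FOb F i, FOb F' j\<rbrakk>"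
   have *: "?E o \<langle>?l o pr1 V X (VHom J i j), pr2 V X (VHom J i j)\<rangle> = ?a"
    "?E o \<langle>?r o pr1 V X (VHom J i j), pr2 V X (VHom J i j)\<rangle> = ?b" by simp_all
   show ?thesis
   proof
    assume "?l = ?r" then show "?a = ?b" using * by metis
   next
    assume "?a = ?b"
    then show "?l = ?r"
     by - (rule transpose_unique[of _ X "VHom J i j" "\<lbrakk>FOb F i, FOb F' j\<rbrakk>"], simp_all add: in_hom)
   qed
  qed
  note 2 = this
  have "u o h = v o h \<longleftrightarrow> (\<forall>i\<in>VOb J. \<forall>j\<in>VOb J. ?u i j o h = ?v i j o h)"
  proof
   assume "u o h = v o h" then show "\<forall>i\<in>VOb J. \<forall>j\<in>VOb J. ?u i j o h = ?v i j o h" using 1 by metis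
  next
   assume *: "\<forall>i\<in>VOb J. \<forall>j\<in>VOb J. ?u i j o h = ?v i j o h"
   show "u o h = v o h"
   proof (rule R(4)[of _ X])
    fix k assume "k : VOb J \<times> VOb J"
    then obtain i j where "k = (i, j)" "i : VOb J" "j : VOb J" by blast
    then show "\<rho> k o u o h = \<rho> k o v o h" using 1 * by metis
   qed (simp_all add: in_hom)
  qed
  also have "\<dots> \<longleftrightarrow> is_wedge V J F F' X (\<lambda>i. \<pi> i o h)"
   unfolding is_wedge_def using 2 by (simp add: in_hom)
  finally show ?thesis .
 qed
 define d where "d = \<langle>Idn V R, Idn V R\<rangle>"
 have d [simp]: "d : Arr V" "Dom V d = R" "Cod V d = R \<otimes> R" by (simp_all add: d_def)
 define c where "c = \<langle>u, v\<rangle>"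
 have c [simp]: "c : Arr V" "Dom V c = Q" "Cod V c = R \<otimes> R" by (simp_all add: c_def)
 define e where "e = pb1 V c d"
 define E where "E = pb_obj V c d"
 have e: "e : hom V E Q" by (simp add: e_def E_def in_hom)
 note [simp] = homD[OF e]
 have "c o e = d o pb2 V c d" unfolding e_def by (rule pb_square) simp_all
 then have ue: "u o e = v o e"
  using pairing_eq_iff[of "u o e" "v o e" "pb2 V c d" "pb2 V c d"] by (simp add: c_def d_def E_def e_def)
 have lift: "\<exists>!h. h : hom V X E \<and> e o h = g" if g: "g : hom V X Q" "u o g = v o g" for g X
 proof -
  note [simp] = homD[OF g(1)]
  have cg: "c o g = d o (u o g)" by (simp add: c_def d_def g(2))
  show ?thesis
  proof (rule ex_ex1I)
   have "pb_pair V c d g (u o g) \<in> hom V X E \<and> e o pb_pair V c d g (u o g) = g"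
    using cg by (simp add: e_def E_def in_hom)
   then show "\<exists>h. h : hom V X E \<and> e o h = g" by blast
   have "pb2 V c d o h = u o g" if "h : hom V X E" "e o h = g" for h
   proof -
    have "c o g = d o pb2 V c d o h"
     using pb_square_point[of c d h] that homD[OF that(1)] by (simp add: e_def E_def)
    then show ?thesis
     using that homD[OF that(1)] pairing_eq_iff[of "u o g" "v o g" "pb2 V c d o h" "pb2 V c d o h"]
     by (simp add: c_def d_def E_def)
   qed
   then show "h = h'" if "h : hom V X E \<and> e o h = g" "h' : hom V X E \<and> e o h' = g" for h h'
    by - (rule pb_ext[of _ _ c d]; use that homD[of h X E] homD[of h' X E] in \<open>simp add: e_def E_def\<close>)
  qed
 qed
 have "is_end V J F F' E (\<lambda>i. \<pi> i o e)"
  unfolding is_end_def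
 proof (intro conjI allI impI)
  show "is_wedge V J F F' E (\<lambda>i. \<pi> i o e)" using eq_iff[OF e] ue by simp
  fix X \<omega> assume \<omega>: "is_wedge V J F F' X \<omega>"
  have "\<exists>g. g : hom V X Q \<and> (\<forall>k\<in>VOb J. \<pi> k o g = \<omega> k)"
   by (rule Q(3)) (use \<omega> in \<open>simp_all add: is_wedge_def H_def\<close>)
  then obtain g where g: "g : hom V X Q" "\<And>k. k : VOb J ==> \<pi> k o g = \<omega> k" by blast
  note [simp] = homD[OF g(1)]
  have "is_wedge V J F F' X (\<lambda>i. \<pi> i o g)"
   using \<omega> g(2) unfolding is_wedge_def by simp
  then have "u o g = v o g" using eq_iff[OF g(1)] by simp
  then have "\<exists>!h. h : hom V X E \<and> e o h = g" by (rule lift[OF g(1)])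
  moreover have "e o h = g \<longleftrightarrow> (\<forall>i\<in>VOb J. (\<pi> i o e) o h = \<omega> i)" if h: "h : hom V X E" for h
  proof
   assume "e o h = g" then show "\<forall>i\<in>VOb J. (\<pi> i o e) o h = \<omega> i"
    using g(2) homD[OF h] by simp
  next
   assume *: "\<forall>i\<in>VOb J. (\<pi> i o e) o h = \<omega> i"
   show "e o h = g"
    by (rule Q(4)[of _ X]) (use * g(2) homD[OF h] in \<open>simp_all add: in_hom\<close>)
  qed
  ultimately show "\<exists>!h. h : hom V X E \<and> (\<forall>i\<in>VOb J. (\<pi> i o e) o h = \<omega> i)" by blast
 qed
 then show ?thesis by blast
qed

end

locale small_vcat = extensive_cat V for V (structure) +
 fixes J :: "('a, 'b, 'i) vcat"
 assumes J: "is_vcat V J" "small U (VOb J)"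
begin

abbreviation "functors \<equiv> {F. is_vfun V J (vself V) F}"

lemma functorD [simp]:
 assumes "is_vfun V J (vself V) F"
 shows "i : VOb J ==> FOb F i : Obj V"
  and "i : VOb J ==> j : VOb J ==> FHom F i j : Arr V"
  and "i : VOb J ==> j : VOb J ==> Dom V (FHom F i j) = VHom J i j"
  and "i : VOb J ==> j : VOb J ==> Cod V (FHom F i j) = \<lbrakk>FOb F i, FOb F j\<rbrakk>"
 using vfunD[OF assms J(1) vself_vcat] by simp_all

lemma vself_cmpD [simp]:
 assumes "A : Obj V" "B : Obj V" "D : Obj V"
 shows "VCmp (vself V) A B D : Arr V" "Dom V (VCmp (vself V) A B D) = \<lbrakk>B, D\<rbrakk> \<otimes> \<lbrakk>A, B\<rbrakk>"
  "Cod V (VCmp (vself V) A B D) = \<lbrakk>A, D\<rbrakk>"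
 using homD[OF vself_cmp_in_hom[OF assms]] by simp_all

context
 fixes F F' assumes F [simp]: "is_vfun V J (vself V) F" and F' [simp]: "is_vfun V J (vself V) F'"
begin

lemma end_is_end: "is_end V J F F' (end_obj V J F F') (end_pr V J F F')"
 unfolding end_obj_def end_pr_def
 by (rule some_pair[OF end_exists[OF J F F'] chosen_end_def])

lemma end_is_wedge: "is_wedge V J F F' (end_obj V J F F') (end_pr V J F F')"
 using end_is_end unfolding is_end_def by blast

lemma end_obj_in_Obj [simp]: "end_obj V J F F' : Obj V"
 using end_is_wedge unfolding is_wedge_def by blast

lemma end_pr_in_hom: "i : VOb J ==> end_pr V J F F' i : hom V (end_obj V J F F') \<lbrakk>FOb F i, FOb F' i\<rbrakk>"
 using end_is_wedge unfolding is_wedge_def by blast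

lemma end_prD [simp]: "i : VOb J ==> end_pr V J F F' i : Arr V"
 "i : VOb J ==> Dom V (end_pr V J F F' i) = end_obj V J F F'"
 "i : VOb J ==> Cod V (end_pr V J F F' i) = \<lbrakk>FOb F i, FOb F' i\<rbrakk>"
 using end_pr_in_hom by (auto simp: in_hom)

lemma end_lift:
 assumes "is_wedge V J F F' X \<omega>"
 shows "end_lift V J F F' X \<omega> \<in> hom V X (end_obj V J F F') \<and>
  (\<forall>i\<in>VOb J. end_pr V J F F' i o end_lift V J F F' X \<omega> = \<omega> i)"
proof -
 have "\<exists>!h. h : hom V X (end_obj V J F F') \<and> (\<forall>i\<in>VOb J. end_pr V J F F' i o h = \<omega> i)"
  using end_is_end assms unfolding is_end_def by blast
 from theI'[OF this] show ?thesis unfolding end_lift_def .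
qed

lemma end_lift_point:
 assumes "is_wedge V J F F' X \<omega>" "i : VOb J" "x : Arr V" "Cod V x = X"
 shows "end_pr V J F F' i o (end_lift V J F F' X \<omega> o x) = \<omega> i o x"
proof -
 have "end_lift V J F F' X \<omega> \<in> hom V X (end_obj V J F F')" "end_pr V J F F' i o end_lift V J F F' X \<omega> = \<omega> i"
  using end_lift[OF assms(1)] assms(2) by blast+
 then show ?thesis
  using comp_assoc[of x "end_lift V J F F' X \<omega>" "end_pr V J F F' i"] assms by (simp add: in_hom)
qed

lemma end_ext:
 assumes h: "h : hom V X (end_obj V J F F')" "h' : hom V X (end_obj V J F F')"
  and eq: "\<And>i. i : VOb J ==> end_pr V J F F' i o h = end_pr V J F F' i o h'"
 shows "h = h'"
proof -
 note [simp] = homD[OF h(1)] homD[OF h(2)]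
 have "is_wedge V J F F' X (\<lambda>i. end_pr V J F F' i o h)"
 proof (rule is_wedgeI[OF J(1)])
  fix i j Y x u assume ij[simp]: "i : VOb J" "j : VOb J" and x: "x : hom V Y X" and u: "u : hom V Y (VHom J i j)"
  note [simp] = homD[OF x] homD[OF u]
  show "VCmp (vself V) (FOb F i) (FOb F j) (FOb F' j) o \<langle>(end_pr V J F F' j o h) o x, FHom F i j o u\<rangle>
   = VCmp (vself V) (FOb F i) (FOb F' i) (FOb F' j) o \<langle>FHom F' i j o u, (end_pr V J F F' i o h) o x\<rangle>"
   using wedge_point[OF end_is_wedge J(1) F F' ij, of "h o x" u] by simp
 qed (simp_all add: in_hom)
 then have "\<exists>!z. z : hom V X (end_obj V J F F') \<and> (\<forall>i\<in>VOb J. end_pr V J F F' i o z = end_pr V J F F' i o h)"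
  using end_is_end unfolding is_end_def by blast
 moreover have "\<forall>i\<in>VOb J. end_pr V J F F' i o h' = end_pr V J F F' i o h" using eq by simp
 ultimately show ?thesis using h by blast
qed

end

lemma vfun_cat_simps [simp]: "VOb (vfun_cat V J) = functors" "VHom (vfun_cat V J) = end_obj V J"
 by (simp_all add: vfun_cat_def)

text \<open>
 Composites of natural families are natural, by the computation for ordinary natural
 transformations, carried out on elements.
\<close>

lemma vfun_cat_cmp_wedge:
 assumes [simp]: "is_vfun V J (vself V) F" "is_vfun V J (vself V) G" "is_vfun V J (vself V) H"
 shows "is_wedge V J F H (end_obj V J G H \<otimes> end_obj V J F G)
  (\<lambda>i. VCmp (vself V) (FOb F i) (FOb G i) (FOb H i) o
   \<langle>end_pr V J G H i o pr1 V (end_obj V J G H) (end_obj V J F G),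
    end_pr V J F G i o pr2 V (end_obj V J G H) (end_obj V J F G)\<rangle>)"
proof (rule is_wedgeI[OF J(1)])
 fix i j Y x u assume ij[simp]: "i : VOb J" "j : VOb J"
  and x: "x : hom V Y (end_obj V J G H \<otimes> end_obj V J F G)" and u: "u : hom V Y (VHom J i j)"
 note [simp] = homD[OF x] homD[OF u]
 define b a where "b = pr1 V (end_obj V J G H) (end_obj V J F G) o x"
  and "a = pr2 V (end_obj V J G H) (end_obj V J F G) o x"
 have x': "x = \<langle>b, a\<rangle>" unfolding b_def a_def by (rule pairing_eta[symmetric]) simp_all
 have [simp]: "b : Arr V" "a : Arr V" "Dom V b = Y" "Dom V a = Y" "Cod V b = end_obj V J G H" "Cod V a = end_obj V J F G"
  by (simp_all add: b_def a_def)
 have 1: "VCmp (vself V) (FOb F i) (FOb F j) (FOb G j) o \<langle>end_pr V J F G j o a, FHom F i j o u\<rangle>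
  = VCmp (vself V) (FOb F i) (FOb G i) (FOb G j) o \<langle>FHom G i j o u, end_pr V J F G i o a\<rangle>"
  by (rule wedge_point[OF end_is_wedge J(1)]) simp_all
 have 2: "VCmp (vself V) (FOb G i) (FOb G j) (FOb H j) o \<langle>end_pr V J G H j o b, FHom G i j o u\<rangle>
  = VCmp (vself V) (FOb G i) (FOb H i) (FOb H j) o \<langle>FHom H i j o u, end_pr V J G H i o b\<rangle>"
  by (rule wedge_point[OF end_is_wedge J(1)]) simp_all
 have "VCmp (vself V) (FOb F i) (FOb F j) (FOb H j) o
   \<langle>VCmp (vself V) (FOb F j) (FOb G j) (FOb H j) o \<langle>end_pr V J G H j o b, end_pr V J F G j o a\<rangle>, FHom F i j o u\<rangle>
  = VCmp (vself V) (FOb F i) (FOb G j) (FOb H j) o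
   \<langle>end_pr V J G H j o b, VCmp (vself V) (FOb F i) (FOb G i) (FOb G j) o \<langle>FHom G i j o u, end_pr V J F G i o a\<rangle>\<rangle>"
  by (simp add: vassoc 1)
 also have "\<dots> = VCmp (vself V) (FOb F i) (FOb G i) (FOb H j) o
   \<langle>VCmp (vself V) (FOb G i) (FOb G j) (FOb H j) o \<langle>end_pr V J G H j o b, FHom G i j o u\<rangle>, end_pr V J F G i o a\<rangle>"
  by (simp add: vassoc)
 also have "\<dots> = VCmp (vself V) (FOb F i) (FOb H i) (FOb H j) o
   \<langle>FHom H i j o u, VCmp (vself V) (FOb F i) (FOb G i) (FOb H i) o \<langle>end_pr V J G H i o b, end_pr V J F G i o a\<rangle>\<rangle>"
  by (simp add: 2 vassoc)
 finally show "VCmp (vself V) (FOb F i) (FOb F j) (FOb H j) o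
   \<langle>(VCmp (vself V) (FOb F j) (FOb G j) (FOb H j) o
    \<langle>end_pr V J G H j o pr1 V (end_obj V J G H) (end_obj V J F G),
     end_pr V J F G j o pr2 V (end_obj V J G H) (end_obj V J F G)\<rangle>) o x, FHom F i j o u\<rangle>
  = VCmp (vself V) (FOb F i) (FOb H i) (FOb H j) o
   \<langle>FHom H i j o u, (VCmp (vself V) (FOb F i) (FOb G i) (FOb H i) o
    \<langle>end_pr V J G H i o pr1 V (end_obj V J G H) (end_obj V J F G),
     end_pr V J F G i o pr2 V (end_obj V J G H) (end_obj V J F G)\<rangle>) o x\<rangle>"
  by (simp add: x')
qed (simp_all add: in_hom)

lemma vfun_cat_cmp [simp]:
 assumes [simp]: "is_vfun V J (vself V) F" "is_vfun V J (vself V) G" "is_vfun V J (vself V) H"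
  and b [simp]: "b : Arr V" "a : Arr V" "Dom V b = Dom V a" "Cod V b = end_obj V J G H" "Cod V a = end_obj V J F G"
  and [simp]: "i : VOb J"
 shows "end_pr V J F H i o VCmp (vfun_cat V J) F G H o \<langle>b, a\<rangle>
  = VCmp (vself V) (FOb F i) (FOb G i) (FOb H i) o \<langle>end_pr V J G H i o b, end_pr V J F G i o a\<rangle>"
 using end_lift_point[OF assms(1,3) vfun_cat_cmp_wedge[OF assms(1-3)], of i "\<langle>b, a\<rangle>"]
 by (simp add: vfun_cat_def Let_def)

lemma vfun_cat_cmp_in_hom:
 assumes "is_vfun V J (vself V) F" "is_vfun V J (vself V) G" "is_vfun V J (vself V) H"
 shows "VCmp (vfun_cat V J) F G H : hom V (end_obj V J G H \<otimes> end_obj V J F G) (end_obj V J F H)"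
 using end_lift[OF assms(1,3) vfun_cat_cmp_wedge[OF assms]] by (simp add: vfun_cat_def Let_def)

lemma vself_idD [simp]:
 assumes "A : Obj V"
 shows "VId (vself V) A : Arr V" "Dom V (VId (vself V) A) = \<one>" "Cod V (VId (vself V) A) = \<lbrakk>A, A\<rbrakk>"
 using homD[OF vself_id_in_hom[OF assms]] by simp_all

lemma vfun_cat_id_wedge:
 assumes [simp]: "is_vfun V J (vself V) F"
 shows "is_wedge V J F F \<one> (\<lambda>i. VId (vself V) (FOb F i))"
proof (rule is_wedgeI[OF J(1)])
 fix i j Y x u assume ij[simp]: "i : VOb J" "j : VOb J" and x: "x : hom V Y \<one>" and u: "u : hom V Y (VHom J i j)"
 note [simp] = homD[OF x] homD[OF u]
 show "VCmp (vself V) (FOb F i) (FOb F j) (FOb F j) o \<langle>VId (vself V) (FOb F j) o x, FHom F i j o u\<rangle>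
   = VCmp (vself V) (FOb F i) (FOb F i) (FOb F j) o \<langle>FHom F i j o u, VId (vself V) (FOb F i) o x\<rangle>"
  by simp
qed (simp_all add: in_hom)

lemma vfun_cat_id [simp]:
 assumes [simp]: "is_vfun V J (vself V) F" "i : VOb J" "x : Arr V" "Cod V x = \<one>"
 shows "end_pr V J F F i o VId (vfun_cat V J) F o x = VId (vself V) (FOb F i) o x"
 using end_lift_point[OF _ _ vfun_cat_id_wedge, of F i x] by (simp add: vfun_cat_def)

lemma vfun_cat_id_in_hom:
 "is_vfun V J (vself V) F ==> VId (vfun_cat V J) F : hom V \<one> (end_obj V J F F)"
 using end_lift[OF _ _ vfun_cat_id_wedge] by (simp add: vfun_cat_def)

lemma vfun_cat_vcat [simp]: "is_vcat V (vfun_cat V J)"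
proof (rule is_vcatI)
 note [simp] = homD[OF vfun_cat_cmp_in_hom] homD[OF vfun_cat_id_in_hom]
 fix F G X f assume "F : VOb (vfun_cat V J)" "G : VOb (vfun_cat V J)" and f: "f : hom V X (VHom (vfun_cat V J) F G)"
 then have [simp]: "is_vfun V J (vself V) F" "is_vfun V J (vself V) G" by simp_all
 note [simp] = homD[OF f[unfolded vfun_cat_simps]]
 show "VCmp (vfun_cat V J) F F G o \<langle>f, VId (vfun_cat V J) F o bang V X\<rangle> = f"
  by (rule end_ext[of F G _ X]) (simp_all add: in_hom)
 show "VCmp (vfun_cat V J) F G G o \<langle>VId (vfun_cat V J) G o bang V X, f\<rangle> = f"
  by (rule end_ext[of F G _ X]) (simp_all add: in_hom)
 fix H K g h assume "H : VOb (vfun_cat V J)" "K : VOb (vfun_cat V J)"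
  and g: "g : hom V X (VHom (vfun_cat V J) G H)" and h: "h : hom V X (VHom (vfun_cat V J) H K)"
 then have [simp]: "is_vfun V J (vself V) H" "is_vfun V J (vself V) K" by simp_all
 note [simp] = homD[OF g[unfolded vfun_cat_simps]] homD[OF h[unfolded vfun_cat_simps]]
 show "VCmp (vfun_cat V J) F G K o \<langle>VCmp (vfun_cat V J) G H K o \<langle>h, g\<rangle>, f\<rangle>
  = VCmp (vfun_cat V J) F H K o \<langle>h, VCmp (vfun_cat V J) F G H o \<langle>g, f\<rangle>\<rangle>"
  by (rule end_ext[of F K _ X]) (simp_all add: in_hom vassoc)
qed (use homD[OF vfun_cat_cmp_in_hom] homD[OF vfun_cat_id_in_hom] in \<open>simp_all add: in_hom\<close>)

end

section \<open>Weighted limits\<close>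

locale diagram = small_vcat U V J for U :: "'u itself" and V :: "('a, 'b) category" (structure) and J :: "('a, 'b, 'i) vcat" +
 fixes C :: "('a, 'b, 'c) vcat" and G :: "('i, 'c, 'b) vfun"
 assumes C [simp]: "is_vcat V C" and G: "is_vfun V J C G"
begin

lemmas GD [simp] = vfunD[OF G J(1) C]

lemma hom_along_FOb [simp]: "i : VOb J ==> FOb (hom_along V J C G A) i = VHom C A (FOb G i)"
 by (simp add: hom_along_def)

lemma hom_along_vfun [simp]: "A : VOb C ==> is_vfun V J (vself V) (hom_along V J C G A)"
 unfolding hom_along_def by (rule vfun_comp_vfun[OF J(1) C vself_vcat G vrep_vfun[OF C]])

lemma hom_along_apply [simp]:
 assumes "A : VOb C" "i : VOb J" "j : VOb J" "u : Arr V" "f : Arr V" "Dom V u = Dom V f"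
  "Cod V u = VHom J i j" "Cod V f = VHom C A (FOb G i)"
 shows "ev V (VHom C A (FOb G i)) (VHom C A (FOb G j)) o \<langle>FHom (hom_along V J C G A) i j o u, f\<rangle>
  = VCmp C A (FOb G i) (FOb G j) o \<langle>FHom G i j o u, f\<rangle>"
 using assms vfunD[OF vrep_vfun[OF C assms(1)] C vself_vcat] by (simp add: hom_along_def)

abbreviation "yoneda \<equiv> yoneda_along V J C G"

text \<open>
 Precomposition with an element of \<open>C(B, A)\<close>, as a map between the values of the two
 representable functors at \<open>G i\<close>.
\<close>

definition yoneda_component :: "'c \<Rightarrow> 'c \<Rightarrow> 'i \<Rightarrow> 'b" where
 "yoneda_component A B i =
  (let P = VHom C B A; Q = VHom C A (FOb G i)
   in transpose V P Q (VHom C B (FOb G i)) (VCmp C B A (FOb G i) o \<langle>pr2 V P Q, pr1 V P Q\<rangle>))"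

lemma yoneda_component_apply [simp]:
 assumes "A : VOb C" "B : VOb C" "i : VOb J" "u : Arr V" "f : Arr V" "Dom V u = Dom V f"
  "Cod V u = VHom C B A" "Cod V f = VHom C A (FOb G i)"
 shows "ev V (VHom C A (FOb G i)) (VHom C B (FOb G i)) o \<langle>yoneda_component A B i o u, f\<rangle>
  = VCmp C B A (FOb G i) o \<langle>f, u\<rangle>"
 using assms by (simp add: yoneda_component_def Let_def)

lemma yoneda_component_in_hom:
 assumes "A : VOb C" "B : VOb C" "i : VOb J"
 shows "yoneda_component A B i : hom V (VHom C B A) \<lbrakk>VHom C A (FOb G i), VHom C B (FOb G i)\<rbrakk>"
 using assms by (simp add: yoneda_component_def Let_def in_hom)

text \<open>
 Precomposition commutes with postcomposition by associativity in \<open>C\<close>.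
\<close>

lemma yoneda_wedge:
 assumes [simp]: "A : VOb C" "B : VOb C"
 shows "is_wedge V J (hom_along V J C G A) (hom_along V J C G B) (VHom C B A) (yoneda_component A B)"
proof (rule is_wedgeI[OF J(1)])
 note [simp] = homD[OF yoneda_component_in_hom]
 note [simp] = functorD[OF hom_along_vfun[OF assms(1)]] functorD[OF hom_along_vfun[OF assms(2)]]
 fix i j Y x u assume [simp]: "i : VOb J" "j : VOb J"
  and x: "x : hom V Y (VHom C B A)" and u: "u : hom V Y (VHom J i j)"
 note [simp] = homD[OF x] homD[OF u]
 let ?A = "hom_along V J C G A" and ?B = "hom_along V J C G B"
 show "VCmp (vself V) (FOb ?A i) (FOb ?A j) (FOb ?B j) o \<langle>yoneda_component A B j o x, FHom ?A i j o u\<rangle>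
  = VCmp (vself V) (FOb ?A i) (FOb ?B i) (FOb ?B j) o \<langle>FHom ?B i j o u, yoneda_component A B i o x\<rangle>"
  (is "?l = ?r")
 proof (rule exp_ext[of _ Y "VHom C A (FOb G i)" "VHom C B (FOb G j)"])
  fix Z y a assume y: "y : hom V Z Y" and a: "a : hom V Z (VHom C A (FOb G i))"
  show "ev V (VHom C A (FOb G i)) (VHom C B (FOb G j)) o \<langle>?l o y, a\<rangle>
   = ev V (VHom C A (FOb G i)) (VHom C B (FOb G j)) o \<langle>?r o y, a\<rangle>"
   by (simp add: homD[OF y] homD[OF a] vassoc)
 qed (simp_all add: in_hom)
qed (simp_all add: homD[OF yoneda_component_in_hom] in_hom)

lemma yoneda_simps [simp]:
 assumes "A : VOb C"
 shows "FOb yoneda A = hom_along V J C G A"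
  and "B : VOb C ==> FHom yoneda A B = end_lift V J (hom_along V J C G A) (hom_along V J C G B)
   (VHom C B A) (yoneda_component A B)"
 using assms unfolding yoneda_along_def yoneda_component_def Let_def by simp_all

lemma yoneda_in_hom:
 assumes [simp]: "A : VOb C" "B : VOb C"
 shows "FHom yoneda A B : hom V (VHom C B A) (end_obj V J (hom_along V J C G A) (hom_along V J C G B))"
 using end_lift[OF _ _ yoneda_wedge] by simp

lemma end_pr_yoneda:
 assumes "A : VOb C" "B : VOb C" "i : VOb J" "u : Arr V" "Cod V u = VHom C B A"
 shows "end_pr V J (hom_along V J C G A) (hom_along V J C G B) i o FHom yoneda A B o u
  = yoneda_component A B i o u"
 using end_lift_point[OF _ _ yoneda_wedge] assms by simp

lemma yoneda_vfun: "is_vfun V (vop V C) (vfun_cat V J) yoneda"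
proof (rule is_vfunI[OF vop_vcat[OF C] vfun_cat_vcat])
 show "FOb yoneda : VOb (vop V C) \<rightarrow>\<^sub>E VOb (vfun_cat V J)"
  by (auto simp: yoneda_along_def mk_vfun_def)
 show "FHom yoneda A B = undefined" if "\<not> (A : VOb (vop V C) \<and> B : VOb (vop V C))" for A B
  using that unfolding yoneda_along_def mk_vfun_def by auto
 show "FHom yoneda A B : hom V (VHom (vop V C) A B) (VHom (vfun_cat V J) (FOb yoneda A) (FOb yoneda B))"
  if "A : VOb (vop V C)" "B : VOb (vop V C)" for A B
  using that yoneda_in_hom[of A B] by simp
 note [simp] = homD[OF yoneda_component_in_hom] homD[OF yoneda_in_hom] homD[OF vfun_cat_id_in_hom]
  homD[OF vfun_cat_cmp_in_hom]
 note [simp del] = yoneda_simps(2)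
 fix A assume "A : VOb (vop V C)" then have A [simp]: "A : VOb C" by simp
 have "FHom yoneda A A o VId C A = VId (vfun_cat V J) (hom_along V J C G A)"
 proof (rule end_ext[of "hom_along V J C G A" "hom_along V J C G A" _ \<one>])
  fix i assume [simp]: "i : VOb J"
  have "yoneda_component A A i o VId C A = VId (vself V) (VHom C A (FOb G i))"
  proof (rule exp_ext[of _ \<one> "VHom C A (FOb G i)" "VHom C A (FOb G i)"])
   fix Z y a assume y: "y : hom V Z \<one>" and a: "a : hom V Z (VHom C A (FOb G i))"
   show "ev V (VHom C A (FOb G i)) (VHom C A (FOb G i)) o \<langle>(yoneda_component A A i o VId C A) o y, a\<rangle>
    = ev V (VHom C A (FOb G i)) (VHom C A (FOb G i)) o \<langle>VId (vself V) (VHom C A (FOb G i)) o y, a\<rangle>"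
    by (simp add: homD[OF y] homD[OF a])
  qed (simp_all add: in_hom)
  then show "end_pr V J (hom_along V J C G A) (hom_along V J C G A) i o FHom yoneda A A o VId C A
   = end_pr V J (hom_along V J C G A) (hom_along V J C G A) i o VId (vfun_cat V J) (hom_along V J C G A)"
   using vfun_cat_id[of "hom_along V J C G A" i "Idn V \<one>"] by (simp add: end_pr_yoneda)
 qed (simp_all add: in_hom)
 then show "FHom yoneda A A o VId (vop V C) A = VId (vfun_cat V J) (FOb yoneda A)" by simp
 fix B E X g f
 assume "B : VOb (vop V C)" "E : VOb (vop V C)"
  and g: "g : hom V X (VHom (vop V C) B E)" and f: "f : hom V X (VHom (vop V C) A B)"
 then have [simp]: "B : VOb C" "E : VOb C" by simp_all
 note [simp] = homD[OF g[unfolded vop_simps]] homD[OF f[unfolded vop_simps]]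
 let ?A = "hom_along V J C G A" and ?B = "hom_along V J C G B" and ?E = "hom_along V J C G E"
 have "FHom yoneda A E o VCmp C E B A o \<langle>f, g\<rangle>
  = VCmp (vfun_cat V J) ?A ?B ?E o \<langle>FHom yoneda B E o g, FHom yoneda A B o f\<rangle>"
 proof (rule end_ext[of ?A ?E _ X])
  fix i assume [simp]: "i : VOb J"
  have "yoneda_component A E i o VCmp C E B A o \<langle>f, g\<rangle>
   = VCmp (vself V) (VHom C A (FOb G i)) (VHom C B (FOb G i)) (VHom C E (FOb G i)) o
    \<langle>yoneda_component B E i o g, yoneda_component A B i o f\<rangle>" (is "?l = ?r")
  proof (rule exp_ext[of _ X "VHom C A (FOb G i)" "VHom C E (FOb G i)"])
   fix Z y a assume y: "y : hom V Z X" and a: "a : hom V Z (VHom C A (FOb G i))"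
   show "ev V (VHom C A (FOb G i)) (VHom C E (FOb G i)) o \<langle>?l o y, a\<rangle>
    = ev V (VHom C A (FOb G i)) (VHom C E (FOb G i)) o \<langle>?r o y, a\<rangle>"
    by (simp add: homD[OF y] homD[OF a] vassoc)
  qed (simp_all add: in_hom)
  then show "end_pr V J ?A ?E i o FHom yoneda A E o VCmp C E B A o \<langle>f, g\<rangle>
   = end_pr V J ?A ?E i o VCmp (vfun_cat V J) ?A ?B ?E o \<langle>FHom yoneda B E o g, FHom yoneda A B o f\<rangle>"
   by (simp add: end_pr_yoneda)
 qed (simp_all add: in_hom)
 then show "FHom yoneda A E o VCmp (vop V C) A B E o \<langle>g, f\<rangle>
  = VCmp (vfun_cat V J) (FOb yoneda A) (FOb yoneda B) (FOb yoneda E) o \<langle>FHom yoneda B E o g, FHom yoneda A B o f\<rangle>"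
  by simp
qed

declare yoneda_simps(2) [simp del]

lemma yonedaD [simp]:
 assumes "A : VOb C" "B : VOb C"
 shows "FHom yoneda A B : Arr V" "Dom V (FHom yoneda A B) = VHom C B A"
  "Cod V (FHom yoneda A B) = end_obj V J (hom_along V J C G A) (hom_along V J C G B)"
 using homD[OF yoneda_in_hom[OF assms]] by simp_all

lemma yoneda_cmp:
 assumes [simp]: "A : VOb C" "B : VOb C" "E : VOb C" "g : Arr V" "f : Arr V" "Dom V f = Dom V g"
  "Cod V g = VHom C E B" "Cod V f = VHom C B A"
 shows "FHom yoneda A E o VCmp C E B A o \<langle>f, g\<rangle> = VCmp (vfun_cat V J)
  (hom_along V J C G A) (hom_along V J C G B) (hom_along V J C G E) o \<langle>FHom yoneda B E o g, FHom yoneda A B o f\<rangle>"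
 using vfun_cmp[OF yoneda_vfun vop_vcat[OF C] vfun_cat_vcat, of A B E g f] by simp

end

context ccc
begin

lemma name_of_apply [simp]:
 assumes "f : Arr V" "x : Arr V" "a : Arr V" "Dom V x = Dom V a" "Cod V x = \<one>" "Cod V a = A" "Dom V f = A" "Cod V f = B"
 shows "ev V A B o \<langle>name_of V f o x, a\<rangle> = f o a"
proof -
 have [simp]: "A : Obj V" "B : Obj V" using assms(1,7,8) by auto
 show ?thesis using assms by (simp add: name_of_def)
qed

lemma name_of_in_hom:
 assumes f: "f : hom V A B"
 shows "name_of V f : hom V \<one> \<lbrakk>A, B\<rbrakk>"
proof -
 note [simp] = homD[OF f]
 show ?thesis by (simp add: name_of_def in_hom)
qed

text \<open>
 An element of \<open>\<lbrakk>B, A\<rbrakk>\<close> at stage \<open>\<one>\<close> is a map from \<open>B\<close> to \<open>A\<close>, so inverses in the enriched sense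
 are inverses in \<open>V\<close>.
\<close>

lemma is_viso_name_of:
 assumes f: "f : hom V A B"
 shows "is_viso V (vself V) A B (name_of V f) \<longleftrightarrow> is_iso V f"
proof -
 note [simp] = homD[OF f] homD[OF name_of_in_hom[OF f]] homD[OF vself_cmp_in_hom] homD[OF vself_id_in_hom]
 have key: "VCmp (vself V) A B A o \<langle>g, name_of V f\<rangle> = VId (vself V) A \<longleftrightarrow> g' o f = Idn V A"
  "VCmp (vself V) B A B o \<langle>name_of V f, g\<rangle> = VId (vself V) B \<longleftrightarrow> f o g' = Idn V B"
  if g: "g : hom V \<one> \<lbrakk>B, A\<rbrakk>" and g': "g' : hom V B A"
   and gg: "\<And>Y b. b : hom V Y B ==> ev V B A o \<langle>g o bang V Y, b\<rangle> = g' o b" for g g'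
 proof -
  note [simp] = homD[OF g] homD[OF g']
  have y: "y = bang V Y" if "y : hom V Y \<one>" for y Y
   using that bang_unique[of y] by (simp add: in_hom)
  show "VCmp (vself V) A B A o \<langle>g, name_of V f\<rangle> = VId (vself V) A \<longleftrightarrow> g' o f = Idn V A" (is "?l = ?r \<longleftrightarrow> _")
  proof
   assume "?l = ?r"
   then have "ev V A A o \<langle>?l o bang V A, Idn V A\<rangle> = ev V A A o \<langle>?r o bang V A, Idn V A\<rangle>" by simp
   then show "g' o f = Idn V A" using gg[OF f] by simp
  next
   assume *: "g' o f = Idn V A"
   show "?l = ?r"
   proof (rule exp_ext[of _ \<one> A A])
    fix Y y a assume y': "y : hom V Y \<one>" and a: "a : hom V Y A"
    have "g' o f o a = a" by (rule comp_iso_cancel[OF * f g' a])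
    then show "ev V A A o \<langle>?l o y, a\<rangle> = ev V A A o \<langle>?r o y, a\<rangle>"
     using gg[of "f o a" Y] by (simp add: homD[OF a] homD[OF y'] in_hom y[OF y'])
   qed (simp_all add: in_hom)
  qed
  show "VCmp (vself V) B A B o \<langle>name_of V f, g\<rangle> = VId (vself V) B \<longleftrightarrow> f o g' = Idn V B" (is "?l = ?r \<longleftrightarrow> _")
  proof
   assume "?l = ?r"
   then have "ev V B B o \<langle>?l o bang V B, Idn V B\<rangle> = ev V B B o \<langle>?r o bang V B, Idn V B\<rangle>" by simp
   then show "f o g' = Idn V B" using gg[of "Idn V B" B] by (simp add: in_hom)
  next
   assume *: "f o g' = Idn V B"
   show "?l = ?r"
   proof (rule exp_ext[of _ \<one> B B])
    fix Y y a assume y': "y : hom V Y \<one>" and a: "a : hom V Y B"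
    have "f o g' o a = a" by (rule comp_iso_cancel[OF * g' f a])
    then show "ev V B B o \<langle>?l o y, a\<rangle> = ev V B B o \<langle>?r o y, a\<rangle>"
     using gg[of a Y] a by (simp add: homD[OF a] homD[OF y'] y[OF y'])
   qed (simp_all add: in_hom)
  qed
 qed
 show ?thesis
 proof
  assume "is_viso V (vself V) A B (name_of V f)"
  then obtain g where g: "g : hom V \<one> \<lbrakk>B, A\<rbrakk>"
   "VCmp (vself V) A B A o \<langle>g, name_of V f\<rangle> = VId (vself V) A"
   "VCmp (vself V) B A B o \<langle>name_of V f, g\<rangle> = VId (vself V) B"
   unfolding is_viso_def by auto
  note [simp] = homD[OF g(1)]
  define g' where "g' = ev V B A o \<langle>g o bang V B, Idn V B\<rangle>"
  have g': "g' : hom V B A" by (simp add: g'_def in_hom)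
  have "ev V B A o \<langle>g o bang V Y, b\<rangle> = g' o b" if "b : hom V Y B" for b Y
   by (simp add: g'_def homD[OF that])
  then show "is_iso V f" using key[OF g(1) g'] g isoI[OF f g'] by blast
 next
  assume "is_iso V f"
  then obtain g' where g': "g' : hom V B A" "g' o f = Idn V A" "f o g' = Idn V B"
   using f by (rule isoE)
  have "ev V B A o \<langle>name_of V g' o bang V Y, b\<rangle> = g' o b" if "b : hom V Y B" for b Y
   by (simp add: homD[OF that] homD[OF g'(1)])
  then show "is_viso V (vself V) A B (name_of V f)"
   using key[OF name_of_in_hom[OF g'(1)] g'(1)] g' name_of_in_hom[OF f] name_of_in_hom[OF g'(1)]
   unfolding is_viso_def by auto
 qed
qed

end

locale cone = diagram +
 fixes W and L and l
 assumes W [simp]: "is_vfun V J (vself V) W" and L [simp]: "L : VOb C"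
  and l: "is_vnat V J (vself V) W (hom_along V J C G L) l"
begin

abbreviation "cone_map \<equiv> vnat_elem V J W (hom_along V J C G L) l"

lemma l_wedge: "is_wedge V J W (hom_along V J C G L) \<one> l"
proof (rule is_wedgeI[OF J(1)])
 note [simp] = functorD[OF hom_along_vfun[OF L]]
 show l_hom: "l i : hom V \<one> \<lbrakk>FOb W i, FOb (hom_along V J C G L) i\<rbrakk>" if "i : VOb J" for i
  using l that unfolding is_vnat_def by simp
 note [simp] = homD[OF l_hom]
 fix i j Y x u assume [simp]: "i : VOb J" "j : VOb J"
  and x: "x : hom V Y \<one>" and u: "u : hom V Y (VHom J i j)"
 note [simp] = homD[OF x] homD[OF u]
 let ?K = "hom_along V J C G L"
 have "x = bang V Y" using bang_unique[of x] by simp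
 moreover have "VCmp (vself V) (FOb W i) (FOb W j) (FOb ?K j) o \<langle>l j o bang V (VHom J i j), FHom W i j\<rangle>
   = VCmp (vself V) (FOb W i) (FOb ?K i) (FOb ?K j) o \<langle>FHom ?K i j, l i o bang V (VHom J i j)\<rangle>"
  using l unfolding is_vnat_def by simp
 then have "(VCmp (vself V) (FOb W i) (FOb W j) (FOb ?K j) o \<langle>l j o bang V (VHom J i j), FHom W i j\<rangle>) o u
   = (VCmp (vself V) (FOb W i) (FOb ?K i) (FOb ?K j) o \<langle>FHom ?K i j, l i o bang V (VHom J i j)\<rangle>) o u" by simp
 ultimately show "VCmp (vself V) (FOb W i) (FOb W j) (FOb ?K j) o \<langle>l j o x, FHom W i j o u\<rangle>
   = VCmp (vself V) (FOb W i) (FOb ?K i) (FOb ?K j) o \<langle>FHom ?K i j o u, l i o x\<rangle>"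
  by (subst (asm) (1 2) comp_assoc) simp_all
qed simp

lemma cone_map_in_hom: "cone_map : hom V \<one> (end_obj V J W (hom_along V J C G L))"
 using end_lift[OF _ _ l_wedge] by (simp add: vnat_elem_def)

lemmas cone_mapD [simp] = homD[OF cone_map_in_hom]

lemma vfun_cat_cmpD [simp]:
 assumes "is_vfun V J (vself V) F" "is_vfun V J (vself V) F'" "is_vfun V J (vself V) H"
 shows "VCmp (vfun_cat V J) F F' H : Arr V"
  "Dom V (VCmp (vfun_cat V J) F F' H) = end_obj V J F' H \<otimes> end_obj V J F F'"
  "Cod V (VCmp (vfun_cat V J) F F' H) = end_obj V J F H"
 using homD[OF vfun_cat_cmp_in_hom[OF assms]] by simp_all

abbreviation "induced \<equiv> induced_map V J C G W L l"

lemma induced_in_hom: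
 "A : VOb C ==> induced A : hom V (VHom C A L) (end_obj V J W (hom_along V J C G A))"
 by (simp add: induced_map_def in_hom)

lemma induced_point:
 assumes "A : VOb C" "f : hom V X (VHom C A L)"
 shows "induced A o f = VCmp (vfun_cat V J) W (hom_along V J C G L) (hom_along V J C G A) o
  \<langle>FHom yoneda L A o f, cone_map o bang V X\<rangle>"
 using assms homD[OF assms(2)] by (simp add: induced_map_def)

text \<open>
 The family of maps \<open>\<lambda>\<^sup>*\<close> is natural, because \<open>C(-,G)\<close> is a functor; so \<open>(L, \<lambda>)\<close> is a weighted limit
 as soon as every component of \<open>\<lambda>\<^sup>*\<close> is invertible in \<open>V\<close>.
\<close>

lemma is_weighted_limit_iff:
 "is_weighted_limit V J C G W L l \<longleftrightarrow> (\<forall>A\<in>VOb C. is_iso V (induced A))"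
proof -
 let ?H = "hom_along V J C G"
 let ?P = "vrep V (vop V C) L"
 let ?R = "vfun_comp V (vop V C) (vrep V (vfun_cat V J) W) yoneda"
 have W': "W : VOb (vfun_cat V J)" by simp
 have obs: "FOb ?P A = VHom C A L" "FOb ?R A = end_obj V J W (?H A)" if "A : VOb C" for A
  using that by simp_all
 note [simp] = homD[OF induced_in_hom] vop_vcat[OF C] homD[OF name_of_in_hom[OF induced_in_hom]]
  vfunD[OF vrep_vfun[OF vop_vcat[OF C], of L] vop_vcat[OF C] vself_vcat, simplified]
  vfunD[OF vrep_vfun[OF vfun_cat_vcat W'] vfun_cat_vcat vself_vcat, simplified]
  vrep_apply[OF vop_vcat[OF C], of L, simplified] vrep_apply[OF vfun_cat_vcat, of W, simplified]
 have "is_vnat V (vop V C) (vself V) ?P ?R (\<lambda>A. name_of V (induced A))"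
  unfolding is_vnat_def
 proof (intro conjI ballI)
  fix A assume "A : VOb (vop V C)" then have [simp]: "A : VOb C" by simp
  show "name_of V (induced A) \<in> hom V \<one> (VHom (vself V) (FOb ?P A) (FOb ?R A))"
   by (simp add: in_hom)
  fix B assume "B : VOb (vop V C)" then have [simp]: "B : VOb C" by simp
  let ?X = "VHom C B A"
  show "VCmp (vself V) (FOb ?P A) (FOb ?P B) (FOb ?R B) o
    \<langle>name_of V (induced B) o bang V (VHom (vop V C) A B), FHom ?P A B\<rangle>
   = VCmp (vself V) (FOb ?P A) (FOb ?R A) (FOb ?R B) o
    \<langle>FHom ?R A B, name_of V (induced A) o bang V (VHom (vop V C) A B)\<rangle>" (is "?l = ?r")
  proof (rule exp_ext[of _ ?X "VHom C A L" "end_obj V J W (?H B)"])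
   fix Y u f assume u: "u : hom V Y ?X" and f: "f : hom V Y (VHom C A L)"
   note [simp] = homD[OF u] homD[OF f]
   have "ev V (VHom C A L) (end_obj V J W (?H B)) o \<langle>?l o u, f\<rangle> = induced B o VCmp C B A L o \<langle>f, u\<rangle>"
    by simp
   also have "\<dots> = VCmp (vfun_cat V J) W (?H L) (?H B) o
     \<langle>FHom yoneda L B o VCmp C B A L o \<langle>f, u\<rangle>, cone_map o bang V Y\<rangle>"
    by (rule induced_point) (simp_all add: in_hom)
   also have "\<dots> = VCmp (vfun_cat V J) W (?H A) (?H B) o
     \<langle>FHom yoneda A B o u, induced A o f\<rangle>"
    by (simp add: induced_point[OF _ f] yoneda_cmp vassoc)
   also have "\<dots> = ev V (VHom C A L) (end_obj V J W (?H B)) o \<langle>?r o u, f\<rangle>"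
    by simp
   finally show "ev V (VHom C A L) (end_obj V J W (?H B)) o \<langle>?l o u, f\<rangle>
    = ev V (VHom C A L) (end_obj V J W (?H B)) o \<langle>?r o u, f\<rangle>" .
  qed (simp_all add: in_hom)
 qed
 then show ?thesis
  unfolding is_weighted_limit_def is_vnat_iso_def
  by (simp add: obs is_viso_name_of[OF induced_in_hom])
qed

end

section \<open>Internal categories through generalized elements\<close>

abbreviation icomp :: "('o, 'm) category \<Rightarrow> ('o, 'm) icat \<Rightarrow> 'm \<Rightarrow> 'm \<Rightarrow> 'm" where
 "icomp V A g f \<equiv> icmp A o\<^bsub>V\<^esub> pb_pair V (isrc A) (itgt A) g f"

lemma CatV_simps:
 "Obj (CatV V) = {A. is_icat V A}" "Arr (CatV V) = {F. is_ifun V F}"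
 "Dom (CatV V) = idom" "Cod (CatV V) = icod"
 by (simp_all add: CatV_def)

lemma CatV_fun_simps [simp]:
 "Dom (CatV V) \<lparr>idom = A, icod = B, if0 = f, if1 = g\<rparr> = A"
 "Cod (CatV V) \<lparr>idom = A, icod = B, if0 = f, if1 = g\<rparr> = B"
 "if0 (Idn (CatV V) A) = Idn V (ic0 A)" "if1 (Idn (CatV V) A) = Idn V (ic1 A)"
 "if0 (G o\<^bsub>CatV V\<^esub> F) = if0 G o\<^bsub>V\<^esub> if0 F" "if1 (G o\<^bsub>CatV V\<^esub> F) = if1 G o\<^bsub>V\<^esub> if1 F"
 by (simp_all add: CatV_def)

context pullback_ccc
begin

lemma icat_laws:
 assumes A: "A : Obj (CatV V)"
 shows ic0_in_Obj [simp]: "ic0 A : Obj V" and ic1_in_Obj [simp]: "ic1 A : Obj V"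
  and isrc_arr [simp]: "isrc A : Arr V" and isrc_dom [simp]: "Dom V (isrc A) = ic1 A"
  and isrc_cod [simp]: "Cod V (isrc A) = ic0 A"
  and itgt_arr [simp]: "itgt A : Arr V" and itgt_dom [simp]: "Dom V (itgt A) = ic1 A"
  and itgt_cod [simp]: "Cod V (itgt A) = ic0 A"
  and iidn_arr [simp]: "iidn A : Arr V" and iidn_dom [simp]: "Dom V (iidn A) = ic0 A"
  and iidn_cod [simp]: "Cod V (iidn A) = ic1 A"
  and icmp_arr [simp]: "icmp A : Arr V" and icmp_dom [simp]: "Dom V (icmp A) = pb_obj V (isrc A) (itgt A)"
  and icmp_cod [simp]: "Cod V (icmp A) = ic1 A"
  and isrc_iidn0: "isrc A o iidn A = Idn V (ic0 A)" and itgt_iidn0: "itgt A o iidn A = Idn V (ic0 A)"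
  and isrc_icmp: "isrc A o icmp A = isrc A o pb2 V (isrc A) (itgt A)"
  and itgt_icmp: "itgt A o icmp A = itgt A o pb1 V (isrc A) (itgt A)"
  and icmp_unit_right: "icomp V A (Idn V (ic1 A)) (iidn A o isrc A) = Idn V (ic1 A)"
  and icmp_unit_left: "icomp V A (iidn A o itgt A) (Idn V (ic1 A)) = Idn V (ic1 A)"
 using A by (simp_all add: CatV_simps is_icat_def Let_def in_hom)

lemma isrc_iidn [simp]:
 assumes "A : Obj (CatV V)" "x : Arr V" "Cod V x = ic0 A"
 shows "isrc A o iidn A o x = x" "itgt A o iidn A o x = x"
 using comp_assoc[of x "iidn A" "isrc A"] comp_assoc[of x "iidn A" "itgt A"] assms
 by (simp_all add: isrc_iidn0 itgt_iidn0)

context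
 fixes A g f
 assumes A [simp]: "A : Obj (CatV V)" and g [simp]: "g : Arr V" "f : Arr V" "Dom V g = Dom V f"
  "Cod V g = ic1 A" "Cod V f = ic1 A" "isrc A o g = itgt A o f"
begin

lemma isrc_icomp [simp]: "isrc A o icomp V A g f = isrc A o f"
proof -
 have "(isrc A o icmp A) o pb_pair V (isrc A) (itgt A) g f
  = (isrc A o pb2 V (isrc A) (itgt A)) o pb_pair V (isrc A) (itgt A) g f" by (simp only: isrc_icmp[OF A])
 then show ?thesis by simp
qed

lemma itgt_icomp [simp]: "itgt A o icomp V A g f = itgt A o g"
proof -
 have "(itgt A o icmp A) o pb_pair V (isrc A) (itgt A) g f
  = (itgt A o pb1 V (isrc A) (itgt A)) o pb_pair V (isrc A) (itgt A) g f" by (simp only: itgt_icmp[OF A])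
 then show ?thesis by simp
qed

end

lemma icomp_unit_right [simp]:
 assumes A [simp]: "A : Obj (CatV V)" and f [simp]: "f : Arr V" "Cod V f = ic1 A" "isrc A o f = x"
 shows "icomp V A f (iidn A o x) = f"
proof -
 have "icomp V A (Idn V (ic1 A)) (iidn A o isrc A) o f = Idn V (ic1 A) o f"
  by (simp only: icmp_unit_right[OF A])
 then show ?thesis by (simp add: isrc_iidn0 itgt_iidn0)
qed

lemma icomp_unit_left [simp]:
 assumes A [simp]: "A : Obj (CatV V)" and f [simp]: "f : Arr V" "Cod V f = ic1 A" "itgt A o f = x"
 shows "icomp V A (iidn A o x) f = f"
proof -
 have "icomp V A (iidn A o itgt A) (Idn V (ic1 A)) o f = Idn V (ic1 A) o f"
  by (simp only: icmp_unit_left[OF A])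
 then show ?thesis by (simp add: isrc_iidn0 itgt_iidn0)
qed

lemma icomp_assoc:
 assumes A [simp]: "A : Obj (CatV V)" and [simp]: "h : Arr V" "g : Arr V" "f : Arr V"
  "Dom V h = Dom V f" "Dom V g = Dom V f"
  "Cod V h = ic1 A" "Cod V g = ic1 A" "Cod V f = ic1 A" "isrc A o h = itgt A o g" "isrc A o g = itgt A o f"
 shows "icomp V A (icomp V A h g) f = icomp V A h (icomp V A g f)"
proof -
 let ?s = "isrc A" and ?t = "itgt A"
 let ?p = "pb1 V ?s ?t" and ?q = "pb2 V ?s ?t"
 let ?a = "pb1 V (?s o ?q) ?t" and ?f = "pb2 V (?s o ?q) ?t"
 have *: "icomp V A (icomp V A (?p o ?a) (?q o ?a)) ?f = icomp V A (?p o ?a) (icomp V A (?q o ?a) ?f)"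
  using A by (simp only: CatV_simps is_icat_def Let_def mem_Collect_eq)
 let ?x = "pb_pair V (?s o ?q) ?t (pb_pair V ?s ?t h g) f"
 define H G F where HGF: "H = ?p o ?a" "G = ?q o ?a" "F = ?f"
 have ty [simp]: "H : Arr V" "G : Arr V" "F : Arr V" "Dom V H = pb_obj V (?s o ?q) ?t"
  "Dom V G = pb_obj V (?s o ?q) ?t" "Dom V F = pb_obj V (?s o ?q) ?t"
  "Cod V H = ic1 A" "Cod V G = ic1 A" "Cod V F = ic1 A"
  unfolding HGF by simp_all
 have ev: "H o ?x = h" "G o ?x = g" "F o ?x = f" unfolding HGF by simp_all
 have x [simp]: "?x : Arr V" "Dom V ?x = Dom V f" "Cod V ?x = pb_obj V (?s o ?q) ?t" by simp_all
 have sq [simp]: "?s o H = ?t o G" "?s o G = ?t o F"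
  unfolding HGF using pb_square_point[of ?s ?t ?a] pb_square[of "?s o ?q" ?t] by simp_all
 note [simp del] = pb_pair_comp
 note pc = pb_pair_comp[where f = ?s and g = ?t and x = ?x]
 have "icomp V A (icomp V A H G) F o ?x = icomp V A H (icomp V A G F) o ?x"
  using * by (simp only: HGF)
 then show ?thesis by (simp add: pc ev)
qed

text \<open>
 The axioms of an internal category are equations between maps, and it suffices to check them on
 elements: each axiom is the instance at the universal element, an identity or the
 projections of an object of composable arrows.
\<close>

lemma is_icatI:
 assumes [simp]: "ic0 A : Obj V" "ic1 A : Obj V"
  and s: "isrc A : hom V (ic1 A) (ic0 A)" and t: "itgt A : hom V (ic1 A) (ic0 A)"
  and i: "iidn A : hom V (ic0 A) (ic1 A)" and c: "icmp A : hom V (pb_obj V (isrc A) (itgt A)) (ic1 A)"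
  and si: "\<And>X x. x : hom V X (ic0 A) ==> isrc A o iidn A o x = x"
  and ti: "\<And>X x. x : hom V X (ic0 A) ==> itgt A o iidn A o x = x"
  and sc: "\<And>X g f. f : hom V X (ic1 A) ==> g : hom V X (ic1 A) ==> isrc A o g = itgt A o f ==>
    isrc A o icomp V A g f = isrc A o f"
  and tc: "\<And>X g f. f : hom V X (ic1 A) ==> g : hom V X (ic1 A) ==> isrc A o g = itgt A o f ==>
    itgt A o icomp V A g f = itgt A o g"
  and unit: "\<And>X f. f : hom V X (ic1 A) ==> icomp V A f (iidn A o isrc A o f) = f"
   "\<And>X f. f : hom V X (ic1 A) ==> icomp V A (iidn A o itgt A o f) f = f"
  and assoc: "\<And>X h g f. f : hom V X (ic1 A) ==> g : hom V X (ic1 A) ==> h : hom V X (ic1 A) ==>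
    isrc A o g = itgt A o f ==> isrc A o h = itgt A o g ==>
    icomp V A (icomp V A h g) f = icomp V A h (icomp V A g f)"
 shows "A : Obj (CatV V)"
proof -
 note [simp] = homD[OF s] homD[OF t] homD[OF i] homD[OF c]
 let ?s = "isrc A" and ?t = "itgt A"
 let ?p = "pb1 V ?s ?t" and ?q = "pb2 V ?s ?t"
 let ?a = "pb1 V (?s o ?q) ?t" and ?f = "pb2 V (?s o ?q) ?t"
 have pq: "?p : hom V (pb_obj V ?s ?t) (ic1 A)" "?q : hom V (pb_obj V ?s ?t) (ic1 A)" "?s o ?p = ?t o ?q"
  by (simp_all add: in_hom pb_square)
 have "isrc A o iidn A = Idn V (ic0 A)" "itgt A o iidn A = Idn V (ic0 A)"
  using si[of "Idn V (ic0 A)" "ic0 A"] ti[of "Idn V (ic0 A)" "ic0 A"] by (simp_all add: in_hom)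
 moreover have "?s o icmp A = ?s o ?q" "?t o icmp A = ?t o ?p"
  using sc[OF pq(2,1,3)] tc[OF pq(2,1,3)] by simp_all
 moreover have "icomp V A (Idn V (ic1 A)) (iidn A o ?s) = Idn V (ic1 A)"
  "icomp V A (iidn A o ?t) (Idn V (ic1 A)) = Idn V (ic1 A)"
  using unit[of "Idn V (ic1 A)" "ic1 A"] by (simp_all add: in_hom)
 moreover have "icomp V A (icomp V A (?p o ?a) (?q o ?a)) ?f = icomp V A (?p o ?a) (icomp V A (?q o ?a) ?f)"
 proof (rule assoc[where X = "pb_obj V (?s o ?q) ?t"])
  show "?s o (?p o ?a) = ?t o (?q o ?a)" by (rule pb_square_point) simp_all
  show "?s o ?q o ?a = ?t o ?f" using pb_square[of "?s o ?q" ?t] by simp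
 qed (simp_all add: in_hom)
 ultimately show ?thesis
  unfolding CatV_simps is_icat_def Let_def mem_Collect_eq
  using assms(1,2) s t i c by (intro conjI)
qed

lemma ifun_laws:
 assumes F: "F : Arr (CatV V)"
 shows ifun_dom_icat: "Dom (CatV V) F : Obj (CatV V)" and ifun_cod_icat: "Cod (CatV V) F : Obj (CatV V)"
  and if0_arr [simp]: "if0 F : Arr V" and if0_dom [simp]: "Dom V (if0 F) = ic0 (Dom (CatV V) F)"
  and if0_cod [simp]: "Cod V (if0 F) = ic0 (Cod (CatV V) F)"
  and if1_arr [simp]: "if1 F : Arr V" and if1_dom [simp]: "Dom V (if1 F) = ic1 (Dom (CatV V) F)"
  and if1_cod [simp]: "Cod V (if1 F) = ic1 (Cod (CatV V) F)"
  and isrc_if1_0: "isrc (Cod (CatV V) F) o if1 F = if0 F o isrc (Dom (CatV V) F)"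
  and itgt_if1_0: "itgt (Cod (CatV V) F) o if1 F = if0 F o itgt (Dom (CatV V) F)"
  and if1_iidn_0: "if1 F o iidn (Dom (CatV V) F) = iidn (Cod (CatV V) F) o if0 F"
  and if1_icmp_0: "if1 F o icmp (Dom (CatV V) F) = icomp V (Cod (CatV V) F)
     (if1 F o pb1 V (isrc (Dom (CatV V) F)) (itgt (Dom (CatV V) F)))
     (if1 F o pb2 V (isrc (Dom (CatV V) F)) (itgt (Dom (CatV V) F)))"
 using F by (simp_all add: CatV_simps is_ifun_def Let_def in_hom)

lemma isrc_if1 [simp]:
 assumes F: "F : Arr (CatV V)" and "Cod (CatV V) F = B" "f : Arr V" "Cod V f = ic1 (Dom (CatV V) F)"
 shows "isrc B o if1 F o f = if0 F o isrc (Dom (CatV V) F) o f"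
  and "itgt B o if1 F o f = if0 F o itgt (Dom (CatV V) F) o f"
 using square_point[OF isrc_if1_0[OF F], of f] square_point[OF itgt_if1_0[OF F], of f] assms
  ifun_dom_icat[OF F] ifun_cod_icat[OF F] by simp_all

lemma if1_iidn [simp]:
 assumes F: "F : Arr (CatV V)" and "Dom (CatV V) F = A" "x : Arr V" "Cod V x = ic0 A"
 shows "if1 F o iidn A o x = iidn (Cod (CatV V) F) o if0 F o x"
 using square_point[OF if1_iidn_0[OF F], of x] assms ifun_dom_icat[OF F] ifun_cod_icat[OF F] by simp

lemma if1_icomp [simp]:
 assumes F: "F : Arr (CatV V)" and A: "Dom (CatV V) F = A" and "g : Arr V" "f : Arr V"
  "Dom V g = Dom V f" "Cod V g = ic1 A" "Cod V f = ic1 A" "isrc A o g = itgt A o f"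
 shows "if1 F o icomp V A g f = icomp V (Cod (CatV V) F) (if1 F o g) (if1 F o f)"
proof -
 note [simp] = assms(1,3-) ifun_dom_icat[OF F, unfolded A] ifun_cod_icat[OF F]
 let ?B = "Cod (CatV V) F" let ?p = "pb1 V (isrc A) (itgt A)" and ?q = "pb2 V (isrc A) (itgt A)"
 have [simp]: "isrc A o ?p = itgt A o ?q" by (rule pb_square) simp_all
 have "(if1 F o icmp A) o pb_pair V (isrc A) (itgt A) g f
  = icomp V ?B (if1 F o ?p) (if1 F o ?q) o pb_pair V (isrc A) (itgt A) g f"
  using if1_icmp_0[OF F] by (simp only: A)
 then show ?thesis by (simp add: A)
qed

lemma is_ifunI:
 assumes A: "A : Obj (CatV V)" and B: "B : Obj (CatV V)"
  and f0: "f0 : hom V (ic0 A) (ic0 B)" and f1: "f1 : hom V (ic1 A) (ic1 B)"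
  and s: "\<And>X u. u : hom V X (ic1 A) ==> isrc B o f1 o u = f0 o isrc A o u"
  and t: "\<And>X u. u : hom V X (ic1 A) ==> itgt B o f1 o u = f0 o itgt A o u"
  and i: "\<And>X x. x : hom V X (ic0 A) ==> f1 o iidn A o x = iidn B o f0 o x"
  and c: "\<And>X v u. u : hom V X (ic1 A) ==> v : hom V X (ic1 A) ==> isrc A o v = itgt A o u ==>
    f1 o icomp V A v u = icomp V B (f1 o v) (f1 o u)"
 shows "\<lparr>idom = A, icod = B, if0 = f0, if1 = f1\<rparr> \<in> hom (CatV V) A B"
proof -
 note [simp] = A B homD[OF f0] homD[OF f1]
 have "isrc B o f1 = f0 o isrc A" "itgt B o f1 = f0 o itgt A"
  using s[of "Idn V (ic1 A)" "ic1 A"] t[of "Idn V (ic1 A)" "ic1 A"] by (simp_all add: in_hom)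
 moreover have "iidn B o f0 = f1 o iidn A"
  using i[of "Idn V (ic0 A)" "ic0 A"] by (simp add: in_hom)
 moreover have "f1 o icmp A = icomp V B (f1 o pb1 V (isrc A) (itgt A)) (f1 o pb2 V (isrc A) (itgt A))"
  using c[of "pb2 V (isrc A) (itgt A)" "pb_obj V (isrc A) (itgt A)" "pb1 V (isrc A) (itgt A)"]
  by (simp add: in_hom pb_square)
 moreover have "is_icat V A" "is_icat V B" using A B by (simp_all only: CatV_simps mem_Collect_eq)
 ultimately show ?thesis
  unfolding in_hom[of _ "CatV V"] CatV_simps is_ifun_def Let_def mem_Collect_eq ifun.simps
  using f0 f1 by (intro conjI refl)
qed

lemma ifun_ext:
 assumes "F : Arr (CatV V)" "F' : Arr (CatV V)" "Dom (CatV V) F = Dom (CatV V) F'"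
  "Cod (CatV V) F = Cod (CatV V) F'" "if0 F = if0 F'" "if1 F = if1 F'"
 shows "F = F'"
 using assms by (cases F; cases F') (simp add: CatV_simps)

lemma CatV_category: "is_category (CatV V)"
proof -
 have id: "Idn (CatV V) A : hom (CatV V) A A" if "A : Obj (CatV V)" for A
 proof -
  have "\<lparr>idom = A, icod = A, if0 = Idn V (ic0 A), if1 = Idn V (ic1 A)\<rparr> \<in> hom (CatV V) A A"
   by (rule is_ifunI) (use that in \<open>simp_all add: in_hom\<close>)
  then show ?thesis by (simp add: CatV_def)
 qed
 have comp: "F' o\<^bsub>CatV V\<^esub> F : hom (CatV V) A D"
  if F: "F : hom (CatV V) A B" and F': "F' : hom (CatV V) B D" for F F' A B D
 proof -
  note [simp] = F[unfolded in_hom[of _ "CatV V"]] F'[unfolded in_hom[of _ "CatV V"]]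
  have [simp]: "A : Obj (CatV V)" "B : Obj (CatV V)" "D : Obj (CatV V)"
   using ifun_dom_icat[of F] ifun_dom_icat[of F'] ifun_cod_icat[of F'] by simp_all
  have "\<lparr>idom = A, icod = D, if0 = if0 F' o if0 F, if1 = if1 F' o if1 F\<rparr> \<in> hom (CatV V) A D"
   by (rule is_ifunI) (simp_all add: in_hom)
  moreover have "F' o\<^bsub>CatV V\<^esub> F = \<lparr>idom = A, icod = D, if0 = if0 F' o if0 F, if1 = if1 F' o if1 F\<rparr>"
   using F F' by (simp add: CatV_def hom_def)
  ultimately show ?thesis by simp
 qed
 show ?thesis
  unfolding is_category_def
 proof (intro conjI ballI allI impI; (elim conjE)?)
  fix F assume "F : Arr (CatV V)"
  then show "Dom (CatV V) F : Obj (CatV V)" "Cod (CatV V) F : Obj (CatV V)"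
   by (rule ifun_dom_icat ifun_cod_icat)+
 next
  fix A B F assume F: "F : hom (CatV V) A B"
  have ob: "A : Obj (CatV V)" "B : Obj (CatV V)"
   using F ifun_dom_icat[of F] ifun_cod_icat[of F] by (auto simp: in_hom)
  have 1: "F o\<^bsub>CatV V\<^esub> Idn (CatV V) A : hom (CatV V) A B" "Idn (CatV V) B o\<^bsub>CatV V\<^esub> F : hom (CatV V) A B"
   using comp F id ob by blast+
  note [simp] = F[unfolded in_hom[of _ "CatV V"]] 1[unfolded in_hom[of _ "CatV V"]]
  show "F o\<^bsub>CatV V\<^esub> Idn (CatV V) A = F" "Idn (CatV V) B o\<^bsub>CatV V\<^esub> F = F"
   by (rule ifun_ext; simp)+
 next
  fix A B D E F F' H assume F: "F : hom (CatV V) A B" "F' : hom (CatV V) B D" "H : hom (CatV V) D E"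
  have 1: "(H o\<^bsub>CatV V\<^esub> F') o\<^bsub>CatV V\<^esub> F : hom (CatV V) A E" "H o\<^bsub>CatV V\<^esub> F' o\<^bsub>CatV V\<^esub> F : hom (CatV V) A E"
   using comp F by blast+
  note [simp] = F[unfolded in_hom[of _ "CatV V"]] 1[unfolded in_hom[of _ "CatV V"]]
  show "(H o\<^bsub>CatV V\<^esub> F') o\<^bsub>CatV V\<^esub> F = H o\<^bsub>CatV V\<^esub> F' o\<^bsub>CatV V\<^esub> F"
   by (rule ifun_ext; simp)
 qed (rule id comp; assumption)+
qed

end

sublocale pullback_ccc \<subseteq> Cat: cat "CatV V"
 by (rule cat.intro) (rule CatV_category)

context pullback_ccc
begin

subsection \<open>Pullbacks of internal categories\<close>

text \<open>
 The points of a pullback of internal categories are pairs, and the structure is computed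
 componentwise.
\<close>

definition icat_pullback :: "('a, 'b) ifun \<Rightarrow> ('a, 'b) ifun \<Rightarrow> ('a, 'b) icat" where
 "icat_pullback F G =
   (let A = Dom (CatV V) F; B = Dom (CatV V) G;
     p0 = pb1 V (if0 F) (if0 G); q0 = pb2 V (if0 F) (if0 G);
     p1 = pb1 V (if1 F) (if1 G); q1 = pb2 V (if1 F) (if1 G);
     s = pb_pair V (if0 F) (if0 G) (isrc A o p1) (isrc B o q1);
     t = pb_pair V (if0 F) (if0 G) (itgt A o p1) (itgt B o q1)
   in \<lparr>ic0 = pb_obj V (if0 F) (if0 G), ic1 = pb_obj V (if1 F) (if1 G), isrc = s, itgt = t,
     iidn = pb_pair V (if1 F) (if1 G) (iidn A o p0) (iidn B o q0),
     icmp = pb_pair V (if1 F) (if1 G)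
      (icomp V A (p1 o pb1 V s t) (p1 o pb2 V s t)) (icomp V B (q1 o pb1 V s t) (q1 o pb2 V s t))\<rparr>)"

end

locale icat_cospan = pullback_ccc V for V (structure) +
 fixes F G A B K
 assumes F: "F : hom (CatV V) A K" and G: "G : hom (CatV V) B K"
begin

lemmas FG [simp] = Cat.homD[OF F] Cat.homD[OF G]

abbreviation "P \<equiv> icat_pullback F G"
abbreviation "p0 \<equiv> pb1 V (if0 F) (if0 G)"
abbreviation "q0 \<equiv> pb2 V (if0 F) (if0 G)"
abbreviation "p1 \<equiv> pb1 V (if1 F) (if1 G)"
abbreviation "q1 \<equiv> pb2 V (if1 F) (if1 G)"

lemma sq0 [simp]: "x : Arr V ==> Cod V x = pb_obj V (if0 F) (if0 G) ==> if0 F o p0 o x = if0 G o q0 o x"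
 by (rule pb_square_point) simp_all

lemma sq1 [simp]: "x : Arr V ==> Cod V x = pb_obj V (if1 F) (if1 G) ==> if1 F o p1 o x = if1 G o q1 o x"
 by (rule pb_square_point) simp_all

lemma st1 [simp]:
 assumes [simp]: "x : Arr V" "Cod V x = pb_obj V (if1 F) (if1 G)"
 shows "if0 F o isrc A o p1 o x = if0 G o isrc B o q1 o x"
  and "if0 F o itgt A o p1 o x = if0 G o itgt B o q1 o x"
 using isrc_if1[of F K "p1 o x"] isrc_if1[of G K "q1 o x"] by simp_all

lemma st1' [simp]:
 "if0 F o isrc A o p1 = if0 G o isrc B o q1" "if0 F o itgt A o p1 = if0 G o itgt B o q1"
 using st1[of "Idn V (pb_obj V (if1 F) (if1 G))"] by simp_all

lemma id1 [simp]: "if1 F o iidn A o p0 = if1 G o iidn B o q0"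
 using pb_square[of "if0 F" "if0 G"] by simp

lemma Pobj [simp]: "ic0 P = pb_obj V (if0 F) (if0 G)" "ic1 P = pb_obj V (if1 F) (if1 G)"
 by (simp_all add: icat_pullback_def Let_def)

lemma Pdefs:
 "isrc P = pb_pair V (if0 F) (if0 G) (isrc A o p1) (isrc B o q1)"
 "itgt P = pb_pair V (if0 F) (if0 G) (itgt A o p1) (itgt B o q1)"
 "iidn P = pb_pair V (if1 F) (if1 G) (iidn A o p0) (iidn B o q0)"
 by (simp_all add: icat_pullback_def Let_def)

lemma Ptypes [simp]:
 "isrc P : Arr V" "Dom V (isrc P) = ic1 P" "Cod V (isrc P) = ic0 P"
 "itgt P : Arr V" "Dom V (itgt P) = ic1 P" "Cod V (itgt P) = ic0 P"
 "iidn P : Arr V" "Dom V (iidn P) = ic0 P" "Cod V (iidn P) = ic1 P"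
 by (simp_all add: Pdefs)

lemma Ppoints [simp]:
 assumes "x : Arr V"
 shows "Cod V x = pb_obj V (if1 F) (if1 G) ==> p0 o isrc P o x = isrc A o p1 o x"
  "Cod V x = pb_obj V (if1 F) (if1 G) ==> q0 o isrc P o x = isrc B o q1 o x"
  "Cod V x = pb_obj V (if1 F) (if1 G) ==> p0 o itgt P o x = itgt A o p1 o x"
  "Cod V x = pb_obj V (if1 F) (if1 G) ==> q0 o itgt P o x = itgt B o q1 o x"
  "Cod V x = pb_obj V (if0 F) (if0 G) ==> p1 o iidn P o x = iidn A o p0 o x"
  "Cod V x = pb_obj V (if0 F) (if0 G) ==> q1 o iidn P o x = iidn B o q0 o x"
 using assms by (simp_all add: Pdefs)

lemma Pext0:
 assumes "x : Arr V" "y : Arr V" "Dom V x = Dom V y" "Cod V x = pb_obj V (if0 F) (if0 G)"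
  "Cod V y = pb_obj V (if0 F) (if0 G)" "p0 o x = p0 o y" "q0 o x = q0 o y"
 shows "x = y"
 by (rule pb_ext[of _ _ "if0 F" "if0 G"]) (use assms in simp_all)

lemma Pext1:
 assumes "x : Arr V" "y : Arr V" "Dom V x = Dom V y" "Cod V x = pb_obj V (if1 F) (if1 G)"
  "Cod V y = pb_obj V (if1 F) (if1 G)" "p1 o x = p1 o y" "q1 o x = q1 o y"
 shows "x = y"
 by (rule pb_ext[of _ _ "if1 F" "if1 G"]) (use assms in simp_all)

lemma comp0:
 assumes [simp]: "g : Arr V" "f : Arr V" "Dom V g = Dom V f" "Cod V g = pb_obj V (if1 F) (if1 G)"
  "Cod V f = pb_obj V (if1 F) (if1 G)" and eq: "isrc P o g = itgt P o f"
 shows "isrc A o p1 o g = itgt A o p1 o f" "isrc B o q1 o g = itgt B o q1 o f"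
proof -
 have "p0 o isrc P o g = p0 o itgt P o f" by (simp only: eq)
 then show "isrc A o p1 o g = itgt A o p1 o f" by simp
 have "q0 o isrc P o g = q0 o itgt P o f" by (simp only: eq)
 then show "isrc B o q1 o g = itgt B o q1 o f" by simp
qed

abbreviation "p \<equiv> pb1 V (isrc P) (itgt P)"
abbreviation "q \<equiv> pb2 V (isrc P) (itgt P)"

lemma pq_sq: "isrc P o p = itgt P o q" by (rule pb_square) simp_all

lemma pq_comp [simp]: "isrc A o p1 o p = itgt A o p1 o q" "isrc B o q1 o p = itgt B o q1 o q"
 by (rule comp0[OF _ _ _ _ _ pq_sq]; simp)+

lemma icmp_P:
 "icmp P = pb_pair V (if1 F) (if1 G) (icomp V A (p1 o p) (p1 o q)) (icomp V B (q1 o p) (q1 o q))"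
 by (simp add: icat_pullback_def Let_def)

lemma icmp_P_in_hom:
 "icmp P : Arr V" "Dom V (icmp P) = pb_obj V (isrc P) (itgt P)" "Cod V (icmp P) = pb_obj V (if1 F) (if1 G)"
 by (simp_all add: icmp_P)

lemma icmp_P_pr:
 "p1 o icmp P = icomp V A (p1 o p) (p1 o q)" "q1 o icmp P = icomp V B (q1 o p) (q1 o q)"
 by (simp_all add: icmp_P)

lemma Pcomp:
 assumes [simp]: "g : Arr V" "f : Arr V" "Dom V g = Dom V f" "Cod V g = pb_obj V (if1 F) (if1 G)"
  "Cod V f = pb_obj V (if1 F) (if1 G)" and eq: "isrc P o g = itgt P o f"
 shows "p1 o icomp V P g f = icomp V A (p1 o g) (p1 o f)"
  and "q1 o icomp V P g f = icomp V B (q1 o g) (q1 o f)"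
  and "icomp V P g f : Arr V" "Dom V (icomp V P g f) = Dom V f" "Cod V (icomp V P g f) = pb_obj V (if1 F) (if1 G)"
proof -
 let ?x = "pb_pair V (isrc P) (itgt P) g f"
 have x: "?x : Arr V" "Dom V ?x = Dom V f" "Cod V ?x = pb_obj V (isrc P) (itgt P)" "p o ?x = g" "q o ?x = f"
  by (simp_all add: eq)
 note [simp] = x icmp_P_in_hom
 have 1: "p1 o icmp P o ?x = (p1 o icmp P) o ?x" "q1 o icmp P o ?x = (q1 o icmp P) o ?x" by simp_all
 show "p1 o icomp V P g f = icomp V A (p1 o g) (p1 o f)"
  "q1 o icomp V P g f = icomp V B (q1 o g) (q1 o f)"
  unfolding 1 icmp_P_pr by simp_all
 show "icomp V P g f : Arr V" "Dom V (icomp V P g f) = Dom V f" "Cod V (icomp V P g f) = pb_obj V (if1 F) (if1 G)"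
  by simp_all
qed

lemma icat_pullback_icat: "P : Obj (CatV V)"
proof (rule is_icatI)
 show "icmp P : hom V (pb_obj V (isrc P) (itgt P)) (ic1 P)"
  by (simp add: in_hom icmp_P_in_hom)
next
 fix X x assume x: "x : hom V X (ic0 P)"
 note [simp] = homD[OF x, simplified]
 show "isrc P o iidn P o x = x" "itgt P o iidn P o x = x"
  by (rule Pext0; simp)+
next
 fix X g f assume f: "f : hom V X (ic1 P)" and g: "g : hom V X (ic1 P)" and eq: "isrc P o g = itgt P o f"
 note [simp] = homD[OF f, simplified] homD[OF g, simplified] Pcomp[OF _ _ _ _ _ eq] comp0[OF _ _ _ _ _ eq]
 show s: "isrc P o icomp V P g f = isrc P o f" by (rule Pext0) simp_all
 show t: "itgt P o icomp V P g f = itgt P o g" by (rule Pext0) simp_all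
next
 fix X h g f assume f: "f : hom V X (ic1 P)" and g: "g : hom V X (ic1 P)" and h: "h : hom V X (ic1 P)"
  and eq: "isrc P o g = itgt P o f" and eq': "isrc P o h = itgt P o g"
 note [simp] = homD[OF f, simplified] homD[OF g, simplified] homD[OF h, simplified]
  Pcomp[OF _ _ _ _ _ eq] comp0[OF _ _ _ _ _ eq] Pcomp[OF _ _ _ _ _ eq'] comp0[OF _ _ _ _ _ eq']
 have t: "isrc P o h = itgt P o icomp V P g f" unfolding eq' by (rule Pext0) simp_all
 have s: "isrc P o icomp V P h g = itgt P o f" unfolding eq[symmetric] by (rule Pext0) simp_all
 note [simp] = Pcomp[OF _ _ _ _ _ s] Pcomp[OF _ _ _ _ _ t]
 show "icomp V P (icomp V P h g) f = icomp V P h (icomp V P g f)"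
  by (rule Pext1) (simp_all add: icomp_assoc)
next
 fix X f assume f: "f : hom V X (ic1 P)"
 note [simp] = homD[OF f, simplified]
 have 1: "isrc P o f = itgt P o iidn P o isrc P o f" "isrc P o iidn P o itgt P o f = itgt P o f"
  by (rule Pext0; simp)+
 note [simp] = Pcomp[OF _ _ _ _ _ 1(1)] Pcomp[OF _ _ _ _ _ 1(2)]
 show "icomp V P f (iidn P o isrc P o f) = f" by (rule Pext1) simp_all
 show "icomp V P (iidn P o itgt P o f) f = f" by (rule Pext1) simp_all
qed (simp_all add: in_hom)

lemma icat_pullback_is_pullback:
 "is_pullback (CatV V) F G P \<lparr>idom = P, icod = A, if0 = p0, if1 = p1\<rparr> \<lparr>idom = P, icod = B, if0 = q0, if1 = q1\<rparr>"
proof -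
 note [simp] = icat_pullback_icat
 let ?p = "\<lparr>idom = P, icod = A, if0 = p0, if1 = p1\<rparr>" and ?q = "\<lparr>idom = P, icod = B, if0 = q0, if1 = q1\<rparr>"
 have p: "?p : hom (CatV V) P A"
 proof (rule is_ifunI)
  fix X v u assume u: "u : hom V X (ic1 P)" and v: "v : hom V X (ic1 P)" and eq: "isrc P o v = itgt P o u"
  note [simp] = homD[OF u, simplified] homD[OF v, simplified] comp0[OF _ _ _ _ _ eq] Pcomp[OF _ _ _ _ _ eq]
  show "p1 o icomp V P v u = icomp V A (p1 o v) (p1 o u)"
   by simp
 next
  fix X u assume u: "u : hom V X (ic1 P)"
  note [simp] = homD[OF u, simplified]
  show "isrc A o p1 o u = p0 o isrc P o u" "itgt A o p1 o u = p0 o itgt P o u" by simp_all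
 next
  fix X x assume x: "x : hom V X (ic0 P)"
  note [simp] = homD[OF x, simplified]
  show "p1 o iidn P o x = iidn A o p0 o x" by simp
 qed (simp_all add: in_hom)
 have q: "?q : hom (CatV V) P B"
 proof (rule is_ifunI)
  fix X v u assume u: "u : hom V X (ic1 P)" and v: "v : hom V X (ic1 P)" and eq: "isrc P o v = itgt P o u"
  note [simp] = homD[OF u, simplified] homD[OF v, simplified] comp0[OF _ _ _ _ _ eq] Pcomp[OF _ _ _ _ _ eq]
  show "q1 o icomp V P v u = icomp V B (q1 o v) (q1 o u)"
   by simp
 next
  fix X u assume u: "u : hom V X (ic1 P)"
  note [simp] = homD[OF u, simplified]
  show "isrc B o q1 o u = q0 o isrc P o u" "itgt B o q1 o u = q0 o itgt P o u" by simp_all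
 next
  fix X x assume x: "x : hom V X (ic0 P)"
  note [simp] = homD[OF x, simplified]
  show "q1 o iidn P o x = iidn B o q0 o x" by simp
 qed (simp_all add: in_hom)
 note [simp] = Cat.homD[OF p] Cat.homD[OF q]
 have "F o\<^bsub>CatV V\<^esub> ?p = G o\<^bsub>CatV V\<^esub> ?q"
  by (rule ifun_ext) (simp_all add: pb_square)
 moreover have "\<exists>!h. h : hom (CatV V) X P \<and> ?p o\<^bsub>CatV V\<^esub> h = a \<and> ?q o\<^bsub>CatV V\<^esub> h = b"
  if a: "a : hom (CatV V) X A" and b: "b : hom (CatV V) X B" and ab: "F o\<^bsub>CatV V\<^esub> a = G o\<^bsub>CatV V\<^esub> b" for X a b
 proof -
  note [simp] = Cat.homD[OF a] Cat.homD[OF b]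
  have "if0 (F o\<^bsub>CatV V\<^esub> a) = if0 (G o\<^bsub>CatV V\<^esub> b)" "if1 (F o\<^bsub>CatV V\<^esub> a) = if1 (G o\<^bsub>CatV V\<^esub> b)" by (simp_all only: ab)
  then have ab0 [simp]: "if0 F o if0 a = if0 G o if0 b" and ab1 [simp]: "if1 F o if1 a = if1 G o if1 b" by simp_all
  have [simp]: "if0 F o if0 a o x = if0 G o if0 b o x" if "x : Arr V" "Cod V x = ic0 X" for x
   by (rule square_point[OF ab0]) (use that in simp_all)
  have [simp]: "if1 F o if1 a o x = if1 G o if1 b o x" if "x : Arr V" "Cod V x = ic1 X" for x
   by (rule square_point[OF ab1]) (use that in simp_all)
  define h where "h = \<lparr>idom = X, icod = P, if0 = pb_pair V (if0 F) (if0 G) (if0 a) (if0 b),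
   if1 = pb_pair V (if1 F) (if1 G) (if1 a) (if1 b)\<rparr>"
  have st: "isrc P o pb_pair V (if1 F) (if1 G) (if1 a o u) (if1 b o u)
     = pb_pair V (if0 F) (if0 G) (if0 a o isrc X o u) (if0 b o isrc X o u)"
    "itgt P o pb_pair V (if1 F) (if1 G) (if1 a o u) (if1 b o u)
     = pb_pair V (if0 F) (if0 G) (if0 a o itgt X o u) (if0 b o itgt X o u)"
   if u: "u : Arr V" "Cod V u = ic1 X" for u
   by (rule Pext0; use u in simp)+
  have h: "h : hom (CatV V) X P"
   unfolding h_def
  proof (rule is_ifunI)
   fix Y v u assume u: "u : hom V Y (ic1 X)" and v: "v : hom V Y (ic1 X)" and eq: "isrc X o v = itgt X o u"
   note [simp] = homD[OF u] homD[OF v] eq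
   show "pb_pair V (if1 F) (if1 G) (if1 a) (if1 b) o icomp V X v u
    = icomp V P (pb_pair V (if1 F) (if1 G) (if1 a) (if1 b) o v) (pb_pair V (if1 F) (if1 G) (if1 a) (if1 b) o u)"
    by (rule Pext1) (simp_all add: st Pcomp)
  next
   fix Y u assume u: "u : hom V Y (ic1 X)"
   note [simp] = homD[OF u]
   show "isrc P o pb_pair V (if1 F) (if1 G) (if1 a) (if1 b) o u = pb_pair V (if0 F) (if0 G) (if0 a) (if0 b) o isrc X o u"
    "itgt P o pb_pair V (if1 F) (if1 G) (if1 a) (if1 b) o u = pb_pair V (if0 F) (if0 G) (if0 a) (if0 b) o itgt X o u"
    by (simp_all add: st)
  next
   fix Y x assume x: "x : hom V Y (ic0 X)"
   note [simp] = homD[OF x]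
   show "pb_pair V (if1 F) (if1 G) (if1 a) (if1 b) o iidn X o x = iidn P o pb_pair V (if0 F) (if0 G) (if0 a) (if0 b) o x"
    by (rule Pext1) simp_all
  qed (simp_all add: in_hom)
  show ?thesis
  proof (rule ex1I[of _ h], intro conjI)
   note [simp] = Cat.homD[OF h]
   show "h : hom (CatV V) X P" by (rule h)
   show "?p o\<^bsub>CatV V\<^esub> h = a" "?q o\<^bsub>CatV V\<^esub> h = b"
    by (rule ifun_ext; simp; simp add: h_def)+
   fix k assume k: "k : hom (CatV V) X P \<and> ?p o\<^bsub>CatV V\<^esub> k = a \<and> ?q o\<^bsub>CatV V\<^esub> k = b"
   then have k': "k : hom (CatV V) X P" by blast
   note [simp] = Cat.homD[OF k']
   have e: "if0 a = p0 o if0 k" "if1 a = p1 o if1 k" "if0 b = q0 o if0 k" "if1 b = q1 o if1 k"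
    using k by auto
   show "k = h"
    by (rule ifun_ext) (simp_all, simp_all add: h_def e pb_pair_eta)
  qed
 qed
 ultimately show ?thesis
  unfolding is_pullback_def Cat.homD(2,3)[OF F] Cat.homD(2,3)[OF G]
  using p q Cat.homD(1)[OF F] Cat.homD(1)[OF G] by (intro conjI allI impI refl; (elim conjE)?) blast+
qed

end

context pullback_ccc
begin

abbreviation "Cat \<equiv> CatV V"

end

text \<open>
 With a terminal object for \<open>T\<close> this reduces products of internal categories to pullbacks.
\<close>

lemma (in cat) pullback_iff_product:
 assumes f: "f : hom V A T" and g: "g : hom V B T"
  and eq: "\<And>X a b. a : hom V X A ==> b : hom V X B ==> f o a = g o b"
 shows "is_pullback V f g P p q \<longleftrightarrow> is_product V A B P p q"
proof
 note [simp] = homD(1-3)[OF f] homD(1-3)[OF g]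
 assume P: "is_pullback V f g P p q"
 show "is_product V A B P p q"
  unfolding is_product_def
 proof (intro conjI allI impI; (elim conjE)?)
  show "p : hom V P A" "q : hom V P B" using P unfolding is_pullback_def by simp_all
  fix X a b assume ab: "a : hom V X A" "b : hom V X B"
  then show "\<exists>!h. h : hom V X P \<and> p o h = a \<and> q o h = b"
   using P eq[OF ab] unfolding is_pullback_def by simp
 qed
next
 note [simp] = homD(1-3)[OF f] homD(1-3)[OF g]
 assume P: "is_product V A B P p q"
 then have pq: "p : hom V P A" "q : hom V P B" unfolding is_product_def by blast+
 show "is_pullback V f g P p q"
  unfolding is_pullback_def
 proof (intro conjI allI impI; (elim conjE)?)
  show "f o p = g o q" by (rule eq[OF pq])
  fix X a b assume "a : hom V X (Dom V f)" "b : hom V X (Dom V g)"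
  then show "\<exists>!h. h : hom V X P \<and> p o h = a \<and> q o h = b"
   using P unfolding is_product_def by simp
 qed (use pq in simp_all)
qed

sublocale pullback_ccc \<subseteq> Cat: cat_with_pullbacks "CatV V"
proof
 show "has_pullbacks Cat"
  unfolding has_pullbacks_def
 proof (intro ballI impI)
  fix F G assume "F : Arr Cat" "G : Arr Cat" "Cod Cat F = Cod Cat G"
  then have "F : hom Cat (Dom Cat F) (Cod Cat F)"
   "G : hom Cat (Dom Cat G) (Cod Cat F)" by (simp_all add: in_hom)
  from icat_cospan.icat_pullback_is_pullback[OF icat_cospan.intro, OF pullback_ccc_axioms icat_cospan_axioms.intro, OF this] show "\<exists>P p q. is_pullback Cat F G P p q" by blast
 qed
qed

context pullback_ccc
begin

text \<open>
 The universal property determines pullbacks up to isomorphism, so what holds for the pullback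
 constructed componentwise holds for every pullback of internal categories.
\<close>

lemma pullback_levels:
 assumes *: "is_pullback Cat F G P p q"
 shows "is_pullback V (if0 F) (if0 G) (ic0 P) (if0 p) (if0 q)"
  and "is_pullback V (if1 F) (if1 G) (ic1 P) (if1 p) (if1 q)"
proof -
 let ?K = "Cod Cat F"
 have F: "F : hom Cat (Dom Cat F) ?K" and G: "G : hom Cat (Dom Cat G) ?K"
  using * unfolding is_pullback_def by (simp_all add: in_hom)
 note [simp] = Cat.homD(1)[OF F] Cat.homD(1,3)[OF G]
 let ?P = "icat_pullback F G"
 obtain h k where h: "h : hom Cat P ?P" "k : hom Cat ?P P" "k o\<^bsub>Cat\<^esub> h = Idn Cat P"
  "h o\<^bsub>Cat\<^esub> k = Idn Cat ?P"
  and p: "\<lparr>idom = ?P, icod = Dom Cat F, if0 = pb1 V (if0 F) (if0 G), if1 = pb1 V (if1 F) (if1 G)\<rparr> o\<^bsub>Cat\<^esub> h = p"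
  and q: "\<lparr>idom = ?P, icod = Dom Cat G, if0 = pb2 V (if0 F) (if0 G), if1 = pb2 V (if1 F) (if1 G)\<rparr> o\<^bsub>Cat\<^esub> h = q"
  by (rule Cat.pullback_cone_iso[OF * icat_cospan.icat_pullback_is_pullback[OF icat_cospan.intro, OF pullback_ccc_axioms icat_cospan_axioms.intro, OF F G]])
 note [simp] = Cat.homD[OF h(1)] Cat.homD[OF h(2)]
 have P: "ic0 ?P = pb_obj V (if0 F) (if0 G)" "ic1 ?P = pb_obj V (if1 F) (if1 G)"
  by (simp_all add: icat_pullback_def Let_def)
 have "if0 k o if0 h = Idn V (ic0 P)" "if0 h o if0 k = Idn V (ic0 ?P)"
  "if1 k o if1 h = Idn V (ic1 P)" "if1 h o if1 k = Idn V (ic1 ?P)"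
  using arg_cong[OF h(3), of if0] arg_cong[OF h(4), of if0] arg_cong[OF h(3), of if1] arg_cong[OF h(4), of if1]
  unfolding CatV_fun_simps .
 note hk = this[unfolded P]
 have "is_pullback V (if0 F) (if0 G) (ic0 P) (pb1 V (if0 F) (if0 G) o if0 h) (pb2 V (if0 F) (if0 G) o if0 h)"
  by (rule pullback_iso_invariant[OF chosen_pullback _ _ hk(1,2)]) (simp_all add: in_hom P)
 then show "is_pullback V (if0 F) (if0 G) (ic0 P) (if0 p) (if0 q)"
  unfolding p[symmetric] q[symmetric] by simp
 have "is_pullback V (if1 F) (if1 G) (ic1 P) (pb1 V (if1 F) (if1 G) o if1 h) (pb2 V (if1 F) (if1 G) o if1 h)"
  by (rule pullback_iso_invariant[OF chosen_pullback _ _ hk(3,4)]) (simp_all add: in_hom P)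
 then show "is_pullback V (if1 F) (if1 G) (ic1 P) (if1 p) (if1 q)"
  unfolding p[symmetric] q[symmetric] by simp
qed

subsection \<open>Discrete internal categories and products\<close>

lemma cst_simps [simp]: "ic0 (cst V X) = X" "ic1 (cst V X) = X" "isrc (cst V X) = Idn V X"
 "itgt (cst V X) = Idn V X" "iidn (cst V X) = Idn V X" "icmp (cst V X) = pb1 V (Idn V X) (Idn V X)"
 by (simp_all add: cst_def)

lemma cst_icat [simp]:
 assumes [simp]: "X : Obj V"
 shows "cst V X : Obj Cat"
proof (rule is_icatI)
 fix Y g f assume f: "f : hom V Y (ic1 (cst V X))" and g: "g : hom V Y (ic1 (cst V X))"
  and eq: "isrc (cst V X) o g = itgt (cst V X) o f"
 note [simp] = homD[OF f[simplified]] homD[OF g[simplified]]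
 have [simp]: "f = g" using eq by simp
 show "isrc (cst V X) o icomp V (cst V X) g f = isrc (cst V X) o f"
  "itgt (cst V X) o icomp V (cst V X) g f = itgt (cst V X) o g" by simp_all
 fix h assume h: "h : hom V Y (ic1 (cst V X))" and eq': "isrc (cst V X) o h = itgt (cst V X) o g"
 note [simp] = homD[OF h[simplified]]
 have [simp]: "h = g" using eq' by simp
 show "icomp V (cst V X) (icomp V (cst V X) h g) f = icomp V (cst V X) h (icomp V (cst V X) g f)" by simp
next
 fix Y f assume f: "f : hom V Y (ic1 (cst V X))"
 note [simp] = homD[OF f[simplified]]
 show "icomp V (cst V X) f (iidn (cst V X) o isrc (cst V X) o f) = f"
  "icomp V (cst V X) (iidn (cst V X) o itgt (cst V X) o f) f = f" by simp_all
next
 fix Y x assume x: "x : hom V Y (ic0 (cst V X))"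
 note [simp] = homD[OF x[simplified]]
 show "isrc (cst V X) o iidn (cst V X) o x = x" "itgt (cst V X) o iidn (cst V X) o x = x" by simp_all
qed (simp_all add: in_hom)

lemma ibang_in_hom:
 assumes [simp]: "A : Obj Cat"
 shows "ibang V A : hom Cat A (cst V \<one>)"
 unfolding ibang_def
proof (rule is_ifunI)
 fix X u v assume u: "u : hom V X (ic1 A)" and v: "v : hom V X (ic1 A)" and [simp]: "isrc A o v = itgt A o u"
 note [simp] = homD[OF u] homD[OF v]
 show "bang V (ic1 A) o icomp V A v u = icomp V (cst V \<one>) (bang V (ic1 A) o v) (bang V (ic1 A) o u)"
  by simp
next
 fix X u assume u: "u : hom V X (ic1 A)"
 note [simp] = homD[OF u]
 show "isrc (cst V \<one>) o bang V (ic1 A) o u = bang V (ic0 A) o isrc A o u"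
  "itgt (cst V \<one>) o bang V (ic1 A) o u = bang V (ic0 A) o itgt A o u" by simp_all
next
 fix X x assume x: "x : hom V X (ic0 A)"
 note [simp] = homD[OF x]
 show "bang V (ic1 A) o iidn A o x = iidn (cst V \<one>) o bang V (ic0 A) o x" by simp
qed (simp_all add: in_hom)

lemma ibang_simps [simp]:
 assumes "A : Obj Cat"
 shows "ibang V A : Arr Cat" "Dom Cat (ibang V A) = A" "Cod Cat (ibang V A) = cst V \<one>"
  "if0 (ibang V A) = bang V (ic0 A)" "if1 (ibang V A) = bang V (ic1 A)"
 using Cat.homD[OF ibang_in_hom[OF assms]] by (simp_all add: ibang_def)

lemma to_cst_one_eq:
 assumes "F : hom Cat A (cst V \<one>)" "F' : hom Cat A (cst V \<one>)"
 shows "F = F'"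
proof -
 note [simp] = Cat.homD[OF assms(1)] Cat.homD[OF assms(2)]
 have "if0 F = if0 F'" "if1 F = if1 F'" by (rule to_one_eq; simp)+
 then show ?thesis by (intro ifun_ext) simp_all
qed

lemma ibang_pullback_iff:
 assumes A: "A : Obj Cat" and B: "B : Obj Cat"
 shows "is_pullback Cat (ibang V A) (ibang V B) P p q \<longleftrightarrow> is_product Cat A B P p q"
proof (rule Cat.pullback_iff_product[OF ibang_in_hom[OF A] ibang_in_hom[OF B]])
 fix X a b assume "a : hom Cat X A" "b : hom Cat X B"
 then show "ibang V A o\<^bsub>Cat\<^esub> a = ibang V B o\<^bsub>Cat\<^esub> b"
  using to_cst_one_eq Cat.comp_in_hom ibang_in_hom[OF A] ibang_in_hom[OF B] by blast
qed

end

sublocale pullback_ccc \<subseteq> Cat: cat_with_products "CatV V"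
proof
 show "\<forall>A\<in>Obj Cat. \<forall>B\<in>Obj Cat. \<exists>P p q. is_product Cat A B P p q"
 proof (intro ballI)
  fix A B assume A [simp]: "A : Obj Cat" and B [simp]: "B : Obj Cat"
  have "is_pullback Cat (ibang V A) (ibang V B) (pb_obj Cat (ibang V A) (ibang V B))
    (pb1 Cat (ibang V A) (ibang V B)) (pb2 Cat (ibang V A) (ibang V B))"
   by (rule Cat.chosen_pullback) simp_all
  then have "is_product Cat A B (pb_obj Cat (ibang V A) (ibang V B))
    (pb1 Cat (ibang V A) (ibang V B)) (pb2 Cat (ibang V A) (ibang V B))"
   by (simp only: ibang_pullback_iff[OF A B])
  then show "\<exists>P p q. is_product Cat A B P p q" by blast
 qed
qed

context pullback_ccc
begin

lemma product_levels:
 assumes [simp]: "A : Obj Cat" "B : Obj Cat"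
 shows "is_product V (ic0 A) (ic0 B) (ic0 (A \<otimes>\<^bsub>Cat\<^esub> B)) (if0 (pr1 Cat A B)) (if0 (pr2 Cat A B))"
  and "is_product V (ic1 A) (ic1 B) (ic1 (A \<otimes>\<^bsub>Cat\<^esub> B)) (if1 (pr1 Cat A B)) (if1 (pr2 Cat A B))"
proof -
 have "is_pullback Cat (ibang V A) (ibang V B) (A \<otimes>\<^bsub>Cat\<^esub> B) (pr1 Cat A B) (pr2 Cat A B)"
  using Cat.chosen_product[of A B] by (simp add: ibang_pullback_iff)
 note * = pullback_levels[OF this]
 have 1: "is_pullback V (bang V D) (bang V E) P p q \<longleftrightarrow> is_product V D E P p q"
  if "D : Obj V" "E : Obj V" for D E P p q
 proof (rule pullback_iff_product[OF bang_in_hom bang_in_hom])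
  show "bang V D o f = bang V E o g" if "f : hom V X D" "g : hom V X E" for f g X
   using homD[OF that(1)] homD[OF that(2)] by simp
 qed (use that in auto)
 show "is_product V (ic0 A) (ic0 B) (ic0 (A \<otimes>\<^bsub>Cat\<^esub> B)) (if0 (pr1 Cat A B)) (if0 (pr2 Cat A B))"
  using *(1) 1 by simp
 show "is_product V (ic1 A) (ic1 B) (ic1 (A \<otimes>\<^bsub>Cat\<^esub> B)) (if1 (pr1 Cat A B)) (if1 (pr2 Cat A B))"
  using *(2) 1 by simp
qed

text \<open>
 Products are computed on objects and on arrows separately, so both kinds of elements of a product are
 pairs, and all structure maps act on them componentwise.
\<close>

definition pair0 :: "('a, 'b) icat \<Rightarrow> ('a, 'b) icat \<Rightarrow> 'b \<Rightarrow> 'b \<Rightarrow> 'b" where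
 "pair0 A B a b = (THE h. h : hom V (Dom V a) (ic0 (A \<otimes>\<^bsub>Cat\<^esub> B)) \<and>
   if0 (pr1 Cat A B) o h = a \<and> if0 (pr2 Cat A B) o h = b)"

definition pair1 :: "('a, 'b) icat \<Rightarrow> ('a, 'b) icat \<Rightarrow> 'b \<Rightarrow> 'b \<Rightarrow> 'b" where
 "pair1 A B a b = (THE h. h : hom V (Dom V a) (ic1 (A \<otimes>\<^bsub>Cat\<^esub> B)) \<and>
   if1 (pr1 Cat A B) o h = a \<and> if1 (pr2 Cat A B) o h = b)"

context
 fixes A B assumes AB [simp]: "A : Obj Cat" "B : Obj Cat"
begin

lemma pair0_props:
 assumes "a : Arr V" "b : Arr V" "Dom V a = Dom V b" "Cod V a = ic0 A" "Cod V b = ic0 B"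
 shows pair0_arr [simp]: "pair0 A B a b : Arr V" and pair0_dom [simp]: "Dom V (pair0 A B a b) = Dom V b"
  and pair0_cod [simp]: "Cod V (pair0 A B a b) = ic0 (A \<otimes>\<^bsub>Cat\<^esub> B)"
  and pair0_pr1 [simp]: "if0 (pr1 Cat A B) o pair0 A B a b = a"
  and pair0_pr2 [simp]: "if0 (pr2 Cat A B) o pair0 A B a b = b"
proof -
 have "a : hom V (Dom V a) (ic0 A)" "b : hom V (Dom V a) (ic0 B)" using assms by (simp_all add: in_hom)
 then have "\<exists>!h. h : hom V (Dom V a) (ic0 (A \<otimes>\<^bsub>Cat\<^esub> B)) \<and>
   if0 (pr1 Cat A B) o h = a \<and> if0 (pr2 Cat A B) o h = b"
  using product_levels(1)[OF AB] unfolding is_product_def by blast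
 from theI'[OF this, folded pair0_def] assms
 show "pair0 A B a b : Arr V" "Dom V (pair0 A B a b) = Dom V b"
  "Cod V (pair0 A B a b) = ic0 (A \<otimes>\<^bsub>Cat\<^esub> B)"
  "if0 (pr1 Cat A B) o pair0 A B a b = a" "if0 (pr2 Cat A B) o pair0 A B a b = b"
  by (simp_all add: in_hom)
qed

lemma pair1_props:
 assumes "a : Arr V" "b : Arr V" "Dom V a = Dom V b" "Cod V a = ic1 A" "Cod V b = ic1 B"
 shows pair1_arr [simp]: "pair1 A B a b : Arr V" and pair1_dom [simp]: "Dom V (pair1 A B a b) = Dom V b"
  and pair1_cod [simp]: "Cod V (pair1 A B a b) = ic1 (A \<otimes>\<^bsub>Cat\<^esub> B)"
  and pair1_pr1 [simp]: "if1 (pr1 Cat A B) o pair1 A B a b = a"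
  and pair1_pr2 [simp]: "if1 (pr2 Cat A B) o pair1 A B a b = b"
proof -
 have "a : hom V (Dom V a) (ic1 A)" "b : hom V (Dom V a) (ic1 B)" using assms by (simp_all add: in_hom)
 then have "\<exists>!h. h : hom V (Dom V a) (ic1 (A \<otimes>\<^bsub>Cat\<^esub> B)) \<and>
   if1 (pr1 Cat A B) o h = a \<and> if1 (pr2 Cat A B) o h = b"
  using product_levels(2)[OF AB] unfolding is_product_def by blast
 from theI'[OF this, folded pair1_def] assms
 show "pair1 A B a b : Arr V" "Dom V (pair1 A B a b) = Dom V b"
  "Cod V (pair1 A B a b) = ic1 (A \<otimes>\<^bsub>Cat\<^esub> B)"
  "if1 (pr1 Cat A B) o pair1 A B a b = a" "if1 (pr2 Cat A B) o pair1 A B a b = b"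
  by (simp_all add: in_hom)
qed

lemma iprod_ext0:
 assumes "h : Arr V" "k : Arr V" "Dom V h = Dom V k" "Cod V h = ic0 (A \<otimes>\<^bsub>Cat\<^esub> B)"
  "Cod V k = ic0 (A \<otimes>\<^bsub>Cat\<^esub> B)" "if0 (pr1 Cat A B) o h = if0 (pr1 Cat A B) o k"
  "if0 (pr2 Cat A B) o h = if0 (pr2 Cat A B) o k"
 shows "h = k"
proof -
 let ?a = "if0 (pr1 Cat A B) o k" and ?b = "if0 (pr2 Cat A B) o k"
 have "?a : hom V (Dom V k) (ic0 A)" "?b : hom V (Dom V k) (ic0 B)"
  using assms(1-5) by (simp_all add: in_hom)
 then have "\<exists>!h. h : hom V (Dom V k) (ic0 (A \<otimes>\<^bsub>Cat\<^esub> B)) \<and>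
   if0 (pr1 Cat A B) o h = ?a \<and> if0 (pr2 Cat A B) o h = ?b"
  using product_levels(1)[OF AB] unfolding is_product_def by blast
 moreover have "h : hom V (Dom V k) (ic0 (A \<otimes>\<^bsub>Cat\<^esub> B))" "k : hom V (Dom V k) (ic0 (A \<otimes>\<^bsub>Cat\<^esub> B))"
  using assms(1-5) by (simp_all add: in_hom)
 ultimately show ?thesis using assms(6,7) by blast
qed

lemma iprod_ext1:
 assumes "h : Arr V" "k : Arr V" "Dom V h = Dom V k" "Cod V h = ic1 (A \<otimes>\<^bsub>Cat\<^esub> B)"
  "Cod V k = ic1 (A \<otimes>\<^bsub>Cat\<^esub> B)" "if1 (pr1 Cat A B) o h = if1 (pr1 Cat A B) o k"
  "if1 (pr2 Cat A B) o h = if1 (pr2 Cat A B) o k"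
 shows "h = k"
proof -
 let ?a = "if1 (pr1 Cat A B) o k" and ?b = "if1 (pr2 Cat A B) o k"
 have "?a : hom V (Dom V k) (ic1 A)" "?b : hom V (Dom V k) (ic1 B)"
  using assms(1-5) by (simp_all add: in_hom)
 then have "\<exists>!h. h : hom V (Dom V k) (ic1 (A \<otimes>\<^bsub>Cat\<^esub> B)) \<and>
   if1 (pr1 Cat A B) o h = ?a \<and> if1 (pr2 Cat A B) o h = ?b"
  using product_levels(2)[OF AB] unfolding is_product_def by blast
 moreover have "h : hom V (Dom V k) (ic1 (A \<otimes>\<^bsub>Cat\<^esub> B))" "k : hom V (Dom V k) (ic1 (A \<otimes>\<^bsub>Cat\<^esub> B))"
  using assms(1-5) by (simp_all add: in_hom)
 ultimately show ?thesis using assms(6,7) by blast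
qed

lemma ipr_point [simp]:
 assumes "x : Arr V"
 shows "Cod V x = ic1 (A \<otimes>\<^bsub>Cat\<^esub> B) ==>
  if0 (pr1 Cat A B) o isrc (A \<otimes>\<^bsub>Cat\<^esub> B) o x = isrc A o if1 (pr1 Cat A B) o x"
  and "Cod V x = ic1 (A \<otimes>\<^bsub>Cat\<^esub> B) ==>
  if0 (pr2 Cat A B) o isrc (A \<otimes>\<^bsub>Cat\<^esub> B) o x = isrc B o if1 (pr2 Cat A B) o x"
  and "Cod V x = ic1 (A \<otimes>\<^bsub>Cat\<^esub> B) ==>
  if0 (pr1 Cat A B) o itgt (A \<otimes>\<^bsub>Cat\<^esub> B) o x = itgt A o if1 (pr1 Cat A B) o x"
  and "Cod V x = ic1 (A \<otimes>\<^bsub>Cat\<^esub> B) ==>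
  if0 (pr2 Cat A B) o itgt (A \<otimes>\<^bsub>Cat\<^esub> B) o x = itgt B o if1 (pr2 Cat A B) o x"
 using assms isrc_if1[of "pr1 Cat A B" A x] isrc_if1[of "pr2 Cat A B" B x] by simp_all

declare isrc_if1 [simp del]

lemma pair0_comp [simp]:
 assumes "a : Arr V" "b : Arr V" "Dom V a = Dom V b" "Cod V a = ic0 A" "Cod V b = ic0 B"
  "x : Arr V" "Cod V x = Dom V b"
 shows "pair0 A B a b o x = pair0 A B (a o x) (b o x)"
proof (rule iprod_ext0)
 have "if0 (pr1 Cat A B) o pair0 A B a b o x = (if0 (pr1 Cat A B) o pair0 A B a b) o x"
  "if0 (pr2 Cat A B) o pair0 A B a b o x = (if0 (pr2 Cat A B) o pair0 A B a b) o x"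
  using assms by (subst comp_assoc; simp)+
 then show "if0 (pr1 Cat A B) o pair0 A B a b o x = if0 (pr1 Cat A B) o pair0 A B (a o x) (b o x)"
  "if0 (pr2 Cat A B) o pair0 A B a b o x = if0 (pr2 Cat A B) o pair0 A B (a o x) (b o x)"
  using assms by simp_all
qed (use assms in simp_all)

lemma pair1_comp [simp]:
 assumes "a : Arr V" "b : Arr V" "Dom V a = Dom V b" "Cod V a = ic1 A" "Cod V b = ic1 B"
  "x : Arr V" "Cod V x = Dom V b"
 shows "pair1 A B a b o x = pair1 A B (a o x) (b o x)"
proof (rule iprod_ext1)
 have "if1 (pr1 Cat A B) o pair1 A B a b o x = (if1 (pr1 Cat A B) o pair1 A B a b) o x"
  "if1 (pr2 Cat A B) o pair1 A B a b o x = (if1 (pr2 Cat A B) o pair1 A B a b) o x"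
  using assms by (subst comp_assoc; simp)+
 then show "if1 (pr1 Cat A B) o pair1 A B a b o x = if1 (pr1 Cat A B) o pair1 A B (a o x) (b o x)"
  "if1 (pr2 Cat A B) o pair1 A B a b o x = if1 (pr2 Cat A B) o pair1 A B (a o x) (b o x)"
  using assms by simp_all
qed (use assms in simp_all)

lemma pair0_eta:
 assumes "x : Arr V" "Cod V x = ic0 (A \<otimes>\<^bsub>Cat\<^esub> B)"
 shows "pair0 A B (if0 (pr1 Cat A B) o x) (if0 (pr2 Cat A B) o x) = x"
 by (rule iprod_ext0) (use assms in simp_all)

lemma pair1_eta:
 assumes "x : Arr V" "Cod V x = ic1 (A \<otimes>\<^bsub>Cat\<^esub> B)"
 shows "pair1 A B (if1 (pr1 Cat A B) o x) (if1 (pr2 Cat A B) o x) = x"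
 by (rule iprod_ext1) (use assms in simp_all)

lemma pair_src [simp]:
 assumes "u : Arr V" "v : Arr V" "Dom V u = Dom V v" "Cod V u = ic1 A" "Cod V v = ic1 B"
 shows "isrc (A \<otimes>\<^bsub>Cat\<^esub> B) o pair1 A B u v = pair0 A B (isrc A o u) (isrc B o v)"
  and "itgt (A \<otimes>\<^bsub>Cat\<^esub> B) o pair1 A B u v = pair0 A B (itgt A o u) (itgt B o v)"
 by (rule iprod_ext0; use assms in simp)+

lemma pair_id [simp]:
 assumes "a : Arr V" "b : Arr V" "Dom V a = Dom V b" "Cod V a = ic0 A" "Cod V b = ic0 B"
 shows "iidn (A \<otimes>\<^bsub>Cat\<^esub> B) o pair0 A B a b = pair1 A B (iidn A o a) (iidn B o b)"
 by (rule iprod_ext1) (use assms in simp_all)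

lemma pair_icomp [simp]:
 assumes [simp]: "u : Arr V" "v : Arr V" "Dom V u = Dom V v" "Cod V u = ic1 A" "Cod V v = ic1 B"
  "u' : Arr V" "v' : Arr V" "Dom V u' = Dom V v" "Dom V v' = Dom V v" "Cod V u' = ic1 A" "Cod V v' = ic1 B"
  "isrc A o u' = itgt A o u" "isrc B o v' = itgt B o v"
 shows "icomp V (A \<otimes>\<^bsub>Cat\<^esub> B) (pair1 A B u' v') (pair1 A B u v) = pair1 A B (icomp V A u' u) (icomp V B v' v)"
 by (rule iprod_ext1) simp_all

end

declare isrc_if1 [simp] and ipr_point [simp del]

lemma if_pairing [simp]:
 assumes F [simp]: "F : Arr Cat" and G [simp]: "G : Arr Cat" "Dom Cat F = Dom Cat G"
  and x [simp]: "x : Arr V"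
 shows "Cod V x = ic0 (Dom Cat G) ==> if0 \<langle>F, G\<rangle>\<^bsub>Cat\<^esub> o x
   = pair0 (Cod Cat F) (Cod Cat G) (if0 F o x) (if0 G o x)"
  and "Cod V x = ic1 (Dom Cat G) ==> if1 \<langle>F, G\<rangle>\<^bsub>Cat\<^esub> o x
   = pair1 (Cod Cat F) (Cod Cat G) (if1 F o x) (if1 G o x)"
proof -
 let ?A = "Cod Cat F" and ?B = "Cod Cat G"
 have 1: "pr1 Cat ?A ?B o\<^bsub>Cat\<^esub> \<langle>F, G\<rangle>\<^bsub>Cat\<^esub> = F" "pr2 Cat ?A ?B o\<^bsub>Cat\<^esub> \<langle>F, G\<rangle>\<^bsub>Cat\<^esub> = G"
  by simp_all
 have e: "if0 (pr1 Cat ?A ?B) o if0 \<langle>F, G\<rangle>\<^bsub>Cat\<^esub> = if0 F" "if0 (pr2 Cat ?A ?B) o if0 \<langle>F, G\<rangle>\<^bsub>Cat\<^esub> = if0 G"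
  "if1 (pr1 Cat ?A ?B) o if1 \<langle>F, G\<rangle>\<^bsub>Cat\<^esub> = if1 F" "if1 (pr2 Cat ?A ?B) o if1 \<langle>F, G\<rangle>\<^bsub>Cat\<^esub> = if1 G"
  using arg_cong[OF 1(1), of if0] arg_cong[OF 1(2), of if0] arg_cong[OF 1(1), of if1] arg_cong[OF 1(2), of if1]
  by (simp_all only: CatV_fun_simps)
 { assume [simp]: "Cod V x = ic0 (Dom Cat G)"
  have "if0 (pr1 Cat ?A ?B) o if0 \<langle>F, G\<rangle>\<^bsub>Cat\<^esub> o x = if0 F o x"
   "if0 (pr2 Cat ?A ?B) o if0 \<langle>F, G\<rangle>\<^bsub>Cat\<^esub> o x = if0 G o x"
   using comp_assoc[of x "if0 \<langle>F, G\<rangle>\<^bsub>Cat\<^esub>" "if0 (pr1 Cat ?A ?B)"]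
    comp_assoc[of x "if0 \<langle>F, G\<rangle>\<^bsub>Cat\<^esub>" "if0 (pr2 Cat ?A ?B)"] by (simp_all add: e)
  then show "if0 \<langle>F, G\<rangle>\<^bsub>Cat\<^esub> o x = pair0 ?A ?B (if0 F o x) (if0 G o x)"
   by - (rule iprod_ext0[of ?A ?B]; simp) }
 { assume [simp]: "Cod V x = ic1 (Dom Cat G)"
  have "if1 (pr1 Cat ?A ?B) o if1 \<langle>F, G\<rangle>\<^bsub>Cat\<^esub> o x = if1 F o x"
   "if1 (pr2 Cat ?A ?B) o if1 \<langle>F, G\<rangle>\<^bsub>Cat\<^esub> o x = if1 G o x"
   using comp_assoc[of x "if1 \<langle>F, G\<rangle>\<^bsub>Cat\<^esub>" "if1 (pr1 Cat ?A ?B)"]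
    comp_assoc[of x "if1 \<langle>F, G\<rangle>\<^bsub>Cat\<^esub>" "if1 (pr2 Cat ?A ?B)"] by (simp_all add: e)
  then show "if1 \<langle>F, G\<rangle>\<^bsub>Cat\<^esub> o x = pair1 ?A ?B (if1 F o x) (if1 G o x)"
   by - (rule iprod_ext1[of ?A ?B]; simp) }
qed

lemma if_ipr_eta:
 assumes "A : Obj Cat" "B : Obj Cat"
 shows "pair0 A B (if0 (pr1 Cat A B)) (if0 (pr2 Cat A B)) = Idn V (ic0 (A \<otimes>\<^bsub>Cat\<^esub> B))"
  and "pair1 A B (if1 (pr1 Cat A B)) (if1 (pr2 Cat A B)) = Idn V (ic1 (A \<otimes>\<^bsub>Cat\<^esub> B))"
 using pair0_eta[OF assms, of "Idn V (ic0 (A \<otimes>\<^bsub>Cat\<^esub> B))"] pair1_eta[OF assms, of "Idn V (ic1 (A \<otimes>\<^bsub>Cat\<^esub> B))"] assms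
 by simp_all

end

section \<open>Exponentials of internal categories by discrete ones\<close>

context pullback_ccc
begin

text \<open>
 The exponential of \<open>A\<close> by \<open>cst X\<close> is computed levelwise: an element of its object of objects or of
 arrows at stage \<open>Z\<close> is a map from \<open>Z \<otimes> X\<close> to the object of objects or of arrows of \<open>A\<close>.
\<close>

definition power :: "'a \<Rightarrow> ('a, 'b) icat \<Rightarrow> ('a, 'b) icat" where
 "power X A =
   (let E0 = \<lbrakk>X, ic0 A\<rbrakk>; E1 = \<lbrakk>X, ic1 A\<rbrakk>;
     s = transpose V E1 X (ic0 A) (isrc A o ev V X (ic1 A));
     t = transpose V E1 X (ic0 A) (itgt A o ev V X (ic1 A));
     P = pb_obj V s t
   in \<lparr>ic0 = E0, ic1 = E1, isrc = s, itgt = t,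
     iidn = transpose V E0 X (ic1 A) (iidn A o ev V X (ic0 A)),
     icmp = transpose V P X (ic1 A) (icomp V A
      (ev V X (ic1 A) o \<langle>pb1 V s t o pr1 V P X, pr2 V P X\<rangle>)
      (ev V X (ic1 A) o \<langle>pb2 V s t o pr1 V P X, pr2 V P X\<rangle>))\<rparr>)"

end

locale icat_power = pullback_ccc V for V (structure) +
 fixes X A
 assumes X [simp]: "X : Obj V" and A [simp]: "A : Obj Cat"
begin

abbreviation "E \<equiv> power X A"
abbreviation "ap0 f a \<equiv> ev V X (ic0 A) o \<langle>f, a\<rangle>"
abbreviation "ap1 f a \<equiv> ev V X (ic1 A) o \<langle>f, a\<rangle>"

lemma Eobj [simp]: "ic0 E = \<lbrakk>X, ic0 A\<rbrakk>" "ic1 E = \<lbrakk>X, ic1 A\<rbrakk>"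
 by (simp_all add: power_def Let_def)

lemma Edefs:
 "isrc E = transpose V \<lbrakk>X, ic1 A\<rbrakk> X (ic0 A) (isrc A o ev V X (ic1 A))"
 "itgt E = transpose V \<lbrakk>X, ic1 A\<rbrakk> X (ic0 A) (itgt A o ev V X (ic1 A))"
 "iidn E = transpose V \<lbrakk>X, ic0 A\<rbrakk> X (ic1 A) (iidn A o ev V X (ic0 A))"
 by (simp_all add: power_def Let_def)

lemma Etypes [simp]:
 "isrc E : Arr V" "Dom V (isrc E) = \<lbrakk>X, ic1 A\<rbrakk>" "Cod V (isrc E) = \<lbrakk>X, ic0 A\<rbrakk>"
 "itgt E : Arr V" "Dom V (itgt E) = \<lbrakk>X, ic1 A\<rbrakk>" "Cod V (itgt E) = \<lbrakk>X, ic0 A\<rbrakk>"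
 "iidn E : Arr V" "Dom V (iidn E) = \<lbrakk>X, ic0 A\<rbrakk>" "Cod V (iidn E) = \<lbrakk>X, ic1 A\<rbrakk>"
 by (simp_all add: Edefs)

lemma Epoints [simp]:
 assumes "f : Arr V" "a : Arr V" "Dom V f = Dom V a" "Cod V a = X"
 shows "Cod V f = \<lbrakk>X, ic1 A\<rbrakk> ==> ap0 (isrc E o f) a = isrc A o ap1 f a"
  and "Cod V f = \<lbrakk>X, ic1 A\<rbrakk> ==> ap0 (itgt E o f) a = itgt A o ap1 f a"
  and "Cod V f = \<lbrakk>X, ic0 A\<rbrakk> ==> ap1 (iidn E o f) a = iidn A o ap0 f a"
 using assms by (simp_all add: Edefs)

lemma comp_ap:
 assumes [simp]: "g : Arr V" "f : Arr V" "Dom V g = Dom V f" "Cod V g = \<lbrakk>X, ic1 A\<rbrakk>" "Cod V f = \<lbrakk>X, ic1 A\<rbrakk>"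
  and eq: "isrc E o g = itgt E o f" and [simp]: "a : Arr V" "Dom V f = Dom V a" "Cod V a = X"
 shows "isrc A o ap1 g a = itgt A o ap1 f a"
proof -
 have "ap0 (isrc E o g) a = ap0 (itgt E o f) a" by (simp only: eq)
 then show ?thesis by simp
qed

abbreviation "p \<equiv> pb1 V (isrc E) (itgt E)"
abbreviation "q \<equiv> pb2 V (isrc E) (itgt E)"
abbreviation "W \<equiv> pb_obj V (isrc E) (itgt E)"

lemma pq_comp: "isrc A o ap1 (p o pr1 V W X) (pr2 V W X) = itgt A o ap1 (q o pr1 V W X) (pr2 V W X)"
 by (rule comp_ap) (simp_all add: pb_square_point)

lemma icmp_E: "icmp E = transpose V W X (ic1 A)
  (icomp V A (ap1 (p o pr1 V W X) (pr2 V W X)) (ap1 (q o pr1 V W X) (pr2 V W X)))"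
 by (simp add: power_def Let_def)

lemma icmp_E_in_hom: "icmp E : Arr V" "Dom V (icmp E) = W" "Cod V (icmp E) = \<lbrakk>X, ic1 A\<rbrakk>"
 by (simp_all add: icmp_E pq_comp)

lemma Ecomp:
 assumes [simp]: "g : Arr V" "f : Arr V" "Dom V g = Dom V f" "Cod V g = \<lbrakk>X, ic1 A\<rbrakk>" "Cod V f = \<lbrakk>X, ic1 A\<rbrakk>"
  and eq [simp]: "isrc E o g = itgt E o f"
 shows "icomp V E g f : Arr V" "Dom V (icomp V E g f) = Dom V f" "Cod V (icomp V E g f) = \<lbrakk>X, ic1 A\<rbrakk>"
  and "x : Arr V ==> a : Arr V ==> Dom V x = Dom V a ==> Cod V x = Dom V f ==> Cod V a = X ==>
   ap1 (icmp E o pb_pair V (isrc E) (itgt E) (g o x) (f o x)) a = icomp V A (ap1 (g o x) a) (ap1 (f o x) a)"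
proof -
 note [simp] = icmp_E_in_hom
 show "icomp V E g f : Arr V" "Dom V (icomp V E g f) = Dom V f" "Cod V (icomp V E g f) = \<lbrakk>X, ic1 A\<rbrakk>" by simp_all
 assume x: "x : Arr V" "a : Arr V" "Dom V x = Dom V a" "Cod V x = Dom V f" "Cod V a = X"
 note [simp] = x pq_comp
 have [simp]: "isrc E o g o x = itgt E o f o x" by (rule square_point[OF eq]) simp_all
 have ca: "isrc A o ap1 (g o x) a = itgt A o ap1 (f o x) a" by (rule comp_ap) simp_all
 have "ap1 (icmp E o pb_pair V (isrc E) (itgt E) (g o x) (f o x)) a
  = icomp V A (ap1 (p o pr1 V W X) (pr2 V W X)) (ap1 (q o pr1 V W X) (pr2 V W X)) o
    \<langle>pb_pair V (isrc E) (itgt E) (g o x) (f o x), a\<rangle>"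
  unfolding icmp_E by (rule beta) simp_all
 then show "ap1 (icmp E o pb_pair V (isrc E) (itgt E) (g o x) (f o x)) a = icomp V A (ap1 (g o x) a) (ap1 (f o x) a)"
  by simp
qed

lemma Eext0:
 assumes "h : Arr V" "k : Arr V" "Dom V h = Dom V k" "Cod V h = \<lbrakk>X, ic0 A\<rbrakk>" "Cod V k = \<lbrakk>X, ic0 A\<rbrakk>"
  "\<And>Y y a. y : hom V Y (Dom V k) ==> a : hom V Y X ==> ap0 (h o y) a = ap0 (k o y) a"
 shows "h = k"
 by (rule exp_ext[of h "Dom V k" X "ic0 A" k]) (use assms in \<open>simp_all add: in_hom\<close>)

lemma Eext1:
 assumes "h : Arr V" "k : Arr V" "Dom V h = Dom V k" "Cod V h = \<lbrakk>X, ic1 A\<rbrakk>" "Cod V k = \<lbrakk>X, ic1 A\<rbrakk>"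
  "\<And>Y y a. y : hom V Y (Dom V k) ==> a : hom V Y X ==> ap1 (h o y) a = ap1 (k o y) a"
 shows "h = k"
 by (rule exp_ext[of h "Dom V k" X "ic1 A" k]) (use assms in \<open>simp_all add: in_hom\<close>)

lemma Ecomp_ends:
 assumes fg: "g : Arr V" "f : Arr V" "Dom V g = Dom V f" "Cod V g = \<lbrakk>X, ic1 A\<rbrakk>" "Cod V f = \<lbrakk>X, ic1 A\<rbrakk>"
  and eq: "isrc E o g = itgt E o f"
 shows "isrc E o icomp V E g f = isrc E o f" "itgt E o icomp V E g f = itgt E o g"
proof -
 have fgx: "isrc E o g o x = itgt E o f o x" if "x : Arr V" "Cod V x = Dom V f" for x
  by (rule square_point[OF eq]) (use that fg in simp_all)
 note [simp] = fg icmp_E_in_hom eq fgx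
 note [simp] = Ecomp(4)[OF _ _ _ _ _ eq] comp_ap[OF _ _ _ _ _ fgx]
 have k: "ap0 ((isrc E o icomp V E g f) o y) a = isrc A o ap1 (f o y) a"
  "ap0 ((itgt E o icomp V E g f) o y) a = itgt A o ap1 (g o y) a"
  if "y : Arr V" "a : Arr V" "Dom V y = Dom V a" "Cod V y = Dom V f" "Cod V a = X" for y a
  using that by simp_all
 show "isrc E o icomp V E g f = isrc E o f"
  by (rule Eext0) (simp_all del: comp_assoc add: k in_hom, simp_all)
 show "itgt E o icomp V E g f = itgt E o g"
  by (rule Eext0) (simp_all del: comp_assoc add: k in_hom, simp_all)
qed

lemma power_icat: "E : Obj Cat"
proof (rule is_icatI)
 show "icmp E : hom V (pb_obj V (isrc E) (itgt E)) (ic1 E)"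
  by (simp add: in_hom icmp_E_in_hom)
next
 fix Z x assume x: "x : hom V Z (ic0 E)"
 note [simp] = homD[OF x, simplified]
 show "isrc E o iidn E o x = x" "itgt E o iidn E o x = x"
  by (rule Eext0; simp add: in_hom)+
next
 fix Z g f assume f: "f : hom V Z (ic1 E)" and g: "g : hom V Z (ic1 E)" and eq: "isrc E o g = itgt E o f"
 show "isrc E o icomp V E g f = isrc E o f" "itgt E o icomp V E g f = itgt E o g"
  using homD[OF f, simplified] homD[OF g, simplified] eq by (auto intro!: Ecomp_ends)
next
 fix Z h g f assume f: "f : hom V Z (ic1 E)" and g: "g : hom V Z (ic1 E)" and h: "h : hom V Z (ic1 E)"
  and eq: "isrc E o g = itgt E o f" and eq': "isrc E o h = itgt E o g"
 note fg = homD[OF f, simplified] homD[OF g, simplified] homD[OF h, simplified]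
 have fgx: "isrc E o g o x = itgt E o f o x" "isrc E o h o x = itgt E o g o x" if "x : Arr V" "Cod V x = Z" for x
  by (rule square_point[OF eq] square_point[OF eq'], use that fg in simp_all)+
 note [simp] = fg icmp_E_in_hom eq eq' fgx
 note [simp] = Ecomp(4)[OF _ _ _ _ _ eq] comp_ap[OF _ _ _ _ _ fgx(1)] Ecomp(4)[OF _ _ _ _ _ eq'] comp_ap[OF _ _ _ _ _ fgx(2)]
 have s: "isrc E o icomp V E h g = itgt E o f" "isrc E o h = itgt E o icomp V E g f"
  using Ecomp_ends[OF _ _ _ _ _ eq'] Ecomp_ends[OF _ _ _ _ _ eq] eq eq' by simp_all
 show "icomp V E (icomp V E h g) f = icomp V E h (icomp V E g f)"
 proof (rule Eext1)
  fix Y y a assume y: "y : hom V Y (Dom V (icomp V E h (icomp V E g f)))" and a: "a : hom V Y X"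
  have y': "y : hom V Y Z" using y s by (simp add: in_hom)
  note [simp] = homD[OF y'] homD[OF a]
  have 1: "ap1 (icmp E o pb_pair V (isrc E) (itgt E) (icomp V E h g o y) (f o y)) a
    = icomp V A (ap1 (icomp V E h g o y) a) (ap1 (f o y) a)"
   by (rule Ecomp(4)[OF _ _ _ _ _ s(1)]) simp_all
  have 2: "ap1 (icmp E o pb_pair V (isrc E) (itgt E) (h o y) (icomp V E g f o y)) a
    = icomp V A (ap1 (h o y) a) (ap1 (icomp V E g f o y) a)"
   by (rule Ecomp(4)[OF _ _ _ _ _ s(2)]) simp_all
  have sy: "isrc E o icomp V E h g o y = itgt E o f o y" "isrc E o h o y = itgt E o icomp V E g f o y"
   using square_point[OF s(1), of y] square_point[OF s(2), of y] s by simp_all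
  have "ap1 (icomp V E (icomp V E h g) f o y) a = icomp V A (ap1 (icomp V E h g o y) a) (ap1 (f o y) a)"
   using 1 s sy by simp
  moreover have "ap1 (icomp V E h (icomp V E g f) o y) a = icomp V A (ap1 (h o y) a) (ap1 (icomp V E g f o y) a)"
   using 2 s sy by simp
  ultimately show "ap1 (icomp V E (icomp V E h g) f o y) a = ap1 (icomp V E h (icomp V E g f) o y) a"
   by (simp add: icomp_assoc)
 qed (use s in \<open>simp_all add: in_hom\<close>)
next
 fix Z f assume f: "f : hom V Z (ic1 E)"
 note fg = homD[OF f, simplified]
 note [simp] = fg icmp_E_in_hom
 have 1: "isrc E o f = itgt E o iidn E o isrc E o f" "isrc E o iidn E o itgt E o f = itgt E o f"
  by (rule Eext0; simp add: in_hom)+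
 have sx: "isrc E o f o x = itgt E o iidn E o isrc E o f o x" "isrc E o iidn E o itgt E o f o x = itgt E o f o x"
  if "x : Arr V" "Cod V x = Z" for x
  using square_point[OF 1(1), of x] square_point[OF 1(2), of x] that by simp_all
 have [simp]: "ap1 (icmp E o pb_pair V (isrc E) (itgt E) (f o y) (iidn E o isrc E o f o y)) a
   = icomp V A (ap1 (f o y) a) (ap1 (iidn E o isrc E o f o y) a)"
  "ap1 (icmp E o pb_pair V (isrc E) (itgt E) (iidn E o itgt E o f o y) (f o y)) a
   = icomp V A (ap1 (iidn E o itgt E o f o y) a) (ap1 (f o y) a)"
  if "y : Arr V" "a : Arr V" "Dom V y = Dom V a" "Cod V y = Z" "Cod V a = X" for y a
  using Ecomp(4)[OF _ _ _ _ _ 1(1), of y a] Ecomp(4)[OF _ _ _ _ _ 1(2), of y a] that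
  by (simp_all del: Epoints)
 note [simp] = 1(1)[symmetric] 1(2) sx(1)[symmetric] sx(2)
 show "icomp V E f (iidn E o isrc E o f) = f"
  by (rule Eext1) (simp_all add: in_hom)
 show "icomp V E (iidn E o itgt E o f) f = f"
  by (rule Eext1) (simp_all add: in_hom)
qed (simp_all add: in_hom)

lemma power_apply_in_hom:
 "\<lparr>idom = E \<otimes>\<^bsub>Cat\<^esub> cst V X, icod = A,
   if0 = ap0 (if0 (pr1 Cat E (cst V X))) (if0 (pr2 Cat E (cst V X))),
   if1 = ap1 (if1 (pr1 Cat E (cst V X))) (if1 (pr2 Cat E (cst V X)))\<rparr>
  \<in> hom Cat (E \<otimes>\<^bsub>Cat\<^esub> cst V X) A"
proof (rule is_ifunI)
 note [simp] = power_icat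
 let ?P = "E \<otimes>\<^bsub>Cat\<^esub> cst V X"
 fix Z v u assume u: "u : hom V Z (ic1 ?P)" and v: "v : hom V Z (ic1 ?P)" and eq: "isrc ?P o v = itgt ?P o u"
 note uv = homD[OF u] homD[OF v]
 note [simp] = uv
 let ?p1 = "if1 (pr1 Cat E (cst V X))" and ?q1 = "if1 (pr2 Cat E (cst V X))"
 have e1: "isrc E o ?p1 o v = itgt E o ?p1 o u"
  using eq by simp
 have e2: "?q1 o v = ?q1 o u"
  using isrc_if1[of "pr2 Cat E (cst V X)" "cst V X" v] isrc_if1(2)[of "pr2 Cat E (cst V X)" "cst V X" u] eq by simp
 define a b x where abx: "a = ?p1 o v" "b = ?p1 o u" "x = ?q1 o u"
 have [simp]: "a : Arr V" "b : Arr V" "x : Arr V" "Dom V a = Z" "Dom V b = Z" "Dom V x = Z"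
  "Cod V a = \<lbrakk>X, ic1 A\<rbrakk>" "Cod V b = \<lbrakk>X, ic1 A\<rbrakk>" "Cod V x = X" by (simp_all add: abx)
 have e: "isrc E o a = itgt E o b" using e1 by (simp only: abx)
 have 1: "?p1 o icomp V ?P v u = icomp V E a b" "?q1 o icomp V ?P v u = x"
  unfolding abx using eq e2 by simp_all
 have 2: "ap1 ?p1 ?q1 o v = ap1 a x" "ap1 ?p1 ?q1 o u = ap1 b x"
  unfolding abx e2[symmetric] by simp_all (simp_all add: e2)
 have [simp]: "icomp V ?P v u : Arr V" "Cod V (icomp V ?P v u) = ic1 ?P" "Dom V (icomp V ?P v u) = Z"
  using eq by simp_all
 have "ap1 ?p1 ?q1 o icomp V ?P v u = ap1 (?p1 o icomp V ?P v u) (?q1 o icomp V ?P v u)"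
  by (simp del: if1_icomp)
 also have "\<dots> = ap1 (icomp V E a b) x" unfolding 1 ..
 also have "\<dots> = icomp V A (ap1 a x) (ap1 b x)"
  using Ecomp(4)[OF _ _ _ _ _ e, of "Idn V Z" x] homD(4)[OF u] by simp
 finally show "ap1 ?p1 ?q1 o icomp V ?P v u = icomp V A (ap1 ?p1 ?q1 o v) (ap1 ?p1 ?q1 o u)"
  unfolding 2 .
next
 note [simp] = power_icat
 let ?P = "E \<otimes>\<^bsub>Cat\<^esub> cst V X"
 fix Z u assume u: "u : hom V Z (ic1 ?P)"
 note [simp] = homD[OF u]
 let ?p1 = "if1 (pr1 Cat E (cst V X))" and ?q1 = "if1 (pr2 Cat E (cst V X))"
 let ?p0 = "if0 (pr1 Cat E (cst V X))" and ?q0 = "if0 (pr2 Cat E (cst V X))"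
 note [simp del] = isrc_if1 and [simp] = ipr_point
 show "isrc A o ap1 ?p1 ?q1 o u = ap0 ?p0 ?q0 o isrc ?P o u"
  "itgt A o ap1 ?p1 ?q1 o u = ap0 ?p0 ?q0 o itgt ?P o u"
  by simp_all
next
 note [simp] = power_icat
 let ?P = "E \<otimes>\<^bsub>Cat\<^esub> cst V X"
 fix Z x assume x: "x : hom V Z (ic0 ?P)"
 note [simp] = homD[OF x]
 show "ap1 (if1 (pr1 Cat E (cst V X))) (if1 (pr2 Cat E (cst V X))) o iidn ?P o x
  = iidn A o ap0 (if0 (pr1 Cat E (cst V X))) (if0 (pr2 Cat E (cst V X))) o x"
  by simp
qed (use power_icat in \<open>simp_all add: in_hom\<close>)

abbreviation "apply \<equiv> \<lparr>idom = E \<otimes>\<^bsub>Cat\<^esub> cst V X, icod = A,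
   if0 = ap0 (if0 (pr1 Cat E (cst V X))) (if0 (pr2 Cat E (cst V X))),
   if1 = ap1 (if1 (pr1 Cat E (cst V X))) (if1 (pr2 Cat E (cst V X)))\<rparr>"

lemma power_is_exponential: "is_exponential Cat (cst V X) A E apply"
 unfolding is_exponential_def
proof (intro conjI ballI)
 note [simp] = power_icat
 show "E : Obj Cat" "apply : hom Cat (E \<otimes>\<^bsub>Cat\<^esub> cst V X) A"
  by (rule power_icat power_apply_in_hom)+
 note [simp] = Cat.homD(1)[OF power_apply_in_hom]
 fix Y F assume Y [simp]: "Y : Obj Cat" and F: "F : hom Cat (Y \<otimes>\<^bsub>Cat\<^esub> cst V X) A"
 note [simp] = Cat.homD(1-3)[OF F]
 let ?c = "cst V X"
 have ap: "if0 (apply o\<^bsub>Cat\<^esub> \<langle>h o\<^bsub>Cat\<^esub> pr1 Cat Y ?c, pr2 Cat Y ?c\<rangle>\<^bsub>Cat\<^esub>) o pair0 Y ?c y x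
   = ap0 (if0 h o y) x"
  "if1 (apply o\<^bsub>Cat\<^esub> \<langle>h o\<^bsub>Cat\<^esub> pr1 Cat Y ?c, pr2 Cat Y ?c\<rangle>\<^bsub>Cat\<^esub>) o pair1 Y ?c y' x
   = ap1 (if1 h o y') x"
  if h: "h : hom Cat Y E" and xy: "x : hom V Z X" "y : hom V Z (ic0 Y)" "y' : hom V Z (ic1 Y)" for h x y y' Z
 proof -
  note [simp] = Cat.homD(1-3)[OF h] homD[OF xy(1)] homD[OF xy(2)] homD[OF xy(3)]
  show "if0 (apply o\<^bsub>Cat\<^esub> \<langle>h o\<^bsub>Cat\<^esub> pr1 Cat Y ?c, pr2 Cat Y ?c\<rangle>\<^bsub>Cat\<^esub>) o pair0 Y ?c y x
    = ap0 (if0 h o y) x"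
   "if1 (apply o\<^bsub>Cat\<^esub> \<langle>h o\<^bsub>Cat\<^esub> pr1 Cat Y ?c, pr2 Cat Y ?c\<rangle>\<^bsub>Cat\<^esub>) o pair1 Y ?c y' x
    = ap1 (if1 h o y') x" by simp_all
 qed
 define h0 where "h0 = transpose V (ic0 Y) X (ic0 A) (if0 F o pair0 Y ?c (pr1 V (ic0 Y) X) (pr2 V (ic0 Y) X))"
 define h1 where "h1 = transpose V (ic1 Y) X (ic1 A) (if1 F o pair1 Y ?c (pr1 V (ic1 Y) X) (pr2 V (ic1 Y) X))"
 have h01 [simp]: "h0 : Arr V" "Dom V h0 = ic0 Y" "Cod V h0 = \<lbrakk>X, ic0 A\<rbrakk>"
  "h1 : Arr V" "Dom V h1 = ic1 Y" "Cod V h1 = \<lbrakk>X, ic1 A\<rbrakk>" by (simp_all add: h0_def h1_def)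
 have h0 [simp]: "ap0 (h0 o y) x = if0 F o pair0 Y ?c y x"
  if "y : Arr V" "x : Arr V" "Dom V y = Dom V x" "Cod V y = ic0 Y" "Cod V x = X" for x y
  using that by (simp add: h0_def)
 have h1 [simp]: "ap1 (h1 o y) x = if1 F o pair1 Y ?c y x"
  if "y : Arr V" "x : Arr V" "Dom V y = Dom V x" "Cod V y = ic1 Y" "Cod V x = X" for x y
  using that by (simp add: h1_def)
 let ?h = "\<lparr>idom = Y, icod = E, if0 = h0, if1 = h1\<rparr>"
 have h: "?h : hom Cat Y E"
 proof (rule is_ifunI)
  fix Z v u assume u: "u : hom V Z (ic1 Y)" and v: "v : hom V Z (ic1 Y)" and eq: "isrc Y o v = itgt Y o u"
  note [simp] = homD[OF u] homD[OF v] eq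
  have eq' [simp]: "isrc Y o v o z = itgt Y o u o z" if "z : Arr V" "Cod V z = Z" for z
   by (rule square_point[OF eq]) (use that in simp_all)
  have s: "isrc E o h1 o v = itgt E o h1 o u" by (rule Eext0) (simp_all add: in_hom)
  have s' [simp]: "isrc E o h1 o v o z = itgt E o h1 o u o z" if "z : Arr V" "Cod V z = Z" for z
   using square_point[OF s, of z] that by simp
  note [simp] = icmp_E_in_hom
  have c: "ap1 (icmp E o pb_pair V (isrc E) (itgt E) (h1 o v o z) (h1 o u o z)) a
    = icomp V A (ap1 (h1 o v o z) a) (ap1 (h1 o u o z) a)"
   if "z : Arr V" "a : Arr V" "Dom V z = Dom V a" "Cod V z = Z" "Cod V a = X" for z a
   using Ecomp(4)[OF _ _ _ _ _ s, of z a] that by simp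
  show "h1 o icomp V Y v u = icomp V E (h1 o v) (h1 o u)"
  proof (rule Eext1)
   fix W y a assume y: "y : hom V W (Dom V (icomp V E (h1 o v) (h1 o u)))" and a: "a : hom V W X"
   have y': "y : hom V W Z" using y s by (simp add: in_hom)
   note [simp] = homD[OF y'] homD[OF a]
   have 1: "ap1 ((h1 o icomp V Y v u) o y) a = if1 F o pair1 Y ?c (icomp V Y (v o y) (u o y)) a" by simp
   have 2: "pair1 Y ?c (icomp V Y (v o y) (u o y)) a
     = icomp V (Y \<otimes>\<^bsub>Cat\<^esub> ?c) (pair1 Y ?c (v o y) a) (pair1 Y ?c (u o y) a)" by simp
   have 3: "isrc (Y \<otimes>\<^bsub>Cat\<^esub> ?c) o pair1 Y ?c (v o y) a = itgt (Y \<otimes>\<^bsub>Cat\<^esub> ?c) o pair1 Y ?c (u o y) a" by simp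
   have "if1 F o pair1 Y ?c (icomp V Y (v o y) (u o y)) a
    = icomp V A (if1 F o pair1 Y ?c (v o y) a) (if1 F o pair1 Y ?c (u o y) a)"
    unfolding 2 by (subst if1_icomp) (simp_all add: 3)
   then show "ap1 ((h1 o icomp V Y v u) o y) a = ap1 (icomp V E (h1 o v) (h1 o u) o y) a"
    unfolding 1 using s by (simp add: c)
  qed (use s in simp_all)
 next
  fix Z u assume u: "u : hom V Z (ic1 Y)"
  note [simp] = homD[OF u]
  show "isrc E o h1 o u = h0 o isrc Y o u" by (rule Eext0) (simp_all add: in_hom)
  show "itgt E o h1 o u = h0 o itgt Y o u" by (rule Eext0) (simp_all add: in_hom)
 next
  fix Z x assume x: "x : hom V Z (ic0 Y)"
  note [simp] = homD[OF x]
  show "h1 o iidn Y o x = iidn E o h0 o x"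
  proof (rule Eext1)
   fix W y a assume y: "y : hom V W (Dom V (iidn E o h0 o x))" and a: "a : hom V W X"
   then have y': "y : hom V W Z" by simp
   note [simp] = homD[OF y'] homD[OF a]
   have "pair1 Y ?c (iidn Y o x o y) a = iidn (Y \<otimes>\<^bsub>Cat\<^esub> ?c) o pair0 Y ?c (x o y) a" by simp
   moreover have "if1 F o iidn (Y \<otimes>\<^bsub>Cat\<^esub> ?c) o pair0 Y ?c (x o y) a = iidn A o if0 F o pair0 Y ?c (x o y) a"
    by (subst if1_iidn) simp_all
   ultimately show "ap1 ((h1 o iidn Y o x) o y) a = ap1 ((iidn E o h0 o x) o y) a" by simp
  qed simp_all
 qed (simp_all add: in_hom)
 show "\<exists>!h. h : hom Cat Y E \<and> apply o\<^bsub>Cat\<^esub> \<langle>h o\<^bsub>Cat\<^esub> pr1 Cat Y ?c, pr2 Cat Y ?c\<rangle>\<^bsub>Cat\<^esub> = F"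
 proof (rule ex1I[of _ ?h], intro conjI)
  show "?h : hom Cat Y E" by (rule h)
  note [simp] = Cat.homD(1)[OF h]
  have p: "pair0 Y ?c (if0 (pr1 Cat Y ?c)) (if0 (pr2 Cat Y ?c)) = Idn V (ic0 (Y \<otimes>\<^bsub>Cat\<^esub> ?c))"
   "pair1 Y ?c (if1 (pr1 Cat Y ?c)) (if1 (pr2 Cat Y ?c)) = Idn V (ic1 (Y \<otimes>\<^bsub>Cat\<^esub> ?c))"
   by (rule if_ipr_eta; simp)+
  let ?F' = "apply o\<^bsub>Cat\<^esub> \<langle>?h o\<^bsub>Cat\<^esub> pr1 Cat Y ?c, pr2 Cat Y ?c\<rangle>\<^bsub>Cat\<^esub>"
  have "if0 ?F' o pair0 Y ?c (if0 (pr1 Cat Y ?c)) (if0 (pr2 Cat Y ?c))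
    = if0 F o pair0 Y ?c (if0 (pr1 Cat Y ?c)) (if0 (pr2 Cat Y ?c))"
   using ap(1)[OF h, of "if0 (pr2 Cat Y ?c)" "ic0 (Y \<otimes>\<^bsub>Cat\<^esub> ?c)" "if0 (pr1 Cat Y ?c)"
     "iidn Y o if0 (pr1 Cat Y ?c)"] by (simp add: in_hom)
  moreover have "if1 ?F' o pair1 Y ?c (if1 (pr1 Cat Y ?c)) (if1 (pr2 Cat Y ?c))
    = if1 F o pair1 Y ?c (if1 (pr1 Cat Y ?c)) (if1 (pr2 Cat Y ?c))"
   using ap(2)[OF h, of "if1 (pr2 Cat Y ?c)" "ic1 (Y \<otimes>\<^bsub>Cat\<^esub> ?c)" "isrc Y o if1 (pr1 Cat Y ?c)"
     "if1 (pr1 Cat Y ?c)"] by (simp add: in_hom)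
  ultimately show "?F' = F"
   unfolding p by - (rule ifun_ext; simp)
  fix k assume k: "k : hom Cat Y E \<and> apply o\<^bsub>Cat\<^esub> \<langle>k o\<^bsub>Cat\<^esub> pr1 Cat Y ?c, pr2 Cat Y ?c\<rangle>\<^bsub>Cat\<^esub> = F"
  then have k': "k : hom Cat Y E" by blast
  note [simp] = Cat.homD(1-3)[OF k']
  have "ap0 (if0 k o y) x = if0 F o pair0 Y ?c y x" if "x : hom V Z X" "y : hom V Z (ic0 Y)" for x y Z
   using ap(1)[OF k' that, of "iidn Y o y"] homD[OF that(1)] homD[OF that(2)] k by (simp add: in_hom)
  note k0 = this
  have "ap1 (if1 k o y) x = if1 F o pair1 Y ?c y x" if "x : hom V Z X" "y : hom V Z (ic1 Y)" for x y Z
   using ap(2)[OF k' that(1) _ that(2), of "isrc Y o y"] homD[OF that(1)] homD[OF that(2)] k by (simp add: in_hom)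
  note k1 = this
  show "k = ?h"
  proof (rule ifun_ext)
   show "if0 k = if0 ?h"
    by (rule Eext0) (simp_all add: k0 homD)
   show "if1 k = if1 ?h"
    by (rule Eext1) (simp_all add: k1 homD)
  qed simp_all
 qed
qed

end

section \<open>The internal category of a small enriched category\<close>

lemma (in extensive_cat) from_void:
 assumes "u : hom V X \<zero>" "Y : Obj V"
 obtains m where "m : hom V X Y"
 using from_zero[OF assms(2)] comp_in_hom[OF assms(1)] by blast

locale int_cat = extensive_cat V U for U :: "'u itself" and V :: "('a, 'b) category" (structure) +
 fixes C :: "('a, 'b, 'c) vcat"
 assumes C [simp]: "is_vcat V C" and small: "small U (VOb C)"
begin

abbreviation "Obs \<equiv> Int_obj V C"
abbreviation "M \<equiv> Int_arr V C"
abbreviation "obj A \<equiv> Int_obj_incl V C A"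
abbreviation "arr A B \<equiv> Int_arr_incl V C A B"

lemma objects: "is_coproduct V (VOb C) (\<lambda>A. \<one>) Obs (Int_obj_incl V C)"
 unfolding Int_obj_def Int_obj_incl_def by (rule coproduct[OF small]) simp

lemma small2: "small U (VOb C \<times> VOb C)"
 by (rule small_Times[OF infinite_universe small small])

lemma arrows: "is_coproduct V (VOb C \<times> VOb C) (\<lambda>(A, B). VHom C A B) M (\<lambda>(A, B). arr A B)"
proof -
 have "is_coproduct V (VOb C \<times> VOb C) (\<lambda>(A, B). VHom C A B) M (incl V (VOb C \<times> VOb C) (\<lambda>(A, B). VHom C A B))"
  unfolding Int_arr_def by (rule coproduct[OF small2]) auto
 then show ?thesis unfolding Int_arr_incl_def by (simp add: case_prod_eta)
qed

lemma obj_in_hom: "A : VOb C ==> obj A : hom V \<one> Obs"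
 by (rule coproductD(2)[OF objects])

lemma arr_in_hom: "A : VOb C ==> B : VOb C ==> arr A B : hom V (VHom C A B) M"
 using coproductD(2)[OF arrows, of "(A, B)"] by simp

lemmas incl_simps [simp] = homD(1-3)[OF obj_in_hom] homD(1-3)[OF arr_in_hom]

lemma OM [simp]: "Obs : Obj V" "M : Obj V"
 by (rule coproductD(1)[OF objects] coproductD(1)[OF arrows])+

lemma obj_desc:
 assumes "Y : Obj V" "\<And>A. A : VOb C ==> f A : hom V \<one> Y"
 shows "cotuple V (VOb C) (\<lambda>A. \<one>) Y f : hom V Obs Y"
  and "A : VOb C ==> cotuple V (VOb C) (\<lambda>A. \<one>) Y f o obj A = f A"
 using cotuple_props[OF objects[unfolded Int_obj_def, unfolded Int_obj_incl_def] assms(1), of f] assms(2)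
 unfolding Int_obj_def Int_obj_incl_def by blast+

lemma arr_desc:
 assumes Y: "Y : Obj V" and f: "\<And>A B. A : VOb C ==> B : VOb C ==> f A B : hom V (VHom C A B) Y"
 shows "cotuple V (VOb C \<times> VOb C) (\<lambda>(A, B). VHom C A B) Y (\<lambda>(A, B). f A B) \<in> hom V M Y"
  and "A : VOb C ==> B : VOb C ==>
   cotuple V (VOb C \<times> VOb C) (\<lambda>(A, B). VHom C A B) Y (\<lambda>(A, B). f A B) o arr A B = f A B"
proof -
 have cop: "is_coproduct V (VOb C \<times> VOb C) (\<lambda>(A, B). VHom C A B) (coprod_obj V (VOb C \<times> VOb C) (\<lambda>(A, B). VHom C A B))
  (incl V (VOb C \<times> VOb C) (\<lambda>(A, B). VHom C A B))"
  by (rule coproduct[OF small2]) auto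
 have g: "(\<lambda>(A, B). f A B) k : hom V ((\<lambda>(A, B). VHom C A B) k) Y" if "k : VOb C \<times> VOb C" for k
  using that f by auto
 show "cotuple V (VOb C \<times> VOb C) (\<lambda>(A, B). VHom C A B) Y (\<lambda>(A, B). f A B) \<in> hom V M Y"
  unfolding Int_arr_def by (rule cotuple_props(1)[OF cop Y g])
 show "cotuple V (VOb C \<times> VOb C) (\<lambda>(A, B). VHom C A B) Y (\<lambda>(A, B). f A B) o arr A B = f A B"
  if "A : VOb C" "B : VOb C"
  using cotuple_props(2)[OF cop Y g, of "(A, B)"] that unfolding Int_arr_incl_def by simp
qed

lemma Int_src: "Int_src V C : hom V M Obs"
  "A : VOb C ==> B : VOb C ==> Int_src V C o arr A B = obj A o bang V (VHom C A B)"
 unfolding Int_src_def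
 by (rule arr_desc(1); simp add: in_hom) (rule arr_desc(2)[of Obs "\<lambda>A B. obj A o bang V (VHom C A B)"]; simp add: in_hom)

lemma Int_tgt: "Int_tgt V C : hom V M Obs"
  "A : VOb C ==> B : VOb C ==> Int_tgt V C o arr A B = obj B o bang V (VHom C A B)"
 unfolding Int_tgt_def
 by (rule arr_desc(1); simp add: in_hom) (rule arr_desc(2)[of Obs "\<lambda>A B. obj B o bang V (VHom C A B)"]; simp add: in_hom)

abbreviation "I \<equiv> Int_cat V C"

lemma Int_cat_simps [simp]: "ic0 I = Obs" "ic1 I = M" "isrc I = Int_src V C" "itgt I = Int_tgt V C"
 by (simp_all add: Int_cat_def)

lemma Int_iidn: "iidn I : hom V Obs M" "A : VOb C ==> iidn I o obj A = arr A A o VId C A"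
 unfolding Int_cat_def icat.simps
 by (rule obj_desc(1); simp add: in_hom) (rule obj_desc(2); simp add: in_hom)

lemmas Int_types [simp] = homD(1-3)[OF Int_src(1)] homD(1-3)[OF Int_tgt(1)] homD(1-3)[OF Int_iidn(1)]

lemma Int_points [simp]:
 assumes "A : VOb C" "f : Arr V"
 shows "B : VOb C ==> Cod V f = VHom C A B ==> Int_src V C o arr A B o f = obj A o bang V (Dom V f)"
  and "B : VOb C ==> Cod V f = VHom C A B ==> Int_tgt V C o arr A B o f = obj B o bang V (Dom V f)"
  and "Cod V f = \<one> ==> iidn I o obj A o f = arr A A o VId C A o f"
 using square_point[OF Int_src(2), of A B f] square_point[OF Int_tgt(2), of A B f]
  square_point[OF Int_iidn(2), of A f] assms by simp_all

subsection \<open>Local reasoning over the summands\<close>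

text \<open>
 Distinct summands are disjoint. In the arguments below the second alternative is harmless: a stage
 with a map to \<open>\<zero>\<close> carries only one map to each object.
\<close>

lemma obj_disjoint:
 assumes "A : VOb C" "B : VOb C" "x : hom V X \<one>" "y : hom V X \<one>" "obj A o x = obj B o y"
 shows "A = B \<or> (\<exists>u. u : hom V X \<zero>)"
 using incl_disjoint[OF small objects assms(1,2) _ assms(3-5)] by blast

lemma arr_mono:
 assumes "A : VOb C" "B : VOb C" "f : hom V X (VHom C A B)" "g : hom V X (VHom C A B)" "arr A B o f = arr A B o g"
 shows "f = g"
 using incl_mono[OF small2 arrows, of "(A, B)" f X g] assms by simp

lemma arr_eqE:
 assumes A: "A : VOb C" "B : VOb C" "A' : VOb C" "B' : VOb C"
  and f: "f : hom V X (VHom C A B)" "f' : hom V X (VHom C A' B')" and eq: "arr A B o f = arr A' B' o f'"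
 obtains "A' = A" "B' = B" "f' = f" | u where "u : hom V X \<zero>"
proof (cases "(A, B) = (A', B')")
 case True
 then show thesis using arr_mono[OF A(1,2) f(1)] f(2) eq that(1) by auto
next
 case False
 then show thesis
  using incl_disjoint[OF small2 arrows, of "(A, B)" "(A', B')" f X f'] A f eq that(2) by auto
qed

lemma local_obj:
 assumes a: "a : hom V X Obs" and f: "f : hom V X Y" "g : hom V X Y"
  and eq: "\<And>W w A. w : hom V W X ==> A : VOb C ==> a o w = obj A o bang V W ==> f o w = g o w"
 shows "f = g"
proof (rule local_ext[OF small objects a f])
 fix W w A x assume w: "w : hom V W X" and A: "A : VOb C" and x: "x : hom V W \<one>" and aw: "a o w = obj A o x"
 have "x = bang V W" using bang_unique[of x] homD[OF x] by simp
 then show "f o w = g o w" using eq[OF w A] aw by simp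
qed

lemma local_arr:
 assumes u: "u : hom V X M" and f: "f : hom V X Y" "g : hom V X Y"
  and eq: "\<And>W w A B h. w : hom V W X ==> A : VOb C ==> B : VOb C ==> h : hom V W (VHom C A B) ==>
   u o w = arr A B o h ==> f o w = g o w"
 shows "f = g"
proof (rule local_ext[OF small2 arrows u f])
 fix W w k h assume w: "w : hom V W X" and k: "k : VOb C \<times> VOb C"
  and h: "h : hom V W (case k of (A, B) \<Rightarrow> VHom C A B)" and uw: "u o w = (case k of (A, B) \<Rightarrow> arr A B) o h"
 obtain A B where "k = (A, B)" by (cases k)
 then show "f o w = g o w" using eq[OF w, of A B h] k h uw by simp
qed

lemma glue_arr:
 assumes u: "u : hom V X M" and Y: "Y : Obj V"
  and stable: "\<And>W w a W' v. w : hom V W X ==> a : hom V W Y ==> v : hom V W' W ==> R w a ==> R (w o v) (a o v)"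
  and ex: "\<And>W w A B h. w : hom V W X ==> A : VOb C ==> B : VOb C ==> h : hom V W (VHom C A B) ==>
   u o w = arr A B o h ==> \<exists>a. a : hom V W Y \<and> R w a"
 obtains g where "g : hom V X Y"
  "\<And>W w A B h. w : hom V W X ==> A : VOb C ==> B : VOb C ==> h : hom V W (VHom C A B) ==>
   u o w = arr A B o h ==> R w (g o w)"
proof -
 have ex': "\<exists>a. a : hom V W Y \<and> R w a"
  if w: "w : hom V W X" and k: "k : VOb C \<times> VOb C" and h: "h : hom V W (case k of (A, B) \<Rightarrow> VHom C A B)"
   and uw: "u o w = (case k of (A, B) \<Rightarrow> arr A B) o h" for W w k h
 proof -
  obtain A B where "k = (A, B)" by (cases k)
  then show ?thesis using ex[OF w, of A B h] k h uw by simp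
 qed
 obtain g where g: "g : hom V X Y" "\<And>W w k h. w : hom V W X ==> k : VOb C \<times> VOb C ==>
   h : hom V W (case k of (A, B) \<Rightarrow> VHom C A B) ==> u o w = (case k of (A, B) \<Rightarrow> arr A B) o h ==> R w (g o w)"
  using local_glue[OF small2 arrows u Y, of R] stable ex' by blast
 have "R w (g o w)" if "w : hom V W X" "A : VOb C" "B : VOb C" "h : hom V W (VHom C A B)" "u o w = arr A B o h"
  for W w A B h
  using g(2)[OF that(1), of "(A, B)" h] that by simp
 then show thesis using that g(1) by blast
qed

text \<open>
 Elements of the object of arrows with source \<open>A\<close> and target \<open>B\<close> are elements of \<open>C(A, B)\<close>.
\<close>

lemma arr_factor:
 assumes f: "f : hom V X M" and A: "A : VOb C" "B : VOb C"
  and s: "Int_src V C o f = obj A o bang V X" and t: "Int_tgt V C o f = obj B o bang V X"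
 obtains f' where "f' : hom V X (VHom C A B)" "f = arr A B o f'"
proof -
 note [simp] = homD[OF f] A
 have "\<exists>a. a : hom V W (VHom C A B) \<and> f o w = arr A B o a"
  if w: "w : hom V W X" and A': "A' : VOb C" "B' : VOb C" and h: "h : hom V W (VHom C A' B')"
   and fw: "f o w = arr A' B' o h" for W w A' B' h
 proof -
  note [simp] = homD[OF w] homD[OF h] A'
  have "Int_src V C o f o w = obj A o bang V W" "Int_tgt V C o f o w = obj B o bang V W"
   using square_point[OF s, of w] square_point[OF t, of w] by simp_all
  then have "obj A' o bang V W = obj A o bang V W" "obj B' o bang V W = obj B o bang V W"
   by (simp_all add: fw)
  then have "(A' = A \<and> B' = B) \<or> (\<exists>u. u : hom V W \<zero>)"
   using obj_disjoint[OF A'(1) A(1) bang_in_hom bang_in_hom] obj_disjoint[OF A'(2) A(2) bang_in_hom bang_in_hom]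
    homD(4)[OF w] by blast
  then show ?thesis
  proof (elim disjE exE)
   assume "A' = A \<and> B' = B" then show ?thesis using h fw by auto
  next
   fix u assume u: "u : hom V W \<zero>"
   obtain a where a: "a : hom V W (VHom C A B)" using from_void[OF u vhom_in_Obj[OF C A]] by blast
   have "f o w = arr A B o a"
    by (rule strict_initial[OF u, of _ M]) (simp_all add: in_hom homD[OF a])
   then show ?thesis using a by blast
  qed
 qed
 note ex = this
 have st: "f o w o v = arr A B o a o v"
  if "w : hom V W X" "a : hom V W (VHom C A B)" "v : hom V W' W" "f o w = arr A B o a" for w a v W W'
  by (rule square_point[OF that(4)]) (simp_all add: homD[OF that(1)] homD[OF that(2)] homD[OF that(3)])
 obtain g where g: "g : hom V X (VHom C A B)" "\<And>W w A' B' h. w : hom V W X ==> A' : VOb C ==> B' : VOb C ==>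
   h : hom V W (VHom C A' B') ==> f o w = arr A' B' o h ==> f o w = arr A B o g o w"
  using glue_arr[OF f, of "VHom C A B" "\<lambda>w a. f o w = arr A B o a"] st ex vhom_in_Obj[OF C A] by blast
 have "f = arr A B o g"
 proof (rule local_arr[OF f f])
  show "arr A B o g : hom V X M" using homD[OF g(1)] by (simp add: in_hom)
  fix W w A' B' h assume *: "w : hom V W X" "A' : VOb C" "B' : VOb C" "h : hom V W (VHom C A' B')" "f o w = arr A' B' o h"
  show "f o w = (arr A B o g) o w" using g(2)[OF *] homD[OF g(1)] homD[OF *(1)] by simp
 qed
 then show thesis using that g(1) by blast
qed

subsection \<open>Composition\<close>

abbreviation "Q \<equiv> pb_obj V (Int_src V C) (Int_tgt V C)"
abbreviation "p \<equiv> pb1 V (Int_src V C) (Int_tgt V C)"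
abbreviation "q \<equiv> pb2 V (Int_src V C) (Int_tgt V C)"

text \<open>
 The element \<open>m\<close> is the value of the composition at the element \<open>w\<close> of \<open>Q\<close>: at every later stage
 where both arrows of \<open>w\<close> lie in a summand, \<open>m\<close> is their composite in \<open>C\<close>.
\<close>

definition composite :: "'b \<Rightarrow> 'b \<Rightarrow> bool" where
 "composite w m \<longleftrightarrow> (\<forall>W v A B D g f. v : hom V W (Dom V w) \<and> A : VOb C \<and> B : VOb C \<and> D : VOb C \<and>
   g : hom V W (VHom C B D) \<and> f : hom V W (VHom C A B) \<and> p o w o v = arr B D o g \<and> q o w o v = arr A B o f \<longrightarrow>
   m o v = arr A D o VCmp C A B D o \<langle>g, f\<rangle>)"

lemma composite_stable:
 assumes w: "w : hom V W Q" and a: "a : hom V W M" and v: "v : hom V W' W" and c: "composite w a"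
 shows "composite (w o v) (a o v)"
 unfolding composite_def
proof (intro allI impI; elim conjE)
 note [simp] = homD[OF w] homD[OF a] homD[OF v]
 fix W'' v' A B D g f assume v': "v' : hom V W'' (Dom V (w o v))" and A: "A : VOb C" "B : VOb C" "D : VOb C"
  and gf: "g : hom V W'' (VHom C B D)" "f : hom V W'' (VHom C A B)"
  and eq: "p o (w o v) o v' = arr B D o g" "q o (w o v) o v' = arr A B o f"
 have v'': "v' : hom V W'' W'" using v' by simp
 note [simp] = homD[OF v'']
 have "v o v' : hom V W'' (Dom V w)" by (simp add: in_hom)
 moreover have "p o w o (v o v') = arr B D o g" "q o w o (v o v') = arr A B o f" using eq by simp_all
 ultimately have "a o v o v' = arr A D o VCmp C A B D o \<langle>g, f\<rangle>"
  using c A gf unfolding composite_def by blast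
 then show "(a o v) o v' = arr A D o VCmp C A B D o \<langle>g, f\<rangle>" by simp
qed

lemma composite_exists_local:
 assumes w: "w : hom V W Q" and A: "A : VOb C" "B : VOb C" "B' : VOb C" "D : VOb C"
  and gf: "g : hom V W (VHom C B' D)" "f : hom V W (VHom C A B)"
  and eq: "p o w = arr B' D o g" "q o w = arr A B o f"
 shows "\<exists>m. m : hom V W M \<and> composite w m"
proof -
 note [simp] = homD[OF w] A homD[OF gf(1)] homD[OF gf(2)]
 have "Int_src V C o p o w = Int_tgt V C o q o w" by (rule pb_square_point) simp_all
 then have "obj B' o bang V W = obj B o bang V W" by (simp add: eq)
 then have "B' = B \<or> (\<exists>u. u : hom V W \<zero>)"
  using obj_disjoint[OF A(3,2) bang_in_hom bang_in_hom] homD(4)[OF w] by blast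
 then show ?thesis
 proof (elim disjE exE)
  assume [simp]: "B' = B"
  let ?m = "arr A D o VCmp C A B D o \<langle>g, f\<rangle>"
  have "composite w ?m"
   unfolding composite_def
  proof (intro allI impI; elim conjE)
   fix W' v A1 B1 D1 g1 f1 assume v: "v : hom V W' (Dom V w)" and A1: "A1 : VOb C" "B1 : VOb C" "D1 : VOb C"
    and gf1: "g1 : hom V W' (VHom C B1 D1)" "f1 : hom V W' (VHom C A1 B1)"
    and eq1: "p o w o v = arr B1 D1 o g1" "q o w o v = arr A1 B1 o f1"
   have v': "v : hom V W' W" using v by simp
   note [simp] = homD[OF v'] A1 homD[OF gf1(1)] homD[OF gf1(2)]
   have "p o w o v = arr B D o g o v" "q o w o v = arr A B o f o v"
    using square_point[OF eq(1), of v] square_point[OF eq(2), of v] by simp_all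
   then have e: "arr B D o g o v = arr B1 D1 o g1" "arr A B o f o v = arr A1 B1 o f1" using eq1 by simp_all
   have h: "g o v : hom V W' (VHom C B D)" "f o v : hom V W' (VHom C A B)" by (simp_all add: in_hom)
   have void: "?m o v = arr A1 D1 o VCmp C A1 B1 D1 o \<langle>g1, f1\<rangle>" if "u : hom V W' \<zero>" for u
    by (rule strict_initial[OF that, of _ M]) (simp_all add: in_hom)
   show "?m o v = arr A1 D1 o VCmp C A1 B1 D1 o \<langle>g1, f1\<rangle>"
   proof (rule arr_eqE[OF A(2,4) A1(2,3) h(1) gf1(1) e(1)])
    assume 1: "B1 = B" "D1 = D" "g1 = g o v"
    show ?thesis
    proof (rule arr_eqE[OF A(1,2) A1(1,2) h(2) gf1(2) e(2)])
     assume "A1 = A" "B1 = B" "f1 = f o v" then show ?thesis using 1 by simp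
    qed (rule void)
   qed (rule void)
  qed
  then show ?thesis by (intro exI[of _ ?m]) (simp add: in_hom)
 next
  fix u assume u: "u : hom V W \<zero>"
  obtain m where m: "m : hom V W M" using from_void[OF u OM(2)] by blast
  have "composite w m"
   unfolding composite_def
  proof (intro allI impI; elim conjE)
   fix W' v A B D g f assume v: "v : hom V W' (Dom V w)" and A: "A : VOb C" "B : VOb C" "D : VOb C"
    and gf: "g : hom V W' (VHom C B D)" "f : hom V W' (VHom C A B)"
   have v': "v : hom V W' W" using v by simp
   show "m o v = arr A D o VCmp C A B D o \<langle>g, f\<rangle>"
    by (rule strict_initial[OF comp_in_hom[OF v' u], of _ M])
     (use A homD[OF gf(1)] homD[OF gf(2)] homD[OF v'] homD[OF m] in \<open>simp_all add: in_hom\<close>)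
  qed
  then show ?thesis using m by blast
 qed
qed

text \<open>
 The composite is glued from the composites in \<open>C\<close>, over the summands of the first arrow and, inside
 each part, over the summands of the second.
\<close>

lemma composition_exists:
 "\<exists>c. c : hom V Q M \<and> (\<forall>A\<in>VOb C. \<forall>B\<in>VOb C. \<forall>D\<in>VOb C. \<forall>X g f. g : hom V X (VHom C B D) \<longrightarrow> f : hom V X (VHom C A B) \<longrightarrow>
   c o pb_pair V (Int_src V C) (Int_tgt V C) (arr B D o g) (arr A B o f) = arr A D o VCmp C A B D o \<langle>g, f\<rangle>)"
proof -
 have inner: "\<exists>m. m : hom V W M \<and> composite w m"
  if w: "w : hom V W Q" and A: "A : VOb C" "B : VOb C" and f: "f : hom V W (VHom C A B)" and qw: "q o w = arr A B o f"
  for W w A B f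
 proof -
  note [simp] = homD[OF w] homD[OF f] A
  have pw: "p o w : hom V W M" by (simp add: in_hom)
  have ex: "\<exists>a. a : hom V W' M \<and> composite (w o v) a"
   if v: "v : hom V W' W" and B': "B' : VOb C" "D : VOb C" and g: "g : hom V W' (VHom C B' D)"
    and e: "(p o w) o v = arr B' D o g" for W' v B' D g
  proof (rule composite_exists_local[OF comp_in_hom[OF v w] A B' g comp_in_hom[OF v f]])
   note [simp] = homD[OF v]
   show "p o w o v = arr B' D o g" using e by simp
   show "q o w o v = arr A B o f o v" by (rule square_point[OF qw]) simp_all
  qed
  have st: "composite (w o v o v') (a o v')"
   if "v : hom V W1 W" "a : hom V W1 M" "v' : hom V W2 W1" "composite (w o v) a" for v a v' W1 W2
   using composite_stable[OF comp_in_hom[OF that(1) w] that(2,3,4)] homD[OF that(1)] homD[OF that(3)] by simp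
  obtain m where m: "m : hom V W M" "\<And>W' v B' D g. v : hom V W' W ==> B' : VOb C ==> D : VOb C ==>
    g : hom V W' (VHom C B' D) ==> (p o w) o v = arr B' D o g ==> composite (w o v) (m o v)"
   using glue_arr[OF pw OM(2), of "\<lambda>v a. composite (w o v) a"] st ex by blast
  have "composite w m"
   unfolding composite_def
  proof (intro allI impI; elim conjE)
   fix W' v A1 B1 D1 g1 f1 assume v: "v : hom V W' (Dom V w)" and A1: "A1 : VOb C" "B1 : VOb C" "D1 : VOb C"
    and gf1: "g1 : hom V W' (VHom C B1 D1)" "f1 : hom V W' (VHom C A1 B1)"
    and eq1: "p o w o v = arr B1 D1 o g1" "q o w o v = arr A1 B1 o f1"
   have v': "v : hom V W' W" using v by simp
   note [simp] = homD[OF v'] homD[OF m(1)]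
   have c: "composite (w o v) (m o v)" by (rule m(2)[OF v' A1(2,3) gf1(1)]) (simp add: eq1)
   have i: "Idn V W' : hom V W' (Dom V (w o v))" "p o (w o v) o Idn V W' = arr B1 D1 o g1"
    "q o (w o v) o Idn V W' = arr A1 B1 o f1" using eq1 by (simp_all add: in_hom)
   have "(m o v) o Idn V W' = arr A1 D1 o VCmp C A1 B1 D1 o \<langle>g1, f1\<rangle>"
    using c[unfolded composite_def] i A1 gf1 by blast
   then show "m o v = arr A1 D1 o VCmp C A1 B1 D1 o \<langle>g1, f1\<rangle>" by simp
  qed
  then show ?thesis using m(1) by blast
 qed
 have q: "q : hom V Q M" by (simp add: in_hom)
 obtain c where c: "c : hom V Q M" "\<And>W w A B h. w : hom V W Q ==> A : VOb C ==> B : VOb C ==>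
   h : hom V W (VHom C A B) ==> q o w = arr A B o h ==> composite w (c o w)"
  using glue_arr[OF q OM(2), of composite] composite_stable inner by blast
 have "c o pb_pair V (Int_src V C) (Int_tgt V C) (arr B D o g) (arr A B o f) = arr A D o VCmp C A B D o \<langle>g, f\<rangle>"
  if A: "A : VOb C" "B : VOb C" "D : VOb C" and g: "g : hom V X (VHom C B D)" and f: "f : hom V X (VHom C A B)"
  for A B D X g f
 proof -
  note [simp] = A homD[OF g] homD[OF f] homD[OF c(1)]
  let ?w = "pb_pair V (Int_src V C) (Int_tgt V C) (arr B D o g) (arr A B o f)"
  have w: "?w : hom V X Q" "Idn V X : hom V X (Dom V ?w)" by (simp_all add: in_hom)
  have "composite ?w (c o ?w)" by (rule c(2)[OF w(1) A(1,2) f]) simp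
  moreover have "p o ?w o Idn V X = arr B D o g" "q o ?w o Idn V X = arr A B o f" by simp_all
  ultimately have "(c o ?w) o Idn V X = arr A D o VCmp C A B D o \<langle>g, f\<rangle>"
   using A g f w(2) unfolding composite_def by blast
  then show ?thesis by simp
 qed
 then show ?thesis using c(1) by blast
qed

text \<open>
 Composable arrows can be assumed to lie in summands \<open>C(B, D)\<close> and \<open>C(A, B)\<close>: on the parts of the
 stage where the summands do not match, the stage is initial.
\<close>

lemma local_pair:
 assumes g: "g : hom V X M" and f: "f : hom V X M" and eq: "Int_src V C o g = Int_tgt V C o f"
  and ab: "a : hom V X Y" "b : hom V X Y"
  and loc: "\<And>W w A B D g' f'. w : hom V W X ==> A : VOb C ==> B : VOb C ==> D : VOb C ==>
   g' : hom V W (VHom C B D) ==> f' : hom V W (VHom C A B) ==> g o w = arr B D o g' ==> f o w = arr A B o f' ==>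
   a o w = b o w"
 shows "a = b"
proof (rule local_arr[OF f ab])
 note [simp] = homD[OF g] homD[OF f] homD[OF ab(1)] homD[OF ab(2)]
 fix W w A B f' assume w: "w : hom V W X" and A: "A : VOb C" "B : VOb C" and f': "f' : hom V W (VHom C A B)"
  and fw: "f o w = arr A B o f'"
 note [simp] = homD[OF w] homD[OF f'] A
 show "a o w = b o w"
 proof (rule local_arr[OF comp_in_hom[OF w g] comp_in_hom[OF w ab(1)] comp_in_hom[OF w ab(2)]])
  fix W' v B' D g' assume v: "v : hom V W' W" and B': "B' : VOb C" "D : VOb C" and g': "g' : hom V W' (VHom C B' D)"
   and gw: "(g o w) o v = arr B' D o g'"
  note [simp] = homD[OF v] homD[OF g'] B'
  have fwv: "f o w o v = arr A B o f' o v" by (rule square_point[OF fw]) simp_all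
  have gwv: "g o w o v = arr B' D o g'" using gw by simp
  have "Int_src V C o g o (w o v) = Int_tgt V C o f o (w o v)" by (rule square_point[OF eq]) simp_all
  then have "obj B' o bang V W' = obj B o bang V W'" by (simp add: fwv gwv)
  then have "B' = B \<or> (\<exists>u. u : hom V W' \<zero>)"
   using obj_disjoint[OF B'(1) A(2) bang_in_hom bang_in_hom] homD(4)[OF v] by blast
  then show "(a o w) o v = (b o w) o v"
  proof (elim disjE exE)
   assume "B' = B"
   then have "a o (w o v) = b o (w o v)"
    using loc[OF comp_in_hom[OF v w] A B'(2) _ comp_in_hom[OF v f']] g' gwv fwv by simp
   then show ?thesis by simp
  next
   fix u assume "u : hom V W' \<zero>"
   then show ?thesis by (rule strict_initial[of u W' _ Y]) (simp_all add: in_hom)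
  qed
 qed
qed

lemma icmp_Int: "icmp I : hom V Q M"
 "A : VOb C ==> B : VOb C ==> D : VOb C ==> g : hom V X (VHom C B D) ==> f : hom V X (VHom C A B) ==>
  icmp I o pb_pair V (Int_src V C) (Int_tgt V C) (arr B D o g) (arr A B o f) = arr A D o VCmp C A B D o \<langle>g, f\<rangle>"
proof -
 let ?P = "\<lambda>c. c : hom V Q M \<and> (\<forall>A\<in>VOb C. \<forall>B\<in>VOb C. \<forall>D\<in>VOb C.
   c o pb_pair V (Int_src V C) (Int_tgt V C) (arr B D o pr1 V (VHom C B D) (VHom C A B))
    (arr A B o pr2 V (VHom C B D) (VHom C A B)) = arr A D o VCmp C A B D)"
 obtain c where c: "c : hom V Q M" "\<And>A B D X g f. A : VOb C ==> B : VOb C ==> D : VOb C ==>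
   g : hom V X (VHom C B D) ==> f : hom V X (VHom C A B) ==>
   c o pb_pair V (Int_src V C) (Int_tgt V C) (arr B D o g) (arr A B o f) = arr A D o VCmp C A B D o \<langle>g, f\<rangle>"
  using composition_exists by blast
 have Pc: "?P c"
 proof (intro conjI ballI c(1))
  fix A B D assume [simp]: "A : VOb C" "B : VOb C" "D : VOb C"
  show "c o pb_pair V (Int_src V C) (Int_tgt V C) (arr B D o pr1 V (VHom C B D) (VHom C A B))
    (arr A B o pr2 V (VHom C B D) (VHom C A B)) = arr A D o VCmp C A B D"
   using c(2)[of A B D "pr1 V (VHom C B D) (VHom C A B)" "VHom C B D \<otimes> VHom C A B" "pr2 V (VHom C B D) (VHom C A B)"]
   by (simp add: in_hom)
 qed
 have uniq: "d = c" if d: "?P d" for d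
 proof -
  have d1: "d : hom V Q M" using d by blast
  have pq: "p : hom V Q M" "q : hom V Q M" "Int_src V C o p = Int_tgt V C o q"
   by (simp_all add: in_hom pb_square)
  show "d = c"
  proof (rule local_pair[OF pq d1 c(1)])
   fix W w A B D g f assume w: "w : hom V W Q" and A: "A : VOb C" "B : VOb C" "D : VOb C"
    and gf: "g : hom V W (VHom C B D)" "f : hom V W (VHom C A B)"
    and e: "p o w = arr B D o g" "q o w = arr A B o f"
   note [simp] = homD[OF w] A homD[OF gf(1)] homD[OF gf(2)] homD[OF d1]
   have w': "w = pb_pair V (Int_src V C) (Int_tgt V C) (arr B D o g) (arr A B o f)"
    using pb_pair_eta[of "Int_src V C" "Int_tgt V C" w] e by simp
   let ?x = "pb_pair V (Int_src V C) (Int_tgt V C) (arr B D o pr1 V (VHom C B D) (VHom C A B))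
    (arr A B o pr2 V (VHom C B D) (VHom C A B))"
   have "d o ?x = arr A D o VCmp C A B D" using d A by blast
   then have "d o ?x o \<langle>g, f\<rangle> = arr A D o VCmp C A B D o \<langle>g, f\<rangle>"
    by (rule square_point) simp_all
   then have "d o w = arr A D o VCmp C A B D o \<langle>g, f\<rangle>" unfolding w' by simp
   then show "d o w = c o w" using c(2)[OF A gf] unfolding w' by simp
  qed
 qed
 have "icmp I = (THE c. ?P c)" unfolding Int_cat_def by simp
 also have "\<dots> = c" by (rule the_equality[of ?P, OF Pc uniq])
 finally have "icmp I = c" .
 then show "icmp I : hom V Q M"
  "A : VOb C ==> B : VOb C ==> D : VOb C ==> g : hom V X (VHom C B D) ==> f : hom V X (VHom C A B) ==>
  icmp I o pb_pair V (Int_src V C) (Int_tgt V C) (arr B D o g) (arr A B o f) = arr A D o VCmp C A B D o \<langle>g, f\<rangle>"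
  using c by simp_all
qed

lemma Int_icomp [simp]:
 assumes "A : VOb C" "B : VOb C" "D : VOb C" "g : Arr V" "f : Arr V" "Dom V g = Dom V f"
  "Cod V g = VHom C B D" "Cod V f = VHom C A B"
 shows "icmp I o pb_pair V (Int_src V C) (Int_tgt V C) (arr B D o g) (arr A B o f) = arr A D o VCmp C A B D o \<langle>g, f\<rangle>"
 by (rule icmp_Int(2)[of _ _ _ _ "Dom V f"]) (use assms in \<open>simp_all add: in_hom\<close>)

lemma Int_iidn_ends [simp]:
 assumes "x : Arr V" "Cod V x = Obs"
 shows "Int_src V C o iidn I o x = x" "Int_tgt V C o iidn I o x = x"
proof -
 have x: "x : hom V (Dom V x) Obs" using assms by (simp add: in_hom)
 have ty: "Int_src V C o iidn I o x : hom V (Dom V x) Obs" "Int_tgt V C o iidn I o x : hom V (Dom V x) Obs"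
  using assms by (simp_all add: in_hom)
 have loc: "(Int_src V C o iidn I o x) o w = x o w" "(Int_tgt V C o iidn I o x) o w = x o w"
  if w: "w : hom V W (Dom V x)" and A: "A : VOb C" and e: "x o w = obj A o bang V W" for W w A
 proof -
  note [simp] = homD(1,3-5)[OF w] assms A
  have [simp]: "Dom V w = W" by (rule homD(2)[OF w])
  have "(Int_src V C o iidn I o x) o w = Int_src V C o iidn I o (x o w)"
   "(Int_tgt V C o iidn I o x) o w = Int_tgt V C o iidn I o (x o w)" by simp_all
  then show "(Int_src V C o iidn I o x) o w = x o w" "(Int_tgt V C o iidn I o x) o w = x o w"
   unfolding e by simp_all
 qed
 show "Int_src V C o iidn I o x = x" by (rule local_obj[OF x ty(1) x loc(1)])
 show "Int_tgt V C o iidn I o x = x" by (rule local_obj[OF x ty(2) x loc(2)])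
qed

lemma Int_ends:
 assumes f: "f : hom V X M" and g: "g : hom V X M" and eq: "Int_src V C o g = Int_tgt V C o f"
 shows "Int_src V C o icomp V I g f = Int_src V C o f" "Int_tgt V C o icomp V I g f = Int_tgt V C o g"
proof -
 note [simp] = homD[OF f] homD[OF g] eq homD[OF icmp_Int(1)]
 have eqw: "Int_src V C o g o w = Int_tgt V C o f o w" if "w : hom V W X" for w W
  by (rule square_point[OF eq]) (simp_all add: homD[OF that])
 show "Int_src V C o icomp V I g f = Int_src V C o f"
 proof (rule local_pair[OF g f eq])
  fix W w A B D g' f' assume w: "w : hom V W X" and A: "A : VOb C" "B : VOb C" "D : VOb C"
   and gf: "g' : hom V W (VHom C B D)" "f' : hom V W (VHom C A B)" and e: "g o w = arr B D o g'" "f o w = arr A B o f'"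
  show "(Int_src V C o icomp V I g f) o w = (Int_src V C o f) o w"
   by (simp add: homD[OF w] eqw[OF w] e A homD[OF gf(1)] homD[OF gf(2)])
 qed (simp_all add: in_hom)
 show "Int_tgt V C o icomp V I g f = Int_tgt V C o g"
 proof (rule local_pair[OF g f eq])
  fix W w A B D g' f' assume w: "w : hom V W X" and A: "A : VOb C" "B : VOb C" "D : VOb C"
   and gf: "g' : hom V W (VHom C B D)" "f' : hom V W (VHom C A B)" and e: "g o w = arr B D o g'" "f o w = arr A B o f'"
  show "(Int_tgt V C o icomp V I g f) o w = (Int_tgt V C o g) o w"
   by (simp add: homD[OF w] eqw[OF w] e A homD[OF gf(1)] homD[OF gf(2)])
 qed (simp_all add: in_hom)
qed

lemma Int_cat_icat [simp]: "I : Obj Cat"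
proof (rule is_icatI)
 note [simp] = homD[OF icmp_Int(1)]
 show "icmp I : hom V (pb_obj V (isrc I) (itgt I)) (ic1 I)" by (simp add: in_hom)
next
 fix X x assume "x : hom V X (ic0 I)"
 then have x: "x : hom V X Obs" by simp
 note [simp] = homD[OF x]
 show "isrc I o iidn I o x = x" "itgt I o iidn I o x = x" by simp_all
next
 fix X g f assume "f : hom V X (ic1 I)" "g : hom V X (ic1 I)" and "isrc I o g = itgt I o f"
 then have f: "f : hom V X M" and g: "g : hom V X M" and eq: "Int_src V C o g = Int_tgt V C o f" by simp_all
 show "isrc I o icomp V I g f = isrc I o f" using Int_ends(1)[OF f g eq] by simp
 show "itgt I o icomp V I g f = itgt I o g" using Int_ends(2)[OF f g eq] by simp
next
 fix X f assume "f : hom V X (ic1 I)"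
 then have f: "f : hom V X M" by simp
 note [simp] = homD[OF f] homD[OF icmp_Int(1)]
 have "icomp V I f (iidn I o Int_src V C o f) = f"
 proof (rule local_arr[OF f _ f])
  fix W w A B h assume w: "w : hom V W X" and A: "A : VOb C" "B : VOb C" and h: "h : hom V W (VHom C A B)"
   and e: "f o w = arr A B o h"
  show "icomp V I f (iidn I o Int_src V C o f) o w = f o w" by (simp add: homD[OF w] A homD[OF h] e)
 qed (simp add: in_hom)
 then show "icomp V I f (iidn I o isrc I o f) = f" by simp
 have "icomp V I (iidn I o Int_tgt V C o f) f = f"
 proof (rule local_arr[OF f _ f])
  fix W w A B h assume w: "w : hom V W X" and A: "A : VOb C" "B : VOb C" and h: "h : hom V W (VHom C A B)"
   and e: "f o w = arr A B o h"
  show "icomp V I (iidn I o Int_tgt V C o f) f o w = f o w" by (simp add: homD[OF w] A homD[OF h] e)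
 qed (simp add: in_hom)
 then show "icomp V I (iidn I o itgt I o f) f = f" by simp
next
 fix X h g f assume "f : hom V X (ic1 I)" "g : hom V X (ic1 I)" "h : hom V X (ic1 I)"
  and "isrc I o g = itgt I o f" "isrc I o h = itgt I o g"
 then have f: "f : hom V X M" and g: "g : hom V X M" and h: "h : hom V X M"
  and eq: "Int_src V C o g = Int_tgt V C o f" and eq': "Int_src V C o h = Int_tgt V C o g" by simp_all
 note [simp] = homD[OF f] homD[OF g] homD[OF h] eq eq' homD[OF icmp_Int(1)]
 note [simp] = Int_ends[OF f g eq, unfolded Int_cat_simps] Int_ends[OF g h eq', unfolded Int_cat_simps]
 have eqw: "Int_src V C o g o w = Int_tgt V C o f o w" "Int_src V C o h o w = Int_tgt V C o g o w" if "w : hom V W X" for w W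
  using square_point[OF eq, of w] square_point[OF eq', of w] homD[OF that] by simp_all
 let ?l = "icomp V I (icomp V I h g) f" and ?r = "icomp V I h (icomp V I g f)"
 have l: "?l : hom V X M" "?r : hom V X M" by (simp_all add: in_hom)
 have "?l = ?r"
 proof (rule local_pair[OF g f eq l])
  fix W w A B D g' f' assume w: "w : hom V W X" and A: "A : VOb C" "B : VOb C" "D : VOb C"
   and gf: "g' : hom V W (VHom C B D)" "f' : hom V W (VHom C A B)" and e: "g o w = arr B D o g'" "f o w = arr A B o f'"
  note [simp] = A homD[OF w] homD[OF gf(1)] homD[OF gf(2)]
  have hw: "h o w : hom V W M" and gw: "arr B D o g' : hom V W M" by (simp_all add: in_hom)
  have ehw: "Int_src V C o h o w = Int_tgt V C o arr B D o g'" using eqw(2)[OF w] e(1) by simp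
  have endsw: "Int_src V C o icomp V I (h o w) (arr B D o g') = Int_src V C o arr B D o g'"
   by (rule Int_ends(1)[OF gw hw ehw])
  show "?l o w = ?r o w"
  proof (rule local_pair[OF hw gw ehw comp_in_hom[OF w l(1)] comp_in_hom[OF w l(2)]])
   fix W' v B' D' E h' g'' assume v: "v : hom V W' W" and B': "B' : VOb C" "D' : VOb C" "E : VOb C"
    and h': "h' : hom V W' (VHom C D' E)" and g'': "g'' : hom V W' (VHom C B' D')"
    and e': "(h o w) o v = arr D' E o h'" "(arr B D o g') o v = arr B' D' o g''"
   note [simp] = homD[OF v] B' homD[OF h'] homD[OF g'']
   have gv: "g' o v : hom V W' (VHom C B D)" by (simp add: in_hom)
   have e'': "arr B D o g' o v = arr B' D' o g''" using e'(2) by simp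
   have wv: "w o v : hom V W' X" by (rule comp_in_hom[OF v w])
   show "(?l o w) o v = (?r o w) o v"
   proof (rule arr_eqE[OF A(2,3) B'(1,2) gv g'' e''])
    assume BD: "B' = B" "D' = D" "g'' = g' o v"
    have x: "h o w o v = arr D E o h'" "g o w o v = arr B D o g' o v" "f o w o v = arr A B o f' o v"
     using e'(1) square_point[OF e(1), of v] square_point[OF e(2), of v] BD by simp_all
    have [simp]: "Cod V h' = VHom C D E" using homD[OF h'] BD by simp
    have y: "Int_src V C o h o w o v = Int_tgt V C o g o w o v" "Int_src V C o g o w o v = Int_tgt V C o f o w o v"
     using eqw[OF wv] by simp_all
    have z: "Int_src V C o icomp V I h g o (w o v) = Int_tgt V C o f o (w o v)"
     "Int_src V C o h o (w o v) = Int_tgt V C o icomp V I g f o (w o v)"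
     by (rule square_point; simp)+
    have hg: "icomp V I h g o (w o v) = arr B E o VCmp C B D E o \<langle>h', g' o v\<rangle>"
     and gf': "icomp V I g f o (w o v) = arr A D o VCmp C A B D o \<langle>g' o v, f' o v\<rangle>"
     by (simp_all add: y x BD(1,2))
    have "?l o (w o v) = icomp V I (icomp V I h g o (w o v)) (f o (w o v))"
     using z by (subst comp_assoc) (simp_all del: pb_pair_comp add: pb_pair_comp[of _ _ _ _ "w o v"])
    moreover have "?r o (w o v) = icomp V I (h o (w o v)) (icomp V I g f o (w o v))"
     using z by (subst comp_assoc) (simp_all del: pb_pair_comp add: pb_pair_comp[of _ _ _ _ "w o v"])
    ultimately have "?l o (w o v) = ?r o (w o v)" unfolding hg gf' by (simp add: x vassoc BD(1,2))
    moreover have "(?l o w) o v = ?l o (w o v)" "(?r o w) o v = ?r o (w o v)"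
     by (rule comp_assoc; use homD[OF l(1)] homD[OF l(2)] in simp)+
    ultimately show ?thesis by (simp only:)
   next
    fix u assume "u : hom V W' \<zero>"
    then show ?thesis
     by (rule strict_initial[OF _ comp_in_hom[OF v comp_in_hom[OF w l(1)]] comp_in_hom[OF v comp_in_hom[OF w l(2)]]])
   qed
  qed
 qed
 then show "icomp V I (icomp V I h g) f = icomp V I h (icomp V I g f)" by simp
qed (simp_all add: in_hom)

end

locale int_functor = int_cat U V C + D: int_cat U V D
 for U :: "'u itself" and V :: "('a, 'b) category" (structure) and C :: "('a, 'b, 'c) vcat" and D :: "('a, 'b, 'd) vcat" +
 fixes F :: "('c, 'd, 'b) vfun"
 assumes F: "is_vfun V C D F"
begin

abbreviation "IF \<equiv> Int_fun V C D F"

lemmas F_simps [simp] = vfunD[OF F C D.C]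

lemma Int_fun_simps [simp]: "idom IF = I" "icod IF = D.I"
 by (simp_all add: Int_fun_def)

lemma if0_obj: "if0 IF : hom V Obs D.Obs" "A : VOb C ==> if0 IF o obj A = D.obj (FOb F A)"
 unfolding Int_fun_def ifun.simps
 by (rule obj_desc(1); simp add: in_hom) (rule obj_desc(2); simp add: in_hom)

lemma if1_arr: "if1 IF : hom V M D.M"
  "A : VOb C ==> B : VOb C ==> if1 IF o arr A B = D.arr (FOb F A) (FOb F B) o FHom F A B"
 unfolding Int_fun_def ifun.simps
 by (rule arr_desc(1); simp add: in_hom)
  (rule arr_desc(2)[of D.M "\<lambda>A B. D.arr (FOb F A) (FOb F B) o FHom F A B"]; simp add: in_hom)

lemmas IF_types [simp] = homD(1-3)[OF if0_obj(1)] homD(1-3)[OF if1_arr(1)]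

lemma Int_fun_points [simp]:
 assumes "A : VOb C" "f : Arr V"
 shows "Cod V f = \<one> ==> if0 IF o obj A o f = D.obj (FOb F A) o f"
  and "B : VOb C ==> Cod V f = VHom C A B ==>
   if1 IF o arr A B o f = D.arr (FOb F A) (FOb F B) o FHom F A B o f"
proof -
 assume "Cod V f = \<one>"
 then have "(if0 IF o obj A) o f = if0 IF o obj A o f" using assms by (intro comp_assoc) simp_all
 then show "if0 IF o obj A o f = D.obj (FOb F A) o f" using if0_obj(2)[OF assms(1)] by simp
qed (use square_point[OF if1_arr(2), of A B f] assms in simp_all)

lemma Int_fun_ifun: "IF : hom Cat I D.I"
proof -
 have loc1: "Int_src V D o if1 IF o f = if0 IF o Int_src V C o f"
  "Int_tgt V D o if1 IF o f = if0 IF o Int_tgt V C o f" if f: "f : hom V X M" for f X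
 proof -
  note [simp] = homD[OF f]
  have loc: "(Int_src V D o if1 IF o f) o w = (if0 IF o Int_src V C o f) o w"
   "(Int_tgt V D o if1 IF o f) o w = (if0 IF o Int_tgt V C o f) o w"
   if w: "w : hom V W X" and A: "A : VOb C" "B : VOb C" and h: "h : hom V W (VHom C A B)"
    and e: "f o w = arr A B o h" for W w A B h
   by (simp_all add: homD[OF w] A homD[OF h] e)
  show "Int_src V D o if1 IF o f = if0 IF o Int_src V C o f"
   by (rule local_arr[OF f _ _ loc(1)]) (simp_all add: in_hom)
  show "Int_tgt V D o if1 IF o f = if0 IF o Int_tgt V C o f"
   by (rule local_arr[OF f _ _ loc(2)]) (simp_all add: in_hom)
 qed
 have ends: "Int_src V D o if1 IF o f = if0 IF o Int_src V C o f"
  "Int_tgt V D o if1 IF o f = if0 IF o Int_tgt V C o f" if "f : Arr V" "Cod V f = M" for f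
  using loc1[of f "Dom V f"] that by (simp_all add: in_hom)
 have ids: "if1 IF o iidn I o x = iidn D.I o if0 IF o x" if x: "x : hom V X Obs" for x X
 proof (rule local_obj[OF x])
  note [simp] = homD[OF x]
  show "if1 IF o iidn I o x : hom V X D.M" "iidn D.I o if0 IF o x : hom V X D.M" by (simp_all add: in_hom)
  fix W w A assume w: "w : hom V W X" and A: "A : VOb C" and e: "x o w = obj A o bang V W"
  show "(if1 IF o iidn I o x) o w = (iidn D.I o if0 IF o x) o w"
   by (simp add: homD[OF w] A e vfun_id[OF F C D.C])
 qed
 have cmps: "if1 IF o icomp V I g f = icomp V D.I (if1 IF o g) (if1 IF o f)"
  if f: "f : hom V X M" and g: "g : hom V X M" and eq: "Int_src V C o g = Int_tgt V C o f" for f g X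
 proof (rule local_pair[OF g f eq])
  note [simp] = homD[OF f] homD[OF g] homD[OF icmp_Int(1)] homD[OF D.icmp_Int(1)] ends eq
  show "if1 IF o icomp V I g f : hom V X D.M" "icomp V D.I (if1 IF o g) (if1 IF o f) \<in> hom V X D.M"
   by (simp_all add: in_hom)
  fix W w A B E g' f' assume w: "w : hom V W X" and A: "A : VOb C" "B : VOb C" "E : VOb C"
   and gf: "g' : hom V W (VHom C B E)" "f' : hom V W (VHom C A B)" and e: "g o w = arr B E o g'" "f o w = arr A B o f'"
  note [simp] = homD[OF w] A homD[OF gf(1)] homD[OF gf(2)]
  have eqw: "Int_src V C o g o w = Int_tgt V C o f o w" by (rule square_point[OF eq]) simp_all
  have l: "(if1 IF o icomp V I g f) o w = D.arr (FOb F A) (FOb F E) o FHom F A E o VCmp C A B E o \<langle>g', f'\<rangle>"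
   by (simp add: eqw e)
  have r: "(icomp V D.I (if1 IF o g) (if1 IF o f)) o w
    = icomp V D.I (if1 IF o g o w) (if1 IF o f o w)"
   by (simp add: eqw)
  show "(if1 IF o icomp V I g f) o w = (icomp V D.I (if1 IF o g) (if1 IF o f)) o w"
   unfolding l r e by (simp add: vfun_cmp[OF F C D.C])
 qed
 have "IF = \<lparr>idom = I, icod = D.I, if0 = if0 IF, if1 = if1 IF\<rparr>" by (simp add: Int_fun_def)
 also have "\<dots> \<in> hom Cat I D.I"
  by (rule is_ifunI) (use if0_obj(1) if1_arr(1) ids cmps homD in \<open>simp_all add: ends\<close>)
 finally show ?thesis .
qed

end

section \<open>The arrow category\<close>

subsection \<open>Maps defined by cases on the summands\<close>

context int_cat
begin

text \<open>
 The products of \<open>V\<close> distribute over coproducts, since \<open>V\<close> is cartesian closed: a map that depends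
 on a further argument \<open>y\<close> is defined by cases through its transpose.
\<close>

definition obj_case :: "'a \<Rightarrow> 'a \<Rightarrow> ('c \<Rightarrow> 'b) \<Rightarrow> 'b \<Rightarrow> 'b \<Rightarrow> 'b" where
 "obj_case Y Z f y x = ev V Y Z o
   \<langle>cotuple V (VOb C) (\<lambda>A. \<one>) \<lbrakk>Y, Z\<rbrakk> (\<lambda>A. transpose V \<one> Y Z (f A o pr2 V \<one> Y)) o x, y\<rangle>"

definition arr_case :: "'a \<Rightarrow> 'a \<Rightarrow> ('c \<Rightarrow> 'c \<Rightarrow> 'b) \<Rightarrow> 'b \<Rightarrow> 'b \<Rightarrow> 'b" where
 "arr_case Y Z f y x = ev V Y Z o
   \<langle>cotuple V (VOb C \<times> VOb C) (\<lambda>(A, B). VHom C A B) \<lbrakk>Y, Z\<rbrakk>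
    (\<lambda>(A, B). transpose V (VHom C A B) Y Z (f A B o pr2 V (VHom C A B) Y)) o x, y\<rangle>"

lemma obj_case:
 assumes f: "\<And>A. A : VOb C ==> f A : hom V Y Z" and YZ: "Y : Obj V" "Z : Obj V"
  and y: "y : Arr V" "Cod V y = Y"
 shows "x : Arr V ==> Dom V x = Dom V y ==> Cod V x = Obs ==> obj_case Y Z f y x : hom V (Dom V y) Z"
  and "x : Arr V ==> Dom V x = Dom V y ==> Cod V x = Obs ==> w : Arr V ==> Cod V w = Dom V y ==>
   obj_case Y Z f y x o w = obj_case Y Z f (y o w) (x o w)"
  and "A : VOb C ==> h : Arr V ==> Dom V h = Dom V y ==> Cod V h = \<one> ==>
   obj_case Y Z f y (obj A o h) = f A o y"
proof -
 note [simp] = YZ y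
 let ?c = "cotuple V (VOb C) (\<lambda>A. \<one>) \<lbrakk>Y, Z\<rbrakk> (\<lambda>A. transpose V \<one> Y Z (f A o pr2 V \<one> Y))"
 have t: "transpose V \<one> Y Z (f A o pr2 V \<one> Y) \<in> hom V \<one> \<lbrakk>Y, Z\<rbrakk>" if "A : VOb C" for A
  using homD[OF f[OF that]] by (simp add: in_hom)
 have c: "?c : hom V Obs \<lbrakk>Y, Z\<rbrakk>" by (rule obj_desc(1)) (use t in auto)
 note [simp] = homD(1-3)[OF c]
 show "obj_case Y Z f y x : hom V (Dom V y) Z" if "x : Arr V" "Dom V x = Dom V y" "Cod V x = Obs"
  using that unfolding obj_case_def by (simp add: in_hom)
 show "obj_case Y Z f y x o w = obj_case Y Z f (y o w) (x o w)"
  if "x : Arr V" "Dom V x = Dom V y" "Cod V x = Obs" "w : Arr V" "Cod V w = Dom V y"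
  using that unfolding obj_case_def by simp
 show "obj_case Y Z f y (obj A o h) = f A o y" if A: "A : VOb C" and h: "h : Arr V" "Dom V h = Dom V y" "Cod V h = \<one>"
 proof -
  note [simp] = A h homD(1-3)[OF f[OF A]] homD(1-3)[OF t[OF A]]
  have "?c o obj A = transpose V \<one> Y Z (f A o pr2 V \<one> Y)" by (rule obj_desc(2)) (use t A in auto)
  then have "(?c o obj A) o h = transpose V \<one> Y Z (f A o pr2 V \<one> Y) o h" by (rule arg_cong)
  moreover have "(?c o obj A) o h = ?c o obj A o h" by (rule comp_assoc) simp_all
  ultimately have "?c o obj A o h = transpose V \<one> Y Z (f A o pr2 V \<one> Y) o h" by simp
  then show ?thesis unfolding obj_case_def by simp
 qed
qed

lemma arr_case:
 assumes f: "\<And>A B. A : VOb C ==> B : VOb C ==> f A B : hom V Y Z" and YZ: "Y : Obj V" "Z : Obj V"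
  and y: "y : Arr V" "Cod V y = Y"
 shows "x : Arr V ==> Dom V x = Dom V y ==> Cod V x = M ==> arr_case Y Z f y x : hom V (Dom V y) Z"
  and "x : Arr V ==> Dom V x = Dom V y ==> Cod V x = M ==> w : Arr V ==> Cod V w = Dom V y ==>
   arr_case Y Z f y x o w = arr_case Y Z f (y o w) (x o w)"
  and "A : VOb C ==> B : VOb C ==> h : Arr V ==> Dom V h = Dom V y ==> Cod V h = VHom C A B ==>
   arr_case Y Z f y (arr A B o h) = f A B o y"
proof -
 note [simp] = YZ y
 let ?t = "\<lambda>A B. transpose V (VHom C A B) Y Z (f A B o pr2 V (VHom C A B) Y)"
 let ?c = "cotuple V (VOb C \<times> VOb C) (\<lambda>(A, B). VHom C A B) \<lbrakk>Y, Z\<rbrakk> (\<lambda>(A, B). ?t A B)"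
 have t: "?t A B : hom V (VHom C A B) \<lbrakk>Y, Z\<rbrakk>" if "A : VOb C" "B : VOb C" for A B
  using homD[OF f[OF that]] that by (simp add: in_hom)
 have c: "?c : hom V M \<lbrakk>Y, Z\<rbrakk>" by (rule arr_desc(1)) (use t in auto)
 note [simp] = homD(1-3)[OF c]
 show "arr_case Y Z f y x : hom V (Dom V y) Z" if "x : Arr V" "Dom V x = Dom V y" "Cod V x = M"
  using that unfolding arr_case_def by (simp add: in_hom)
 show "arr_case Y Z f y x o w = arr_case Y Z f (y o w) (x o w)"
  if "x : Arr V" "Dom V x = Dom V y" "Cod V x = M" "w : Arr V" "Cod V w = Dom V y"
  using that unfolding arr_case_def by simp
 show "arr_case Y Z f y (arr A B o h) = f A B o y"
  if A: "A : VOb C" "B : VOb C" and h: "h : Arr V" "Dom V h = Dom V y" "Cod V h = VHom C A B"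
 proof -
  note [simp] = A h homD(1-3)[OF f[OF A]] homD(1-3)[OF t[OF A]]
  have "?c o arr A B = ?t A B" by (rule arr_desc(2)) (use t A in auto)
  then have "(?c o arr A B) o h = ?t A B o h" by (rule arg_cong)
  moreover have "(?c o arr A B) o h = ?c o arr A B o h" by (rule comp_assoc) simp_all
  ultimately have "?c o arr A B o h = ?t A B o h" by simp
  then show ?thesis unfolding arr_case_def by simp
 qed
qed

end

subsection \<open>The walking arrow\<close>

context extensive_cat
begin

lemma two_simps [simp]: "VOb (two V) = {False, True}" "VHom (two V) a b = (if a \<le> b then \<one> else \<zero>)"
 "VId (two V) a = Idn V \<one>"
 by (simp_all add: two_def Let_def)

text \<open>
 The hom-objects of \<open>two V\<close> are terminal or initial, hence subterminal. All laws of an enriched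
 category hold for this reason.
\<close>

lemma two_hom_unique:
 assumes "f : hom V X (VHom (two V) a b)" "g : hom V X (VHom (two V) a b)"
 shows "f = g"
proof (cases "a \<le> b")
 case True
 then show ?thesis using assms to_one_eq[of f g] by (simp add: in_hom)
next
 case False
 then have "f : hom V X \<zero>" "g : hom V X \<zero>" using assms by simp_all
 then show ?thesis using strict_initial[of f X f \<zero> g] by blast
qed

lemma two_cmp: "VCmp (two V) a b d : hom V (VHom (two V) b d \<otimes> VHom (two V) a b) (VHom (two V) a d)"
proof -
 let ?P = "VHom (two V) b d \<otimes> VHom (two V) a b"
 have Obj: "VHom (two V) a b : Obj V" for a b using zero_in_Obj by simp
 have "\<exists>m. m : hom V ?P (VHom (two V) a d)"
 proof (cases "a \<le> d")
  case True
  then have "bang V ?P : hom V ?P (VHom (two V) a d)" using Obj by (simp add: in_hom del: le_bool_def)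
  then show ?thesis by blast
 next
  case False
  then have "\<not> b \<le> d \<or> \<not> a \<le> b" by auto
  moreover have "pr1 V (VHom (two V) b d) (VHom (two V) a b) \<in> hom V ?P (VHom (two V) b d)"
   "pr2 V (VHom (two V) b d) (VHom (two V) a b) \<in> hom V ?P (VHom (two V) a b)" using Obj by (simp_all add: in_hom del: two_simps)
  ultimately have "\<exists>u. u : hom V ?P \<zero>" by auto
  then show ?thesis using from_void[OF _ Obj] by blast
 qed
 then have "\<exists>!m. m : hom V ?P (VHom (two V) a d)" using two_hom_unique by blast
 from theI'[OF this] show ?thesis by (simp add: two_def Let_def)
qed

lemma two_vcat: "is_vcat V (two V)"
proof -
 have Obj [simp]: "VHom (two V) a b : Obj V" for a b using zero_in_Obj by simp
 note c [simp] = homD(1-3)[OF two_cmp]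
 note [simp del] = two_simps(2)
 have i [simp]: "VHom (two V) a a = \<one>" for a by (simp add: two_simps)
 show ?thesis
 proof (rule is_vcatI)
  fix A B X f assume f: "f : hom V X (VHom (two V) A B)"
  note [simp] = homD[OF f]
  show "VCmp (two V) A A B o \<langle>f, VId (two V) A o bang V X\<rangle> = f"
   "VCmp (two V) A B B o \<langle>VId (two V) B o bang V X, f\<rangle> = f"
   by (rule two_hom_unique; simp add: in_hom)+
  fix D E g h assume g: "g : hom V X (VHom (two V) B D)" and h: "h : hom V X (VHom (two V) D E)"
  note [simp] = homD[OF g] homD[OF h]
  show "VCmp (two V) A B E o \<langle>VCmp (two V) B D E o \<langle>h, g\<rangle>, f\<rangle> = VCmp (two V) A D E o \<langle>h, VCmp (two V) A B D o \<langle>g, f\<rangle>\<rangle>"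
   by (rule two_hom_unique[of _ X A E]; simp add: in_hom)
 qed (simp_all add: in_hom)
qed

end

sublocale extensive_cat \<subseteq> two: int_cat U V "two V"
 by unfold_locales (simp_all add: two_vcat small_finite[OF infinite_universe])

context extensive_cat
begin

lemma itwo_eq [simp]: "Int_cat V (two V) = itwo V"
 by (simp add: itwo_def)

lemma itwo_icat [simp]: "itwo V : Obj Cat"
 using two.Int_cat_icat by simp

abbreviation "two_arr a b X \<equiv> two.arr a b o bang V X"

lemma itwo_simps [simp]: "ic0 (itwo V) = two.Obs" "ic1 (itwo V) = two.M" "isrc (itwo V) = Int_src V (two V)"
 "itgt (itwo V) = Int_tgt V (two V)"
 using two.Int_cat_simps by simp_all

lemma two_arr_comp:
 assumes "a \<le> b" "b \<le> d" "X : Obj V"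
 shows "icomp V (itwo V) (two_arr b d X) (two_arr a b X) = two_arr a d X"
proof -
 have ad: "a \<le> d" using assms by auto
 note [simp] = homD(1-3)[OF two_cmp]
 have "VCmp (two V) a b d o \<langle>bang V X, bang V X\<rangle> = bang V X"
  by (rule two_hom_unique[of _ X a d]) (use assms ad in \<open>simp_all add: in_hom\<close>)
 then show ?thesis
  using two.Int_icomp[of a b d "bang V X" "bang V X"] assms ad by simp
qed

lemma local_two:
 assumes u: "u : hom V X two.M" and f: "f : hom V X Y" "g : hom V X Y"
  and eq: "\<And>W w a b. w : hom V W X ==> a \<le> b ==> u o w = two_arr a b W ==> f o w = g o w"
 shows "f = g"
proof (rule two.local_arr[OF u f])
 fix W w a b h assume w: "w : hom V W X" and h: "h : hom V W (VHom (two V) a b)" and e: "u o w = two.arr a b o h"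
 show "f o w = g o w"
 proof (cases "a \<le> b")
  case True
  then have "h = bang V W" using bang_unique[of h] homD[OF h] by simp
  then show ?thesis using eq[OF w True] e by simp
 next
  case False
  then show ?thesis using strict_initial[OF _ comp_in_hom[OF w f(1)] comp_in_hom[OF w f(2)], of h] h by simp
 qed
qed

lemma local_two_pair:
 assumes g: "g : hom V X two.M" and f: "f : hom V X two.M" and eq: "Int_src V (two V) o g = Int_tgt V (two V) o f"
  and ab: "k : hom V X Y" "l : hom V X Y"
  and loc: "\<And>W w a b d. w : hom V W X ==> a \<le> b ==> b \<le> d ==> g o w = two_arr b d W ==> f o w = two_arr a b W ==>
   k o w = l o w"
 shows "k = l"
proof (rule two.local_pair[OF g f eq ab])
 fix W w a b d h h' assume w: "w : hom V W X" and h: "h : hom V W (VHom (two V) b d)" "h' : hom V W (VHom (two V) a b)"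
  and e: "g o w = two.arr b d o h" "f o w = two.arr a b o h'"
 show "k o w = l o w"
 proof (cases "a \<le> b \<and> b \<le> d")
  case True
  then have "h = bang V W" "h' = bang V W" using bang_unique[of h] bang_unique[of h'] homD[OF h(1)] homD[OF h(2)] by simp_all
  then show ?thesis using loc[OF w, of a b d] True e by blast
 next
  case False
  then have "h : hom V W \<zero> \<or> h' : hom V W \<zero>" using h by auto
  then show ?thesis using strict_initial[OF _ comp_in_hom[OF w ab(1)] comp_in_hom[OF w ab(2)]] by blast
 qed
qed

end

subsection \<open>Commutative squares\<close>

locale arrow_icat = extensive_cat V U for U :: "'u itself" and V :: "('a, 'b) category" (structure) +
 fixes B
 assumes B [simp]: "B : Obj Cat"
begin

abbreviation "src \<equiv> isrc B"
abbreviation "tgt \<equiv> itgt B"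

text \<open>
 An element of \<open>squares\<close> is a commutative square of elements of \<open>B\<close>: its composites are \<open>right\<close>
 after \<open>upper\<close> and \<open>lower\<close> after \<open>left\<close>. As an arrow of the arrow category it leads from \<open>upper\<close>
 to \<open>lower\<close>.
\<close>

definition "squares = pb_obj V (icmp B) (icmp B)"
definition "right = pb1 V src tgt o pb1 V (icmp B) (icmp B)"
definition "upper = pb2 V src tgt o pb1 V (icmp B) (icmp B)"
definition "lower = pb1 V src tgt o pb2 V (icmp B) (icmp B)"
definition "left = pb2 V src tgt o pb2 V (icmp B) (icmp B)"
definition "square v f f' u = pb_pair V (icmp B) (icmp B) (pb_pair V src tgt v f) (pb_pair V src tgt f' u)"

lemma square_types [simp]: "squares : Obj V" "right : Arr V" "Dom V right = squares" "Cod V right = ic1 B"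
 "upper : Arr V" "Dom V upper = squares" "Cod V upper = ic1 B" "lower : Arr V" "Dom V lower = squares" "Cod V lower = ic1 B"
 "left : Arr V" "Dom V left = squares" "Cod V left = ic1 B"
 by (simp_all add: squares_def right_def upper_def lower_def left_def)

lemma square_laws:
 assumes [simp]: "x : Arr V" "Cod V x = squares"
 shows "src o right o x = tgt o upper o x" "src o lower o x = tgt o left o x"
  and "icomp V B (right o x) (upper o x) = icomp V B (lower o x) (left o x)"
  and "src o left o x = src o upper o x" "tgt o right o x = tgt o lower o x"
proof -
 have c [simp]: "Cod V x = pb_obj V (icmp B) (icmp B)" by (simp flip: squares_def)
 note [simp del] = assms(2)
 show 1: "src o right o x = tgt o upper o x" "src o lower o x = tgt o left o x"
  by (simp_all add: right_def upper_def lower_def left_def pb_square_point)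
 have 2: "icmp B o pb1 V (icmp B) (icmp B) o x = icmp B o pb2 V (icmp B) (icmp B) o x"
  by (rule pb_square_point) simp_all
 show 3: "icomp V B (right o x) (upper o x) = icomp V B (lower o x) (left o x)"
  using 2 pb_pair_eta[of src tgt "pb1 V (icmp B) (icmp B) o x"] pb_pair_eta[of src tgt "pb2 V (icmp B) (icmp B) o x"]
  by (simp add: right_def upper_def lower_def left_def)
 note [simp del] = c and [simp] = assms(2)
 have "src o left o x = src o icomp V B (lower o x) (left o x)" by (rule isrc_icomp[symmetric]) (simp_all add: 1)
 also have "\<dots> = src o icomp V B (right o x) (upper o x)" by (simp only: 3)
 also have "\<dots> = src o upper o x" by (rule isrc_icomp) (simp_all add: 1)
 finally show "src o left o x = src o upper o x" .
 have "tgt o right o x = tgt o icomp V B (right o x) (upper o x)" by (rule itgt_icomp[symmetric]) (simp_all add: 1)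
 also have "\<dots> = tgt o icomp V B (lower o x) (left o x)" by (simp only: 3)
 also have "\<dots> = tgt o lower o x" by (rule itgt_icomp) (simp_all add: 1)
 finally show "tgt o right o x = tgt o lower o x" .
qed

lemmas square_ends [simp] = square_laws(1,2,4,5)

lemma square_ext:
 assumes "x : Arr V" "y : Arr V" "Dom V x = Dom V y" "Cod V x = squares" "Cod V y = squares"
  "right o x = right o y" "upper o x = upper o y" "lower o x = lower o y" "left o x = left o y"
 shows "x = y"
proof (rule pb_ext)
 have c: "Cod V x = pb_obj V (icmp B) (icmp B)" "Cod V y = pb_obj V (icmp B) (icmp B)"
  using assms(4,5) by (simp_all flip: squares_def)
 note [simp] = assms(1-3) c
 show "pb1 V (icmp B) (icmp B) o x = pb1 V (icmp B) (icmp B) o y"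
  by (rule pb_ext[of _ _ src tgt]) (use assms(6,7) in \<open>simp_all add: right_def upper_def\<close>)
 show "pb2 V (icmp B) (icmp B) o x = pb2 V (icmp B) (icmp B) o y"
  by (rule pb_ext[of _ _ src tgt]) (use assms(8,9) in \<open>simp_all add: lower_def left_def\<close>)
qed (use assms in \<open>simp_all add: squares_def\<close>)

lemma square_props [simp]:
 assumes "v : Arr V" "f : Arr V" "f' : Arr V" "u : Arr V" "Dom V v = Dom V u" "Dom V f = Dom V u" "Dom V f' = Dom V u"
  "Cod V v = ic1 B" "Cod V f = ic1 B" "Cod V f' = ic1 B" "Cod V u = ic1 B"
  "src o v = tgt o f" "src o f' = tgt o u" "icomp V B v f = icomp V B f' u"
 shows "square v f f' u : Arr V" "Dom V (square v f f' u) = Dom V u" "Cod V (square v f f' u) = squares"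
  "right o square v f f' u = v" "upper o square v f f' u = f" "lower o square v f f' u = f'" "left o square v f f' u = u"
 using assms by (simp_all add: square_def right_def upper_def lower_def left_def squares_def)

definition "Ar = \<lparr>ic0 = ic1 B, ic1 = squares, isrc = upper, itgt = lower,
  iidn = square (iidn B o tgt) (Idn V (ic1 B)) (Idn V (ic1 B)) (iidn B o src),
  icmp = (let p = pb1 V upper lower; q = pb2 V upper lower
   in square (icomp V B (right o p) (right o q)) (upper o q) (lower o p) (icomp V B (left o p) (left o q)))\<rparr>"

lemma Ar_simps [simp]: "ic0 Ar = ic1 B" "ic1 Ar = squares" "isrc Ar = upper" "itgt Ar = lower"
 by (simp_all add: Ar_def)

text \<open>
 Two squares that share an edge paste: by associativity the common edge can be passed from one square
 to the other.
\<close>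

lemma paste:
 assumes [simp]: "g : Arr V" "f : Arr V" "Dom V g = Dom V f" "Cod V g = squares" "Cod V f = squares"
  and eq: "upper o g = lower o f"
 shows "src o right o g = tgt o right o f" "src o left o g = tgt o left o f"
  and "icomp V B (icomp V B (right o g) (right o f)) (upper o f) = icomp V B (lower o g) (icomp V B (left o g) (left o f))"
proof -
 note [simp] = eq
 show s: "src o right o g = tgt o right o f" "src o left o g = tgt o left o f" by simp_all
 have "icomp V B (icomp V B (right o g) (right o f)) (upper o f) = icomp V B (right o g) (icomp V B (right o f) (upper o f))"
  by (rule icomp_assoc) simp_all
 also have "\<dots> = icomp V B (right o g) (icomp V B (lower o f) (left o f))" by (simp only: square_laws(3) assms)
 also have "\<dots> = icomp V B (icomp V B (right o g) (lower o f)) (left o f)"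
  by (rule icomp_assoc[symmetric]) simp_all
 also have "\<dots> = icomp V B (icomp V B (lower o g) (left o g)) (left o f)"
  by (simp only: square_laws(3) assms flip: eq)
 also have "\<dots> = icomp V B (lower o g) (icomp V B (left o g) (left o f))"
  by (rule icomp_assoc) simp_all
 finally show "icomp V B (icomp V B (right o g) (right o f)) (upper o f) = icomp V B (lower o g) (icomp V B (left o g) (left o f))" .
qed

lemma Ar_iidn [simp]: "iidn Ar : Arr V" "Dom V (iidn Ar) = ic1 B" "Cod V (iidn Ar) = squares"
 "x : Arr V ==> Cod V x = ic1 B ==> right o iidn Ar o x = iidn B o tgt o x"
 "x : Arr V ==> Cod V x = ic1 B ==> upper o iidn Ar o x = x"
 "x : Arr V ==> Cod V x = ic1 B ==> lower o iidn Ar o x = x"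
 "x : Arr V ==> Cod V x = ic1 B ==> left o iidn Ar o x = iidn B o src o x"
proof -
 have i: "iidn Ar = square (iidn B o tgt) (Idn V (ic1 B)) (Idn V (ic1 B)) (iidn B o src)" by (simp add: Ar_def)
 have s: "src o iidn B o tgt = tgt o Idn V (ic1 B)" "src o Idn V (ic1 B) = tgt o iidn B o src" by simp_all
 have c: "icomp V B (iidn B o tgt) (Idn V (ic1 B)) = icomp V B (Idn V (ic1 B)) (iidn B o src)" by simp
 note p = square_props[OF _ _ _ _ _ _ _ _ _ _ _ s c, folded i]
 show t [simp]: "iidn Ar : Arr V" "Dom V (iidn Ar) = ic1 B" "Cod V (iidn Ar) = squares" using p(1-3) by simp_all
 assume x [simp]: "x : Arr V" "Cod V x = ic1 B"
 have "right o iidn Ar = iidn B o tgt" "upper o iidn Ar = Idn V (ic1 B)" "lower o iidn Ar = Idn V (ic1 B)"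
  "left o iidn Ar = iidn B o src" using p(4-7) by simp_all
 note e = this
 have "(right o iidn Ar) o x = right o iidn Ar o x" "(upper o iidn Ar) o x = upper o iidn Ar o x"
  "(lower o iidn Ar) o x = lower o iidn Ar o x" "(left o iidn Ar) o x = left o iidn Ar o x" by simp_all
 then show "right o iidn Ar o x = iidn B o tgt o x" "upper o iidn Ar o x = x" "lower o iidn Ar o x = x"
  "left o iidn Ar o x = iidn B o src o x" unfolding e by simp_all
qed

lemma Ar_icmp [simp]: "icmp Ar : Arr V" "Dom V (icmp Ar) = pb_obj V upper lower" "Cod V (icmp Ar) = squares"
proof -
 let ?p = "pb1 V upper lower" and ?q = "pb2 V upper lower"
 have eq: "upper o ?p = lower o ?q" by (rule pb_square) simp_all
 have i: "icmp Ar = square (icomp V B (right o ?p) (right o ?q)) (upper o ?q) (lower o ?p) (icomp V B (left o ?p) (left o ?q))"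
  by (simp add: Ar_def Let_def)
 note s = paste[of ?p ?q]
 show "icmp Ar : Arr V" "Dom V (icmp Ar) = pb_obj V upper lower" "Cod V (icmp Ar) = squares"
  unfolding i using s eq by simp_all
qed

lemma Ar_icomp [simp]:
 assumes [simp]: "g : Arr V" "f : Arr V" "Dom V g = Dom V f" "Cod V g = squares" "Cod V f = squares"
  and eq: "upper o g = lower o f"
 shows "right o icmp Ar o pb_pair V upper lower g f = icomp V B (right o g) (right o f)"
  "upper o icmp Ar o pb_pair V upper lower g f = upper o f"
  "lower o icmp Ar o pb_pair V upper lower g f = lower o g"
  "left o icmp Ar o pb_pair V upper lower g f = icomp V B (left o g) (left o f)"
proof -
 let ?p = "pb1 V upper lower" and ?q = "pb2 V upper lower" and ?x = "pb_pair V upper lower g f"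
 have eq': "upper o ?p = lower o ?q" by (rule pb_square) simp_all
 have i: "icmp Ar = square (icomp V B (right o ?p) (right o ?q)) (upper o ?q) (lower o ?p) (icomp V B (left o ?p) (left o ?q))"
  by (simp add: Ar_def Let_def)
 note s = paste[of ?p ?q]
 note [simp] = eq eq'
 have e: "right o icmp Ar = icomp V B (right o ?p) (right o ?q)" "upper o icmp Ar = upper o ?q" "lower o icmp Ar = lower o ?p"
  "left o icmp Ar = icomp V B (left o ?p) (left o ?q)"
  unfolding i by (rule square_props; use s in simp)+
 have a: "right o icmp Ar o ?x = (right o icmp Ar) o ?x" "upper o icmp Ar o ?x = (upper o icmp Ar) o ?x"
  "lower o icmp Ar o ?x = (lower o icmp Ar) o ?x" "left o icmp Ar o ?x = (left o icmp Ar) o ?x"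
  by (rule comp_assoc[symmetric]; simp)+
 show "right o icmp Ar o ?x = icomp V B (right o g) (right o f)" "upper o icmp Ar o ?x = upper o f"
  "lower o icmp Ar o ?x = lower o g" "left o icmp Ar o ?x = icomp V B (left o g) (left o f)"
  unfolding a e using s by simp_all
qed

lemma Ar_icat [simp]: "Ar : Obj Cat"
proof (rule is_icatI)
 fix X g f assume "f : hom V X (ic1 Ar)" "g : hom V X (ic1 Ar)" and "isrc Ar o g = itgt Ar o f"
 then have f: "f : hom V X squares" and g: "g : hom V X squares" and eq: "upper o g = lower o f" by simp_all
 note [simp] = homD[OF f] homD[OF g] eq
 show "isrc Ar o icomp V Ar g f = isrc Ar o f" "itgt Ar o icomp V Ar g f = itgt Ar o g" by simp_all
 fix h assume "h : hom V X (ic1 Ar)" and "isrc Ar o h = itgt Ar o g"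
 then have h: "h : hom V X squares" and eq': "upper o h = lower o g" by simp_all
 note [simp] = homD[OF h] eq'
 show "icomp V Ar (icomp V Ar h g) f = icomp V Ar h (icomp V Ar g f)"
  by (rule square_ext) (simp_all add: icomp_assoc paste(1,2))
next
 fix X f assume "f : hom V X (ic1 Ar)"
 then have f: "f : hom V X squares" by simp
 note [simp] = homD[OF f]
 show "icomp V Ar f (iidn Ar o isrc Ar o f) = f" "icomp V Ar (iidn Ar o itgt Ar o f) f = f"
  by (rule square_ext; simp)+
next
 fix X x assume "x : hom V X (ic0 Ar)"
 then have f: "x : hom V X (ic1 B)" by simp
 note [simp] = homD[OF f]
 show "isrc Ar o iidn Ar o x = x" "itgt Ar o iidn Ar o x = x" by simp_all
qed (simp_all add: in_hom)

end

subsection \<open>Evaluation of an arrow on the walking arrow\<close>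

context extensive_cat
begin

lemma itwo_points [simp]:
 "f : Arr V ==> Cod V f = \<one> ==> iidn (itwo V) o two.obj k o f = two.arr k k o f"
 "x : Arr V ==> Cod V x = two.Obs ==> Int_src V (two V) o iidn (itwo V) o x = x"
 "x : Arr V ==> Cod V x = two.Obs ==> Int_tgt V (two V) o iidn (itwo V) o x = x"
 using two.Int_points(3)[of k f] two.Int_iidn_ends[of x] by (auto simp: )

lemma two_incl_simps [simp]:
 "two.obj k : Arr V" "Dom V (two.obj k) = \<one>" "Cod V (two.obj k) = two.Obs"
 "two.arr a b : Arr V" "Dom V (two.arr a b) = (if a \<le> b then \<one> else \<zero>)" "Cod V (two.arr a b) = two.M"
 using two.incl_simps[of k] two.incl_simps(4-6)[of a b] by simp_all

lemma two_ends [simp]: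
 assumes "a \<le> b" "X : Obj V"
 shows "Int_src V (two V) o two_arr a b X = two.obj a o bang V X" "Int_tgt V (two V) o two_arr a b X = two.obj b o bang V X"
 using two.Int_points(1,2)[of a "bang V X" b] assms by simp_all

lemma two_arr_icomp [simp]:
 assumes "a \<le> b" "b \<le> d" "X : Obj V"
 shows "icmp (itwo V) o pb_pair V (Int_src V (two V)) (Int_tgt V (two V)) (two_arr b d X) (two_arr a b X) = two_arr a d X"
 using two_arr_comp[OF assms] by simp

end

context arrow_icat
begin

definition "ap0 f x = two.obj_case (ic1 B) (ic0 B) (\<lambda>k. if k then tgt else src) f x"

text \<open>
 The arrow of \<open>two V\<close> from \<open>False\<close> to \<open>True\<close> takes a square to its diagonal. An arrow
 from \<open>True\<close> to \<open>False\<close> exists only at an initial stage, where all values agree.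
\<close>

definition "ap1 x u = two.arr_case squares (ic1 B)
  (\<lambda>a b. if a = b then if b then right else left else icmp B o pb1 V (icmp B) (icmp B)) x u"

lemma ap0 [simp]:
 assumes "f : Arr V" "x : Arr V" "Dom V f = Dom V x" "Cod V f = ic1 B"
 shows "Cod V x = two.Obs ==> ap0 f x : Arr V" "Cod V x = two.Obs ==> Dom V (ap0 f x) = Dom V x"
  "Cod V x = two.Obs ==> Cod V (ap0 f x) = ic0 B"
  "Cod V x = two.Obs ==> w : Arr V ==> Cod V w = Dom V x ==> ap0 f x o w = ap0 (f o w) (x o w)"
  "Cod V x = \<one> ==> ap0 f (two.obj k o x) = (if k then tgt o f else src o f)"
proof -
 have h: "(if k then tgt else src) \<in> hom V (ic1 B) (ic0 B)" for k by (simp add: in_hom)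
 note c = two.obj_case[of "\<lambda>k. if k then tgt else src", OF h _ _ assms(1,4)]
 show "Cod V x = two.Obs ==> ap0 f x : Arr V" "Cod V x = two.Obs ==> Dom V (ap0 f x) = Dom V x"
  "Cod V x = two.Obs ==> Cod V (ap0 f x) = ic0 B"
  "Cod V x = two.Obs ==> w : Arr V ==> Cod V w = Dom V x ==> ap0 f x o w = ap0 (f o w) (x o w)"
  "Cod V x = \<one> ==> ap0 f (two.obj k o x) = (if k then tgt o f else src o f)"
  unfolding ap0_def using c(1)[of x] c(2)[of x w] c(3)[of k x] assms by (simp_all add: in_hom)
qed

lemma ap1 [simp]:
 assumes "x : Arr V" "u : Arr V" "Dom V x = Dom V u" "Cod V x = squares"
 shows "Cod V u = two.M ==> ap1 x u : Arr V" "Cod V u = two.M ==> Dom V (ap1 x u) = Dom V u"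
  "Cod V u = two.M ==> Cod V (ap1 x u) = ic1 B"
  "Cod V u = two.M ==> w : Arr V ==> Cod V w = Dom V u ==> ap1 x u o w = ap1 (x o w) (u o w)"
proof -
 let ?f = "\<lambda>a b. if a = b then if b then right else left else icmp B o pb1 V (icmp B) (icmp B)"
 have h: "?f a b : hom V squares (ic1 B)" for a b by (simp add: in_hom squares_def[symmetric])
 note c = two.arr_case[of ?f, OF h _ _ assms(1,4)]
 show "Cod V u = two.M ==> ap1 x u : Arr V" "Cod V u = two.M ==> Dom V (ap1 x u) = Dom V u"
  "Cod V u = two.M ==> Cod V (ap1 x u) = ic1 B"
  "Cod V u = two.M ==> w : Arr V ==> Cod V w = Dom V u ==> ap1 x u o w = ap1 (x o w) (u o w)"
  unfolding ap1_def using c(1)[of u] c(2)[of u w] assms by (simp_all add: in_hom)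
qed

lemma ap1_arr [simp]:
 assumes [simp]: "x : Arr V" "Dom V x = X" "Cod V x = squares" and ab: "a \<le> b" and X [simp]: "X : Obj V"
 shows "ap1 x (two_arr a b X) = (if a = b then if b then right o x else left o x else icomp V B (right o x) (upper o x))"
proof -
 let ?f = "\<lambda>a b. if a = b then if b then right else left else icmp B o pb1 V (icmp B) (icmp B)"
 have h: "?f a b : hom V squares (ic1 B)" for a b by (simp add: in_hom squares_def[symmetric])
 have 1: "ap1 x (two_arr a b X) = ?f a b o x"
  unfolding ap1_def by (rule two.arr_case(3)[of ?f, OF h]) (use ab in simp_all)
 have c: "Cod V x = pb_obj V (icmp B) (icmp B)" by (simp flip: squares_def)
 note [simp del] = assms(3) and [simp] = c
 have "(icmp B o pb1 V (icmp B) (icmp B)) o x = icomp V B (right o x) (upper o x)"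
  using pb_pair_eta[of src tgt "pb1 V (icmp B) (icmp B) o x"] by (simp add: right_def upper_def)
 then show ?thesis unfolding 1 by simp
qed

lemma ap_ends [simp]:
 assumes "x : Arr V" "u : Arr V" "Dom V x = Dom V u" "Cod V x = squares" "Cod V u = two.M"
 shows "src o ap1 x u = ap0 (upper o x) (Int_src V (two V) o u)" "tgt o ap1 x u = ap0 (lower o x) (Int_tgt V (two V) o u)"
proof -
 note [simp] = assms
 have u: "u : hom V (Dom V u) two.M" by (simp only: in_hom assms)
 have l: "(src o ap1 x u) o w = ap0 (upper o x) (Int_src V (two V) o u) o w"
  "(tgt o ap1 x u) o w = ap0 (lower o x) (Int_tgt V (two V) o u) o w"
  if w: "w : hom V W (Dom V u)" and ab: "a \<le> b" and e: "u o w = two_arr a b W" for W w a b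
 proof -
  have [simp]: "w : Arr V" "Dom V w = W" "Cod V w = Dom V u" "W : Obj V" using homD[OF w] by simp_all
  show "(src o ap1 x u) o w = ap0 (upper o x) (Int_src V (two V) o u) o w"
   "(tgt o ap1 x u) o w = ap0 (lower o x) (Int_tgt V (two V) o u) o w"
   using ab by (cases a; cases b; simp add: e)+
 qed
 show "src o ap1 x u = ap0 (upper o x) (Int_src V (two V) o u)"
  by (rule local_two[OF u _ _ l(1)]) (simp_all add: in_hom)
 show "tgt o ap1 x u = ap0 (lower o x) (Int_tgt V (two V) o u)"
  by (rule local_two[OF u _ _ l(2)]) (simp_all add: in_hom)
qed

lemma ap_iidn:
 assumes f: "f : hom V X (ic1 B)" and x: "x : hom V X two.Obs"
 shows "ap1 (iidn Ar o f) (iidn (itwo V) o x) = iidn B o ap0 f x"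
proof (rule two.local_obj[OF x])
 note [simp] = homD[OF f] homD[OF x]
 show "ap1 (iidn Ar o f) (iidn (itwo V) o x) \<in> hom V X (ic1 B)" "iidn B o ap0 f x : hom V X (ic1 B)"
  by (simp_all add: in_hom)
 fix W w k assume w: "w : hom V W X" and e: "x o w = two.obj k o bang V W"
 note [simp] = homD[OF w]
 show "ap1 (iidn Ar o f) (iidn (itwo V) o x) o w = (iidn B o ap0 f x) o w"
  by (cases k; simp add: e)
qed

lemma ap_icomp:
 assumes x: "x : hom V X squares" "x' : hom V X squares" and eq: "upper o x' = lower o x"
  and u: "u : hom V X two.M" "u' : hom V X two.M" and eq': "Int_src V (two V) o u' = Int_tgt V (two V) o u"
 shows "ap1 (icomp V Ar x' x) (icomp V (itwo V) u' u) = icomp V B (ap1 x' u') (ap1 x u)"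
proof (rule local_two_pair[OF u(2,1) eq'])
 note [simp] = homD[OF x(1)] homD[OF x(2)] homD[OF u(1)] homD[OF u(2)] eq eq'
 show "ap1 (icomp V Ar x' x) (icomp V (itwo V) u' u) \<in> hom V X (ic1 B)" "icomp V B (ap1 x' u') (ap1 x u) \<in> hom V X (ic1 B)"
  by (simp_all add: in_hom)
 fix W w a b d assume w: "w : hom V W X" and ab: "a \<le> b" "b \<le> d" and e: "u' o w = two_arr b d W" "u o w = two_arr a b W"
 note [simp] = homD[OF w]
 have eqw [simp]: "upper o x' o w = lower o x o w" by (rule square_point[OF eq]) simp_all
 have eqw': "Int_src V (two V) o u' o w = Int_tgt V (two V) o u o w" by (rule square_point[OF eq']) simp_all
 have sw [simp]: "src o right o x' o w = tgt o right o x o w" "src o left o x' o w = tgt o left o x o w"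
  by (rule paste[OF _ _ _ _ _ eqw]; simp)+
 have s: "icomp V B (icomp V B (right o x' o w) (right o x o w)) (upper o x o w)
   = icomp V B (right o x' o w) (icomp V B (right o x o w) (upper o x o w))"
  "icomp V B (icomp V B (right o x' o w) (lower o x o w)) (left o x o w)
   = icomp V B (right o x' o w) (icomp V B (lower o x o w) (left o x o w))"
  by (rule icomp_assoc; simp)+
 have s': "icomp V B (right o x o w) (upper o x o w) = icomp V B (lower o x o w) (left o x o w)"
  by (rule square_laws(3)) simp_all
 have ad: "a \<le> d" using ab by auto
 have "ap1 (icomp V Ar x' x) (icomp V (itwo V) u' u) o w = ap1 (icomp V Ar (x' o w) (x o w)) (two_arr a d W)"
  using ab by (simp add: eqw' e)
 also have "\<dots> = icomp V B (ap1 (x' o w) (two_arr b d W)) (ap1 (x o w) (two_arr a b W))"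
  using ab ad by (cases a; cases b; cases d; simp add: s s')
 also have "\<dots> = icomp V B (ap1 x' u') (ap1 x u) o w" by (simp add: e eqw')
 finally show "ap1 (icomp V Ar x' x) (icomp V (itwo V) u' u) o w = icomp V B (ap1 x' u') (ap1 x u) o w" .
qed

abbreviation "apply \<equiv> \<lparr>idom = Ar \<otimes>\<^bsub>Cat\<^esub> itwo V, icod = B,
   if0 = ap0 (if0 (pr1 Cat Ar (itwo V))) (if0 (pr2 Cat Ar (itwo V))),
   if1 = ap1 (if1 (pr1 Cat Ar (itwo V))) (if1 (pr2 Cat Ar (itwo V)))\<rparr>"

lemma apply_in_hom: "apply : hom Cat (Ar \<otimes>\<^bsub>Cat\<^esub> itwo V) B"
proof (rule is_ifunI)
 let ?P = "Ar \<otimes>\<^bsub>Cat\<^esub> itwo V"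
 let ?p1 = "if1 (pr1 Cat Ar (itwo V))" and ?q1 = "if1 (pr2 Cat Ar (itwo V))"
 let ?p0 = "if0 (pr1 Cat Ar (itwo V))" and ?q0 = "if0 (pr2 Cat Ar (itwo V))"
 note [simp del] = isrc_if1 and [simp] = ipr_point
 { fix X u assume u: "u : hom V X (ic1 ?P)"
  note [simp] = homD[OF u]
  show "src o ap1 ?p1 ?q1 o u = ap0 ?p0 ?q0 o isrc ?P o u" "tgt o ap1 ?p1 ?q1 o u = ap0 ?p0 ?q0 o itgt ?P o u"
   by simp_all
  fix v assume v: "v : hom V X (ic1 ?P)" and eq: "isrc ?P o v = itgt ?P o u"
  note [simp] = homD[OF v]
  have "?p0 o isrc ?P o v = ?p0 o itgt ?P o u" "?q0 o isrc ?P o v = ?q0 o itgt ?P o u" by (simp_all only: eq)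
  then have e: "upper o ?p1 o v = lower o ?p1 o u" "Int_src V (two V) o ?q1 o v = Int_tgt V (two V) o ?q1 o u" by simp_all
  have 1: "?p1 o icomp V ?P v u = icomp V Ar (?p1 o v) (?p1 o u)"
   "?q1 o icomp V ?P v u = icomp V (itwo V) (?q1 o v) (?q1 o u)"
   by (subst if1_icomp; simp add: eq)+
  have "ap1 ?p1 ?q1 o icomp V ?P v u = ap1 (?p1 o icomp V ?P v u) (?q1 o icomp V ?P v u)"
   by (rule ap1(4)) (simp_all add: eq)
  also have "\<dots> = icomp V B (ap1 (?p1 o v) (?q1 o v)) (ap1 (?p1 o u) (?q1 o u))"
   unfolding 1 by (rule ap_icomp[of _ X]) (simp_all add: in_hom e)
  finally show "ap1 ?p1 ?q1 o icomp V ?P v u = icomp V B (ap1 ?p1 ?q1 o v) (ap1 ?p1 ?q1 o u)" by simp }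
 fix X x assume x: "x : hom V X (ic0 ?P)"
 note [simp] = homD[OF x]
 show "ap1 ?p1 ?q1 o iidn ?P o x = iidn B o ap0 ?p0 ?q0 o x"
  using ap_iidn[of "?p0 o x" X "?q0 o x"] by (simp add: in_hom)
qed (simp_all add: in_hom)

end

subsection \<open>The arrow category is an exponential\<close>

text \<open>
 A functor \<open>F\<close> on \<open>Y \<otimes> itwo V\<close> amounts to two functors on \<open>Y\<close> and a natural transformation between
 them: the values of \<open>F\<close> at the identities of the walking arrow and at its non-identity arrow.
\<close>

locale arrow_transpose = arrow_icat U V B
 for U :: "'u itself" and V :: "('a, 'b) category" (structure) and B +
 fixes Y F
 assumes Y [simp]: "Y : Obj Cat" and F: "F : hom Cat (Y \<otimes>\<^bsub>Cat\<^esub> itwo V) B"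
begin

lemmas F_simps [simp] = Cat.homD(1-3)[OF F]

abbreviation "F0 y x \<equiv> if0 F o pair0 Y (itwo V) y x"
abbreviation "F1 y x \<equiv> if1 F o pair1 Y (itwo V) y x"

lemma F1_comp:
 assumes [simp]: "g : Arr V" "f : Arr V" "Dom V g = X" "Dom V f = X" "Cod V g = ic1 Y" "Cod V f = ic1 Y"
  "isrc Y o g = itgt Y o f" and ab: "a \<le> b" "b \<le> d" and X [simp]: "X : Obj V"
 shows "icomp V B (F1 g (two_arr b d X)) (F1 f (two_arr a b X)) = F1 (icomp V Y g f) (two_arr a d X)"
proof -
 let ?P = "Y \<otimes>\<^bsub>Cat\<^esub> itwo V"
 have 1: "icomp V ?P (pair1 Y (itwo V) g (two_arr b d X)) (pair1 Y (itwo V) f (two_arr a b X))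
   = pair1 Y (itwo V) (icomp V Y g f) (icomp V (itwo V) (two_arr b d X) (two_arr a b X))"
  by (rule pair_icomp) (use ab in simp_all)
 have "if1 F o icomp V ?P (pair1 Y (itwo V) g (two_arr b d X)) (pair1 Y (itwo V) f (two_arr a b X))
   = icomp V (Cod Cat F) (F1 g (two_arr b d X)) (F1 f (two_arr a b X))"
  by (rule if1_icomp) (use ab in simp_all)
 then show ?thesis unfolding 1 using ab by simp
qed

lemma F1_id:
 assumes "y : Arr V" "Dom V y = X" "Cod V y = ic0 Y" "X : Obj V"
 shows "F1 (iidn Y o y) (two_arr k k X) = iidn B o F0 y (two.obj k o bang V X)"
proof -
 have "pair1 Y (itwo V) (iidn Y o y) (two_arr k k X) = iidn (Y \<otimes>\<^bsub>Cat\<^esub> itwo V) o pair0 Y (itwo V) y (two.obj k o bang V X)"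
  using assms by simp
 moreover have "if1 F o iidn (Y \<otimes>\<^bsub>Cat\<^esub> itwo V) o pair0 Y (itwo V) y (two.obj k o bang V X)
   = iidn (Cod Cat F) o F0 y (two.obj k o bang V X)"
  by (rule if1_iidn) (use assms in simp_all)
 ultimately show ?thesis by simp
qed

definition "h0 = F1 (iidn Y) (two_arr False True (ic0 Y))"
definition "h1 = square (F1 (Idn V (ic1 Y)) (two_arr True True (ic1 Y))) (h0 o isrc Y) (h0 o itgt Y)
  (F1 (Idn V (ic1 Y)) (two_arr False False (ic1 Y)))"

lemma h0 [simp]: "h0 : Arr V" "Dom V h0 = ic0 Y" "Cod V h0 = ic1 B"
 "y : Arr V ==> Cod V y = ic0 Y ==> h0 o y = F1 (iidn Y o y) (two_arr False True (Dom V y))"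
 by (simp_all add: h0_def)

lemma h1 [simp]: "h1 : Arr V" "Dom V h1 = ic1 Y" "Cod V h1 = squares"
 "w : Arr V ==> Cod V w = ic1 Y ==> right o h1 o w = F1 w (two_arr True True (Dom V w))"
 "w : Arr V ==> Cod V w = ic1 Y ==> upper o h1 o w = F1 (iidn Y o isrc Y o w) (two_arr False True (Dom V w))"
 "w : Arr V ==> Cod V w = ic1 Y ==> lower o h1 o w = F1 (iidn Y o itgt Y o w) (two_arr False True (Dom V w))"
 "w : Arr V ==> Cod V w = ic1 Y ==> left o h1 o w = F1 w (two_arr False False (Dom V w))"
proof -
 let ?i = "Idn V (ic1 Y)"
 have c: "icomp V B (F1 ?i (two_arr True True (ic1 Y))) (h0 o isrc Y) = icomp V B (h0 o itgt Y) (F1 ?i (two_arr False False (ic1 Y)))"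
  by (simp add: F1_comp)
 note p = square_props[OF _ _ _ _ _ _ _ _ _ _ _ _ _ c, folded h1_def]
 show t [simp]: "h1 : Arr V" "Dom V h1 = ic1 Y" "Cod V h1 = squares" using p(1-3) by simp_all
 assume w [simp]: "w : Arr V" "Cod V w = ic1 Y"
 have e: "right o h1 = F1 ?i (two_arr True True (ic1 Y))" "upper o h1 = h0 o isrc Y" "lower o h1 = h0 o itgt Y"
  "left o h1 = F1 ?i (two_arr False False (ic1 Y))" by (rule p(4-7); simp)+
 have "(right o h1) o w = right o h1 o w" "(upper o h1) o w = upper o h1 o w"
  "(lower o h1) o w = lower o h1 o w" "(left o h1) o w = left o h1 o w" by (rule comp_assoc; simp)+
 then show "right o h1 o w = F1 w (two_arr True True (Dom V w))"
  "upper o h1 o w = F1 (iidn Y o isrc Y o w) (two_arr False True (Dom V w))"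
  "lower o h1 o w = F1 (iidn Y o itgt Y o w) (two_arr False True (Dom V w))"
  "left o h1 o w = F1 w (two_arr False False (Dom V w))"
  unfolding e by simp_all
qed

abbreviation "h \<equiv> \<lparr>idom = Y, icod = Ar, if0 = h0, if1 = h1\<rparr>"

lemma h_in_hom: "h : hom Cat Y Ar"
proof (rule is_ifunI)
 fix X u assume u: "u : hom V X (ic1 Y)"
 note [simp] = homD[OF u]
 show "isrc Ar o h1 o u = h0 o isrc Y o u" "itgt Ar o h1 o u = h0 o itgt Y o u" by simp_all
 fix v assume v: "v : hom V X (ic1 Y)" and eq: "isrc Y o v = itgt Y o u"
 note [simp] = homD[OF v] eq
 show "h1 o icomp V Y v u = icomp V Ar (h1 o v) (h1 o u)"
  by (rule square_ext) (simp_all add: F1_comp)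
next
 fix X x assume x: "x : hom V X (ic0 Y)"
 note [simp] = homD[OF x]
 show "h1 o iidn Y o x = iidn Ar o h0 o x"
  by (rule square_ext) (simp_all add: F1_id)
qed (simp_all add: in_hom)

lemma ap_h:
 assumes "x : hom V X two.Obs" "y : hom V X (ic0 Y)"
 shows "ap0 (h0 o y) x = F0 y x"
proof (rule two.local_obj[OF assms(1)])
 note [simp] = homD[OF assms(1)] homD[OF assms(2)]
 show "ap0 (h0 o y) x : hom V X (ic0 B)" "F0 y x : hom V X (ic0 B)" by (simp_all add: in_hom)
 fix W w k assume w: "w : hom V W X" and e: "x o w = two.obj k o bang V W"
 note [simp] = homD[OF w]
 show "ap0 (h0 o y) x o w = F0 y x o w" by (cases k; simp add: e)
qed

lemma ap_h1:
 assumes "u : hom V X two.M" "y : hom V X (ic1 Y)"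
 shows "ap1 (h1 o y) u = F1 y u"
proof (rule local_two[OF assms(1)])
 note [simp] = homD[OF assms(1)] homD[OF assms(2)]
 show "ap1 (h1 o y) u : hom V X (ic1 B)" "F1 y u : hom V X (ic1 B)" by (simp_all add: in_hom)
 fix W w a b assume w: "w : hom V W X" and ab: "a \<le> b" and e: "u o w = two_arr a b W"
 note [simp] = homD[OF w]
 show "ap1 (h1 o y) u o w = F1 y u o w" using ab by (cases a; cases b; simp add: e F1_comp)
qed

lemma apply_value:
 assumes k: "k : hom Cat Y Ar"
 shows "x : hom V X two.Obs ==> y : hom V X (ic0 Y) ==>
   if0 (apply o\<^bsub>Cat\<^esub> \<langle>k o\<^bsub>Cat\<^esub> pr1 Cat Y (itwo V), pr2 Cat Y (itwo V)\<rangle>\<^bsub>Cat\<^esub>) o pair0 Y (itwo V) y x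
    = ap0 (if0 k o y) x"
  and "x : hom V X two.M ==> y : hom V X (ic1 Y) ==>
   if1 (apply o\<^bsub>Cat\<^esub> \<langle>k o\<^bsub>Cat\<^esub> pr1 Cat Y (itwo V), pr2 Cat Y (itwo V)\<rangle>\<^bsub>Cat\<^esub>) o pair1 Y (itwo V) y x
    = ap1 (if1 k o y) x"
proof -
 note [simp] = Cat.homD(1-3)[OF k]
 show "if0 (apply o\<^bsub>Cat\<^esub> \<langle>k o\<^bsub>Cat\<^esub> pr1 Cat Y (itwo V), pr2 Cat Y (itwo V)\<rangle>\<^bsub>Cat\<^esub>) o pair0 Y (itwo V) y x
    = ap0 (if0 k o y) x" if "x : hom V X two.Obs" "y : hom V X (ic0 Y)"
  using homD[OF that(1)] homD[OF that(2)] by simp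
 show "if1 (apply o\<^bsub>Cat\<^esub> \<langle>k o\<^bsub>Cat\<^esub> pr1 Cat Y (itwo V), pr2 Cat Y (itwo V)\<rangle>\<^bsub>Cat\<^esub>) o pair1 Y (itwo V) y x
    = ap1 (if1 k o y) x" if "x : hom V X two.M" "y : hom V X (ic1 Y)"
  using homD[OF that(1)] homD[OF that(2)] by simp
qed

text \<open>
 A transpose is determined on objects by its values at the non-identity arrow of \<open>two V\<close>, since the
 diagonal of an identity square is the arrow itself.
\<close>

lemma transpose_on_objects:
 assumes k: "k : hom Cat Y Ar"
  and eq: "apply o\<^bsub>Cat\<^esub> \<langle>k o\<^bsub>Cat\<^esub> pr1 Cat Y (itwo V), pr2 Cat Y (itwo V)\<rangle>\<^bsub>Cat\<^esub> = F"
 shows "if0 k = h0"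
proof -
 note [simp] = Cat.homD(1-3)[OF k]
 have "ap1 (if1 k o iidn Y) (two_arr False True (ic0 Y)) = F1 (iidn Y) (two_arr False True (ic0 Y))"
  using apply_value(2)[OF k, of "two_arr False True (ic0 Y)" "ic0 Y" "iidn Y", unfolded eq] by (simp add: in_hom)
 moreover have "if1 k o iidn Y = iidn Ar o if0 k" using if1_iidn_0[of k] by simp
 ultimately show ?thesis by (simp add: h0_def)
qed

lemma transpose_exists_unique:
 "\<exists>!k. k : hom Cat Y Ar \<and> apply o\<^bsub>Cat\<^esub> \<langle>k o\<^bsub>Cat\<^esub> pr1 Cat Y (itwo V), pr2 Cat Y (itwo V)\<rangle>\<^bsub>Cat\<^esub> = F"
proof (rule ex1I[of _ h], intro conjI)
 let ?T = "\<lambda>k. apply o\<^bsub>Cat\<^esub> \<langle>k o\<^bsub>Cat\<^esub> pr1 Cat Y (itwo V), pr2 Cat Y (itwo V)\<rangle>\<^bsub>Cat\<^esub>"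
 show "h : hom Cat Y Ar" by (rule h_in_hom)
 note [simp] = Cat.homD(1-3)[OF h_in_hom] Cat.homD(1-3)[OF apply_in_hom]
 have p: "pair0 Y (itwo V) (if0 (pr1 Cat Y (itwo V))) (if0 (pr2 Cat Y (itwo V))) = Idn V (ic0 (Y \<otimes>\<^bsub>Cat\<^esub> itwo V))"
  "pair1 Y (itwo V) (if1 (pr1 Cat Y (itwo V))) (if1 (pr2 Cat Y (itwo V))) = Idn V (ic1 (Y \<otimes>\<^bsub>Cat\<^esub> itwo V))"
  by (rule if_ipr_eta; simp)+
 have T: "?T h : hom Cat (Y \<otimes>\<^bsub>Cat\<^esub> itwo V) B" by (simp add: in_hom)
 note [simp] = Cat.homD(1-3)[OF T]
 have "if0 (?T h) o Idn V (ic0 (Y \<otimes>\<^bsub>Cat\<^esub> itwo V)) = if0 F o Idn V (ic0 (Y \<otimes>\<^bsub>Cat\<^esub> itwo V))"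
  unfolding p(1)[symmetric] by (subst apply_value(1)[OF h_in_hom, of _ "ic0 (Y \<otimes>\<^bsub>Cat\<^esub> itwo V)"],
   simp add: in_hom, simp add: in_hom, subst ifun.simps, rule ap_h) (simp_all add: in_hom)
 moreover have "if1 (?T h) o Idn V (ic1 (Y \<otimes>\<^bsub>Cat\<^esub> itwo V)) = if1 F o Idn V (ic1 (Y \<otimes>\<^bsub>Cat\<^esub> itwo V))"
  unfolding p(2)[symmetric] by (subst apply_value(2)[OF h_in_hom, of _ "ic1 (Y \<otimes>\<^bsub>Cat\<^esub> itwo V)"],
   simp add: in_hom, simp add: in_hom, subst ifun.simps, rule ap_h1) (simp_all add: in_hom)
 moreover have "if0 (?T h) o Idn V (ic0 (Y \<otimes>\<^bsub>Cat\<^esub> itwo V)) = if0 (?T h)"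
  "if1 (?T h) o Idn V (ic1 (Y \<otimes>\<^bsub>Cat\<^esub> itwo V)) = if1 (?T h)"
  by (rule comp_id_right; simp only: ifun_laws Cat.homD[OF T])+
 ultimately have "if0 (?T h) = if0 F" "if1 (?T h) = if1 F" by simp_all
 then show "?T h = F" by - (rule ifun_ext, simp_all only: Cat.homD[OF T] F_simps)
 fix k assume k: "k : hom Cat Y Ar \<and> ?T k = F"
 then have k': "k : hom Cat Y Ar" and eq: "?T k = F" by blast+
 note [simp] = Cat.homD(1-3)[OF k']
 have k0: "if0 k = h0" by (rule transpose_on_objects[OF k' eq])
 have v: "ap1 (if1 k o Idn V (ic1 Y)) (two_arr b b (ic1 Y)) = F1 (Idn V (ic1 Y)) (two_arr b b (ic1 Y))" for b
  using apply_value(2)[OF k', of "two_arr b b (ic1 Y)" "ic1 Y" "Idn V (ic1 Y)", unfolded eq] by (simp add: in_hom)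
 have "if1 k = h1"
 proof (rule square_ext)
  have "upper o if1 k = if0 k o isrc Y" "lower o if1 k = if0 k o itgt Y"
   using isrc_if1_0[of k] itgt_if1_0[of k] by simp_all
  then show "upper o if1 k = upper o h1" "lower o if1 k = lower o h1"
   using h1(5,6)[of "Idn V (ic1 Y)"] by (simp_all add: k0)
  show "right o if1 k = right o h1" "left o if1 k = left o h1"
   using v[of True] v[of False] h1(4,7)[of "Idn V (ic1 Y)"] by simp_all
 qed simp_all
 then show "k = h" using k0 by (intro ifun_ext) simp_all
qed

end

lemma (in arrow_icat) arrow_category_is_exponential: "is_exponential Cat (itwo V) B Ar apply"
 unfolding is_exponential_def
proof (intro conjI ballI)
 show "Ar : Obj Cat" "apply : hom Cat (Ar \<otimes>\<^bsub>Cat\<^esub> itwo V) B" by (rule Ar_icat apply_in_hom)+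
 fix Y F assume "Y : Obj Cat" "F : hom Cat (Y \<otimes>\<^bsub>Cat\<^esub> itwo V) B"
 then interpret arrow_transpose U V B Y F by unfold_locales
 show "\<exists>!k. k : hom Cat Y Ar \<and> apply o\<^bsub>Cat\<^esub> \<langle>k o\<^bsub>Cat\<^esub> pr1 Cat Y (itwo V), pr2 Cat Y (itwo V)\<rangle>\<^bsub>Cat\<^esub> = F"
  by (rule transpose_exists_unique)
qed

section \<open>Comma categories and internal terminal objects\<close>

context pullback_ccc
begin

lemma elem_ifun_in_hom:
 assumes [simp]: "A : Obj Cat" and a: "a : hom V \<one> (ic0 A)"
 shows "elem_ifun V A a : hom Cat (cst V \<one>) A"
 unfolding elem_ifun_def
proof (rule is_ifunI)
 note [simp] = homD[OF a]
 { fix X u assume "u : hom V X (ic1 (cst V \<one>))"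
  then have u: "u : hom V X \<one>" by simp
  note [simp] = homD[OF u]
  show "isrc A o (iidn A o a) o u = a o isrc (cst V \<one>) o u" "itgt A o (iidn A o a) o u = a o itgt (cst V \<one>) o u"
   by simp_all
  fix v assume "v : hom V X (ic1 (cst V \<one>))"
  then have v: "v : hom V X \<one>" by simp
  note [simp] = homD[OF v]
  have [simp]: "v = u" by (rule to_one_eq) simp_all
  show "(iidn A o a) o icomp V (cst V \<one>) v u = icomp V A ((iidn A o a) o v) ((iidn A o a) o u)"
   by simp }
 fix X x assume "x : hom V X (ic0 (cst V \<one>))"
 then have x: "x : hom V X \<one>" by simp
 note [simp] = homD[OF x]
 show "(iidn A o a) o iidn (cst V \<one>) o x = iidn A o a o x" by simp
qed (use homD[OF a] in \<open>simp_all add: in_hom\<close>)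

lemma elem_ifun_simps [simp]: "if0 (elem_ifun V A a) = a" "if1 (elem_ifun V A a) = iidn A o a"
 by (simp_all add: elem_ifun_def)

text \<open>
 The inverses on objects and on arrows form a functor: to see that they respect the structure, cancel
 \<open>F\<close>, which respects it.
\<close>

lemma ifun_isoI:
 assumes F: "F : hom Cat A B" and "is_iso V (if0 F)" "is_iso V (if1 F)"
 shows "is_iso Cat F"
proof -
 note [simp] = Cat.homD[OF F]
 obtain g0 where g0: "g0 : hom V (ic0 B) (ic0 A)" "g0 o if0 F = Idn V (ic0 A)" "if0 F o g0 = Idn V (ic0 B)"
  using isoE[OF assms(2), of "ic0 A" "ic0 B"] by (auto simp: in_hom)
 obtain g1 where g1: "g1 : hom V (ic1 B) (ic1 A)" "g1 o if1 F = Idn V (ic1 A)" "if1 F o g1 = Idn V (ic1 B)"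
  using isoE[OF assms(3), of "ic1 A" "ic1 B"] by (auto simp: in_hom)
 note [simp] = homD(1-3)[OF g0(1)] homD(1-3)[OF g1(1)]
 have c: "g0 o if0 F o x = x" if "x : Arr V" "Cod V x = ic0 A" for x
  by (rule comp_iso_cancel[OF g0(2) _ g0(1), of x "Dom V x"]) (use that in \<open>simp_all add: in_hom\<close>)
 have d: "if0 F o g0 o x = x" if "x : Arr V" "Cod V x = ic0 B" for x
  by (rule comp_iso_cancel[OF g0(3) g0(1), of x "Dom V x"]) (use that in \<open>simp_all add: in_hom\<close>)
 have c1: "g1 o if1 F o x = x" if "x : Arr V" "Cod V x = ic1 A" for x
  by (rule comp_iso_cancel[OF g1(2) _ g1(1), of x "Dom V x"]) (use that in \<open>simp_all add: in_hom\<close>)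
 have d1: "if1 F o g1 o x = x" if "x : Arr V" "Cod V x = ic1 B" for x
  by (rule comp_iso_cancel[OF g1(3) g1(1), of x "Dom V x"]) (use that in \<open>simp_all add: in_hom\<close>)
 let ?G = "\<lparr>idom = B, icod = A, if0 = g0, if1 = g1\<rparr>"
 have G: "?G : hom Cat B A"
 proof (rule is_ifunI)
  have s: "isrc A o g1 o u = g0 o isrc B o u" "itgt A o g1 o u = g0 o itgt B o u"
   if "u : Arr V" "Cod V u = ic1 B" for u
  proof -
   note [simp] = that
   have "isrc B o u = isrc B o if1 F o g1 o u" "itgt B o u = itgt B o if1 F o g1 o u" by (simp_all only: d1 that)
   then show "isrc A o g1 o u = g0 o isrc B o u" "itgt A o g1 o u = g0 o itgt B o u" by (simp_all add: c)
  qed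
  { fix X u assume u: "u : hom V X (ic1 B)"
   note [simp] = homD[OF u]
   show "isrc A o g1 o u = g0 o isrc B o u" "itgt A o g1 o u = g0 o itgt B o u" by (rule s; simp)+
   fix v assume v: "v : hom V X (ic1 B)" and eq: "isrc B o v = itgt B o u"
   note [simp] = homD[OF v]
   have sq: "isrc A o g1 o v = itgt A o g1 o u" by (simp add: s eq)
   have "icomp V B v u = icomp V B (if1 F o g1 o v) (if1 F o g1 o u)" by (simp add: d1)
   also have "\<dots> = if1 F o icomp V A (g1 o v) (g1 o u)"
    using if1_icomp[of F A "g1 o v" "g1 o u"] sq by simp
   finally show "g1 o icomp V B v u = icomp V A (g1 o v) (g1 o u)" by (simp add: c1 sq del: if1_icomp) }
  fix X x assume x: "x : hom V X (ic0 B)"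
  note [simp] = homD[OF x]
  have "iidn B o x = if1 F o iidn A o g0 o x" by (simp add: d)
  then show "g1 o iidn B o x = iidn A o g0 o x" by (simp add: c1 del: if1_iidn)
 qed (use g0(1) g1(1) in simp_all)
 note [simp] = Cat.homD[OF G]
 show ?thesis
 proof (rule Cat.isoI[OF F G])
  show "?G o\<^bsub>Cat\<^esub> F = Idn Cat A" by (rule ifun_ext) (simp_all add: g0 g1)
  show "F o\<^bsub>Cat\<^esub> ?G = Idn Cat B" by (rule ifun_ext) (simp_all add: g0 g1)
 qed
qed

lemma if_iso:
 assumes "is_iso Cat F"
 shows "is_iso V (if0 F)" "is_iso V (if1 F)"
proof -
 have F: "F : hom Cat (Dom Cat F) (Cod Cat F)" using assms unfolding is_iso_def by (simp add: in_hom)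
 obtain G where G: "G : hom Cat (Cod Cat F) (Dom Cat F)" "G o\<^bsub>Cat\<^esub> F = Idn Cat (Dom Cat F)"
  "F o\<^bsub>Cat\<^esub> G = Idn Cat (Cod Cat F)"
  using Cat.isoE[OF assms F] by blast
 note t = Cat.homD(1)[OF F] Cat.homD[OF G(1)]
 have "if0 G o if0 F = Idn V (ic0 (Dom Cat F))" "if0 F o if0 G = Idn V (ic0 (Cod Cat F))"
  "if1 G o if1 F = Idn V (ic1 (Dom Cat F))" "if1 F o if1 G = Idn V (ic1 (Cod Cat F))"
  using arg_cong[OF G(2), of if0] arg_cong[OF G(3), of if0] arg_cong[OF G(2), of if1] arg_cong[OF G(3), of if1]
  unfolding CatV_fun_simps .
 note e = this
 show "is_iso V (if0 F)" by (rule isoI[OF _ _ e(1,2)]) (simp_all add: t in_hom)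
 show "is_iso V (if1 F)" by (rule isoI[OF _ _ e(3,4)]) (simp_all add: t in_hom)
qed

end

subsection \<open>The chosen arrow category\<close>

context arrow_icat
begin

abbreviation "E \<equiv> \<lbrakk>itwo V, B\<rbrakk>\<^bsub>Cat\<^esub>"

lemma chosen_arrow_category: "is_exponential Cat (itwo V) B E (ev Cat (itwo V) B)"
 by (rule Cat.chosen_exponential[OF arrow_category_is_exponential])

text \<open>
 The chosen exponential is known only up to isomorphism; this is its comparison with the category of
 arrows and squares.
\<close>

definition "compare = (SOME k. k : hom Cat E Ar \<and> is_iso Cat k \<and>
  apply o\<^bsub>Cat\<^esub> \<langle>k o\<^bsub>Cat\<^esub> pr1 Cat E (itwo V), pr2 Cat E (itwo V)\<rangle>\<^bsub>Cat\<^esub> = ev Cat (itwo V) B)"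

lemma compare: "compare : hom Cat E Ar" "is_iso Cat compare"
 "apply o\<^bsub>Cat\<^esub> \<langle>compare o\<^bsub>Cat\<^esub> pr1 Cat E (itwo V), pr2 Cat E (itwo V)\<rangle>\<^bsub>Cat\<^esub> = ev Cat (itwo V) B"
proof -
 obtain h k where hk: "h : hom Cat E Ar" "k : hom Cat Ar E" "k o\<^bsub>Cat\<^esub> h = Idn Cat E"
  "h o\<^bsub>Cat\<^esub> k = Idn Cat Ar"
  "apply o\<^bsub>Cat\<^esub> \<langle>h o\<^bsub>Cat\<^esub> pr1 Cat E (itwo V), pr2 Cat E (itwo V)\<rangle>\<^bsub>Cat\<^esub> = ev Cat (itwo V) B"
  by (rule Cat.exponential_iso[OF chosen_arrow_category arrow_category_is_exponential]) simp_all
 have "is_iso Cat h" by (rule Cat.isoI[OF hk(1-4)])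
 then have "\<exists>k. k : hom Cat E Ar \<and> is_iso Cat k \<and>
  apply o\<^bsub>Cat\<^esub> \<langle>k o\<^bsub>Cat\<^esub> pr1 Cat E (itwo V), pr2 Cat E (itwo V)\<rangle>\<^bsub>Cat\<^esub> = ev Cat (itwo V) B"
  using hk(1,5) by blast
 from someI_ex[OF this, folded compare_def]
 show "compare : hom Cat E Ar" "is_iso Cat compare"
  "apply o\<^bsub>Cat\<^esub> \<langle>compare o\<^bsub>Cat\<^esub> pr1 Cat E (itwo V), pr2 Cat E (itwo V)\<rangle>\<^bsub>Cat\<^esub> = ev Cat (itwo V) B"
  by blast+
qed

lemmas compare_simps [simp] = Cat.homD[OF compare(1)]

lemma ev_two_in_hom: "ev Cat (itwo V) B : hom Cat (E \<otimes>\<^bsub>Cat\<^esub> itwo V) B"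
 using chosen_arrow_category unfolding is_exponential_def by blast

lemmas ev_two_simps [simp] = Cat.homD(1-3)[OF ev_two_in_hom]

lemma ev_two_value [simp]:
 assumes "x : Arr V" "y : Arr V" "Dom V x = Dom V y"
 shows "Cod V x = ic0 E ==> Cod V y = two.Obs ==> if0 (ev Cat (itwo V) B) o pair0 E (itwo V) x y = ap0 (if0 compare o x) y"
  and "Cod V x = ic1 E ==> Cod V y = two.M ==> if1 (ev Cat (itwo V) B) o pair1 E (itwo V) x y = ap1 (if1 compare o x) y"
proof -
 interpret arrow_transpose U V B E "ev Cat (itwo V) B"
  by unfold_locales (simp_all add: ev_two_in_hom)
 note v = apply_value[OF compare(1), unfolded compare(3)]
 show "Cod V x = ic0 E ==> Cod V y = two.Obs ==> if0 (ev Cat (itwo V) B) o pair0 E (itwo V) x y = ap0 (if0 compare o x) y"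
  using v(1)[of y "Dom V y" x] assms by (simp add: in_hom)
 show "Cod V x = ic1 E ==> Cod V y = two.M ==> if1 (ev Cat (itwo V) B) o pair1 E (itwo V) x y = ap1 (if1 compare o x) y"
  using v(2)[of y "Dom V y" x] assms by (simp add: in_hom)
qed

lemma eval_at_in_hom: "eval_at V B k : hom Cat E B"
proof -
 have "elem_ifun V (itwo V) (two.obj k) \<in> hom Cat (cst V \<one>) (itwo V)"
  by (rule elem_ifun_in_hom) (simp_all add: in_hom)
 note [simp] = Cat.homD[OF this]
 show ?thesis unfolding eval_at_def Let_def by (simp add: in_hom)
qed

lemmas eval_at_types [simp] = Cat.homD(1-3)[OF eval_at_in_hom]

lemma eval_at_value [simp]:
 "x : Arr V ==> Cod V x = ic0 E ==> if0 (eval_at V B k) o x = (if k then tgt else src) o if0 compare o x"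
 "x : Arr V ==> Cod V x = ic1 E ==> if1 (eval_at V B k) o x = (if k then right else left) o if1 compare o x"
proof -
 have "elem_ifun V (itwo V) (two.obj k) \<in> hom Cat (cst V \<one>) (itwo V)"
  by (rule elem_ifun_in_hom) (simp_all add: in_hom)
 note [simp] = Cat.homD[OF this]
 show "if0 (eval_at V B k) o x = (if k then tgt else src) o if0 compare o x" if "x : Arr V" "Cod V x = ic0 E"
  using that unfolding eval_at_def Let_def by simp
 show "if1 (eval_at V B k) o x = (if k then right else left) o if1 compare o x" if "x : Arr V" "Cod V x = ic1 E"
  using that unfolding eval_at_def Let_def by simp
qed

end

subsection \<open>Elements of comma categories\<close>

locale comma_icat = arrow_icat U V B
 for U :: "'u itself" and V :: "('a, 'b) category" (structure) and B +
 fixes A H b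
 assumes H: "H : hom Cat A B" and b: "b : hom V \<one> (ic0 B)"
begin

lemmas H_simps [simp] = Cat.homD[OF H] homD(1-3)[OF b]

lemma icod_H [simp]: "icod H = B" "idom H = A"
 using Cat.homD(2,3)[OF H] by (simp_all add: CatV_simps)

abbreviation "P \<equiv> comma V H b"
abbreviation "proj \<equiv> comma_proj V H b"
abbreviation "leg \<equiv> pb2 Cat (comma_cospan V H b) (ends_ifun V B)"

lemma cospan_in_hom: "comma_cospan V H b : hom Cat A (B \<otimes>\<^bsub>Cat\<^esub> B)"
 using Cat.homD[OF elem_ifun_in_hom[OF B b]] unfolding comma_cospan_def by (simp add: in_hom)

lemma ends_in_hom: "ends_ifun V B : hom Cat E (B \<otimes>\<^bsub>Cat\<^esub> B)"
 unfolding ends_ifun_def by (simp add: in_hom)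

lemmas cospan_types [simp] = Cat.homD(1-3)[OF cospan_in_hom] Cat.homD(1-3)[OF ends_in_hom]

lemma cospan_value [simp]:
 "x : Arr V ==> Cod V x = ic0 A ==> if0 (comma_cospan V H b) o x = pair0 B B (if0 H o x) (b o bang V (Dom V x))"
 "x : Arr V ==> Cod V x = ic1 A ==> if1 (comma_cospan V H b) o x = pair1 B B (if1 H o x) (iidn B o b o bang V (Dom V x))"
 "x : Arr V ==> Cod V x = ic0 E ==> if0 (ends_ifun V B) o x = pair0 B B (src o if0 compare o x) (tgt o if0 compare o x)"
 "x : Arr V ==> Cod V x = ic1 E ==> if1 (ends_ifun V B) o x = pair1 B B (left o if1 compare o x) (right o if1 compare o x)"
 using Cat.homD[OF elem_ifun_in_hom[OF B b]] unfolding comma_cospan_def ends_ifun_def by simp_all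

lemma comma_pullback: "is_pullback Cat (comma_cospan V H b) (ends_ifun V B) P proj leg"
 unfolding comma_def comma_proj_def icod_H by (rule Cat.chosen_pullback) simp_all

lemma proj_in_hom: "proj : hom Cat P A" and leg_in_hom: "leg : hom Cat P E"
 using comma_pullback unfolding is_pullback_def by simp_all

lemmas proj_simps [simp] = Cat.homD[OF proj_in_hom] Cat.homD[OF leg_in_hom]

text \<open>
 An object of the comma category is an object \<open>a\<close> of \<open>A\<close> with an arrow \<open>arrow\<close> from \<open>H a\<close> to \<open>b\<close>.
\<close>

definition "arrow = if0 compare o if0 leg"

lemma arrow_types [simp]: "arrow : Arr V" "Dom V arrow = ic0 P" "Cod V arrow = ic1 B"
 by (simp_all add: arrow_def)

lemma arrow_ends [simp]:
 assumes "x : Arr V" "Cod V x = ic0 P"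
 shows "src o arrow o x = if0 H o if0 proj o x" "tgt o arrow o x = b o bang V (Dom V x)"
proof -
 note [simp] = assms
 have "if0 (comma_cospan V H b) o if0 proj = if0 (ends_ifun V B) o if0 leg"
  using pullback_levels(1)[OF comma_pullback] unfolding is_pullback_def by blast
 from square_point[OF this, of x]
 have e: "pair0 B B (if0 H o if0 proj o x) (b o bang V (Dom V x)) = pair0 B B (src o arrow o x) (tgt o arrow o x)"
  by (simp add: arrow_def)
 from arg_cong[OF e, of "\<lambda>y. if0 (pr1 Cat B B) o y"] arg_cong[OF e, of "\<lambda>y. if0 (pr2 Cat B B) o y"]
 show "src o arrow o x = if0 H o if0 proj o x" "tgt o arrow o x = b o bang V (Dom V x)" by simp_all
qed

lemma compare_bij:
 "y : hom V X (ic1 B) ==> \<exists>!x. x : hom V X (ic0 E) \<and> if0 compare o x = y"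
 "y' : hom V X squares ==> \<exists>!x. x : hom V X (ic1 E) \<and> if1 compare o x = y'"
 using if_iso[OF compare(2)] is_iso_iff_points[of "if0 compare" "ic0 E" "ic1 B"] is_iso_iff_points[of "if1 compare" "ic1 E" squares]
  homD(4)[of y X "ic1 B"] homD(4)[of y' X squares] by (simp_all add: in_hom)

lemma comma_objects:
 assumes a: "a : hom V X (ic0 A)" and f: "f : hom V X (ic1 B)" "src o f = if0 H o a" "tgt o f = b o bang V X"
 shows "\<exists>!x. x : hom V X (ic0 P) \<and> if0 proj o x = a \<and> arrow o x = f"
proof -
 note [simp] = homD[OF a] homD[OF f(1)]
 obtain g where g: "g : hom V X (ic0 E)" "if0 compare o g = f" using compare_bij(1)[OF f(1)] by blast
 note [simp] = homD(1-3)[OF g(1)]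
 have sq: "if0 (comma_cospan V H b) o a = if0 (ends_ifun V B) o g" by (simp add: g(2) f)
 have ex: "\<exists>!x. x : hom V X (ic0 P) \<and> if0 proj o x = a \<and> if0 leg o x = g"
  using pullback_levels(1)[OF comma_pullback] a g(1) sq unfolding is_pullback_def by simp
 have iff: "arrow o x = f \<longleftrightarrow> if0 leg o x = g" if x: "x : hom V X (ic0 P)" for x
 proof -
  note [simp] = homD[OF x]
  have l: "if0 leg o x : hom V X (ic0 E)" by (simp add: in_hom)
  have e: "arrow o x = if0 compare o if0 leg o x" by (simp add: arrow_def)
  show ?thesis unfolding e using compare_bij(1)[OF f(1)] l g by blast
 qed
 show ?thesis using ex iff by metis
qed

lemma comma_leg_square:
 assumes "e : Arr V" "Cod V e = ic1 P"
 shows "left o if1 compare o if1 leg o e = if1 H o if1 proj o e"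
  "right o if1 compare o if1 leg o e = iidn B o b o bang V (Dom V e)"
  "upper o if1 compare o if1 leg o e = arrow o isrc P o e"
  "lower o if1 compare o if1 leg o e = arrow o itgt P o e"
proof -
 note [simp] = assms
 have "if1 (comma_cospan V H b) o if1 proj = if1 (ends_ifun V B) o if1 leg"
  using pullback_levels(2)[OF comma_pullback] unfolding is_pullback_def by blast
 from square_point[OF this, of e]
 have q: "pair1 B B (if1 H o if1 proj o e) (iidn B o b o bang V (Dom V e))
   = pair1 B B (left o if1 compare o if1 leg o e) (right o if1 compare o if1 leg o e)"
  by simp
 from arg_cong[OF q, of "\<lambda>y. if1 (pr1 Cat B B) o y"] arg_cong[OF q, of "\<lambda>y. if1 (pr2 Cat B B) o y"]
 show "left o if1 compare o if1 leg o e = if1 H o if1 proj o e"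
  "right o if1 compare o if1 leg o e = iidn B o b o bang V (Dom V e)" by simp_all
 show "upper o if1 compare o if1 leg o e = arrow o isrc P o e" "lower o if1 compare o if1 leg o e = arrow o itgt P o e"
  using isrc_if1(1)[of compare Ar "if1 leg o e"] isrc_if1(2)[of compare Ar "if1 leg o e"] by (simp_all add: arrow_def)
qed

lemma comma_arrow_triangle:
 assumes "e : Arr V" "Cod V e = ic1 P"
 shows "icomp V B (arrow o itgt P o e) (if1 H o if1 proj o e) = arrow o isrc P o e"
proof -
 note [simp] = assms
 have "icomp V B (iidn B o b o bang V (Dom V e)) (arrow o isrc P o e)
   = icomp V B (arrow o itgt P o e) (if1 H o if1 proj o e)"
  using square_laws(3)[of "if1 compare o if1 leg o e"] by (simp add: comma_leg_square)
 then show ?thesis by simp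
qed

lemma comma_arrows:
 assumes x: "x : hom V X (ic0 P)" "x' : hom V X (ic0 P)" and u: "u : hom V X (ic1 A)"
  and ends: "isrc A o u = if0 proj o x" "itgt A o u = if0 proj o x'"
  and triangle: "icomp V B (arrow o x') (if1 H o u) = arrow o x"
 shows "\<exists>!e. e : hom V X (ic1 P) \<and> isrc P o e = x \<and> itgt P o e = x' \<and> if1 proj o e = u"
proof -
 note [simp] = homD[OF x(1)] homD[OF x(2)] homD[OF u] ends
 let ?s = "square (iidn B o b o bang V X) (arrow o x) (arrow o x') (if1 H o u)"
 have c: "icomp V B (iidn B o b o bang V X) (arrow o x) = icomp V B (arrow o x') (if1 H o u)" by (simp add: triangle)
 note p = square_props[OF _ _ _ _ _ _ _ _ _ _ _ _ _ c]
 have s: "?s : hom V X squares" by (simp add: in_hom triangle)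
 have pr: "right o ?s = iidn B o b o bang V X" "upper o ?s = arrow o x" "lower o ?s = arrow o x'" "left o ?s = if1 H o u"
  by (rule p(4-7); simp)+
 obtain g where g: "g : hom V X (ic1 E)" "if1 compare o g = ?s" using compare_bij(2)[OF s] by blast
 note [simp] = homD(1-3)[OF g(1)]
 have sq: "if1 (comma_cospan V H b) o u = if1 (ends_ifun V B) o g" by (simp add: g(2) pr)
 have ex: "\<exists>!e. e : hom V X (ic1 P) \<and> if1 proj o e = u \<and> if1 leg o e = g"
  using pullback_levels(2)[OF comma_pullback] u g(1) sq unfolding is_pullback_def by simp
 have iff: "(isrc P o e = x \<and> itgt P o e = x') \<longleftrightarrow> if1 leg o e = g"
  if e: "e : hom V X (ic1 P)" and pe: "if1 proj o e = u" for e
 proof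
  note [simp] = homD[OF e]
  have l: "if1 leg o e : hom V X (ic1 E)" by (simp add: in_hom)
  { assume xs: "isrc P o e = x \<and> itgt P o e = x'"
   have "if1 compare o if1 leg o e = ?s"
   proof (rule square_ext)
    show "right o if1 compare o if1 leg o e = right o ?s" "upper o if1 compare o if1 leg o e = upper o ?s"
     "lower o if1 compare o if1 leg o e = lower o ?s" "left o if1 compare o if1 leg o e = left o ?s"
     unfolding pr using xs pe by (simp_all add: comma_leg_square)
   qed (simp_all add: homD[OF s])
   then show "if1 leg o e = g" using compare_bij(2)[OF s] l g by blast }
  assume eg: "if1 leg o e = g"
  have cs: "upper o if1 compare o if1 leg o e = arrow o isrc P o e" "lower o if1 compare o if1 leg o e = arrow o itgt P o e"
   by (rule comma_leg_square; simp)+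
  have "arrow o isrc P o e = arrow o x" by (rule cs(1)[unfolded eg g(2) pr, symmetric])
  moreover have "arrow o itgt P o e = arrow o x'" by (rule cs(2)[unfolded eg g(2) pr, symmetric])
  moreover have "if0 proj o isrc P o e = if0 proj o x" "if0 proj o itgt P o e = if0 proj o x'"
   using isrc_if1(1)[of proj A e] isrc_if1(2)[of proj A e] by (simp_all add: pe)
  moreover have "isrc P o e : hom V X (ic0 P)" "itgt P o e : hom V X (ic0 P)" by (simp_all add: in_hom)
  moreover have "\<exists>!y. y : hom V X (ic0 P) \<and> if0 proj o y = if0 proj o x \<and> arrow o y = arrow o x"
   "\<exists>!y. y : hom V X (ic0 P) \<and> if0 proj o y = if0 proj o x' \<and> arrow o y = arrow o x'"
   by (rule comma_objects; simp add: in_hom)+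
  ultimately show "isrc P o e = x \<and> itgt P o e = x'" using x by blast
 qed
 show ?thesis using ex iff by metis
qed

end

subsection \<open>Internal terminal objects\<close>

definition terminal_points :: "('o, 'm) category \<Rightarrow> ('o, 'm) icat \<Rightarrow> 'm \<Rightarrow> 'o \<Rightarrow> bool" where
 "terminal_points V A T X \<longleftrightarrow> (\<forall>a\<in>hom V X (ic0 A). \<exists>!f. f : hom V X (ic1 A) \<and>
   isrc A o\<^bsub>V\<^esub> f = a \<and> itgt A o\<^bsub>V\<^esub> f = T o\<^bsub>V\<^esub> bang V X)"

text \<open>
 An element of the slice over \<open>T\<close> is an arrow into \<open>T\<close>, so the projection of the slice is
 bijective on elements of the object of objects if and only if there is exactly one arrow to \<open>T\<close>
 from every element; it is then bijective on arrows, too, since every triangle over \<open>T\<close> commutes.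
\<close>

lemma (in extensive_cat) internal_terminal_iff:
 assumes A [simp]: "A : Obj Cat"
 shows "is_internal_terminal V A T \<longleftrightarrow> T : hom V \<one> (ic0 A) \<and> (\<forall>X\<in>Obj V. terminal_points V A T X)"
proof (cases "T : hom V \<one> (ic0 A)")
 case False
 then show ?thesis unfolding is_internal_terminal_def by blast
next
 case T: True
 interpret comma_icat U V A A "Idn Cat A" T
  by unfold_locales (rule A Cat.id_in_hom[OF A] T)+
 have H: "if0 (Idn Cat A) = Idn V (ic0 A)" "if1 (Idn Cat A) = Idn V (ic1 A)" by simp_all
 have p0: "if0 proj : hom V (ic0 P) (ic0 A)" "if1 proj : hom V (ic1 P) (ic1 A)" by (simp_all add: in_hom)
 have obj: "\<exists>!x. x : hom V X (ic0 P) \<and> if0 proj o x = a \<and> arrow o x = f"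
  if "a : hom V X (ic0 A)" "f : hom V X (ic1 A)" "isrc A o f = a" "itgt A o f = T o bang V X" for a f X
  using comma_objects[OF that(1,2)] that homD[OF that(1)] by simp
 have ar: "arrow o x : hom V X (ic1 A)" "isrc A o arrow o x = if0 proj o x" "itgt A o arrow o x = T o bang V X"
  if "x : hom V X (ic0 P)" for x X
  using homD[OF that] by (simp_all add: in_hom)
 have iso0: "is_iso V (if0 proj) \<longleftrightarrow> (\<forall>X\<in>Obj V. terminal_points V A T X)"
  unfolding is_iso_iff_points[OF p0(1)] terminal_points_def
 proof (intro ball_cong refl)
  fix X a assume a: "a : hom V X (ic0 A)"
  show "(\<exists>!x. x : hom V X (ic0 P) \<and> if0 proj o x = a) \<longleftrightarrow>
   (\<exists>!f. f : hom V X (ic1 A) \<and> isrc A o f = a \<and> itgt A o f = T o bang V X)"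
  proof
   assume "\<exists>!x. x : hom V X (ic0 P) \<and> if0 proj o x = a"
   then obtain x where x: "x : hom V X (ic0 P)" "if0 proj o x = a"
    and uniq: "\<And>x'. x' : hom V X (ic0 P) ==> if0 proj o x' = a ==> x' = x" by blast
   show "\<exists>!f. f : hom V X (ic1 A) \<and> isrc A o f = a \<and> itgt A o f = T o bang V X"
   proof (rule ex1I[of _ "arrow o x"])
    show "arrow o x : hom V X (ic1 A) \<and> isrc A o arrow o x = a \<and> itgt A o arrow o x = T o bang V X"
     using ar[OF x(1)] x(2) by simp
    fix f assume f: "f : hom V X (ic1 A) \<and> isrc A o f = a \<and> itgt A o f = T o bang V X"
    then obtain x' where "x' : hom V X (ic0 P)" "if0 proj o x' = a" "arrow o x' = f"
     using obj[OF a, of f] by blast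
    then show "f = arrow o x" using uniq[of x'] by blast
   qed
  next
   assume "\<exists>!f. f : hom V X (ic1 A) \<and> isrc A o f = a \<and> itgt A o f = T o bang V X"
   then obtain f where f: "f : hom V X (ic1 A)" "isrc A o f = a" "itgt A o f = T o bang V X"
    and uniq: "\<And>f'. f' : hom V X (ic1 A) ==> isrc A o f' = a ==> itgt A o f' = T o bang V X ==> f' = f" by blast
   have "arrow o x = f" if "x : hom V X (ic0 P)" "if0 proj o x = a" for x
    using uniq[OF ar(1)[OF that(1)]] ar(2,3)[OF that(1)] that(2) by simp
   then show "\<exists>!x. x : hom V X (ic0 P) \<and> if0 proj o x = a" using obj[OF a f] by blast
  qed
 qed
 have "is_iso V (if1 proj)" if iso: "is_iso V (if0 proj)"
  unfolding is_iso_iff_points[OF p0(2)]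
 proof (intro ballI)
  fix X u assume u: "u : hom V X (ic1 A)"
  note [simp] = homD[OF u]
  have uniq: "\<exists>!x. x : hom V X (ic0 P) \<and> if0 proj o x = a" if "a : hom V X (ic0 A)" for a
   using iso that homD(4)[OF u] unfolding is_iso_iff_points[OF p0(1)] by blast
  have st: "isrc A o u : hom V X (ic0 A)" "itgt A o u : hom V X (ic0 A)" by (simp_all add: in_hom)
  obtain x where x: "x : hom V X (ic0 P)" "if0 proj o x = isrc A o u" using uniq[OF st(1)] by blast
  obtain x' where x': "x' : hom V X (ic0 P)" "if0 proj o x' = itgt A o u" using uniq[OF st(2)] by blast
  note [simp] = homD[OF x(1)] homD[OF x'(1)]
  have "\<forall>X\<in>Obj V. terminal_points V A T X" using iso iso0 by blast
  then have t: "\<exists>!f. f : hom V X (ic1 A) \<and> isrc A o f = isrc A o u \<and> itgt A o f = T o bang V X"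
   using st(1) homD(4)[OF u] unfolding terminal_points_def by blast
  have "icomp V A (arrow o x') u : hom V X (ic1 A)" "isrc A o icomp V A (arrow o x') u = isrc A o u"
   "itgt A o icomp V A (arrow o x') u = T o bang V X"
   using ar[OF x'(1)] x' by (simp_all add: in_hom)
  then have tri: "icomp V A (arrow o x') u = arrow o x" using t ar[OF x(1)] x(2) by metis
  have "\<exists>!e. e : hom V X (ic1 P) \<and> isrc P o e = x \<and> itgt P o e = x' \<and> if1 proj o e = u"
   by (rule comma_arrows[OF x(1) x'(1) u]) (use x(2) x'(2) tri in simp_all)
  moreover have "isrc P o e = x \<and> itgt P o e = x'" if e: "e : hom V X (ic1 P)" "if1 proj o e = u" for e
  proof -
   note [simp] = homD[OF e(1)]
   have "if0 proj o isrc P o e = isrc A o u" "if0 proj o itgt P o e = itgt A o u"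
    using isrc_if1(1)[of proj A e] isrc_if1(2)[of proj A e] by (simp_all add: e(2))
   moreover have "isrc P o e : hom V X (ic0 P)" "itgt P o e : hom V X (ic0 P)" by (simp_all add: in_hom)
   ultimately show ?thesis using uniq[OF st(1)] uniq[OF st(2)] x x' by blast
  qed
  ultimately show "\<exists>!e. e : hom V X (ic1 P) \<and> if1 proj o e = u" by metis
 qed
 then have "is_iso Cat proj \<longleftrightarrow> is_iso V (if0 proj)"
  using ifun_isoI[OF proj_in_hom] if_iso(1) by blast
 then show ?thesis unfolding is_internal_terminal_def using T iso0 by blast
qed

text \<open>
 Unique existence is transported along a map \<open>F\<close> that is bijective from the candidates in \<open>R\<close> onto
 the solutions of \<open>Q\<close>.
\<close>

lemma ex1_transfer:
 assumes "\<And>y. Q y ==> \<exists>!x. R x \<and> F x = y" "\<And>x. R x ==> P x \<longleftrightarrow> Q (F x)" "\<And>x. P x ==> R x"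
 shows "(\<exists>!x. P x) \<longleftrightarrow> (\<exists>!y. Q y)"
proof
 assume "\<exists>!x. P x"
 then obtain x where x: "P x" and ux: "\<And>x'. P x' ==> x' = x" by blast
 show "\<exists>!y. Q y"
 proof (rule ex1I[of _ "F x"])
  show "Q (F x)" using assms(2,3) x by blast
  fix y assume y: "Q y"
  then obtain x' where "R x'" "F x' = y" using assms(1) by blast
  then show "y = F x" using ux[of x'] assms(2)[of x'] y by blast
 qed
next
 assume "\<exists>!y. Q y"
 then obtain y where y: "Q y" and uy: "\<And>y'. Q y' ==> y' = y" by blast
 obtain x where x: "R x" "F x = y" and ux: "\<And>x'. R x' ==> F x' = y ==> x' = x" using assms(1)[OF y] by blast
 show "\<exists>!x. P x"
 proof (rule ex1I[of _ x])
  show "P x" using assms(2) x y by blast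
  fix x' assume "P x'"
  then show "x' = x" using assms(2,3) ux uy by blast
 qed
qed

text \<open>
 By the description of the arrows of a comma category, an arrow to a fixed object \<open>T\<close> amounts to
 an arrow \<open>u\<close> of \<open>A\<close> that fills a triangle.
\<close>

lemma (in comma_icat) comma_terminal_iff:
 assumes T: "T : hom V \<one> (ic0 P)"
 shows "(\<forall>X\<in>Obj V. terminal_points V P T X) \<longleftrightarrow>
  (\<forall>X\<in>Obj V. \<forall>a\<in>hom V X (ic0 A). \<forall>f\<in>hom V X (ic1 B). src o f = if0 H o a \<longrightarrow> tgt o f = b o bang V X \<longrightarrow>
   (\<exists>!u. u : hom V X (ic1 A) \<and> isrc A o u = a \<and> itgt A o u = (if0 proj o T) o bang V X \<and>
     icomp V B (arrow o T o bang V X) (if1 H o u) = f))"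
proof -
 note [simp] = homD[OF T]
 have eq: "(\<exists>!e. e : hom V X (ic1 P) \<and> isrc P o e = x \<and> itgt P o e = T o bang V X) \<longleftrightarrow>
  (\<exists>!u. u : hom V X (ic1 A) \<and> isrc A o u = if0 proj o x \<and> itgt A o u = (if0 proj o T) o bang V X \<and>
     icomp V B (arrow o T o bang V X) (if1 H o u) = arrow o x)" if x: "x : hom V X (ic0 P)" for x X
 proof (rule ex1_transfer[where F = "\<lambda>e. if1 proj o e"
    and R = "\<lambda>e. e : hom V X (ic1 P) \<and> isrc P o e = x \<and> itgt P o e = T o bang V X"])
  note [simp] = homD[OF x]
  have x': "T o bang V X : hom V X (ic0 P)" by (simp add: in_hom)
  fix u assume "u : hom V X (ic1 A) \<and> isrc A o u = if0 proj o x \<and> itgt A o u = (if0 proj o T) o bang V X \<and>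
     icomp V B (arrow o T o bang V X) (if1 H o u) = arrow o x"
  then have u: "u : hom V X (ic1 A)" "isrc A o u = if0 proj o x" "itgt A o u = if0 proj o T o bang V X"
     "icomp V B (arrow o T o bang V X) (if1 H o u) = arrow o x" by simp_all
  show "\<exists>!e. (e : hom V X (ic1 P) \<and> isrc P o e = x \<and> itgt P o e = T o bang V X) \<and> if1 proj o e = u"
   using comma_arrows[OF x x' u] by simp
 next
  note [simp] = homD[OF x]
  fix e assume e: "e : hom V X (ic1 P) \<and> isrc P o e = x \<and> itgt P o e = T o bang V X"
  then have e': "e : hom V X (ic1 P)" and ends: "isrc P o e = x" "itgt P o e = T o bang V X" by blast+
  note [simp] = homD[OF e'] ends
  have "icomp V B (arrow o itgt P o e) (if1 H o if1 proj o e) = arrow o isrc P o e"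
   by (rule comma_arrow_triangle) simp_all
  moreover have "isrc A o if1 proj o e = if0 proj o x" "itgt A o if1 proj o e = if0 proj o T o bang V X"
   using isrc_if1(1)[of proj A e] isrc_if1(2)[of proj A e] by simp_all
  moreover have "if1 proj o e : hom V X (ic1 A)" by (simp add: in_hom)
  ultimately show "(e : hom V X (ic1 P) \<and> isrc P o e = x \<and> itgt P o e = T o bang V X) \<longleftrightarrow>
   (if1 proj o e : hom V X (ic1 A) \<and> isrc A o if1 proj o e = if0 proj o x \<and>
    itgt A o if1 proj o e = (if0 proj o T) o bang V X \<and>
    icomp V B (arrow o T o bang V X) (if1 H o if1 proj o e) = arrow o x)" using e by simp
 qed
 show ?thesis
 proof (rule iffI; intro ballI impI)
  fix X a f assume "\<forall>X\<in>Obj V. terminal_points V P T X" and X: "X : Obj V" and a: "a : hom V X (ic0 A)"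
   and f: "f : hom V X (ic1 B)" "src o f = if0 H o a" "tgt o f = b o bang V X"
  moreover obtain x where x: "x : hom V X (ic0 P)" "if0 proj o x = a" "arrow o x = f" using comma_objects[OF a f] by blast
  ultimately have "\<exists>!e. e : hom V X (ic1 P) \<and> isrc P o e = x \<and> itgt P o e = T o bang V X"
   unfolding terminal_points_def by blast
  then show "\<exists>!u. u : hom V X (ic1 A) \<and> isrc A o u = a \<and> itgt A o u = (if0 proj o T) o bang V X \<and>
     icomp V B (arrow o T o bang V X) (if1 H o u) = f" unfolding eq[OF x(1)] x(2,3) .
 next
  fix X assume R: "\<forall>X\<in>Obj V. \<forall>a\<in>hom V X (ic0 A). \<forall>f\<in>hom V X (ic1 B). src o f = if0 H o a \<longrightarrow> tgt o f = b o bang V X \<longrightarrow>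
   (\<exists>!u. u : hom V X (ic1 A) \<and> isrc A o u = a \<and> itgt A o u = (if0 proj o T) o bang V X \<and>
     icomp V B (arrow o T o bang V X) (if1 H o u) = f)" and X: "X : Obj V"
  show "terminal_points V P T X"
   unfolding terminal_points_def
  proof (intro ballI)
   fix x assume x: "x : hom V X (ic0 P)"
   note [simp] = homD[OF x]
   have "if0 proj o x : hom V X (ic0 A)" "arrow o x : hom V X (ic1 B)" "src o arrow o x = if0 H o if0 proj o x"
    "tgt o arrow o x = b o bang V X" by (simp_all add: in_hom)
   then show "\<exists>!e. e : hom V X (ic1 P) \<and> isrc P o e = x \<and> itgt P o e = T o bang V X"
    unfolding eq[OF x] using R X by blast
  qed
 qed
qed

section \<open>Terminal objects of underlying enriched categories\<close>

text \<open>
 The pullback of the pair of source and target along \<open>\<langle>a, b\<rangle>\<close> is the object of arrows from \<open>a\<close> to \<open>b\<close>.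
\<close>

lemma (in pullback_ccc) arrows_between:
 fixes E Y a b
 defines "K \<equiv> pb_obj V \<langle>isrc E, itgt E\<rangle> \<langle>a, b\<rangle>" and "k \<equiv> pb2 V \<langle>isrc E, itgt E\<rangle> \<langle>a, b\<rangle>"
 assumes E [simp]: "E : Obj Cat" and ab: "a : hom V Y (ic0 E)" "b : hom V Y (ic0 E)"
 shows "k : hom V K Y"
  and "y : hom V X Y ==> (\<exists>!z. z : hom V X K \<and> k o z = y) \<longleftrightarrow>
   (\<exists>!f. f : hom V X (ic1 E) \<and> isrc E o f = a o y \<and> itgt E o f = b o y)"
proof -
 note [simp] = homD[OF ab(1)] homD[OF ab(2)]
 let ?st = "\<langle>isrc E, itgt E\<rangle>" let ?p = "pb1 V ?st \<langle>a, b\<rangle>"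
 have p: "is_pullback V ?st \<langle>a, b\<rangle> K ?p k" unfolding K_def k_def by (rule chosen_pullback) simp_all
 show k: "k : hom V K Y" by (simp add: in_hom k_def K_def)
 note [simp] = homD[OF k]
 have pK [simp]: "Dom V ?p = K" "Cod V ?p = ic1 E" "?p : Arr V" by (simp_all add: K_def)
 assume y: "y : hom V X Y"
 note [simp] = homD[OF y]
 show "(\<exists>!z. z : hom V X K \<and> k o z = y) \<longleftrightarrow>
   (\<exists>!f. f : hom V X (ic1 E) \<and> isrc E o f = a o y \<and> itgt E o f = b o y)"
 proof (rule ex1_transfer[where F = "\<lambda>z. ?p o z" and R = "\<lambda>z. z : hom V X K \<and> k o z = y"])
  fix f assume "f : hom V X (ic1 E) \<and> isrc E o f = a o y \<and> itgt E o f = b o y"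
  then have f: "f : hom V X (ic1 E)" and e: "isrc E o f = a o y" "itgt E o f = b o y" by blast+
  note [simp] = homD[OF f]
  have "?st o f = \<langle>a, b\<rangle> o y" by (simp add: e)
  moreover have "f : hom V X (Dom V ?st)" "y : hom V X (Dom V \<langle>a, b\<rangle>)" by (simp_all add: in_hom)
  ultimately have "\<exists>!z. z : hom V X K \<and> ?p o z = f \<and> k o z = y"
   using p unfolding is_pullback_def by blast
  then show "\<exists>!z. (z : hom V X K \<and> k o z = y) \<and> ?p o z = f" by metis
 next
  fix z assume z: "z : hom V X K \<and> k o z = y"
  then have z': "z : hom V X K" and kz: "k o z = y" by blast+
  note [simp] = homD[OF z']
  have "?st o ?p o z = \<langle>a, b\<rangle> o k o z" unfolding k_def by (rule pb_square_point) (simp_all flip: K_def)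
  then have e: "\<langle>isrc E o ?p o z, itgt E o ?p o z\<rangle> = \<langle>a o y, b o y\<rangle>" unfolding kz by simp
  have "isrc E o ?p o z = a o y \<and> itgt E o ?p o z = b o y"
   by (rule iffD1[OF pairing_eq_iff e]) simp_all
  then show "(z : hom V X K \<and> k o z = y) \<longleftrightarrow> (?p o z : hom V X (ic1 E) \<and>
   isrc E o ?p o z = a o y \<and> itgt E o ?p o z = b o y)"
   using z by (simp add: in_hom)
 qed
qed

lemma (in pullback_ccc) vterminal_Und_iff:
 assumes E [simp]: "E : Obj Cat"
 shows "is_vterminal V (Und V E) t \<longleftrightarrow> t : hom V \<one> (ic0 E) \<and> (\<forall>a\<in>hom V \<one> (ic0 E). \<forall>Z\<in>Obj V.
  \<exists>!f. f : hom V Z (ic1 E) \<and> isrc E o f = a o bang V Z \<and> itgt E o f = t o bang V Z)"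
proof -
 have iso: "is_iso V (bang V (VHom (Und V E) a t)) \<longleftrightarrow>
   (\<forall>Z\<in>Obj V. \<exists>!f. f : hom V Z (ic1 E) \<and> isrc E o f = a o bang V Z \<and> itgt E o f = t o bang V Z)"
  if t: "t : hom V \<one> (ic0 E)" and a: "a : hom V \<one> (ic0 E)" for a
 proof -
  let ?k = "pb2 V \<langle>isrc E, itgt E\<rangle> \<langle>a, t\<rangle>"
  note k = arrows_between[OF E a t]
  have b: "bang V (VHom (Und V E) a t) = ?k"
   using bang_unique[of ?k] homD[OF k(1)] by (simp add: Und_def Let_def)
  have al: "(\<forall>y\<in>hom V Z \<one>. Q y) \<longleftrightarrow> Q (bang V Z)" if "Z : Obj V" for Q Z
   using that bang_in_hom[OF that] bang_unique by (metis homD(1-3))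
  have "is_iso V ?k \<longleftrightarrow> (\<forall>Z\<in>Obj V. \<forall>y\<in>hom V Z \<one>. \<exists>!z. z : hom V Z (pb_obj V \<langle>isrc E, itgt E\<rangle> \<langle>a, t\<rangle>) \<and> ?k o z = y)"
   by (rule is_iso_iff_points[OF k(1)])
  also have "\<dots> \<longleftrightarrow> (\<forall>Z\<in>Obj V. \<exists>!z. z : hom V Z (pb_obj V \<langle>isrc E, itgt E\<rangle> \<langle>a, t\<rangle>) \<and> ?k o z = bang V Z)"
   by (intro ball_cong refl al)
  also have "\<dots> \<longleftrightarrow> (\<forall>Z\<in>Obj V. \<exists>!f. f : hom V Z (ic1 E) \<and> isrc E o f = a o bang V Z \<and> itgt E o f = t o bang V Z)"
   by (intro ball_cong refl k(2)[OF bang_in_hom])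
  finally show ?thesis unfolding b .
 qed
 have ob: "VOb (Und V E) = hom V \<one> (ic0 E)" by (simp add: Und_def Let_def)
 show ?thesis
  unfolding is_vterminal_def ob by (intro conj_cong ball_cong refl) (rule iso)
qed

context icat_power
begin

abbreviation "Exp \<equiv> \<lbrakk>cst V X, A\<rbrakk>\<^bsub>Cat\<^esub>"

lemma chosen_power: "is_exponential Cat (cst V X) A Exp (ev Cat (cst V X) A)"
 by (rule Cat.chosen_exponential[OF power_is_exponential])

lemma Exp_icat [simp]: "Exp : Obj Cat"
 using chosen_power unfolding is_exponential_def by blast

text \<open>
 Elements of the chosen exponential at stage \<open>Z\<close> are maps out of \<open>Z \<otimes> X\<close>, compatibly with sources
 and targets, by comparison with the levelwise one.
\<close>

lemma power_elements:
 obtains k where "k : hom Cat Exp E" "is_iso Cat k"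
  "\<And>Z x. x : hom V Z X ==> T : hom V \<one> (ic0 A) ==> if0 (const_ifun V X A) \<in> hom V (ic0 A) (ic0 Exp) \<and>
    ap0 (if0 k o if0 (const_ifun V X A) o T o bang V Z) x = T o bang V Z"
proof -
 let ?c = "cst V X"
 note [simp] = power_icat
 obtain k k' where k: "k : hom Cat Exp E" "k' : hom Cat E Exp" "k' o\<^bsub>Cat\<^esub> k = Idn Cat Exp"
  "k o\<^bsub>Cat\<^esub> k' = Idn Cat E"
  "apply o\<^bsub>Cat\<^esub> \<langle>k o\<^bsub>Cat\<^esub> pr1 Cat Exp ?c, pr2 Cat Exp ?c\<rangle>\<^bsub>Cat\<^esub> = ev Cat ?c A"
  by (rule Cat.exponential_iso[OF chosen_power power_is_exponential]) simp_all
 let ?h = "const_ifun V X A"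
 have "pr1 Cat A ?c : hom Cat (A \<otimes>\<^bsub>Cat\<^esub> ?c) A" by (simp add: in_hom)
 from Cat.transpose_props[OF chosen_power A this, folded const_ifun_def]
 have h: "?h : hom Cat A Exp"
  and hev: "ev Cat ?c A o\<^bsub>Cat\<^esub> \<langle>?h o\<^bsub>Cat\<^esub> pr1 Cat A ?c, pr2 Cat A ?c\<rangle>\<^bsub>Cat\<^esub> = pr1 Cat A ?c"
  by blast+
 note [simp] = Cat.homD[OF k(1)] Cat.homD[OF h] Cat.homD[OF power_apply_in_hom]
 have e: "apply o\<^bsub>Cat\<^esub> \<langle>(k o\<^bsub>Cat\<^esub> ?h) o\<^bsub>Cat\<^esub> pr1 Cat A ?c, pr2 Cat A ?c\<rangle>\<^bsub>Cat\<^esub> = pr1 Cat A ?c"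
 proof -
  have "apply o\<^bsub>Cat\<^esub> \<langle>(k o\<^bsub>Cat\<^esub> ?h) o\<^bsub>Cat\<^esub> pr1 Cat A ?c, pr2 Cat A ?c\<rangle>\<^bsub>Cat\<^esub>
   = (apply o\<^bsub>Cat\<^esub> \<langle>k o\<^bsub>Cat\<^esub> pr1 Cat Exp ?c, pr2 Cat Exp ?c\<rangle>\<^bsub>Cat\<^esub>) o\<^bsub>Cat\<^esub>
    \<langle>?h o\<^bsub>Cat\<^esub> pr1 Cat A ?c, pr2 Cat A ?c\<rangle>\<^bsub>Cat\<^esub>" by simp
  then show ?thesis by (simp only: k(5) hev)
 qed
 show thesis
 proof (rule that[OF k(1)])
  show "is_iso Cat k" by (rule Cat.isoI[OF k(1-4)])
  fix Z x assume x: "x : hom V Z X" and T: "T : hom V \<one> (ic0 A)"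
  note [simp] = homD[OF x] homD[OF T]
  have "if0 (apply o\<^bsub>Cat\<^esub> \<langle>(k o\<^bsub>Cat\<^esub> ?h) o\<^bsub>Cat\<^esub> pr1 Cat A ?c, pr2 Cat A ?c\<rangle>\<^bsub>Cat\<^esub>) o pair0 A ?c (T o bang V Z) x
    = ap0 (if0 k o if0 ?h o T o bang V Z) x" by simp
  then have "ap0 (if0 k o if0 ?h o T o bang V Z) x = T o bang V Z" unfolding e by simp
  moreover have "if0 ?h : hom V (ic0 A) (ic0 Exp)" by (simp add: in_hom)
  ultimately show "if0 ?h : hom V (ic0 A) (ic0 Exp) \<and> ap0 (if0 k o if0 ?h o T o bang V Z) x = T o bang V Z" by blast
 qed
qed

lemma vterminal_power_iff:
 assumes T: "T : hom V \<one> (ic0 A)"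
 shows "is_vterminal V (Und V Exp) (if0 (const_ifun V X A) o T) \<longleftrightarrow>
  (\<forall>a\<in>hom V X (ic0 A). \<forall>Z\<in>Obj V. \<exists>!f. f : hom V (Z \<otimes> X) (ic1 A) \<and>
    isrc A o f = a o pr2 V Z X \<and> itgt A o f = T o bang V (Z \<otimes> X))"
proof -
 let ?h = "const_ifun V X A"
 note [simp] = homD[OF T] power_icat
 obtain k where k: "k : hom Cat Exp E" "is_iso Cat k"
  and kT: "\<And>Z x. x : hom V Z X ==> T : hom V \<one> (ic0 A) ==> if0 ?h : hom V (ic0 A) (ic0 Exp) \<and>
    ap0 (if0 k o if0 ?h o T o bang V Z) x = T o bang V Z"
  using power_elements[of T] by blast
 have h0: "if0 ?h : hom V (ic0 A) (ic0 Exp)" using kT[OF id_in_hom[OF X] T] by blast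
 note [simp] = Cat.homD[OF k(1)] homD[OF h0]
 have k01: "if0 k : hom V (ic0 Exp) \<lbrakk>X, ic0 A\<rbrakk>" "if1 k : hom V (ic1 Exp) \<lbrakk>X, ic1 A\<rbrakk>" by (simp_all add: in_hom)
 have k0: "\<exists>!x. x : hom V Z (ic0 Exp) \<and> if0 k o x = y" if "y : hom V Z \<lbrakk>X, ic0 A\<rbrakk>" for y Z
  using if_iso(1)[OF k(2)] that homD(4)[OF that] unfolding is_iso_iff_points[OF k01(1)] by blast
 have k1: "\<exists>!x. x : hom V Z (ic1 Exp) \<and> if1 k o x = y" if "y : hom V Z \<lbrakk>X, ic1 A\<rbrakk>" for y Z
  using if_iso(2)[OF k(2)] that homD(4)[OF that] unfolding is_iso_iff_points[OF k01(2)] by blast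
 let ?v0 = "\<lambda>Z x. ap0 (if0 k o x o pr1 V Z X) (pr2 V Z X)"
 let ?v1 = "\<lambda>Z x. ap1 (if1 k o x o pr1 V Z X) (pr2 V Z X)"
 have b1: "\<exists>!x. x : hom V Z (ic1 Exp) \<and> ?v1 Z x = g" if Z [simp]: "Z : Obj V" and g: "g : hom V (Z \<otimes> X) (ic1 A)" for g Z
 proof -
  have "\<exists>!y. y : hom V Z \<lbrakk>X, ic1 A\<rbrakk> \<and> ap1 (y o pr1 V Z X) (pr2 V Z X) = g"
   using exponential[OF X, of "ic1 A"] Z g unfolding is_exponential_def by simp
  moreover have "(\<exists>!x. x : hom V Z (ic1 Exp) \<and> ?v1 Z x = g) \<longleftrightarrow>
    (\<exists>!y. y : hom V Z \<lbrakk>X, ic1 A\<rbrakk> \<and> ap1 (y o pr1 V Z X) (pr2 V Z X) = g)"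
  proof (rule ex1_transfer[where F = "\<lambda>x. if1 k o x" and R = "\<lambda>x. x : hom V Z (ic1 Exp)"])
   show "\<exists>!x. x : hom V Z (ic1 Exp) \<and> if1 k o x = y" if "y : hom V Z \<lbrakk>X, ic1 A\<rbrakk> \<and> ap1 (y o pr1 V Z X) (pr2 V Z X) = g" for y
    using k1 that by blast
   show "(x : hom V Z (ic1 Exp) \<and> ?v1 Z x = g) \<longleftrightarrow>
    (if1 k o x : hom V Z \<lbrakk>X, ic1 A\<rbrakk> \<and> ap1 ((if1 k o x) o pr1 V Z X) (pr2 V Z X) = g)" if "x : hom V Z (ic1 Exp)" for x
    using homD[OF that] by (simp add: in_hom)
  qed blast
  ultimately show ?thesis by blast
 qed
 have m0: "x = y" if Z: "Z : Obj V" and xy: "x : hom V Z (ic0 Exp)" "y : hom V Z (ic0 Exp)" and e: "?v0 Z x = ?v0 Z y" for x y Z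
 proof -
  note [simp] = homD[OF xy(1)] homD[OF xy(2)]
  have "if0 k o x = if0 k o y"
   by (rule transpose_unique[of _ Z X "ic0 A"]) (use e in \<open>simp_all add: in_hom\<close>)
  moreover have "if0 k o x : hom V Z \<lbrakk>X, ic0 A\<rbrakk>" by (simp add: in_hom)
  ultimately show ?thesis using k0[of "if0 k o x" Z] xy by metis
 qed
 have st: "isrc A o ?v1 Z f = ?v0 Z (isrc Exp o f)" "itgt A o ?v1 Z f = ?v0 Z (itgt Exp o f)"
  if "f : hom V Z (ic1 Exp)" for f Z
 proof -
  note [simp] = homD[OF that]
  have "if0 k o isrc Exp o f o pr1 V Z X = isrc E o if1 k o f o pr1 V Z X"
   "if0 k o itgt Exp o f o pr1 V Z X = itgt E o if1 k o f o pr1 V Z X"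
   using isrc_if1(1)[of k E "f o pr1 V Z X"] isrc_if1(2)[of k E "f o pr1 V Z X"] by simp_all
  then show "isrc A o ?v1 Z f = ?v0 Z (isrc Exp o f)" "itgt A o ?v1 Z f = ?v0 Z (itgt Exp o f)"
   by (simp_all del: isrc_if1)
 qed
 have T0: "?v0 Z ((if0 ?h o T) o bang V Z) = T o bang V (Z \<otimes> X)" if [simp]: "Z : Obj V" for Z
  using kT[of "pr2 V Z X" "Z \<otimes> X"] T by (simp add: in_hom)
 have key: "(\<exists>!f. f : hom V Z (ic1 Exp) \<and> isrc Exp o f = a' o bang V Z \<and> itgt Exp o f = (if0 ?h o T) o bang V Z) \<longleftrightarrow>
   (\<exists>!f. f : hom V (Z \<otimes> X) (ic1 A) \<and> isrc A o f = a o pr2 V Z X \<and> itgt A o f = T o bang V (Z \<otimes> X))"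
  if Z [simp]: "Z : Obj V" and a': "a' : hom V \<one> (ic0 Exp)" and aa: "?v0 Z (a' o bang V Z) = a o pr2 V Z X" for Z a a'
 proof (rule ex1_transfer[where F = "?v1 Z" and R = "\<lambda>f. f : hom V Z (ic1 Exp)"])
  fix f assume f: "f : hom V Z (ic1 Exp)"
  note [simp] = homD[OF f] homD[OF a']
  have ends: "isrc Exp o f : hom V Z (ic0 Exp)" "itgt Exp o f : hom V Z (ic0 Exp)" "a' o bang V Z : hom V Z (ic0 Exp)"
   "(if0 ?h o T) o bang V Z : hom V Z (ic0 Exp)" by (simp_all add: in_hom)
  have i: "isrc Exp o f = a' o bang V Z \<longleftrightarrow> isrc A o ?v1 Z f = a o pr2 V Z X"
   unfolding st[OF f] aa[symmetric]
  proof
   show "isrc Exp o f = a' o bang V Z" if "?v0 Z (isrc Exp o f) = ?v0 Z (a' o bang V Z)"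
    by (rule m0[OF Z ends(1,3) that])
  qed (simp only:)
  have j: "itgt Exp o f = (if0 ?h o T) o bang V Z \<longleftrightarrow> itgt A o ?v1 Z f = T o bang V (Z \<otimes> X)"
   unfolding st[OF f] T0[OF Z, symmetric]
  proof
   show "itgt Exp o f = (if0 ?h o T) o bang V Z" if "?v0 Z (itgt Exp o f) = ?v0 Z ((if0 ?h o T) o bang V Z)"
    by (rule m0[OF Z ends(2,4) that])
  qed (simp only:)
  have ty: "?v1 Z f : hom V (Z \<otimes> X) (ic1 A)" by (simp add: in_hom)
  show "(f : hom V Z (ic1 Exp) \<and> isrc Exp o f = a' o bang V Z \<and> itgt Exp o f = (if0 ?h o T) o bang V Z) \<longleftrightarrow>
   (?v1 Z f : hom V (Z \<otimes> X) (ic1 A) \<and> isrc A o ?v1 Z f = a o pr2 V Z X \<and> itgt A o ?v1 Z f = T o bang V (Z \<otimes> X))"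
   by (simp only: i j f ty simp_thms)
 qed (use b1[OF Z] in blast)+
 have up: "\<exists>a'. a' : hom V \<one> (ic0 Exp) \<and> (\<forall>Z\<in>Obj V. ?v0 Z (a' o bang V Z) = a o pr2 V Z X)"
  if a: "a : hom V X (ic0 A)" for a
 proof -
  note [simp] = homD[OF a]
  let ?y = "transpose V \<one> X (ic0 A) (a o pr2 V \<one> X)"
  have "?y : hom V \<one> \<lbrakk>X, ic0 A\<rbrakk>" by (simp add: in_hom)
  from k0[OF this] obtain a' where a': "a' : hom V \<one> (ic0 Exp)" "if0 k o a' = ?y" by blast
  note [simp] = homD[OF a'(1)]
  have "?v0 Z (a' o bang V Z) = a o pr2 V Z X" if [simp]: "Z : Obj V" for Z
  proof -
   have "if0 k o (a' o bang V Z) o pr1 V Z X = (if0 k o a') o bang V (Z \<otimes> X)" by simp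
   then show ?thesis unfolding a'(2) by simp
  qed
  then show ?thesis using a'(1) by blast
 qed
 have down: "\<exists>a. a : hom V X (ic0 A) \<and> (\<forall>Z\<in>Obj V. ?v0 Z (a' o bang V Z) = a o pr2 V Z X)"
  if a': "a' : hom V \<one> (ic0 Exp)" for a'
 proof -
  note [simp] = homD[OF a']
  let ?a = "ap0 (if0 k o a' o bang V X) (Idn V X)"
  have "?a : hom V X (ic0 A)" by (simp add: in_hom)
  moreover have "?v0 Z (a' o bang V Z) = ?a o pr2 V Z X" if [simp]: "Z : Obj V" for Z by simp
  ultimately show ?thesis by blast
 qed
 have "if0 ?h o T : hom V \<one> (ic0 Exp)" by (simp add: in_hom)
 then have "is_vterminal V (Und V Exp) (if0 ?h o T) \<longleftrightarrow> (\<forall>a'\<in>hom V \<one> (ic0 Exp). \<forall>Z\<in>Obj V.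
  \<exists>!f. f : hom V Z (ic1 Exp) \<and> isrc Exp o f = a' o bang V Z \<and> itgt Exp o f = (if0 ?h o T) o bang V Z)"
  unfolding vterminal_Und_iff[OF Exp_icat] by blast
 also have "\<dots> \<longleftrightarrow> (\<forall>a\<in>hom V X (ic0 A). \<forall>Z\<in>Obj V. \<exists>!f. f : hom V (Z \<otimes> X) (ic1 A) \<and>
    isrc A o f = a o pr2 V Z X \<and> itgt A o f = T o bang V (Z \<otimes> X))"
 proof (rule iffI; intro ballI)
  fix a Z assume L: "\<forall>a'\<in>hom V \<one> (ic0 Exp). \<forall>Z\<in>Obj V.
   \<exists>!f. f : hom V Z (ic1 Exp) \<and> isrc Exp o f = a' o bang V Z \<and> itgt Exp o f = (if0 ?h o T) o bang V Z"
   and a: "a : hom V X (ic0 A)" and Z: "Z : Obj V"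
  obtain a' where a': "a' : hom V \<one> (ic0 Exp)" "?v0 Z (a' o bang V Z) = a o pr2 V Z X" using up[OF a] Z by blast
  show "\<exists>!f. f : hom V (Z \<otimes> X) (ic1 A) \<and> isrc A o f = a o pr2 V Z X \<and> itgt A o f = T o bang V (Z \<otimes> X)"
   by (rule iffD1[OF key[OF Z a']]) (use L a' Z in blast)
 next
  fix a' Z assume R: "\<forall>a\<in>hom V X (ic0 A). \<forall>Z\<in>Obj V. \<exists>!f. f : hom V (Z \<otimes> X) (ic1 A) \<and>
    isrc A o f = a o pr2 V Z X \<and> itgt A o f = T o bang V (Z \<otimes> X)"
   and a': "a' : hom V \<one> (ic0 Exp)" and Z: "Z : Obj V"
  obtain a where a: "a : hom V X (ic0 A)" "?v0 Z (a' o bang V Z) = a o pr2 V Z X" using down[OF a'] Z by blast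
  show "\<exists>!f. f : hom V Z (ic1 Exp) \<and> isrc Exp o f = a' o bang V Z \<and> itgt Exp o f = (if0 ?h o T) o bang V Z"
   by (rule iffD2[OF key[OF Z a' a(2)]]) (use R a(1) Z in blast)
 qed
 finally show ?thesis .
qed

end

text \<open>
 Terminality in the underlying category of \<open>\<lbrakk>cst X, A\<rbrakk>\<close> concerns the arrows of \<open>A\<close> at the stages
 \<open>Z \<otimes> X\<close>, so it follows from internal terminality. Conversely, at \<open>Z = \<one>\<close> it says that the object
 of arrows into \<open>T\<close> has, over the object of objects, exactly one element at stage \<open>X\<close> over each
 element, and for a conservative family this already makes the projection invertible.
\<close>

lemma (in extensive_cat) internal_terminal_iff_vterminal:
 assumes A [simp]: "A : Obj Cat" and T: "T : hom V \<one> (ic0 A)" and cons: "conservative_family V \<G>"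
 shows "is_internal_terminal V A T \<longleftrightarrow>
  (\<forall>X\<in>\<G>. is_vterminal V (Und V \<lbrakk>cst V X, A\<rbrakk>\<^bsub>Cat\<^esub>) (if0 (const_ifun V X A) o T))"
proof -
 note [simp] = homD[OF T]
 have GO: "X : Obj V" if "X : \<G>" for X using cons that unfolding conservative_family_def by blast
 let ?C = "\<lambda>X. \<forall>a\<in>hom V X (ic0 A). \<forall>Z\<in>Obj V. \<exists>!f. f : hom V (Z \<otimes> X) (ic1 A) \<and>
    isrc A o f = a o pr2 V Z X \<and> itgt A o f = T o bang V (Z \<otimes> X)"
 have "is_vterminal V (Und V \<lbrakk>cst V X, A\<rbrakk>\<^bsub>Cat\<^esub>) (if0 (const_ifun V X A) o T) \<longleftrightarrow> ?C X" if "X : \<G>" for X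
  by (rule icat_power.vterminal_power_iff[OF _ T], unfold_locales) (use GO that in simp_all)
 moreover have "(\<forall>X\<in>Obj V. terminal_points V A T X) \<longleftrightarrow> (\<forall>X\<in>\<G>. ?C X)"
 proof
  assume L: "\<forall>X\<in>Obj V. terminal_points V A T X"
  show "\<forall>X\<in>\<G>. ?C X"
  proof (intro ballI)
   fix X a Z assume X: "X : \<G>" and a: "a : hom V X (ic0 A)" and Z [simp]: "Z : Obj V"
   note [simp] = homD[OF a]
   have "a o pr2 V Z X : hom V (Z \<otimes> X) (ic0 A)" "Z \<otimes> X : Obj V" by (simp_all add: in_hom)
   then show "\<exists>!f. f : hom V (Z \<otimes> X) (ic1 A) \<and> isrc A o f = a o pr2 V Z X \<and> itgt A o f = T o bang V (Z \<otimes> X)"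
    using L unfolding terminal_points_def by blast
  qed
 next
  assume R: "\<forall>X\<in>\<G>. ?C X"
  have tX: "terminal_points V A T X" if X: "X : \<G>" for X
   unfolding terminal_points_def
  proof (intro ballI)
   fix a assume a: "a : hom V X (ic0 A)"
   note [simp] = homD[OF a]
   let ?i = "\<langle>bang V X, Idn V X\<rangle>"
   have c: "(g o pr2 V \<one> X) o ?i = g" if "g : Arr V" "Dom V g = X" for g using that by simp
   obtain f where f: "f : hom V (\<one> \<otimes> X) (ic1 A)" "isrc A o f = a o pr2 V \<one> X" "itgt A o f = T o bang V (\<one> \<otimes> X)"
    and uniq: "\<And>g. g : hom V (\<one> \<otimes> X) (ic1 A) ==> isrc A o g = a o pr2 V \<one> X ==>
     itgt A o g = T o bang V (\<one> \<otimes> X) ==> g = f"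
    using R X a one_in_Obj by blast
   note [simp] = homD[OF f(1)]
   show "\<exists>!f. f : hom V X (ic1 A) \<and> isrc A o f = a \<and> itgt A o f = T o bang V X"
   proof (rule ex1I[of _ "f o ?i"])
    show "f o ?i : hom V X (ic1 A) \<and> isrc A o f o ?i = a \<and> itgt A o f o ?i = T o bang V X"
     using square_point[OF f(2), of ?i] square_point[OF f(3), of ?i] by (simp add: in_hom)
    fix g assume "g : hom V X (ic1 A) \<and> isrc A o g = a \<and> itgt A o g = T o bang V X"
    then have g: "g : hom V X (ic1 A)" "isrc A o g = a" "itgt A o g = T o bang V X" by blast+
    note [simp] = homD[OF g(1)]
    have "isrc A o g o pr2 V \<one> X = (isrc A o g) o pr2 V \<one> X" "itgt A o g o pr2 V \<one> X = (itgt A o g) o pr2 V \<one> X"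
     by simp_all
    then have "g o pr2 V \<one> X = f" unfolding g by (intro uniq) (simp_all add: in_hom)
    then show "g = f o ?i" using c[of g] by simp
   qed
  qed
  have Tb: "Idn V (ic0 A) \<in> hom V (ic0 A) (ic0 A)" "T o bang V (ic0 A) \<in> hom V (ic0 A) (ic0 A)" by (simp_all add: in_hom)
  let ?K = "pb_obj V \<langle>isrc A, itgt A\<rangle> \<langle>Idn V (ic0 A), T o bang V (ic0 A)\<rangle>"
  let ?k = "pb2 V \<langle>isrc A, itgt A\<rangle> \<langle>Idn V (ic0 A), T o bang V (ic0 A)\<rangle>"
  note k = arrows_between(1)[OF A Tb]
  have kt: "(\<exists>!z. z : hom V X ?K \<and> ?k o z = a) \<longleftrightarrow>
   (\<exists>!f. f : hom V X (ic1 A) \<and> isrc A o f = a \<and> itgt A o f = T o bang V X)" if a: "a : hom V X (ic0 A)" for a X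
   using arrows_between(2)[OF A Tb a] homD[OF a] by simp
  have "bij_betw (\<lambda>h. ?k o h) (hom V X ?K) (hom V X (ic0 A))" if "X : \<G>" for X
   unfolding bij_betw_def
  proof
   have ex: "\<exists>!z. z : hom V X ?K \<and> ?k o z = a" if "a : hom V X (ic0 A)" for a
    unfolding kt[OF that] using tX[OF \<open>X \<in> \<G>\<close>] that unfolding terminal_points_def by blast
   show "inj_on (\<lambda>h. ?k o h) (hom V X ?K)"
    using ex comp_in_hom[OF _ k] by (intro inj_onI) metis
   show "(\<lambda>h. ?k o h) ` hom V X ?K = hom V X (ic0 A)"
    using ex comp_in_hom[OF _ k] by blast
  qed
  then have "is_iso V ?k" using cons k unfolding conservative_family_def by blast
  then show "\<forall>X\<in>Obj V. terminal_points V A T X"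
   unfolding is_iso_iff_points[OF k] terminal_points_def using kt by blast
 qed
 ultimately show ?thesis unfolding internal_terminal_iff[OF A] using T by simp
qed

section \<open>The internal category of cones\<close>

text \<open>
 Of two composable arrows of \<open>two V\<close> one is an identity, so functoriality reduces to the unit laws.
 The other compositions have initial source.
\<close>

lemma (in int_cat) arrow_vfun_is_vfun:
 assumes A [simp]: "A : VOb C" "B : VOb C" and f: "f : hom V \<one> (VHom C A B)"
 shows "is_vfun V (two V) C (arrow_vfun V C A B f)"
proof -
 note [simp] = homD[OF f]
 let ?F0 = "\<lambda>x. if x then B else A"
 let ?F1 = "\<lambda>x y. if x = y then VId C (if x then B else A) else if y then f else (THE h. h : hom V \<zero> (VHom C B A))"
 have ob [simp]: "?F0 x : VOb C" for x by simp
 have v: "(THE h. h : hom V \<zero> (VHom C B A)) \<in> hom V \<zero> (VHom C B A)"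
 proof (rule theI')
  show "\<exists>!h. h : hom V \<zero> (VHom C B A)" using from_zero[of "VHom C B A"] from_zero_eq[of _ "VHom C B A"] by auto
 qed
 have h: "?F1 x y : hom V (VHom (two V) x y) (VHom C (?F0 x) (?F0 y))" for x y
  using v by (cases x; cases y) (auto simp: in_hom)
 have "is_vfun V (two V) C (mk_vfun (VOb (two V)) ?F0 ?F1)"
 proof (rule mk_vfun_is_vfun)
  show "?F1 x x o VId (two V) x = VId C (?F0 x)" for x by simp
  fix x y z X g h' assume g: "g : hom V X (VHom (two V) y z)" and h': "h' : hom V X (VHom (two V) x y)"
  note t = homD(1-3)[OF two_cmp]
  note ty = homD(1-3)[OF h]
  have l: "?F1 x z o VCmp (two V) x y z o \<langle>g, h'\<rangle> \<in> hom V X (VHom C (?F0 x) (?F0 z))"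
   by (rule comp_in_hom[OF _ h], rule comp_in_hom[OF _ two_cmp]) (simp add: in_hom homD[OF g] homD[OF h'] del: two_simps)
  have r: "VCmp C (?F0 x) (?F0 y) (?F0 z) o \<langle>?F1 y z o g, ?F1 x y o h'\<rangle> \<in> hom V X (VHom C (?F0 x) (?F0 z))"
   using comp_in_hom[OF g h] comp_in_hom[OF h' h] by (simp add: in_hom del: two_simps if_split_asm)
  show "?F1 x z o VCmp (two V) x y z o \<langle>g, h'\<rangle> = VCmp C (?F0 x) (?F0 y) (?F0 z) o \<langle>?F1 y z o g, ?F1 x y o h'\<rangle>"
  proof (cases "x \<le> y \<and> y \<le> z")
   case True
   have X [simp]: "X : Obj V" by (rule homD(4)[OF g])
   have e: "g = bang V X" "h' = bang V X"
    using bang_unique[of g] bang_unique[of h'] homD[OF g] homD[OF h'] True by simp_all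
   have "VCmp (two V) x y z o \<langle>bang V X, bang V X\<rangle> = bang V X"
    by (rule two_hom_unique[of _ X x z]) (use True t in \<open>auto simp: in_hom\<close>)
   then show ?thesis unfolding e using True by (cases x; cases y; cases z; simp)
  next
   case False
   then have "g : hom V X \<zero> \<or> h' : hom V X \<zero>" using g h' by auto
   then show ?thesis using strict_initial[OF _ l r] by blast
  qed
 qed (use h two_vcat in \<open>simp_all del: if_split\<close>)
 then show ?thesis by (simp add: arrow_vfun_def)
qed

text \<open>
 All arrows of \<open>cst X\<close> are identities.
\<close>

lemma (in pullback_ccc) cst_ifun_ext:
 assumes F: "F : hom Cat (cst V X) A" "F' : hom Cat (cst V X) A" and X [simp]: "X : Obj V" and eq: "if0 F = if0 F'"
 shows "F = F'"
proof (rule ifun_ext)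
 note [simp] = Cat.homD[OF F(1)] Cat.homD[OF F(2)]
 show "if1 F = if1 F'" using if1_iidn_0[of F] if1_iidn_0[of F'] eq by simp
qed (use Cat.homD[OF F(1)] Cat.homD[OF F(2)] eq in simp_all)

locale cone_category = cone U V J C G W L l
 for U :: "'u itself" and V :: "('a, 'b) category" (structure) and J :: "('a, 'b, 'i) vcat"
  and C :: "('a, 'b, 'c) vcat" and G :: "('i, 'c, 'b) vfun" and W L l +
 fixes S :: "('i, 'a, 'b) vfun set"
 assumes C_small: "small U (VOb C)" and S: "S \<subseteq> VOb (vfun_cat V J)" "small U S" "W : S"
  "\<And>A. A : VOb C ==> hom_along V J C G A : S"
begin

abbreviation "D \<equiv> fun_sub_op V J S"

lemma D_vcat: "is_vcat V D"
 unfolding fun_sub_op_def by (rule vfull_vcat[OF vop_vcat[OF vfun_cat_vcat]]) (use S(1) in simp)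

lemma D_simps [simp]: "VOb D = S" "VHom D F F' = end_obj V J F' F"
 by (simp_all add: fun_sub_op_def)

lemma S_vfun [simp]: "F : S ==> is_vfun V J (vself V) F"
 using S(1) by auto

lemma D_cmp [simp]:
 assumes "F : S" "F' : S" "K : S" "g : Arr V" "f : Arr V" "Dom V g = Dom V f" "Cod V g = end_obj V J K F'"
  "Cod V f = end_obj V J F' F"
 shows "VCmp D F F' K o \<langle>g, f\<rangle> = VCmp (vfun_cat V J) K F' F o \<langle>f, g\<rangle>"
 using assms vop_cmp[OF vfun_cat_vcat, of F F' K g f] by (simp add: fun_sub_op_def)

lemma yoneda_op_vfun: "is_vfun V C D (vfun_op yoneda)"
 unfolding fun_sub_op_def
 by (rule vfun_op_vfun[OF C vfun_cat_vcat yoneda_vfun]) (use S in simp_all)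

end

sublocale cone_category \<subseteq> N: int_functor U V C "fun_sub_op V J S" "vfun_op (yoneda_along V J C G)"
 by unfold_locales (use C C_small D_vcat S(2) yoneda_op_vfun in simp_all)

sublocale cone_category \<subseteq> K: comma_icat U V "Int_cat V (fun_sub_op V J S)" "Int_cat V C"
  "Int_fun V C (fun_sub_op V J S) (vfun_op (yoneda_along V J C G))" "Int_obj_incl V (fun_sub_op V J S) W"
 by unfold_locales (use N.D.Int_cat_icat N.Int_fun_ifun N.D.obj_in_hom[of W] S(3) in simp_all)

context cone_category
begin

lemma yoneda_op_simps [simp]: "FOb (vfun_op yoneda) A = FOb yoneda A" "FHom (vfun_op yoneda) A B = FHom yoneda B A"
 by (simp_all add: vfun_op_def)

abbreviation "\<Lambda> \<equiv> N.D.arr (hom_along V J C G L) W o cone_map"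

text \<open>
 In \<open>Int (V\<^sup>J)\<^sup>o\<^sup>p\<close> the triangle under \<open>\<lambda>\<close> with base an arrow \<open>f\<close> from \<open>A\<close> to \<open>L\<close> is filled by the cone that
 \<open>f\<close> induces, the value of \<open>\<lambda>\<^sup>*\<close> at \<open>f\<close>.
\<close>

lemma triangle:
 assumes A [simp]: "A : VOb C" and f: "f : hom V X (VHom C A L)"
 shows "icomp V N.D.I (\<Lambda> o bang V X) (if1 N.IF o N.arr A L o f) = N.D.arr (hom_along V J C G A) W o induced A o f"
proof -
 note [simp] = homD[OF f] S(3,4)
 show ?thesis by (simp add: induced_point[OF A f])
qed

text \<open>
 An arrow from \<open>a\<close> to \<open>L\<close> completes \<open>\<phi>\<close> and \<open>\<lambda>\<close> to a triangle over \<open>W\<close>.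
\<close>

definition filler :: "'b \<Rightarrow> 'b \<Rightarrow> 'b \<Rightarrow> bool" where
 "filler a \<phi> u \<longleftrightarrow> Int_src V C o u = a \<and> Int_tgt V C o u = N.obj L o bang V (Dom V u) \<and>
   icomp V N.D.I (\<Lambda> o bang V (Dom V u)) (if1 N.IF o u) = \<phi>"

lemma filler_stable:
 assumes u: "u : hom V X N.M" and w: "w : hom V Y X" and fil: "filler a \<phi> u"
  and a: "if0 N.IF o a : Arr V" "a : Arr V" "\<phi> \<in> Arr V"
 shows "filler (a o w) (\<phi> o w) (u o w)"
proof -
 note [simp] = homD[OF u] homD[OF w] S(3,4)
 have e: "Int_src V C o u = a" "Int_tgt V C o u = N.obj L o bang V X" "icomp V N.D.I (\<Lambda> o bang V X) (if1 N.IF o u) = \<phi>"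
  using fil by (simp_all add: filler_def)
 have t: "Int_tgt V D o if1 N.IF o u = N.D.obj (hom_along V J C G L) o bang V X"
  using isrc_if1(2)[of N.IF N.D.I u] Cat.homD[OF N.Int_fun_ifun] by (simp add: e(2))
 have tw: "Int_tgt V D o if1 N.IF o u o w = N.D.obj (hom_along V J C G L) o bang V Y"
  using square_point[OF t, of w] by simp
 have "Int_src V C o u o w = a o w" unfolding e(1)[symmetric] by simp
 moreover have "Int_tgt V C o u o w = N.obj L o bang V Y" using square_point[OF e(2), of w] by simp
 moreover have "icomp V N.D.I (\<Lambda> o bang V Y) (if1 N.IF o u o w) = \<phi> o w"
  unfolding e(3)[symmetric] using t by (simp add: tw)
 ultimately show ?thesis unfolding filler_def by simp
qed

lemma filler_arr_iff:
 assumes A: "A : VOb C" and f: "f : hom V X (VHom C A L)" and g: "g : hom V X (end_obj V J W (hom_along V J C G A))"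
 shows "filler (N.obj A o bang V X) (N.D.arr (hom_along V J C G A) W o g) (N.arr A L o f) \<longleftrightarrow> induced A o f = g"
proof -
 note [simp] = homD[OF f] homD[OF g] A S(3,4)
 have i: "induced A o f : hom V X (end_obj V J W (hom_along V J C G A))" by (rule comp_in_hom[OF f induced_in_hom[OF A]])
 have "filler (N.obj A o bang V X) (N.D.arr (hom_along V J C G A) W o g) (N.arr A L o f) \<longleftrightarrow>
   N.D.arr (hom_along V J C G A) W o induced A o f = N.D.arr (hom_along V J C G A) W o g"
  using triangle[OF A f] unfolding filler_def by simp
 also have "\<dots> \<longleftrightarrow> induced A o f = g"
  using N.D.arr_mono[of "hom_along V J C G A" W "induced A o f" X g] i g by auto
 finally show ?thesis .
qed

lemma filler_factor:
 assumes A: "A : VOb C" and u: "u : hom V X N.M" and fil: "filler (N.obj A o bang V X) \<phi> u"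
 obtains f where "f : hom V X (VHom C A L)" "u = N.arr A L o f"
 by (rule N.arr_factor[OF u A L]) (use fil homD[OF u] in \<open>simp_all add: filler_def\<close>)

lemma unique_filler_iff:
 assumes A: "A : VOb C" and g: "g : hom V X (end_obj V J W (hom_along V J C G A))"
 shows "(\<exists>!f. f : hom V X (VHom C A L) \<and> induced A o f = g) \<longleftrightarrow>
  (\<exists>!u. u : hom V X N.M \<and> filler (N.obj A o bang V X) (N.D.arr (hom_along V J C G A) W o g) u)"
  (is "_ \<longleftrightarrow> (\<exists>!u. _ \<and> filler ?a ?\<phi> u)")
proof (rule ex1_transfer[where F = "\<lambda>f. N.arr A L o f" and R = "\<lambda>f. f : hom V X (VHom C A L)"])
 fix u assume u: "u : hom V X N.M \<and> filler ?a ?\<phi> u"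
 obtain f where f: "f : hom V X (VHom C A L)" "u = N.arr A L o f" using filler_factor[OF A] u by blast
 show "\<exists>!f. f : hom V X (VHom C A L) \<and> N.arr A L o f = u"
  by (rule ex1I[of _ f]) (use f N.arr_mono[OF A L _ f(1)] in auto)
next
 fix f assume f: "f : hom V X (VHom C A L)"
 have "N.arr A L o f : hom V X N.M" using A homD[OF f] by (simp add: in_hom)
 then show "(f : hom V X (VHom C A L) \<and> induced A o f = g) \<longleftrightarrow> (N.arr A L o f : hom V X N.M \<and> filler ?a ?\<phi> (N.arr A L o f))"
  using filler_arr_iff[OF A f g] f by blast
qed blast

text \<open>
 The triangles over an arrow from the value of \<open>C(-,G)\<close> at \<open>A\<close> to \<open>W\<close>, an element of
 \<open>V\<^sup>J(W, C(A,G-))\<close>, have unique fillers if and only if the component of \<open>\<lambda>\<^sup>*\<close> at \<open>A\<close> is bijective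
 on elements. Every triangle is of this kind on the parts of a decomposition of its stage, and
 unique fillers on the parts can be glued.
\<close>

lemma unique_fillers_iff:
 "(\<forall>X\<in>Obj V. \<forall>a\<in>hom V X N.Obs. \<forall>\<phi>\<in>hom V X N.D.M. Int_src V D o \<phi> = if0 N.IF o a \<longrightarrow>
   Int_tgt V D o \<phi> = N.D.obj W o bang V X \<longrightarrow> (\<exists>!u. u : hom V X N.M \<and> filler a \<phi> u)) \<longleftrightarrow>
  (\<forall>A\<in>VOb C. is_iso V (induced A))"
proof (rule iffI; intro ballI impI)
 fix A assume R: "\<forall>X\<in>Obj V. \<forall>a\<in>hom V X N.Obs. \<forall>\<phi>\<in>hom V X N.D.M. Int_src V D o \<phi> = if0 N.IF o a \<longrightarrow>
   Int_tgt V D o \<phi> = N.D.obj W o bang V X \<longrightarrow> (\<exists>!u. u : hom V X N.M \<and> filler a \<phi> u)" and A [simp]: "A : VOb C"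
 show "is_iso V (induced A)"
  unfolding is_iso_iff_points[OF induced_in_hom[OF A]]
 proof (intro ballI)
  fix X g assume X [simp]: "X : Obj V" and g: "g : hom V X (end_obj V J W (hom_along V J C G A))"
  note [simp] = homD[OF g] S(3,4)
  let ?a = "N.obj A o bang V X" and ?\<phi> = "N.D.arr (hom_along V J C G A) W o g"
  have "?a : hom V X N.Obs" "?\<phi> \<in> hom V X N.D.M" "Int_src V D o ?\<phi> = if0 N.IF o ?a"
   "Int_tgt V D o ?\<phi> = N.D.obj W o bang V X" by (simp_all add: in_hom)
  then have "\<exists>!u. u : hom V X N.M \<and> filler ?a ?\<phi> u" using R X by blast
  then show "\<exists>!f. f : hom V X (VHom C A L) \<and> induced A o f = g" unfolding unique_filler_iff[OF A g] .
 qed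
next
 fix X a \<phi> assume iso: "\<forall>A\<in>VOb C. is_iso V (induced A)" and X [simp]: "X : Obj V" and a: "a : hom V X N.Obs"
  and \<phi>: "\<phi> \<in> hom V X N.D.M" and s: "Int_src V D o \<phi> = if0 N.IF o a" and t: "Int_tgt V D o \<phi> = N.D.obj W o bang V X"
 note [simp] = homD[OF a] homD[OF \<phi>] S(3,4)
 have arrs: "if0 N.IF o a : Arr V" "a : Arr V" "\<phi> \<in> Arr V" by simp_all
 have loc: "\<exists>!u. u : hom V Y N.M \<and> filler (a o w) (\<phi> o w) u"
  if w: "w : hom V Y X" and A [simp]: "A : VOb C" and aw: "a o w = N.obj A o bang V Y" for Y w A
 proof -
  note [simp] = homD[OF w]
  have "Int_src V D o \<phi> o w = if0 N.IF o a o w" by (rule square_point[OF s]) simp_all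
  then have sw: "Int_src V D o \<phi> o w = N.D.obj (hom_along V J C G A) o bang V Y" unfolding aw by simp
  have tw: "Int_tgt V D o \<phi> o w = N.D.obj W o bang V Y" using square_point[OF t, of w] by simp
  obtain g where g: "g : hom V Y (end_obj V J W (hom_along V J C G A))" "\<phi> o w = N.D.arr (hom_along V J C G A) W o g"
   by (rule N.D.arr_factor[OF comp_in_hom[OF w \<phi>] _ _ sw tw]) simp_all
  note [simp] = homD[OF g(1)]
  have "\<exists>!f. f : hom V Y (VHom C A L) \<and> induced A o f = g"
   using iso A g(1) homD(4)[OF w] is_iso_iff_points[OF induced_in_hom[OF A]] by blast
  then show ?thesis unfolding aw g(2) unique_filler_iff[OF A g(1)] .
 qed
 have one: "x = bang V Y" if "x : hom V Y \<one>" for x Y using that bang_unique[of x] by (simp add: in_hom)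
 obtain u where u: "u : hom V X N.M" and loc_u: "\<And>Y w A x. w : hom V Y X ==> A : VOb C ==> x : hom V Y \<one> ==>
   a o w = N.obj A o x ==> filler (a o w) (\<phi> o w) (u o w)"
 proof (rule local_glue[OF N.small N.objects a N.OM(2), of "\<lambda>w u. filler (a o w) (\<phi> o w) u"])
  fix Y w m Y' v assume w: "w : hom V Y X" and m: "m : hom V Y N.M" and v: "v : hom V Y' Y"
   and fil: "filler (a o w) (\<phi> o w) m"
  note [simp] = homD[OF w] homD[OF v]
  show "filler (a o w o v) (\<phi> o w o v) (m o v)"
   using filler_stable[OF m v fil] by simp
 next
  fix Y w A x assume w: "w : hom V Y X" and A: "A : VOb C" and x: "x : hom V Y \<one>" and e: "a o w = N.obj A o x"
  show "\<exists>m. m : hom V Y N.M \<and> filler (a o w) (\<phi> o w) m" using loc[OF w A e[unfolded one[OF x]]] by blast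
 next
  fix g assume *: "g : hom V X N.M" "\<And>Y w A x. w : hom V Y X ==> A : VOb C ==> x : hom V Y \<one> ==>
   a o w = N.obj A o x ==> filler (a o w) (\<phi> o w) (g o w)"
  show thesis by (rule that[OF *])
 qed
 note [simp] = homD[OF u]
 have lu: "filler (a o w) (\<phi> o w) (u o w)" if "w : hom V Y X" "A : VOb C" "a o w = N.obj A o bang V Y" for w Y A
  by (rule loc_u[OF that(1,2) bang_in_hom that(3)]) (rule homD(4)[OF that(1)])
 have fu: "filler a \<phi> u"
 proof -
  have 1: "Int_src V C o u = a"
  proof (rule N.local_obj[OF a _ a])
   fix Y w A assume w: "w : hom V Y X" and A: "A : VOb C" and e: "a o w = N.obj A o bang V Y"
   show "(Int_src V C o u) o w = a o w" using lu[OF w A e] homD[OF w] by (simp add: filler_def)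
  qed (simp add: in_hom)
  have 2: "Int_tgt V C o u = N.obj L o bang V X"
  proof (rule N.local_obj[OF a])
   fix Y w A assume w: "w : hom V Y X" and A: "A : VOb C" and e: "a o w = N.obj A o bang V Y"
   show "(Int_tgt V C o u) o w = (N.obj L o bang V X) o w" using lu[OF w A e] homD[OF w] by (simp add: filler_def)
  qed (simp_all add: in_hom)
  have t': "Int_tgt V D o if1 N.IF o u = N.D.obj (hom_along V J C G L) o bang V X"
   using isrc_if1(2)[of N.IF N.D.I u] Cat.homD[OF N.Int_fun_ifun] by (simp add: 2)
  have 3: "icomp V N.D.I (\<Lambda> o bang V X) (if1 N.IF o u) = \<phi>"
  proof (rule N.local_obj[OF a _ \<phi>])
   show "icomp V N.D.I (\<Lambda> o bang V X) (if1 N.IF o u) \<in> hom V X N.D.M" by (simp add: in_hom t')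
   fix Y w A assume w: "w : hom V Y X" and A: "A : VOb C" and e: "a o w = N.obj A o bang V Y"
   note [simp] = homD[OF w]
   have tw: "Int_tgt V D o if1 N.IF o u o w = N.D.obj (hom_along V J C G L) o bang V Y"
    using square_point[OF t', of w] by simp
   show "icomp V N.D.I (\<Lambda> o bang V X) (if1 N.IF o u) o w = \<phi> o w"
    using lu[OF w A e] by (simp add: filler_def t' tw)
  qed
  show ?thesis using 1 2 3 by (simp add: filler_def)
 qed
 have "u' = u" if u': "u' : hom V X N.M" and fu': "filler a \<phi> u'" for u'
 proof (rule N.local_obj[OF a u' u])
  fix Y w A assume w: "w : hom V Y X" and A: "A : VOb C" and e: "a o w = N.obj A o bang V Y"
  show "u' o w = u o w"
   using loc[OF w A e] filler_stable[OF u' w fu' arrs] lu[OF w A e] comp_in_hom[OF w u] comp_in_hom[OF w u'] by blast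
 qed
 then show "\<exists>!u. u : hom V X N.M \<and> filler a \<phi> u" using u fu by blast
qed

subsection \<open>The element given by the cone\<close>

abbreviation "cones \<equiv> cone_icat V J C G W S"
abbreviation "T \<equiv> cone_elem V J C G W S L l"

lemma cones_eq: "cones = K.P"
 by (simp add: cone_icat_def cone_functor_def)

text \<open>
 By definition the second component of \<open>T\<close> is a transpose, and a transpose takes on objects the value
 of the given functor at the non-identity arrow of \<open>two V\<close>, which here is \<open>\<lambda>\<close>. The pair is an element
 of the comma category, because functors out of a discrete category agree if they agree on objects.
\<close>

lemma cone_elem_props:
 shows "T : hom V \<one> (ic0 cones)" and "if0 K.proj o T = N.obj L" and "K.arrow o T = \<Lambda>"
proof -
 note [simp] = S(3,4)
 let ?B = "N.D.I" and ?L = "hom_along V J C G L"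
 let ?ar = "arrow_vfun V D ?L W cone_map"
 have cm: "cone_map : hom V \<one> (VHom D ?L W)" using cone_map_in_hom by simp
 have ar: "is_vfun V (two V) D ?ar" by (rule N.D.arrow_vfun_is_vfun[OF _ _ cm]) simp_all
 interpret R: int_functor U V "two V" D ?ar by unfold_locales (rule ar)
 have R: "R.IF : hom Cat (itwo V) ?B" using R.Int_fun_ifun by simp
 note [simp] = Cat.homD[OF R]
 let ?F = "R.IF o\<^bsub>Cat\<^esub> pr2 Cat (cst V \<one>) (itwo V)"
 have F: "?F : hom Cat (cst V \<one> \<otimes>\<^bsub>Cat\<^esub> itwo V) ?B" by (simp add: in_hom)
 let ?t = "transpose Cat (cst V \<one>) (itwo V) ?B ?F"
 have t: "?t : hom Cat (cst V \<one>) K.E"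
  and tev: "ev Cat (itwo V) ?B o\<^bsub>Cat\<^esub> \<langle>?t o\<^bsub>Cat\<^esub> pr1 Cat (cst V \<one>) (itwo V), pr2 Cat (cst V \<one>) (itwo V)\<rangle>\<^bsub>Cat\<^esub> = ?F"
  using Cat.transpose_props[OF K.chosen_arrow_category _ F] by simp_all
 note [simp] = Cat.homD[OF t]
 interpret AT: arrow_transpose U V ?B "cst V \<one>" ?F by unfold_locales (simp_all add: F)
 note [simp] = Cat.homD[OF K.apply_in_hom]
 have "K.apply o\<^bsub>Cat\<^esub> \<langle>(K.compare o\<^bsub>Cat\<^esub> ?t) o\<^bsub>Cat\<^esub> pr1 Cat (cst V \<one>) (itwo V), pr2 Cat (cst V \<one>) (itwo V)\<rangle>\<^bsub>Cat\<^esub>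
  = (K.apply o\<^bsub>Cat\<^esub> \<langle>K.compare o\<^bsub>Cat\<^esub> pr1 Cat K.E (itwo V), pr2 Cat K.E (itwo V)\<rangle>\<^bsub>Cat\<^esub>) o\<^bsub>Cat\<^esub>
    \<langle>?t o\<^bsub>Cat\<^esub> pr1 Cat (cst V \<one>) (itwo V), pr2 Cat (cst V \<one>) (itwo V)\<rangle>\<^bsub>Cat\<^esub>" by simp
 then have "K.apply o\<^bsub>Cat\<^esub> \<langle>(K.compare o\<^bsub>Cat\<^esub> ?t) o\<^bsub>Cat\<^esub> pr1 Cat (cst V \<one>) (itwo V), pr2 Cat (cst V \<one>) (itwo V)\<rangle>\<^bsub>Cat\<^esub> = ?F"
  by (simp only: K.compare(3) tev)
 then have "if0 (K.compare o\<^bsub>Cat\<^esub> ?t) = AT.h0"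
  by (rule AT.transpose_on_objects[rotated]) (simp add: in_hom)
 moreover have "AT.h0 = \<Lambda>"
 proof -
  have "AT.h0 = if1 R.IF o two_arr False True \<one>" by (simp add: AT.h0_def)
  also have "\<dots> = N.D.arr (FOb ?ar False) (FOb ?ar True) o FHom ?ar False True o bang V \<one>"
   by (rule R.Int_fun_points) simp_all
  also have "\<dots> = \<Lambda>" by (simp add: arrow_vfun_def)
  finally show ?thesis .
 qed
 ultimately have kt: "if0 K.compare o if0 ?t = \<Lambda>" by simp
 let ?e = "elem_ifun V N.I (N.obj L)"
 have e: "?e : hom Cat (cst V \<one>) N.I" by (rule elem_ifun_in_hom) (simp_all add: N.obj_in_hom)
 note [simp] = Cat.homD[OF e]
 let ?H = "comma_cospan V N.IF (N.D.obj W)" and ?E = "ends_ifun V ?B"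
 have sq: "?H o\<^bsub>Cat\<^esub> ?e = ?E o\<^bsub>Cat\<^esub> ?t"
 proof (rule cst_ifun_ext[of _ \<one> "?B \<otimes>\<^bsub>Cat\<^esub> ?B"])
  have "if0 ?E o if0 ?t = pair0 ?B ?B (isrc ?B o if0 K.compare o if0 ?t) (itgt ?B o if0 K.compare o if0 ?t)"
   by (rule K.cospan_value(3)) simp_all
  also have "\<dots> = pair0 ?B ?B (N.D.obj ?L) (N.D.obj W)"
   unfolding kt using N.D.Int_points(1,2)[of ?L cone_map W] by simp
  finally have 1: "if0 ?E o if0 ?t = pair0 ?B ?B (N.D.obj ?L) (N.D.obj W)" .
  have "if0 ?H o N.obj L = pair0 ?B ?B (if0 N.IF o N.obj L) (N.D.obj W o bang V (Dom V (N.obj L)))"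
   by (rule K.cospan_value(1)) simp_all
  also have "\<dots> = pair0 ?B ?B (N.D.obj ?L) (N.D.obj W)"
   using N.if0_obj(2)[of L] by simp
  finally show "if0 (?H o\<^bsub>Cat\<^esub> ?e) = if0 (?E o\<^bsub>Cat\<^esub> ?t)" using 1 by simp
 qed (simp_all add: in_hom)
 let ?p = "pb_pair Cat ?H ?E ?e ?t"
 have p: "?p : hom Cat (cst V \<one>) K.P" "K.proj o\<^bsub>Cat\<^esub> ?p = ?e" "K.leg o\<^bsub>Cat\<^esub> ?p = ?t"
  using sq by (simp_all add: in_hom comma_def comma_proj_def)
 note [simp] = Cat.homD[OF p(1)]
 have T: "T = if0 ?p" by (simp add: cone_elem_def Let_def cone_functor_def)
 show "T : hom V \<one> (ic0 cones)" unfolding T cones_eq by (simp add: in_hom)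
 show "if0 K.proj o T = N.obj L" unfolding T using arg_cong[OF p(2), of if0] by simp
 have "if0 K.leg o if0 ?p = if0 ?t" using arg_cong[OF p(3), of if0] by (simp only: CatV_fun_simps)
 then show "K.arrow o T = \<Lambda>" unfolding T K.arrow_def kt[symmetric] by simp
qed

lemma weighted_limit_iff_internal_terminal:
 "is_weighted_limit V J C G W L l \<longleftrightarrow> is_internal_terminal V cones T"
proof -
 have T: "T : hom V \<one> (ic0 K.P)" using cone_elem_props(1) unfolding cones_eq .
 have "is_internal_terminal V cones T \<longleftrightarrow> (\<forall>X\<in>Obj V. terminal_points V K.P T X)"
  unfolding cones_eq using internal_terminal_iff[of K.P T] T by simp
 also have "\<dots> \<longleftrightarrow> (\<forall>X\<in>Obj V. \<forall>a\<in>hom V X N.Obs. \<forall>\<phi>\<in>hom V X N.D.M. Int_src V D o \<phi> = if0 N.IF o a \<longrightarrow>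
   Int_tgt V D o \<phi> = N.D.obj W o bang V X \<longrightarrow> (\<exists>!u. u : hom V X N.M \<and> filler a \<phi> u))"
  unfolding K.comma_terminal_iff[OF T] cone_elem_props(2) N.Int_cat_simps N.D.Int_cat_simps
 proof (intro ball_cong refl imp_cong arg_cong[where f = Ex1] ext)
  fix X u assume X [simp]: "X : Obj V"
  have "K.arrow o T o bang V X = (K.arrow o T) o bang V X"
   by (rule comp_assoc[symmetric]) (simp_all add: homD[OF T])
  then have "K.arrow o T o bang V X = \<Lambda> o bang V X" unfolding cone_elem_props(3) .
  then show "(u : hom V X N.M \<and> Int_src V C o u = a \<and> Int_tgt V C o u = N.obj L o bang V X \<and>
    icmp N.D.I o pb_pair V (Int_src V D) (Int_tgt V D) (K.arrow o T o bang V X) (if1 N.IF o u) = \<phi>)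
   \<longleftrightarrow> (u : hom V X N.M \<and> filler a \<phi> u)" for a \<phi>
   by (auto simp: filler_def in_hom)
 qed
 also have "\<dots> \<longleftrightarrow> is_weighted_limit V J C G W L l"
  unfolding unique_fillers_iff is_weighted_limit_iff ..
 finally show ?thesis by blast
qed

end

section \<open>Weighted limits as internal terminal objects\<close>

theorem theorem8p6:
  fixes V :: "('o, 'm) category"
    and \<G> :: "'o set"
    and J :: "('o, 'm, 'i) vcat"
    and C :: "('o, 'm, 'c) vcat"
    and G :: "('i, 'c, 'm) vfun"
    and W :: "('i, 'o, 'm) vfun"
    and L :: 'c
    and l :: "'i \<Rightarrow> 'm"
    and S :: "('i, 'o, 'm) vfun set"
  assumes universe: "infinite (UNIV :: 'u set)"
    and V: "is_category V" "extensive TYPE('u) V" "cartesian_closed V" "has_pullbacks V"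
    and \<G>: "conservative_family V \<G>"
    and J: "is_vcat V J" "small TYPE('u) (VOb J)"
    and C: "is_vcat V C" "small TYPE('u) (VOb C)"
    and G: "is_vfun V J C G"
    and W: "is_vfun V J (vself V) W"
    and L: "L \<in> VOb C"
    and l: "is_vnat V J (vself V) W (hom_along V J C G L) l"
    and S: "S \<subseteq> VOb (vfun_cat V J)" "small TYPE('u) S"
           "W \<in> S" "\<forall>A\<in>VOb C. hom_along V J C G A \<in> S"
  shows "(is_weighted_limit V J C G W L l \<longleftrightarrow>
            is_internal_terminal V (cone_icat V J C G W S) (cone_elem V J C G W S L l)) \<and>
         (is_internal_terminal V (cone_icat V J C G W S) (cone_elem V J C G W S L l) \<longleftrightarrow>
            (\<forall>X\<in>\<G>. is_vterminal V (Und V \<lbrakk>cst V X, cone_icat V J C G W S\<rbrakk>\<^bsub>CatV V\<^esub>)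
                (if0 (const_ifun V X (cone_icat V J C G W S)) \<cdot>\<^bsub>V\<^esub> cone_elem V J C G W S L l)))"
proof -
  interpret cone_category "TYPE('u)" V J C G W L l S
  proof unfold_locales
    show "\<forall>A\<in>Obj V. \<forall>B\<in>Obj V. \<exists>P p q. is_product V A B P p q" using V(3) unfolding cartesian_closed_def by blast
  qed (use assms in blast)+
  have "cones \<in> Obj (CatV V)" using cones_eq K.proj_simps by simp
  then show ?thesis
    using weighted_limit_iff_internal_terminal internal_terminal_iff_vterminal[OF _ cone_elem_props(1) \<G>] by blast
qed

end
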